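(* Suppose that conditions (RV), (S), (BC), (TC) and (C$\Theta$) (all stated in the context) hold. For $A\in\mathcal A$ put $$Z_n^{(p)}(A):=\sqrt{nv_n}\,\Big(\hat p_{n,A}-E\big(g_A(W_{n,0})\mid \|X_0\|>u_n\big)\Big).$$ Let $Z=(Z(A))_{A\in\mathcal A\cup\{\mathbb R^d\}}$ be a centered Gaussian process with covariance function $$c(A,B)=\mathrm{Cov}(Z(A),Z(B))=\sum_{j\in\mathbb Z}E\bigg[(\|\Theta_j\|^\alpha\wedge 1)\bigg(\sum_{h\in\mathbb Z}\frac{\|\Theta_h\|^\alpha}{\|\Theta\|_\alpha^\alpha}\mathbf 1_A\Big(\frac{\Theta_{h+i}}{\|\Theta_h\|}\Big)\bigg)\bigg(\sum_{h\in\mathbb Z}\frac{\|\Theta_h\|^\alpha}{\|\Theta\|_\alpha^\alpha}\mathbf 1_B\Big(\frac{\Theta_{h+i}}{\|\Theta_h\|}\Big)\bigg)\bigg],$$ and let $Z^{(p)}(A):=Z(A)-P\{\Theta_i\in A\}\,Z(\mathbb R^d)$. Then the finite dimensional distributions of $(Z_n^{(p)}(A))_{A\in\mathcal A}$ converge weakly to those of $(Z^{(p)}(A))_{A\in\mathcal A}$ as $n\to\infty$. Hence, if in addition $$E\big(g_A(W_{n,0})\mid \|X_0\|>u_n\big)-P\{\Theta_i\in A\}=o\big((nv_n)^{-1/2}\big)\quad\text{for all }A\in\mathcal A,$$ then $$\sqrt{nv_n}\,\big(\hat p_{n,A}-P\{\Theta_i\in A\}\big)_{A\in\tilde{\mathcal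 A}}\to (Z^{(p)}(A))_{A\in\tilde{\mathcal A}}$$ weakly for all finite subsets $\tilde{\mathcal A}$ of $\mathcal A$.
   Context: Setting. Fix $d\in\mathbb N$, a norm $\|\cdot\|$ on $\mathbb R^d$, a lag $i\in\mathbb Z$, a family $\mathcal A$ of Borel sets in $\mathbb R^d$, and sequences $s_n\in\mathbb N$, $u_n>0$ with $u_n\to\infty$. $(X_t)_{t\in\mathbb Z}$ is an $\mathbb R^d$-valued stationary time series, $v_n:=P\{\|X_1\|>u_n\}$. The $\beta$-mixing coefficients are $\beta_k:=E[\sup_{B\in\mathcal B_{k+1}^\infty}|P(B\mid\mathcal B_{-\infty}^0)-P(B)|]$, where $\mathcal B_{-\infty}^0$, $\mathcal B_{k+1}^\infty$ are the $\sigma$-fields generated by $(X_l)_{l\le 0}$ and $(X_l)_{l\ge k+1}$. For $w=(w_t)_{t\in\mathbb Z}$, $\|w\|_\alpha:=(\sum_{t\in\mathbb Z}\|w_t\|^\alpha)^{1/\alpha}$. Summands with factor $\|w_h\|^\alpha=0$ are interpreted as $0$. (RV) $(X_t)$ is stationary and regularly varying with index $\alpha>0$: there is a process $Y=(Y_t)_{t\in\mathbb Z}$ (tail process) such that for all $m,n\in\mathbb N_0$ the conditional law of $(X_t/u)_{-m\le t\le n}$ given $\|X_0\|>u$ converges weakly to the law of $(Y_t)_{-m\le t\le n}$ as $u\to\infty$, with $P\{\|Y_0\|>x\}=x^{-\alpha}$, $x\ge1$. The spectral tail process is $\Theta=(\Theta_t)_{t\in\mathbb Z}:=(Y_t/\|Y_0\|)_{t\in\mathbb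 Z}$; it is independent of $\|Y_0\|$. (S) $s_n\to\infty$ and $nv_n\to\infty$; there are sequences $l_n,r_n\in\mathbb N$ with $s_n\le l_n=o(r_n)$, $r_nv_n\to0$, $r_n=o(\sqrt{nv_n})$ and $\beta_{l_n}=o(r_n/n)$. (BC) For each $c\in(0,1]$, $n\in\mathbb N$, $1\le k\le r_n$ there is $e_{n,c}(k)\ge P(\|X_k\|>cu_n\mid\|X_0\|>cu_n)$ such that $e_{\infty,c}(k)=\lim_{n\to\infty}e_{n,c}(k)$ exists for all $k\in\mathbb N$ and $\lim_{n\to\infty}\sum_{k=1}^{r_n}e_{n,c}(k)=\sum_{k=1}^\infty e_{\infty,c}(k)<\infty$. (TC) For some $c\in(0,1)$ and all $j\in\mathbb Z$: $\lim_{m\to\infty}\limsup_{n\to\infty}E\Big(\frac{\sum_{m<|h|\le s_n}\|X_{h+j}\|^\alpha\mathbf 1_{\{\|X_{h+j}\|\le cu_n\}}}{\sum_{|h|\le s_n}\|X_{h+j}\|^\alpha}\,\Big|\,\|X_0\|>u_n\Big)=0$. (C$\Theta$) $P\{\Theta_i\in\partial A\}=0$ for all $A\in\mathcal A$. Definitions. $W_{n,t}:=(X_{t+h}/u_n)_{-s_n\le h\le s_n}$ and, for $s\in\mathbb N$, $$g_A\big((w_h)_{-s\le h\le s}\big):=\frac{\mathbf 1_{\{\|w_0\|>1\}}}{\sum_{h=-s}^s\|w_h\|^\alpha}\sum_{h=-s}^s\|w_h\|^\alpha\Big(\mathbf 1_A\Big(\frac{w_{h+i}}{\|w_h\|}\Big)\mathbf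 1_{\{|h+i|\le s\}}+\mathbf 1_A(0)\mathbf 1_{\{|h+i|>s\}}\Big).$$ The projection based estimator of $P\{\Theta_i\in A\}$ with known $\alpha$ is $\hat p_{n,A}:=\dfrac{\sum_{t=1}^n g_A(W_{n,t})}{\sum_{t=1}^n\mathbf 1_{\{\|X_t\|>u_n\}}}$. (Under (RV) and (BC), $\|\Theta\|_\alpha<\infty$ a.s.) *)

theory Defs
  imports "HOL-Probability.Probability"
begin

definition is_norm :: "(real^'d \<Rightarrow> real) \<Rightarrow> bool" where
  "is_norm N \<longleftrightarrow>
     (\<forall>x. N x \<ge> 0) \<and> (\<forall>x. N x = 0 \<longleftrightarrow> x = 0) \<and>
     (\<forall>a x. N (a *\<^sub>R x) = \<bar>a\<bar> * N x) \<and> (\<forall>x y. N (x + y) \<le> N x + N y)"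

definition joint_law :: "'w measure \<Rightarrow> 'i set \<Rightarrow> ('i \<Rightarrow> 'w \<Rightarrow> 'b::topological_space) \<Rightarrow> ('i \<Rightarrow> 'b) measure" where
  "joint_law M I \<xi> = distr M (\<Pi>\<^sub>M t\<in>I. borel) (\<lambda>\<omega>. \<lambda>t\<in>I. \<xi> t \<omega>)"

text \<open>Weak convergence of measures on a product space, by testing against the functions that are
  bounded and continuous on \<open>\<Pi>\<^sub>E t\<in>I. UNIV\<close> with the product topology. It is used for finite
  \<open>I\<close> and \<open>'b\<close> equal to \<open>real\<close> or \<open>real^'d\<close>, when the product sigma-algebra is the Borel
  sigma-algebra of that topology.\<close>

definition weakly_converges_PiM ::
    "'i set \<Rightarrow> ('n \<Rightarrow> ('i \<Rightarrow> 'b::topological_space) measure) \<Rightarrow> ('i \<Rightarrow> 'b) measure \<Rightarrow> 'n filter \<Rightarrow> bool" where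
  "weakly_converges_PiM I \<mu> \<nu> F \<longleftrightarrow>
     (\<forall>f. continuous_map (product_topology (\<lambda>t. euclidean) I) euclideanreal f \<and>
          bounded (f ` (\<Pi>\<^sub>E t\<in>I. UNIV)) \<longrightarrow>
          ((\<lambda>n. \<integral>x. f x \<partial>\<mu> n) \<longlongrightarrow> (\<integral>x. f x \<partial>\<nu>)) F)"

definition stationary :: "'w measure \<Rightarrow> (int \<Rightarrow> 'w \<Rightarrow> real^'d) \<Rightarrow> bool" where
  "stationary M X \<longleftrightarrow>
     (\<forall>t. X t \<in> borel_measurable M) \<and>
     (\<forall>k. joint_law M UNIV (\<lambda>t. X (t + k)) = joint_law M UNIV X)"

definition sigma_gen :: "'w measure \<Rightarrow> (int \<Rightarrow> 'w \<Rightarrow> real^'d) \<Rightarrow> int set \<Rightarrow> 'w measure" where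
  "sigma_gen M X T = sigma (space M) (\<Union>t\<in>T. {X t -` B \<inter> space M | B. B \<in> sets borel})"

text \<open>Conditional probabilities \<open>P(B | \<F>)\<close> are only determined up to null sets, so the supremum over
  the generally uncountable family of all \<open>B\<close> in the definition of the mixing coefficients is the
  essential supremum. If the conditional probabilities are taken from a regular conditional
  distribution, the pointwise supremum is a version of it.\<close>

definition is_essential_sup :: "'w measure \<Rightarrow> ('w \<Rightarrow> real) set \<Rightarrow> ('w \<Rightarrow> real) \<Rightarrow> bool" where
  "is_essential_sup M \<F> g \<longleftrightarrow>
     g \<in> borel_measurable M \<and>
     (\<forall>f\<in>\<F>. AE \<omega> in M. f \<omega> \<le> g \<omega>) \<and>
     (\<forall>h\<in>borel_measurable M. (\<forall>f\<in>\<F>. AE \<omega> in M. f \<omega> \<le> h \<omega>) \<longrightarrow> (AE \<omega> in M. g \<omega> \<le> h \<omega>))"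

definition essential_sup :: "'w measure \<Rightarrow> ('w \<Rightarrow> real) set \<Rightarrow> 'w \<Rightarrow> real" where
  "essential_sup M \<F> = (SOME g. is_essential_sup M \<F> g)"

definition beta_family :: "'w measure \<Rightarrow> (int \<Rightarrow> 'w \<Rightarrow> real^'d) \<Rightarrow> nat \<Rightarrow> ('w \<Rightarrow> real) set" where
  "beta_family M X k =
     (\<lambda>B \<omega>. \<bar>real_cond_exp M (sigma_gen M X {..0}) (indicator B) \<omega> - measure M B\<bar>)
       ` sets (sigma_gen M X {int k + 1..})"

definition beta_mixing :: "'w measure \<Rightarrow> (int \<Rightarrow> 'w \<Rightarrow> real^'d) \<Rightarrow> nat \<Rightarrow> real" where
  "beta_mixing M X k = (\<integral>\<omega>. essential_sup M (beta_family M X k) \<omega> \<partial>M)"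

lemma essential_sup_exists:
  fixes \<F> :: "('w \<Rightarrow> real) set"
  assumes "prob_space M" and ne: "\<F> \<noteq> {}"
    and meas: "\<And>f. f \<in> \<F> \<Longrightarrow> f \<in> borel_measurable M"
    and nn: "\<And>f \<omega>. f \<in> \<F> \<Longrightarrow> 0 \<le> f \<omega>"
    and bd: "\<And>f. f \<in> \<F> \<Longrightarrow> AE \<omega> in M. f \<omega> \<le> C"
  shows "is_essential_sup M \<F> (essential_sup M \<F>)"
proof -
  interpret prob_space M by fact
  define G :: "(nat \<Rightarrow> 'w \<Rightarrow> real) \<Rightarrow> 'w \<Rightarrow> ennreal"
    where "G = (\<lambda>f \<omega>. SUP n. ennreal (f n \<omega>))"
  define S where "S = {f :: nat \<Rightarrow> 'w \<Rightarrow> real. range f \<subseteq> \<F>}"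
  define \<Phi> where "\<Phi> = (\<lambda>f. \<integral>\<^sup>+\<omega>. G f \<omega> \<partial>M)"
  have Gm [measurable]: "G f \<in> borel_measurable M" if "f \<in> S" for f
  proof -
    have [measurable]: "f n \<in> borel_measurable M" for n
      using that meas by (auto simp: S_def)
    show ?thesis unfolding G_def by measurable
  qed
  have Gb: "AE \<omega> in M. G f \<omega> \<le> ennreal C" if "f \<in> S" for f
  proof -
    have "AE \<omega> in M. \<forall>n. f n \<omega> \<le> C"
      unfolding AE_all_countable using that bd by (auto simp: S_def)
    then show ?thesis
      by eventually_elim (auto simp: G_def intro!: SUP_least ennreal_leI)
  qed
  have \<Phi>fin: "\<Phi> f \<noteq> \<infinity>" if "f \<in> S" for f
  proof -
    have "\<Phi> f \<le> (\<integral>\<^sup>+\<omega>. ennreal C \<partial>M)"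
      unfolding \<Phi>_def by (rule nn_integral_mono_AE) (rule Gb[OF that])
    also have "\<dots> < \<infinity>"
      by (simp add: emeasure_space_1)
    finally show ?thesis by simp
  qed
  obtain f0 where "f0 \<in> \<F>" using ne by auto
  then have "S \<noteq> {}" by (auto simp: S_def intro!: exI[of _ "\<lambda>_. f0"])
  then obtain q :: "nat \<Rightarrow> ennreal" where q: "range q \<subseteq> \<Phi> ` S" "Sup (\<Phi> ` S) = (SUP k. q k)"
    using ennreal_Sup_countable_SUP[of "\<Phi> ` S"] by (metis image_is_empty)
  have "\<forall>k. \<exists>f\<in>S. q k = \<Phi> f" using q(1) by auto
  then obtain F where F: "\<And>k. F k \<in> S" "\<And>k. q k = \<Phi> (F k)" by metis
  define f where "f = (\<lambda>n. F (fst (prod_decode n)) (snd (prod_decode n)))"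
  have fS: "f \<in> S" using F(1) by (auto simp: S_def f_def)
  have "q k \<le> \<Phi> f" for k
  proof -
    have "G (F k) \<omega> \<le> G f \<omega>" for \<omega>
      unfolding G_def
    proof (rule SUP_least)
      fix n show "ennreal (F k n \<omega>) \<le> (SUP n. ennreal (f n \<omega>))"
        by (rule SUP_upper2[of "prod_encode (k, n)"]) (auto simp: f_def)
    qed
    then show ?thesis unfolding F(2) \<Phi>_def by (intro nn_integral_mono)
  qed
  then have max: "\<Phi> f' \<le> \<Phi> f" if "f' \<in> S" for f'
    using q(2) that by (metis SUP_least SUP_upper order_trans)
  have fin: "AE \<omega> in M. G f \<omega> < \<infinity>"
    using Gb[OF fS] by eventually_elim (auto simp: less_top[symmetric] top_unique)
  have "is_essential_sup M \<F> (\<lambda>\<omega>. enn2real (G f \<omega>))"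
    unfolding is_essential_sup_def
  proof (intro conjI ballI impI)
    show "(\<lambda>\<omega>. enn2real (G f \<omega>)) \<in> borel_measurable M"
      using Gm[OF fS] by measurable
  next
    fix a assume a: "a \<in> \<F>"
    define f' where "f' = case_nat a f"
    have f'S: "f' \<in> S"
      using a fS by (auto simp: S_def f'_def image_subset_iff split: nat.split)
    have le: "G f \<omega> \<le> G f' \<omega>" for \<omega>
      unfolding G_def
    proof (rule SUP_least)
      fix n show "ennreal (f n \<omega>) \<le> (SUP n. ennreal (f' n \<omega>))"
        by (rule SUP_upper2[of "Suc n"]) (auto simp: f'_def)
    qed
    have "(\<integral>\<^sup>+\<omega>. G f' \<omega> - G f \<omega> \<partial>M) = \<Phi> f' - \<Phi> f"
      unfolding \<Phi>_def using fS f'S \<Phi>fin[OF fS] le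
      by (intro nn_integral_diff) (auto simp: \<Phi>_def)
    also have "\<dots> = 0"
      using max[OF f'S] \<Phi>fin[OF f'S] by (simp add: diff_eq_0_iff_ennreal less_top[symmetric])
    finally have "AE \<omega> in M. G f' \<omega> - G f \<omega> = 0"
      using fS f'S by (subst (asm) nn_integral_0_iff_AE) auto
    then show "AE \<omega> in M. a \<omega> \<le> enn2real (G f \<omega>)"
      using fin
    proof eventually_elim
      case (elim \<omega>)
      have "ennreal (a \<omega>) \<le> G f' \<omega>"
        unfolding G_def by (rule SUP_upper2[of 0]) (auto simp: f'_def)
      also have "\<dots> \<le> G f \<omega>" using elim by (auto simp: diff_eq_0_iff_ennreal)
      finally show ?case using elim nn[OF a]
        by (metis enn2real_ennreal enn2real_mono infinity_ennreal_def)
    qed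
  next
    fix h assume h: "h \<in> borel_measurable M" "\<forall>f\<in>\<F>. AE \<omega> in M. f \<omega> \<le> h \<omega>"
    have "AE \<omega> in M. \<forall>n. f n \<omega> \<le> h \<omega>"
      unfolding AE_all_countable using fS h by (auto simp: S_def)
    then show "AE \<omega> in M. enn2real (G f \<omega>) \<le> h \<omega>"
    proof eventually_elim
      case (elim \<omega>)
      have "f 0 \<in> \<F>" using fS by (auto simp: S_def)
      then have "0 \<le> h \<omega>" using elim nn by (meson order_trans)
      moreover have "G f \<omega> \<le> ennreal (h \<omega>)"
        using elim by (auto simp: G_def intro!: SUP_least ennreal_leI)
      ultimately show ?case by (simp add: enn2real_leI)
    qed
  qed
  then show ?thesis unfolding essential_sup_def by (rule someI[of "is_essential_sup M \<F>"])
qed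

lemma beta_family_essential_sup:
  assumes "prob_space M" and X: "\<And>t. X t \<in> borel_measurable M"
  shows "is_essential_sup M (beta_family M X k) (essential_sup M (beta_family M X k))"
proof -
  interpret prob_space M by fact
  have sp: "space (sigma_gen M X T) = space M" for T
    by (simp add: sigma_gen_def space_measure_of_conv)
  have sub: "sets (sigma_gen M X T) \<subseteq> sets M" for T
  proof -
    let ?G = "\<Union>t\<in>T. {X t -` B \<inter> space M | B. B \<in> sets borel}"
    have "?G \<subseteq> sets M" using measurable_sets[OF X] by auto
    moreover have "?G \<subseteq> Pow (space M)" by auto
    ultimately show ?thesis
      by (simp add: sigma_gen_def sets_measure_of sets.sigma_sets_subset)
  qed
  let ?F = "sigma_gen M X {..0}"
  have "finite_measure_subalgebra M ?F"
    by unfold_locales (use sub sp in \<open>auto simp: subalgebra_def\<close>)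
  then interpret finite_measure_subalgebra M ?F .
  have bounds: "AE \<omega> in M. \<bar>real_cond_exp M ?F (indicator B) \<omega> - measure M B\<bar> \<le> 1"
    if "B \<in> sets M" for B
  proof -
    have int: "integrable M (indicator B :: 'a \<Rightarrow> real)"
      using that by (intro integrable_real_indicator) (auto simp: less_top[symmetric])
    have "AE \<omega> in M. real_cond_exp M ?F (indicator B) \<omega> \<ge> 0"
      by (rule real_cond_exp_ge_c[OF int]) auto
    moreover have "AE \<omega> in M. real_cond_exp M ?F (indicator B) \<omega> \<le> 1"
      by (rule real_cond_exp_le_c[OF int]) (auto simp: indicator_def)
    ultimately show ?thesis
    proof eventually_elim
      case (elim \<omega>)
      then show ?case using prob_le_1[of B] measure_nonneg[of M B] by linarith
    qed
  qed
  show ?thesis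
  proof (rule essential_sup_exists[where C = 1])
    show "beta_family M X k \<noteq> {}"
      using sets.top by (auto simp: beta_family_def)
  qed (use assms(1) sub bounds in \<open>auto simp: beta_family_def\<close>)
qed

text \<open>A normal random variable may be degenerate: \<open>\<sigma> = 0\<close> means that it is a.s. constant.\<close>

definition normal_rv :: "'w measure \<Rightarrow> ('w \<Rightarrow> real) \<Rightarrow> real \<Rightarrow> real \<Rightarrow> bool" where
  "normal_rv M \<xi> m \<sigma> \<longleftrightarrow>
     \<xi> \<in> borel_measurable M \<and> \<sigma> \<ge> 0 \<and>
     (if \<sigma> = 0 then AE \<omega> in M. \<xi> \<omega> = m
      else distributed M lborel \<xi> (\<lambda>x. ennreal (normal_density m \<sigma> x)))"

definition gaussian_process :: "'w measure \<Rightarrow> 'i set \<Rightarrow> ('i \<Rightarrow> 'w \<Rightarrow> real) \<Rightarrow> bool" where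
  "gaussian_process M T Z \<longleftrightarrow>
     (\<forall>t\<in>T. Z t \<in> borel_measurable M) \<and>
     (\<forall>I a. finite I \<and> I \<subseteq> T \<longrightarrow> (\<exists>m \<sigma>. normal_rv M (\<lambda>\<omega>. \<Sum>t\<in>I. a t * Z t \<omega>) m \<sigma>))"

definition covariance :: "'w measure \<Rightarrow> ('w \<Rightarrow> real) \<Rightarrow> ('w \<Rightarrow> real) \<Rightarrow> real" where
  "covariance M \<xi> \<eta> =
     (\<integral>\<omega>. (\<xi> \<omega> - (\<integral>\<omega>. \<xi> \<omega> \<partial>M)) * (\<eta> \<omega> - (\<integral>\<omega>. \<eta> \<omega> \<partial>M)) \<partial>M)"

definition centered_gaussian_process ::
    "'w measure \<Rightarrow> 'i set \<Rightarrow> ('i \<Rightarrow> 'w \<Rightarrow> real) \<Rightarrow> ('i \<Rightarrow> 'i \<Rightarrow> real) \<Rightarrow> bool" where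
  "centered_gaussian_process M T Z c \<longleftrightarrow>
     gaussian_process M T Z \<and>
     (\<forall>t\<in>T. (\<integral>\<omega>. Z t \<omega> \<partial>M) = 0) \<and>
     (\<forall>s\<in>T. \<forall>t\<in>T. covariance M (Z s) (Z t) = c s t)"

text \<open>In the following, \<open>M\<close> carries the time series \<open>X\<close>, \<open>M'\<close> the tail process \<open>Y\<close>, and \<open>N\<close> is the
  norm.\<close>

definition exceed :: "'w measure \<Rightarrow> (real^'d \<Rightarrow> real) \<Rightarrow> (int \<Rightarrow> 'w \<Rightarrow> real^'d) \<Rightarrow> int \<Rightarrow> real \<Rightarrow> 'w set" where
  "exceed M N X t x = {\<omega> \<in> space M. N (X t \<omega>) > x}"

definition v_seq :: "'w measure \<Rightarrow> (real^'d \<Rightarrow> real) \<Rightarrow> (int \<Rightarrow> 'w \<Rightarrow> real^'d) \<Rightarrow> (nat \<Rightarrow> real) \<Rightarrow> nat \<Rightarrow> real" where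
  "v_seq M N X u n = measure M (exceed M N X 1 (u n))"

text \<open>The conditional probability measure given that the norm of \<open>X 0\<close> exceeds \<open>x\<close>. If the
  conditioning event has probability 0, this is the null measure; the weak convergence to a
  probability measure in \<open>regularly_varying\<close> rules that out.\<close>

definition cond_exceed :: "'w measure \<Rightarrow> (real^'d \<Rightarrow> real) \<Rightarrow> (int \<Rightarrow> 'w \<Rightarrow> real^'d) \<Rightarrow> real \<Rightarrow> 'w measure" where
  "cond_exceed M N X x = uniform_measure M (exceed M N X 0 x)"

definition regularly_varying ::
    "'w measure \<Rightarrow> 'y measure \<Rightarrow> (real^'d \<Rightarrow> real) \<Rightarrow> real \<Rightarrow> (int \<Rightarrow> 'w \<Rightarrow> real^'d) \<Rightarrow> (int \<Rightarrow> 'y \<Rightarrow> real^'d) \<Rightarrow> bool" where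
  "regularly_varying M M' N \<alpha> X Y \<longleftrightarrow>
     stationary M X \<and> \<alpha> > 0 \<and>
     (\<forall>t. Y t \<in> borel_measurable M') \<and>
     (\<forall>m n :: nat. weakly_converges_PiM {- int m..int n}
        (\<lambda>x. joint_law (cond_exceed M N X x) {- int m..int n} (\<lambda>t \<omega>. X t \<omega> /\<^sub>R x))
        (joint_law M' {- int m..int n} Y) at_top) \<and>
     (\<forall>x\<ge>1. measure M' (exceed M' N Y 0 x) = x powr (- \<alpha>))"

definition spectral_tail :: "(real^'d \<Rightarrow> real) \<Rightarrow> (int \<Rightarrow> 'y \<Rightarrow> real^'d) \<Rightarrow> int \<Rightarrow> 'y \<Rightarrow> real^'d" where
  "spectral_tail N Y t \<omega> = Y t \<omega> /\<^sub>R N (Y 0 \<omega>)"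

text \<open>The sequences \<open>l\<close> and \<open>r\<close>, whose existence is required in the first condition, are parameters
  because \<open>r\<close> also occurs in the anti-clustering condition \<open>condition_BC\<close>.\<close>

definition condition_S ::
    "'w measure \<Rightarrow> (real^'d \<Rightarrow> real) \<Rightarrow> (int \<Rightarrow> 'w \<Rightarrow> real^'d) \<Rightarrow> (nat \<Rightarrow> real) \<Rightarrow>
     (nat \<Rightarrow> nat) \<Rightarrow> (nat \<Rightarrow> nat) \<Rightarrow> (nat \<Rightarrow> nat) \<Rightarrow> bool" where
  "condition_S M N X u s l r \<longleftrightarrow>
     filterlim s at_top sequentially \<and>
     filterlim (\<lambda>n. n * v_seq M N X u n) at_top sequentially \<and>
     (\<forall>n\<ge>1. s n \<le> l n) \<and>
     (\<lambda>n. real (l n)) \<in> o(\<lambda>n. real (r n)) \<and>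
     (\<lambda>n. r n * v_seq M N X u n) \<longlonglongrightarrow> 0 \<and>
     (\<lambda>n. real (r n)) \<in> o(\<lambda>n. sqrt (n * v_seq M N X u n)) \<and>
     (\<lambda>n. beta_mixing M X (l n)) \<in> o(\<lambda>n. real (r n) / real n)"

definition condition_BC ::
    "'w measure \<Rightarrow> (real^'d \<Rightarrow> real) \<Rightarrow> (int \<Rightarrow> 'w \<Rightarrow> real^'d) \<Rightarrow> (nat \<Rightarrow> real) \<Rightarrow> (nat \<Rightarrow> nat) \<Rightarrow> bool" where
  "condition_BC M N X u r \<longleftrightarrow>
     (\<forall>c\<in>{0<..1}. \<exists>(e :: nat \<Rightarrow> nat \<Rightarrow> real) (e_inf :: nat \<Rightarrow> real).
        (\<forall>n\<ge>1. \<forall>k\<in>{1..r n}.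
           e n k \<ge> cond_prob M (\<lambda>\<omega>. N (X (int k) \<omega>) > c * u n) (\<lambda>\<omega>. N (X 0 \<omega>) > c * u n)) \<and>
        (\<forall>k\<ge>1. (\<lambda>n. e n k) \<longlonglongrightarrow> e_inf k) \<and>
        summable (\<lambda>k. e_inf (Suc k)) \<and>
        (\<lambda>n. \<Sum>k=1..r n. e n k) \<longlonglongrightarrow> (\<Sum>k. e_inf (Suc k)))"

definition condition_TC ::
    "'w measure \<Rightarrow> (real^'d \<Rightarrow> real) \<Rightarrow> real \<Rightarrow> (int \<Rightarrow> 'w \<Rightarrow> real^'d) \<Rightarrow> (nat \<Rightarrow> real) \<Rightarrow> (nat \<Rightarrow> nat) \<Rightarrow> bool" where
  "condition_TC M N \<alpha> X u s \<longleftrightarrow>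
     (\<exists>c\<in>{0<..<1}. \<forall>j. (\<lambda>m::nat. limsup (\<lambda>n. ereal (\<integral>\<omega>.
          (\<Sum>h | int m < \<bar>h\<bar> \<and> \<bar>h\<bar> \<le> int (s n).
             N (X (h + j) \<omega>) powr \<alpha> * of_bool (N (X (h + j) \<omega>) \<le> c * u n))
          / (\<Sum>h | \<bar>h\<bar> \<le> int (s n). N (X (h + j) \<omega>) powr \<alpha>)
          \<partial>cond_exceed M N X (u n)))) \<longlonglongrightarrow> 0)"

text \<open>Since \<open>0 powr \<alpha> = 0\<close>, summands with a vanishing factor \<open>N (w h) powr \<alpha>\<close> are 0, as required.\<close>

definition g_fun ::
    "(real^'d \<Rightarrow> real) \<Rightarrow> real \<Rightarrow> int \<Rightarrow> nat \<Rightarrow> (real^'d) set \<Rightarrow> (int \<Rightarrow> real^'d) \<Rightarrow> real" where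
  "g_fun N \<alpha> i s A w =
     of_bool (N (w 0) > 1) / (\<Sum>h = - int s..int s. N (w h) powr \<alpha>) *
     (\<Sum>h = - int s..int s. N (w h) powr \<alpha> *
        (indicator A (w (h + i) /\<^sub>R N (w h)) * of_bool (\<bar>h + i\<bar> \<le> int s) +
         indicator A 0 * of_bool (\<bar>h + i\<bar> > int s)))"

definition W_block ::
    "(int \<Rightarrow> 'w \<Rightarrow> real^'d) \<Rightarrow> (nat \<Rightarrow> real) \<Rightarrow> (nat \<Rightarrow> nat) \<Rightarrow> nat \<Rightarrow> int \<Rightarrow> 'w \<Rightarrow> int \<Rightarrow> real^'d" where
  "W_block X u s n t \<omega> = (\<lambda>h\<in>{- int (s n)..int (s n)}. X (t + h) \<omega> /\<^sub>R u n)"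

definition p_hat ::
    "(real^'d \<Rightarrow> real) \<Rightarrow> real \<Rightarrow> int \<Rightarrow> (int \<Rightarrow> 'w \<Rightarrow> real^'d) \<Rightarrow> (nat \<Rightarrow> real) \<Rightarrow> (nat \<Rightarrow> nat) \<Rightarrow>
     nat \<Rightarrow> (real^'d) set \<Rightarrow> 'w \<Rightarrow> real" where
  "p_hat N \<alpha> i X u s n A \<omega> =
     (\<Sum>t = 1..int n. g_fun N \<alpha> i (s n) A (W_block X u s n t \<omega>)) /
     (\<Sum>t = 1..int n. of_bool (N (X t \<omega>) > u n))"

definition cond_mean_g ::
    "'w measure \<Rightarrow> (real^'d \<Rightarrow> real) \<Rightarrow> real \<Rightarrow> int \<Rightarrow> (int \<Rightarrow> 'w \<Rightarrow> real^'d) \<Rightarrow> (nat \<Rightarrow> real) \<Rightarrow> (nat \<Rightarrow> nat) \<Rightarrow>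
     nat \<Rightarrow> (real^'d) set \<Rightarrow> real" where
  "cond_mean_g M N \<alpha> i X u s n A =
     (\<integral>\<omega>. g_fun N \<alpha> i (s n) A (W_block X u s n 0 \<omega>) \<partial>cond_exceed M N X (u n))"

definition Z_n ::
    "'w measure \<Rightarrow> (real^'d \<Rightarrow> real) \<Rightarrow> real \<Rightarrow> int \<Rightarrow> (int \<Rightarrow> 'w \<Rightarrow> real^'d) \<Rightarrow> (nat \<Rightarrow> real) \<Rightarrow> (nat \<Rightarrow> nat) \<Rightarrow>
     nat \<Rightarrow> (real^'d) set \<Rightarrow> 'w \<Rightarrow> real" where
  "Z_n M N \<alpha> i X u s n A \<omega> =
     sqrt (n * v_seq M N X u n) * (p_hat N \<alpha> i X u s n A \<omega> - cond_mean_g M N \<alpha> i X u s n A)"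

definition alpha_norm :: "(real^'d \<Rightarrow> real) \<Rightarrow> real \<Rightarrow> (int \<Rightarrow> real^'d) \<Rightarrow> real" where
  "alpha_norm N \<alpha> w = (\<Sum>\<^sub>\<infinity>t. N (w t) powr \<alpha>) powr (1 / \<alpha>)"

definition projection_sum ::
    "(real^'d \<Rightarrow> real) \<Rightarrow> real \<Rightarrow> int \<Rightarrow> (real^'d) set \<Rightarrow> (int \<Rightarrow> real^'d) \<Rightarrow> real" where
  "projection_sum N \<alpha> i A w =
     (\<Sum>\<^sub>\<infinity>h. N (w h) powr \<alpha> / alpha_norm N \<alpha> w powr \<alpha> * indicator A (w (h + i) /\<^sub>R N (w h)))"

definition cov_fun ::
    "'y measure \<Rightarrow> (real^'d \<Rightarrow> real) \<Rightarrow> real \<Rightarrow> int \<Rightarrow> (int \<Rightarrow> 'y \<Rightarrow> real^'d) \<Rightarrow> (real^'d) set \<Rightarrow> (real^'d) set \<Rightarrow> real" where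
  "cov_fun M' N \<alpha> i \<Theta> A B =
     (\<Sum>\<^sub>\<infinity>j. \<integral>\<omega>. min (N (\<Theta> j \<omega>) powr \<alpha>) 1 *
        projection_sum N \<alpha> i A (\<lambda>t. \<Theta> t \<omega>) * projection_sum N \<alpha> i B (\<lambda>t. \<Theta> t \<omega>) \<partial>M')"

end

theory Submission
  imports Defs
begin

text \<open>Up to a factor tending to 1 in probability, \<open>Z\<^sub>n(A)\<close> is the normalised sum over \<open>t \<le> n\<close> of the
  centred functionals \<open>g\<^sub>A - q\<^sub>n g\<^sub>U\<close> of the windows around \<open>t\<close>, where \<open>U\<close> is the whole space and \<open>q\<^sub>n\<close>
  the conditional mean of \<open>g\<^sub>A\<close>. Levy's theorem and a multivariate version of it, obtained from
  Stone-Weierstrass, reduce the claim to a central limit theorem for one-dimensional linear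
  combinations of such sums.

  The latter is proved with big blocks of length \<open>r\<^sub>n - 3 l\<^sub>n\<close> separated by small ones: beta-mixing
  makes the big blocks nearly independent, and since a block sum is at most of order
  \<open>r\<^sub>n / \<surd>(n v\<^sub>n) = o(1)\<close>, its characteristic function is determined by its variance. By the
  anti-clustering condition the variances converge to the sum over \<open>j\<close> of the limits of the lag \<open>j\<close>
  covariances. To identify these limits, (TC) allows to replace the sums in \<open>g\<^sub>A\<close> by sums over a
  fixed window, to which the convergence to the tail process applies. The time change formula of the
  tail process then gives the covariance function and the limit \<open>P(\<Theta>\<^sub>i \<in> A)\<close> of \<open>q\<^sub>n\<close>.\<close>

section \<open>Weak convergence\<close>

text \<open>Three obstacles shape the argument. Regular variation speaks of finite windows, whereas
  the limit involves sums over all integers of discontinuous functions of ratios. Continuity at the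
  limit path is needed at every time h, while (C\<Theta>) concerns the ratio at time 0; the time
  change formula, itself a consequence of stationarity before the limit, carries the null boundary
  to all h. Secondly, the centring constants vary with n, so the limit theorem is stated for
  functionals whose coefficients depend on n. It then also shows that combinations divided by a
  diverging factor vanish in probability, which the linearisation of the ratio requires. Thirdly,
  the windows of a block reach \<open>s n\<close> beyond its ends on both sides: a gap of
  \<open>3 * l n\<close> leaves \<open>2 * s n\<close> for the windows and \<open>l n\<close> for
  mixing. The gaps, seen as short blocks separated by long ones, satisfy the same independence
  estimate, so their total is removed by the same computation with limiting variance 0.\<close>

lemma Lipschitz_real_imp_continuous_on:
  fixes g :: "'a::metric_space \<Rightarrow> real"
  assumes "\<And>x y. \<bar>g x - g y\<bar> \<le> L * dist x y"
  shows "continuous_on A g"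
proof (rule lipschitz_on_continuous_on)
  show "(max L 0)-lipschitz_on A g"
    unfolding lipschitz_on_def dist_real_def
  proof (intro conjI ballI)
    fix x y
    show "\<bar>g x - g y\<bar> \<le> max L 0 * dist x y"
      using assms[of x y] by (smt (verit) mult_right_mono zero_le_dist)
  qed simp
qed

text \<open>The upper Lipschitz envelope decreases to the upper semicontinuous envelope, and the latter
  agrees with the function exactly at its points of continuity.\<close>

definition lipschitz_env :: "real \<Rightarrow> ('a::metric_space \<Rightarrow> real) \<Rightarrow> 'a \<Rightarrow> real" where
  "lipschitz_env k f x = (SUP y. f y - k * dist x y)"

context
  fixes f :: "'a::metric_space \<Rightarrow> real" and C :: real
  assumes bounded: "\<And>x. \<bar>f x\<bar> \<le> C"
begin

lemma lipschitz_env_bdd_above: "k \<ge> 0 \<Longrightarrow> bdd_above (range (\<lambda>y. f y - k * dist x y))"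
  using bounded by (intro bdd_aboveI2[where M=C]) (smt (verit) mult_nonneg_nonneg zero_le_dist)

lemma lipschitz_env_ge: "k \<ge> 0 \<Longrightarrow> f x \<le> lipschitz_env k f x"
  unfolding lipschitz_env_def
  by (rule cSUP_upper2[OF lipschitz_env_bdd_above, where x=x]) auto

lemma lipschitz_env_le: "k \<ge> 0 \<Longrightarrow> lipschitz_env k f x \<le> C"
  unfolding lipschitz_env_def
  by (rule cSUP_least) (use bounded in \<open>auto, smt (verit) mult_nonneg_nonneg zero_le_dist\<close>)

lemma abs_lipschitz_env_le: "k \<ge> 0 \<Longrightarrow> \<bar>lipschitz_env k f x\<bar> \<le> C"
  using lipschitz_env_ge[of k x] lipschitz_env_le[of k x] bounded[of x] by linarith

lemma lipschitz_env_lipschitz: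
  assumes "k \<ge> 0" shows "\<bar>lipschitz_env k f x - lipschitz_env k f y\<bar> \<le> k * dist x y"
proof -
  have *: "lipschitz_env k f x \<le> lipschitz_env k f y + k * dist x y" for x y
    unfolding lipschitz_env_def[of k f x]
  proof (rule cSUP_least)
    fix z
    have "f z - k * dist y z \<le> lipschitz_env k f y"
      unfolding lipschitz_env_def by (rule cSUP_upper[OF _ lipschitz_env_bdd_above]) (use assms in auto)
    moreover have "k * dist y z \<le> k * (dist x y + dist x z)"
      using assms by (intro mult_left_mono) (metis dist_commute dist_triangle)
    ultimately show "f z - k * dist x z \<le> lipschitz_env k f y + k * dist x y"
      by (simp add: algebra_simps)
  qed simp
  show ?thesis using *[of x y] *[of y x] by (simp add: dist_commute)
qed

lemma lipschitz_env_tendsto: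
  assumes "isCont f x"
  shows "(\<lambda>k. lipschitz_env (real k) f x) \<longlonglongrightarrow> f x"
proof (rule order_tendstoI)
  fix a assume "a < f x"
  then show "\<forall>\<^sub>F k in sequentially. a < lipschitz_env (real k) f x"
    by (intro always_eventually allI) (rule less_le_trans, assumption, rule lipschitz_env_ge, simp)
next
  fix a assume a: "f x < a"
  define e where "e = (a - f x) / 2"
  have e: "e > 0" using a by (simp add: e_def)
  obtain d where d: "d > 0" "\<And>y. dist x y < d \<Longrightarrow> \<bar>f y - f x\<bar> < e"
    using assms e unfolding continuous_at_eps_delta dist_real_def by (metis dist_commute)
  \<comment> \<open>Beyond distance \<open>d\<close> the penalty is then at least
    \<open>2 * C\<close>, the largest possible gain of \<open>f y\<close> over \<open>f x\<close>,
    so only points near \<open>x\<close> can push the supremum above \<open>f x\<close>.\<close>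
  obtain K :: nat where K: "2 * C / d < real K" using reals_Archimedean2 by blast
  have C: "0 \<le> C" using bounded[of x] by linarith
  have "lipschitz_env (real k) f x < a" if "k \<ge> K" for k
  proof -
    have "lipschitz_env (real k) f x \<le> f x + e"
      unfolding lipschitz_env_def
    proof (rule cSUP_least)
      fix y
      show "f y - real k * dist x y \<le> f x + e"
      proof (cases "dist x y < d")
        case True
        have "0 \<le> real k * dist x y" by simp
        then show ?thesis using d(2)[OF True] by linarith
      next
        case False
        have "2 * C \<le> real K * d" using K d by (simp add: field_simps)
        also have "\<dots> \<le> real k * dist x y" using that False d by (intro mult_mono) auto
        finally show ?thesis using bounded[of x] bounded[of y] e by linarith
      qed
    qed simp
    also have "\<dots> < a" using a by (simp add: e_def field_simps)
    finally show ?thesis .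
  qed
  then show "\<forall>\<^sub>F k in sequentially. lipschitz_env (real k) f x < a"
    by (rule eventually_sequentiallyI)
qed

end

text \<open>The envelopes are bounded by \<open>C\<close> and tend to \<open>f\<close> at its
  continuity points, so by dominated convergence one of them has an integral below any bound that
  exceeds the integral of \<open>f\<close>. This majorant is how a merely almost everywhere
  continuous function is reached from Lipschitz test functions.\<close>

lemma integral_upper_envelope:
  fixes f :: "'a::metric_space \<Rightarrow> real"
  assumes "finite_measure \<nu>" "sets \<nu> = sets borel"
    and f: "f \<in> borel_measurable borel" "\<And>x. \<bar>f x\<bar> \<le> C"
    and ae: "AE x in \<nu>. isCont f x" and a: "integral\<^sup>L \<nu> f < a"
  obtains k :: nat where "integral\<^sup>L \<nu> (lipschitz_env (real k) f) < a"
proof -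
  interpret finite_measure \<nu> by fact
  note [measurable_cong] = assms(2)
  note [measurable] = f(1)
  have [measurable]: "lipschitz_env (real k) f \<in> borel_measurable borel" for k
    by (rule borel_measurable_continuous_onI, rule Lipschitz_real_imp_continuous_on, rule lipschitz_env_lipschitz[where f=f and C=C, OF f(2)]) auto
  have "(\<lambda>k. integral\<^sup>L \<nu> (lipschitz_env (real k) f)) \<longlonglongrightarrow> integral\<^sup>L \<nu> f"
  proof (rule integral_dominated_convergence[where w="\<lambda>_. C"])
    show "AE x in \<nu>. (\<lambda>k. lipschitz_env (real k) f x) \<longlonglongrightarrow> f x"
      using ae by eventually_elim (rule lipschitz_env_tendsto[where f=f and C=C, OF f(2)])
    show "\<And>k. AE x in \<nu>. norm (lipschitz_env (real k) f x) \<le> C"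
      by (intro AE_I2) (simp add: abs_lipschitz_env_le[where f=f and C=C, OF f(2)])
  qed simp_all
  then have "\<forall>\<^sub>F k in sequentially. integral\<^sup>L \<nu> (lipschitz_env (real k) f) < a"
    using a by (rule order_tendstoD)
  then have "\<exists>k. integral\<^sup>L \<nu> (lipschitz_env (real k) f) < a"
    by (auto simp: eventually_sequentially)
  then show ?thesis using that by blast
qed

lemma finite_measure_integrable_bounded:
  fixes f :: "'a \<Rightarrow> real"
  assumes "finite_measure M" "f \<in> borel_measurable M" "\<And>x. \<bar>f x\<bar> \<le> C"
  shows "integrable M f"
  using assms by (intro finite_measure.integrable_const_bound[where B=C]) auto

text \<open>Comparison with one Lipschitz majorant of nearly the same limit integral gives the upper
  half; the same for \<open>- f\<close> gives the lower half. The filter is arbitrary because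
  regular variation is a limit over a real threshold, and the measures are only finite because a
  conditional law may be the null measure.\<close>

lemma tendsto_integral_if_AE_isCont:
  fixes f :: "'a::metric_space \<Rightarrow> real" and \<mu> :: "'n \<Rightarrow> 'a measure"
  assumes \<mu>: "\<And>n. finite_measure (\<mu> n)" "\<And>n. sets (\<mu> n) = sets borel"
    and \<nu>: "finite_measure \<nu>" "sets \<nu> = sets borel"
    and conv: "\<And>g L C. (\<And>x y. \<bar>g x - g y\<bar> \<le> L * dist x y) \<Longrightarrow> (\<And>x. \<bar>g x\<bar> \<le> C) \<Longrightarrow>
                 ((\<lambda>n. integral\<^sup>L (\<mu> n) g) \<longlongrightarrow> integral\<^sup>L \<nu> g) F"
    and f: "f \<in> borel_measurable borel" "\<And>x. \<bar>f x\<bar> \<le> C"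
    and ae: "AE x in \<nu>. isCont f x"
  shows "((\<lambda>n. integral\<^sup>L (\<mu> n) f) \<longlongrightarrow> integral\<^sup>L \<nu> f) F"
proof -
  have upper: "\<forall>\<^sub>F n in F. integral\<^sup>L (\<mu> n) f < a"
    if f: "f \<in> borel_measurable borel" "\<And>x. \<bar>f x\<bar> \<le> C" and ae: "AE x in \<nu>. isCont f x"
      and a: "integral\<^sup>L \<nu> f < a" for a f
  proof -
    obtain k :: nat where k: "integral\<^sup>L \<nu> (lipschitz_env (real k) f) < a"
      using integral_upper_envelope[OF \<nu> f ae a] by blast
    have "((\<lambda>n. integral\<^sup>L (\<mu> n) (lipschitz_env (real k) f)) \<longlongrightarrow> integral\<^sup>L \<nu> (lipschitz_env (real k) f)) F"
      by (rule conv[where L="real k" and C=C])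
         (simp_all add: lipschitz_env_lipschitz[where f=f and C=C, OF f(2)] abs_lipschitz_env_le[where f=f and C=C, OF f(2)])
    then have "\<forall>\<^sub>F n in F. integral\<^sup>L (\<mu> n) (lipschitz_env (real k) f) < a"
      using k by (rule order_tendstoD)
    then show ?thesis
    proof eventually_elim
      case (elim n)
      have m: "lipschitz_env (real k) f \<in> borel_measurable (\<mu> n)"
        unfolding measurable_cong_sets[OF \<mu>(2) refl]
        by (rule borel_measurable_continuous_onI, rule Lipschitz_real_imp_continuous_on, rule lipschitz_env_lipschitz[where f=f and C=C, OF f(2)]) auto
      have "integral\<^sup>L (\<mu> n) f \<le> integral\<^sup>L (\<mu> n) (lipschitz_env (real k) f)"
        using \<mu> f m abs_lipschitz_env_le[where f=f and C=C, OF f(2)] lipschitz_env_ge[where f=f and C=C, OF f(2)]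
        by (intro integral_mono finite_measure_integrable_bounded[where C=C])
           (auto simp: measurable_cong_sets[OF \<mu>(2) refl])
      then show ?case using elim by simp
    qed
  qed
  show ?thesis
  proof (rule order_tendstoI)
    fix a assume "integral\<^sup>L \<nu> f < a"
    then show "\<forall>\<^sub>F n in F. integral\<^sup>L (\<mu> n) f < a" by (rule upper[OF f ae])
  next
    fix a assume "a < integral\<^sup>L \<nu> f"
    then have "\<forall>\<^sub>F n in F. integral\<^sup>L (\<mu> n) (\<lambda>x. - f x) < - a"
      using f ae by (intro upper) (auto simp: continuous_minus elim!: eventually_mono)
    then show "\<forall>\<^sub>F n in F. a < integral\<^sup>L (\<mu> n) f" by eventually_elim simp
  qed
qed

text \<open>Closed sets form an intersection-stable generator, and the indicator of a nonempty
  closed set is the decreasing limit of Lipschitz functions of the distance to it. Identities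
  between laws on path space arise as limits and are at first known for Lipschitz functionals
  only.\<close>

lemma measure_eqI_Lipschitz:
  fixes M N :: "'a::metric_space measure"
  assumes M: "finite_measure M" "sets M = sets borel"
    and N: "finite_measure N" "sets N = sets borel"
    and eq: "\<And>g L C. (\<And>x y. \<bar>g x - g y\<bar> \<le> L * dist x y) \<Longrightarrow> (\<And>x. \<bar>g x\<bar> \<le> C) \<Longrightarrow>
               integral\<^sup>L M g = integral\<^sup>L N g"
  shows "M = N"
proof (rule measure_eqI_generator_eq[where E="Collect closed" and \<Omega>=UNIV and A="\<lambda>_. UNIV"])
  interpret M: finite_measure M by fact
  interpret N: finite_measure N by fact
  note [measurable_cong] = M(2) N(2)
  fix X :: "'a set" assume X: "X \<in> Collect closed"
  show "emeasure M X = emeasure N X"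
  proof (cases "X = {}")
    \<comment> \<open>\<open>infdist\<close> to the empty set is 0 by convention, so for empty
      \<open>X\<close> the approximations below would be constantly 1.\<close>
    case False
    define g where "g k x = max 0 (1 - real k * infdist x X)" for k x
    have lip: "\<bar>g k x - g k y\<bar> \<le> real k * dist x y" for k x y
    proof -
      have "\<bar>g k x - g k y\<bar> \<le> \<bar>real k * infdist x X - real k * infdist y X\<bar>"
        unfolding g_def by linarith
      also have "\<dots> = real k * \<bar>infdist x X - infdist y X\<bar>"
        by (simp add: abs_mult flip: right_diff_distrib)
      also have "\<dots> \<le> real k * dist x y"
        by (intro mult_left_mono infdist_triangle_abs) auto
      finally show ?thesis .
    qed
    have bd: "\<bar>g k x\<bar> \<le> 1" for k x
      using infdist_nonneg[of x X] by (auto simp: g_def)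
    have [measurable]: "g k \<in> borel_measurable borel" for k
      by (rule borel_measurable_continuous_onI, rule Lipschitz_real_imp_continuous_on, rule lip)
    have lim: "(\<lambda>k. g k x) \<longlonglongrightarrow> indicator X x" for x
    proof (cases "x \<in> X")
      case True then show ?thesis by (simp add: g_def)
    next
      case nx: False
      then have pos: "infdist x X > 0"
        using X False by (simp add: infdist_pos_not_in_closed)
      obtain K :: nat where K: "1 / infdist x X < real K" using reals_Archimedean2 by blast
      have "g k x = 0" if "k \<ge> K" for k
      proof -
        have "1 \<le> real K * infdist x X" using K pos by (simp add: field_simps)
        also have "\<dots> \<le> real k * infdist x X" using that pos by simp
        finally show ?thesis by (simp add: g_def)
      qed
      then have "\<forall>\<^sub>F k in sequentially. g k x = 0" by (rule eventually_sequentiallyI)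
      then show ?thesis using nx by (simp add: tendsto_eventually)
    qed
    have [measurable]: "X \<in> sets borel" using X by auto
    have "(\<lambda>k. integral\<^sup>L M (g k)) \<longlonglongrightarrow> integral\<^sup>L M (indicator X)"
      by (rule integral_dominated_convergence[where w="\<lambda>_. 1"]) (use lim bd in auto)
    moreover have "(\<lambda>k. integral\<^sup>L N (g k)) \<longlonglongrightarrow> integral\<^sup>L N (indicator X)"
      by (rule integral_dominated_convergence[where w="\<lambda>_. 1"]) (use lim bd in auto)
    moreover have "integral\<^sup>L M (g k) = integral\<^sup>L N (g k)" for k
      by (rule eq[OF lip bd])
    ultimately have "integral\<^sup>L M (indicator X :: _ \<Rightarrow> real) = integral\<^sup>L N (indicator X)"
      by (simp add: LIMSEQ_unique)
    then have "measure M X = measure N X" using M(2) N(2) sets_eq_imp_space_eq[OF M(2)] sets_eq_imp_space_eq[OF N(2)] by simp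
    then show ?thesis by (simp add: M.emeasure_eq_measure N.emeasure_eq_measure)
  qed simp
qed (auto simp: Int_stable_def closed_Int borel_eq_closed M N finite_measure.emeasure_finite)

section \<open>Weak convergence from characteristic functions\<close>

lemma expectation_tendsto_if_char_tendsto:
  fixes X :: "nat \<Rightarrow> 'a \<Rightarrow> real" and f :: "real \<Rightarrow> real"
  assumes M: "prob_space M" and M': "prob_space M'"
    and X: "\<And>n. X n \<in> borel_measurable M" and Z: "Z \<in> borel_measurable M'"
    and conv: "\<And>t. (\<lambda>n. \<integral>\<omega>. iexp (t * X n \<omega>) \<partial>M) \<longlonglongrightarrow> (\<integral>\<omega>. iexp (t * Z \<omega>) \<partial>M')"
    and f: "\<And>x. isCont f x" "\<And>x. \<bar>f x\<bar> \<le> B"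
  shows "(\<lambda>n. \<integral>\<omega>. f (X n \<omega>) \<partial>M) \<longlonglongrightarrow> (\<integral>\<omega>. f (Z \<omega>) \<partial>M')"
proof -
  interpret M: prob_space M by fact
  interpret M': prob_space M' by fact
  note [measurable] = X Z
  have fm[measurable]: "f \<in> borel_measurable borel"
    using f(1) by (intro borel_measurable_continuous_onI) (simp add: continuous_at_imp_continuous_on)
  have rd: "real_distribution (distr M borel (X n))" for n
    by (rule M.real_distribution_distr) simp
  have rd': "real_distribution (distr M' borel Z)"
    by (rule M'.real_distribution_distr) simp
  have wc: "weak_conv_m (\<lambda>n. distr M borel (X n)) (distr M' borel Z)"
  proof (rule levy_continuity[OF rd rd'])
    fix t
    show "(\<lambda>n. char (distr M borel (X n)) t) \<longlonglongrightarrow> char (distr M' borel Z) t"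
      using conv[of t] unfolding char_def by (simp add: integral_distr)
  qed
  show ?thesis
    using weak_conv_imp_integral_bdd_continuous_conv[OF rd rd' wc, of f B] f
    by (simp add: integral_distr)
qed

text \<open>Reindexing a countable index set by natural numbers makes the borel algebra of the
  function space available, which needs a countable index type.\<close>

lemma continuous_map_imp_measurable_PiM:
  fixes f :: "('i \<Rightarrow> 'b::second_countable_topology) \<Rightarrow> real"
  assumes I: "countable I"
    and f: "continuous_map (product_topology (\<lambda>_. euclidean) I) euclideanreal f"
  shows "f \<in> borel_measurable (\<Pi>\<^sub>M t\<in>I. borel)"
proof -
  define \<kappa> where "\<kappa> = to_nat_on I"
  have inj: "inj_on \<kappa> I" unfolding \<kappa>_def by (rule inj_on_to_nat_on[OF I])
  define G :: "(nat \<Rightarrow> 'b) \<Rightarrow> 'i \<Rightarrow> 'b" where "G z = (\<lambda>t\<in>I. z (\<kappa> t))" for z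
  define E :: "('i \<Rightarrow> 'b) \<Rightarrow> nat \<Rightarrow> 'b" where
    "E x = (\<lambda>k. if k \<in> \<kappa> ` I then x (inv_into I \<kappa> k) else undefined)" for x
  have "continuous_map euclidean (product_topology (\<lambda>_. euclidean) I) G"
    unfolding continuous_map_componentwise by (auto simp: G_def)
  then have "continuous_map euclidean euclideanreal (f \<circ> G)"
    using f by (rule continuous_map_compose)
  then have fG: "f \<circ> G \<in> borel_measurable borel"
    by (intro borel_measurable_continuous_onI) simp
  have E: "E \<in> measurable (\<Pi>\<^sub>M t\<in>I. borel) borel"
  proof (rule measurable_coordinatewise_then_product)
    fix k
    show "(\<lambda>x. E x k) \<in> borel_measurable (\<Pi>\<^sub>M t\<in>I. borel)"
    proof (cases "k \<in> \<kappa> ` I")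
      case True
      then obtain s where s: "s \<in> I" "k = \<kappa> s" by auto
      have "inv_into I \<kappa> k = s" unfolding s(2) by (rule inv_into_f_f[OF inj s(1)])
      then have "(\<lambda>x. E x k) = (\<lambda>x. x s)" using True by (simp add: E_def)
      then show ?thesis using measurable_component_singleton[OF s(1), of "\<lambda>_. borel"] by simp
    qed (simp add: E_def)
  qed
  have "(f \<circ> G) \<circ> E \<in> borel_measurable (\<Pi>\<^sub>M t\<in>I. borel)"
    using E fG by (rule measurable_comp)
  moreover have "((f \<circ> G) \<circ> E) x = f x" if "x \<in> space (\<Pi>\<^sub>M t\<in>I. borel)" for x
  proof -
    have x: "x \<in> extensional I" using that by (simp add: space_PiM PiE_def)
    have "G (E x) t = x t" for t
    proof (cases "t \<in> I")
      case True
      then have "E x (\<kappa> t) = x t" unfolding E_def by (simp add: inv_into_f_f[OF inj True])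
      then show ?thesis using True by (simp add: G_def)
    next
      case False
      then show ?thesis using extensional_arb[OF x False] by (simp add: G_def)
    qed
    then have "G (E x) = x" by (rule ext)
    then show ?thesis by simp
  qed
  ultimately show ?thesis by (simp cong: measurable_cong)
qed

text \<open>Finite linear combinations of characters: convergence of characteristic functions
  extends to them by linearity, and they are closed under products, as an algebra for the
  Stone-Weierstrass theorem must be. The values are complex, but the approximants used later are
  real-valued members.\<close>

inductive trig_poly :: "'i set \<Rightarrow> (('i \<Rightarrow> real) \<Rightarrow> complex) \<Rightarrow> bool" for I where
  trig_poly_exp: "trig_poly I (\<lambda>x. c * iexp (\<Sum>t\<in>I. \<theta> t * x t))"
| trig_poly_add: "trig_poly I f \<Longrightarrow> trig_poly I g \<Longrightarrow> trig_poly I (\<lambda>x. f x + g x)"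

lemma trig_poly_mult:
  assumes "trig_poly I f" "trig_poly I g" shows "trig_poly I (\<lambda>x. f x * g x)"
  using assms(1)
proof induction
  case (trig_poly_exp c \<theta>)
  show ?case using assms(2)
  proof induction
    case (trig_poly_exp c' \<theta>')
    have "(\<lambda>x. c * iexp (\<Sum>t\<in>I. \<theta> t * x t) * (c' * iexp (\<Sum>t\<in>I. \<theta>' t * x t))) =
      (\<lambda>x. (c * c') * iexp (\<Sum>t\<in>I. (\<theta> t + \<theta>' t) * x t))"
      by (simp add: distrib_right sum.distrib distrib_left exp_add mult_ac)
    then show ?case by (simp only: trig_poly.trig_poly_exp)
  next
    case (trig_poly_add f g)
    then show ?case by (simp add: distrib_left trig_poly.trig_poly_add)
  qed
next
  case (trig_poly_add f g)
  then show ?case by (simp add: distrib_right trig_poly.trig_poly_add)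
qed

lemma trig_poly_const: "trig_poly I (\<lambda>_. c)"
  using trig_poly_exp[of I c "\<lambda>_. 0"] by simp

text \<open>In the folded variables this is a coordinate function, which is what separates points in
  the Stone-Weierstrass argument.\<close>

lemma trig_poly_sin:
  assumes "finite I" "t \<in> I" shows "trig_poly I (\<lambda>x. complex_of_real (sin (b * x t)))"
proof -
  have s: "(\<Sum>k\<in>I. (if k = t then a else 0) * x k) = a * x t" for a :: real and x
    using assms by (simp add: if_distrib[of "\<lambda>y. y * _"] cong: if_cong)
  have "trig_poly I (\<lambda>x. 1 / (2 * \<i>) * iexp (b * x t) + (- 1 / (2 * \<i>)) * iexp (- b * x t))"
    using trig_poly_add[OF trig_poly_exp[of I "1 / (2 * \<i>)" "\<lambda>k. if k = t then b else 0"]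
        trig_poly_exp[of I "- 1 / (2 * \<i>)" "\<lambda>k. if k = t then - b else 0"]]
    unfolding s .
  moreover have sy: "complex_of_real (sin y) = 1 / (2 * \<i>) * iexp y + (- 1 / (2 * \<i>)) * iexp (- y)" for y
    by (simp flip: sin_of_real add: sin_exp_eq field_simps)
  moreover have "(\<lambda>x. complex_of_real (sin (b * x t))) =
      (\<lambda>x. 1 / (2 * \<i>) * iexp (b * x t) + (- 1 / (2 * \<i>)) * iexp (- b * x t))"
    unfolding sy mult_minus_left ..
  ultimately show ?thesis by (simp only:)
qed

lemma trig_poly_bounded: "trig_poly I f \<Longrightarrow> \<exists>B. \<forall>x. norm (f x) \<le> B"
proof (induction rule: trig_poly.induct)
  case (trig_poly_exp c \<theta>)
  show ?case by (intro exI[of _ "norm c"]) (simp add: norm_mult)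
next
  case (trig_poly_add f g)
  then obtain B B' where "\<And>x. norm (f x) \<le> B" "\<And>x. norm (g x) \<le> B'" by blast
  then show ?case by (intro exI[of _ "B + B'"] allI norm_triangle_mono)
qed

lemma trig_poly_measurable:
  assumes "trig_poly I f" and X: "\<And>t. t \<in> I \<Longrightarrow> X t \<in> borel_measurable M"
  shows "(\<lambda>\<omega>. f (\<lambda>t. X t \<omega>)) \<in> borel_measurable M"
  using assms(1)
proof induction
  case (trig_poly_exp c \<theta>)
  have [measurable]: "(\<lambda>\<omega>. \<Sum>t\<in>I. \<theta> t * X t \<omega>) \<in> borel_measurable M"
    using X by (intro borel_measurable_sum borel_measurable_times) auto
  show ?case by measurable
next
  case (trig_poly_add f g)
  show ?case using trig_poly_add.IH by (rule borel_measurable_add)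
qed

lemma trig_poly_integrable:
  assumes "finite_measure M" "trig_poly I f" "\<And>t. t \<in> I \<Longrightarrow> X t \<in> borel_measurable M"
  shows "integrable M (\<lambda>\<omega>. f (\<lambda>t. X t \<omega>))"
proof -
  obtain B where "\<And>x. norm (f x) \<le> B" using trig_poly_bounded[OF assms(2)] by blast
  then show ?thesis
    by (intro finite_measure.integrable_const_bound[OF assms(1), where B=B] trig_poly_measurable[OF assms(2,3)]) auto
qed

lemma trig_poly_tendsto:
  fixes X :: "nat \<Rightarrow> 'i \<Rightarrow> 'a \<Rightarrow> real"
  assumes M: "finite_measure M" "finite_measure M'"
    and X: "\<And>n t. t \<in> I \<Longrightarrow> X n t \<in> borel_measurable M"
    and Z: "\<And>t. t \<in> I \<Longrightarrow> Z t \<in> borel_measurable M'"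
    and conv: "\<And>a. (\<lambda>n. \<integral>\<omega>. iexp (\<Sum>t\<in>I. a t * X n t \<omega>) \<partial>M) \<longlonglongrightarrow> (\<integral>\<omega>. iexp (\<Sum>t\<in>I. a t * Z t \<omega>) \<partial>M')"
    and f: "trig_poly I f"
  shows "(\<lambda>n. \<integral>\<omega>. f (\<lambda>t. X n t \<omega>) \<partial>M) \<longlonglongrightarrow> (\<integral>\<omega>. f (\<lambda>t. Z t \<omega>) \<partial>M')"
  using f
proof induction
  case (trig_poly_exp c \<theta>)
  show ?case using tendsto_mult_left[OF conv[of \<theta>], of c] by simp
next
  case (trig_poly_add f g)
  have "(\<integral>\<omega>. f (\<lambda>t. V t \<omega>) + g (\<lambda>t. V t \<omega>) \<partial>Q) = (\<integral>\<omega>. f (\<lambda>t. V t \<omega>) \<partial>Q) + (\<integral>\<omega>. g (\<lambda>t. V t \<omega>) \<partial>Q)"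
    if "finite_measure Q" "\<And>t. t \<in> I \<Longrightarrow> V t \<in> borel_measurable Q" for Q :: "'q measure" and V
    using trig_poly_integrable[OF that(1) trig_poly_add.hyps(1) that(2)]
      trig_poly_integrable[OF that(1) trig_poly_add.hyps(2) that(2)]
    by (rule Bochner_Integration.integral_add)
  from this[OF M(1) X] this[OF M(2) Z] show ?case
    using tendsto_add[OF trig_poly_add.IH] by simp
qed

lemma integral_joint_law:
  fixes f :: "('i \<Rightarrow> 'b::topological_space) \<Rightarrow> real"
  assumes "f \<in> borel_measurable (\<Pi>\<^sub>M t\<in>I. borel)" "\<And>t. t \<in> I \<Longrightarrow> X t \<in> borel_measurable M"
  shows "(\<integral>x. f x \<partial>joint_law M I X) = (\<integral>\<omega>. f (\<lambda>t\<in>I. X t \<omega>) \<partial>M)"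
  unfolding joint_law_def by (rule integral_distr[OF measurable_restrict[OF assms(2)] assms(1)])

text \<open>Trigonometric polynomials are dense for uniform approximation of \<open>f\<close> after folding: on the
  cube of radius \<open>K\<close> the function \<open>f\<close> agrees with a periodic function of
  \<open>sin (\<pi> x / (2 K))\<close>, to which the Stone-Weierstrass theorem applies.\<close>

lemma trig_poly_approximation:
  fixes f :: "('i \<Rightarrow> real) \<Rightarrow> real"
  assumes I: "finite I"
    and f: "continuous_map (product_topology (\<lambda>_. euclidean) I) euclideanreal f"
    and B: "\<And>x. x \<in> (\<Pi>\<^sub>E t\<in>I. UNIV) \<Longrightarrow> \<bar>f x\<bar> \<le> B"
    and K: "K > 0" and e: "e > 0"
  obtains p where "trig_poly I (\<lambda>x. complex_of_real (p x))"
    and "\<And>x. \<bar>p x\<bar> \<le> B + e"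
    and "\<And>x. (\<And>t. t \<in> I \<Longrightarrow> \<bar>x t\<bar> \<le> K) \<Longrightarrow> \<bar>f (restrict x I) - p x\<bar> \<le> e"
proof -
  define \<kappa> where "\<kappa> = to_nat_on I"
  have inj: "inj_on \<kappa> I" unfolding \<kappa>_def by (rule inj_on_to_nat_on[OF countable_finite[OF I]])
  \<comment> \<open>This frequency maps \<open>[-K, K]\<close> onto
    \<open>[-pi / 2, pi / 2]\<close>, where \<open>arcsin\<close> inverts
    \<open>sin\<close>.\<close>
  define w where "w = pi / (2 * K)"
  have w: "w > 0" using K by (simp add: w_def)
  define z :: "('i \<Rightarrow> real) \<Rightarrow> nat \<Rightarrow> real" where
    "z x = (\<lambda>k. if k \<in> \<kappa> ` I then sin (w * x (inv_into I \<kappa> k)) else 0)" for x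
  have z: "z x (\<kappa> t) = sin (w * x t)" if "t \<in> I" for x t
    using that inj by (simp add: z_def)
  \<comment> \<open>Coordinates outside the range of \<open>\<kappa>\<close> are frozen at 0, which
    keeps the set compact although its members are functions on all naturals.\<close>
  define S :: "(nat \<Rightarrow> real) set" where "S = (\<Pi>\<^sub>E k\<in>UNIV. if k \<in> \<kappa> ` I then {-1..1} else {0})"
  have zS: "z x \<in> S" for x by (auto simp: z_def S_def)
  have "compactin (product_topology (\<lambda>_. euclidean) UNIV) S"
    unfolding S_def compactin_PiE by auto
  then have "compact S" by (simp add: euclidean_product_topology)
  define G :: "(nat \<Rightarrow> real) \<Rightarrow> 'i \<Rightarrow> real" where "G v = (\<lambda>t\<in>I. arcsin (v (\<kappa> t)) / w)" for v
  have "continuous_map (top_of_set S) (product_topology (\<lambda>_. euclidean) I) G"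
    unfolding continuous_map_componentwise
  proof (intro conjI ballI)
    fix t assume t: "t \<in> I"
    have c: "continuous_on S (\<lambda>v. v (\<kappa> t))"
      by (rule continuous_on_subset[OF continuous_on_product_coordinates]) simp
    have "continuous_on S (\<lambda>v. arcsin (v (\<kappa> t)))"
    proof (rule continuous_on_arcsin[OF c], rule ballI)
      fix v assume "v \<in> S"
      then have "v (\<kappa> t) \<in> (if \<kappa> t \<in> \<kappa> ` I then {-1..1} else {0})"
        unfolding S_def by (rule PiE_mem) simp
      then show "-1 \<le> v (\<kappa> t) \<and> v (\<kappa> t) \<le> 1" using t by auto
    qed
    then have "continuous_on S (\<lambda>v. arcsin (v (\<kappa> t)) / w)"
      using w by (intro continuous_on_divide continuous_on_const) auto
    then show "continuous_map (top_of_set S) euclidean (\<lambda>v. G v t)"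
      using t by (simp add: G_def)
  qed (auto simp: G_def)
  then have "continuous_map (top_of_set S) euclideanreal (f \<circ> G)"
    using f by (rule continuous_map_compose)
  then have fG: "continuous_on S (f \<circ> G)" by simp
  define P where "P g \<longleftrightarrow> continuous_on S g \<and> trig_poly I (\<lambda>x. complex_of_real (g (z x)))" for g
  have "\<exists>g. P g \<and> (\<forall>v\<in>S. \<bar>(f \<circ> G) v - g v\<bar> < e)"
  proof (rule Stone_Weierstrass_HOL[OF \<open>compact S\<close>, of P])
    show "P (\<lambda>x. c)" for c by (simp add: P_def trig_poly_const)
    show "P g \<Longrightarrow> continuous_on S g" for g by (simp add: P_def)
    show "P g \<and> P h \<Longrightarrow> P (\<lambda>x. g x + h x)" for g h
      by (auto simp: P_def intro!: continuous_intros trig_poly_add)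
    show "P g \<and> P h \<Longrightarrow> P (\<lambda>x. g x * h x)" for g h
      by (auto simp: P_def intro!: continuous_intros trig_poly_mult)
    show "\<exists>g. P g \<and> g x \<noteq> g y" if xy: "x \<in> S \<and> y \<in> S \<and> x \<noteq> y" for x y
    proof -
      obtain k where k: "x k \<noteq> y k" using xy by auto
      have "v k \<in> (if k \<in> \<kappa> ` I then {-1..1} else {0})" if "v \<in> S" for v
        using that unfolding S_def by (rule PiE_mem) simp
      from this[of x] this[of y] k xy have "k \<in> \<kappa> ` I" by (auto split: if_splits)
      then obtain t where t: "t \<in> I" "k = \<kappa> t" by auto
      have "continuous_on S (\<lambda>v. v k)"
        by (rule continuous_on_subset[OF continuous_on_product_coordinates]) simp
      moreover have "trig_poly I (\<lambda>x. complex_of_real (z x k))"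
        using trig_poly_sin[OF I t(1), of w] z[OF t(1)] t(2) by simp
      ultimately have "P (\<lambda>v. v k)" by (simp add: P_def)
      then show ?thesis using k by blast
    qed
  qed (use fG e in auto)
  then obtain g where g: "P g" "\<And>v. v \<in> S \<Longrightarrow> \<bar>f (G v) - g v\<bar> < e" by auto
  show ?thesis
  proof (rule that[of "\<lambda>x. g (z x)"])
    show "trig_poly I (\<lambda>x. complex_of_real (g (z x)))" using g(1) by (simp add: P_def)
    \<comment> \<open>The folded point lies in \<open>S\<close> for every \<open>x\<close>, so
      \<open>g\<close> is close to \<open>f\<close> composed with \<open>G\<close> everywhere, and
      the bound of \<open>f\<close> is inherited off the cube as well.\<close>
    show "\<bar>g (z x)\<bar> \<le> B + e" for x
    proof -
      have "\<bar>f (G (z x))\<bar> \<le> B" by (rule B) (simp add: G_def)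
      then show ?thesis using g(2)[OF zS[of x]] by linarith
    qed
    show "\<bar>f (restrict x I) - g (z x)\<bar> \<le> e" if x: "\<And>t. t \<in> I \<Longrightarrow> \<bar>x t\<bar> \<le> K" for x
    proof -
      have "arcsin (z x (\<kappa> t)) / w = x t" if t: "t \<in> I" for t
      proof -
        have "w * \<bar>x t\<bar> \<le> w * K" using x[OF t] w by (intro mult_left_mono) auto
        also have "w * K = pi / 2" using K by (simp add: w_def)
        finally have "\<bar>w * x t\<bar> \<le> pi / 2" using w by (simp add: abs_mult)
        then have "arcsin (sin (w * x t)) = w * x t" by (intro arcsin_sin) auto
        then show ?thesis using z[OF t] w by simp
      qed
      then have "G (z x) = restrict x I" by (auto simp: G_def)
      then show ?thesis using g(2)[OF zS[of x]] by simp
    qed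
  qed
qed

text \<open>A continuous substitute for the indicator of \<open>\<bar>x\<bar> > K\<close>: its
  expectation passes to the limit under weak convergence of a coordinate, which takes the place of a
  tightness argument.\<close>

definition tail_cutoff :: "real \<Rightarrow> real \<Rightarrow> real" where
  "tail_cutoff K x = min 1 (max 0 (\<bar>x\<bar> - K))"

lemma tail_cutoff_simps: "0 \<le> tail_cutoff K x" "tail_cutoff K x \<le> 1" "\<bar>tail_cutoff K x\<bar> \<le> 1"
  "K + 1 \<le> \<bar>x\<bar> \<Longrightarrow> tail_cutoff K x = 1"
  by (auto simp: tail_cutoff_def)

lemma isCont_tail_cutoff: "isCont (tail_cutoff K) x"
  unfolding tail_cutoff_def by (intro continuous_intros)

lemma tail_cutoff_measurable[measurable]: "tail_cutoff K \<in> borel_measurable borel"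
  unfolding tail_cutoff_def by measurable

lemma tail_cutoff_expectation_tendsto_0:
  assumes "prob_space M" and Z[measurable]: "Z \<in> borel_measurable M"
  shows "(\<lambda>K. \<integral>\<omega>. tail_cutoff (real K) (Z \<omega>) \<partial>M) \<longlonglongrightarrow> 0"
proof -
  interpret prob_space M by fact
  have "(\<lambda>K. \<integral>\<omega>. tail_cutoff (real K) (Z \<omega>) \<partial>M) \<longlonglongrightarrow> (\<integral>\<omega>. 0 \<partial>M)"
  proof (rule integral_dominated_convergence[where w="\<lambda>_. 1"])
    show "AE \<omega> in M. (\<lambda>K. tail_cutoff (real K) (Z \<omega>)) \<longlonglongrightarrow> 0"
    proof (rule AE_I2, rule tendsto_eventually)
      fix \<omega>
      obtain K :: nat where "\<bar>Z \<omega>\<bar> \<le> real K" using real_arch_simple by blast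
      then show "\<forall>\<^sub>F K in sequentially. tail_cutoff (real K) (Z \<omega>) = 0"
        by (intro eventually_sequentiallyI[of K]) (auto simp: tail_cutoff_def)
    qed
  qed (auto simp: tail_cutoff_simps)
  then show ?thesis by simp
qed

text \<open>On a large cube \<open>f\<close> is uniformly close to a trigonometric polynomial. Off
  the cube their difference is bounded, and the mass there is controlled by the cutoffs of single
  coordinates, whose expectations converge by the one-dimensional Levy theorem. Tightness thus comes
  from the limit being the characteristic function of an actual random vector.\<close>

lemma weakly_converges_PiM_if_char_tendsto:
  fixes X :: "nat \<Rightarrow> 'i \<Rightarrow> 'a \<Rightarrow> real" and Z :: "'i \<Rightarrow> 'b \<Rightarrow> real"
  assumes M: "prob_space M" and M': "prob_space M'" and I: "finite I"
    and X: "\<And>n t. t \<in> I \<Longrightarrow> X n t \<in> borel_measurable M"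
    and Z: "\<And>t. t \<in> I \<Longrightarrow> Z t \<in> borel_measurable M'"
    and conv: "\<And>a. (\<lambda>n. \<integral>\<omega>. iexp (\<Sum>t\<in>I. a t * X n t \<omega>) \<partial>M) \<longlonglongrightarrow> (\<integral>\<omega>. iexp (\<Sum>t\<in>I. a t * Z t \<omega>) \<partial>M')"
  shows "weakly_converges_PiM I (\<lambda>n. joint_law M I (X n)) (joint_law M' I Z) sequentially"
  unfolding weakly_converges_PiM_def
proof (intro allI impI, elim conjE)
  interpret M: prob_space M by fact
  interpret M': prob_space M' by fact
  fix f :: "('i \<Rightarrow> real) \<Rightarrow> real"
  assume f: "continuous_map (product_topology (\<lambda>t. euclidean) I) euclideanreal f"
    and bd: "bounded (f ` (\<Pi>\<^sub>E t\<in>I. UNIV))"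
  obtain B0 where B0: "\<And>x. x \<in> (\<Pi>\<^sub>E t\<in>I. UNIV) \<Longrightarrow> \<bar>f x\<bar> \<le> B0"
    using bd unfolding bounded_iff by auto
  define B where "B = max B0 1"
  have B: "\<bar>f x\<bar> \<le> B" if "x \<in> (\<Pi>\<^sub>E t\<in>I. UNIV)" for x using B0[OF that] by (simp add: B_def)
  have B1: "B \<ge> 1" by (simp add: B_def)
  have fm: "f \<in> borel_measurable (\<Pi>\<^sub>M t\<in>I. borel)"
    using I f by (intro continuous_map_imp_measurable_PiM) (auto simp: countable_finite)
  have single: "(\<lambda>n. \<integral>\<omega>. g (X n t \<omega>) \<partial>M) \<longlonglongrightarrow> (\<integral>\<omega>. g (Z t \<omega>) \<partial>M')"
    if t: "t \<in> I" and g: "\<And>x. isCont g x" "\<And>x. \<bar>g x\<bar> \<le> C" for t C and g :: "real \<Rightarrow> real"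
  proof (rule expectation_tendsto_if_char_tendsto[OF M M' _ _ _ g])
    fix \<theta> :: real
    have "(\<Sum>k\<in>I. (if k = t then \<theta> else 0) * x k) = \<theta> * x t" for x :: "'i \<Rightarrow> real"
      using t I by (simp add: if_distrib[of "\<lambda>y. y * _"] cong: if_cong)
    then show "(\<lambda>n. \<integral>\<omega>. iexp (\<theta> * X n t \<omega>) \<partial>M) \<longlonglongrightarrow> (\<integral>\<omega>. iexp (\<theta> * Z t \<omega>) \<partial>M')"
      using conv[of "\<lambda>k. if k = t then \<theta> else 0"] by simp
  qed (use t X Z in auto)
  have "(\<lambda>n. \<integral>\<omega>. f (\<lambda>t\<in>I. X n t \<omega>) \<partial>M) \<longlonglongrightarrow> (\<integral>\<omega>. f (\<lambda>t\<in>I. Z t \<omega>) \<partial>M')"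
  proof (rule LIMSEQ_I)
    fix e0 :: real assume e0: "e0 > 0"
    \<comment> \<open>Each of the two replacements of \<open>f\<close> by \<open>p\<close> costs at
      most \<open>(2 * B + 2) * e\<close>, and the comparison of the two expectations of
      \<open>p\<close> costs \<open>e\<close>; together this is below
      \<open>(8 * B + 8) * e\<close>.\<close>
    define e where "e = min 1 (e0 / (8 * B + 8))"
    have e: "e > 0" "e \<le> 1" using e0 B1 by (auto simp: e_def)
    have "(\<lambda>K. \<Sum>t\<in>I. \<integral>\<omega>. tail_cutoff (real K) (Z t \<omega>) \<partial>M') \<longlonglongrightarrow> (\<Sum>t\<in>I. 0)"
      using M' Z by (intro tendsto_sum tail_cutoff_expectation_tendsto_0) auto
    then have "\<forall>\<^sub>F K in sequentially. (\<Sum>t\<in>I. \<integral>\<omega>. tail_cutoff (real K) (Z t \<omega>) \<partial>M') < e"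
      using e by (intro order_tendstoD) auto
    then obtain K :: nat where K: "(\<Sum>t\<in>I. \<integral>\<omega>. tail_cutoff (real K) (Z t \<omega>) \<partial>M') < e"
      by (auto simp: eventually_sequentially)
    have K1: "real K + 1 > 0" by simp
    have "\<exists>p. trig_poly I (\<lambda>x. complex_of_real (p x)) \<and> (\<forall>x. \<bar>p x\<bar> \<le> B + e) \<and>
        (\<forall>x. (\<forall>t\<in>I. \<bar>x t\<bar> \<le> real K + 1) \<longrightarrow> \<bar>f (restrict x I) - p x\<bar> \<le> e)"
      by (rule trig_poly_approximation[OF I f B K1 e(1)], assumption, blast)
    then obtain p where p: "trig_poly I (\<lambda>x. complex_of_real (p x))" "\<And>x. \<bar>p x\<bar> \<le> B + e"
        "\<And>x. (\<And>t. t \<in> I \<Longrightarrow> \<bar>x t\<bar> \<le> real K + 1) \<Longrightarrow> \<bar>f (restrict x I) - p x\<bar> \<le> e"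
      by blast
    \<comment> \<open>A coordinate beyond \<open>K + 1\<close> in modulus has cutoff 1, which pays
      for the crude bound \<open>2 * B + e\<close>.\<close>
    have pt: "\<bar>f (restrict x I) - p x\<bar> \<le> (2 * B + e) * (\<Sum>t\<in>I. tail_cutoff (real K) (x t)) + e" for x
    proof (cases "\<forall>t\<in>I. \<bar>x t\<bar> \<le> real K + 1")
      case True
      have "0 \<le> (2 * B + e) * (\<Sum>t\<in>I. tail_cutoff (real K) (x t))"
        using B1 e by (intro mult_nonneg_nonneg sum_nonneg tail_cutoff_simps) auto
      moreover have "\<bar>f (restrict x I) - p x\<bar> \<le> e" using p(3) True by blast
      ultimately show ?thesis by linarith
    next
      case False
      then obtain t where t: "t \<in> I" "real K + 1 \<le> \<bar>x t\<bar>" by force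
      have "1 = tail_cutoff (real K) (x t)" using t by (simp add: tail_cutoff_simps)
      also have "\<dots> \<le> (\<Sum>t\<in>I. tail_cutoff (real K) (x t))"
        by (rule member_le_sum[OF t(1)]) (auto simp: tail_cutoff_simps I)
      finally have "2 * B + e \<le> (2 * B + e) * (\<Sum>t\<in>I. tail_cutoff (real K) (x t))"
        using B1 e by simp
      moreover have "\<bar>f (restrict x I)\<bar> \<le> B" by (rule B) simp
      ultimately show ?thesis using p(2)[of x] e by linarith
    qed
    have est: "\<bar>(\<integral>\<omega>. f (\<lambda>t\<in>I. V t \<omega>) \<partial>Q) - (\<integral>\<omega>. p (\<lambda>t. V t \<omega>) \<partial>Q)\<bar> \<le>
        (2 * B + e) * (\<Sum>t\<in>I. \<integral>\<omega>. tail_cutoff (real K) (V t \<omega>) \<partial>Q) + e"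
      "(\<integral>\<omega>. complex_of_real (p (\<lambda>t. V t \<omega>)) \<partial>Q) = complex_of_real (\<integral>\<omega>. p (\<lambda>t. V t \<omega>) \<partial>Q)"
      if Q: "prob_space Q" and V[measurable]: "\<And>t. t \<in> I \<Longrightarrow> V t \<in> borel_measurable Q" for Q :: "'q measure" and V
    proof -
      interpret Q: prob_space Q by fact
      have [measurable]: "(\<lambda>\<omega>. f (\<lambda>t\<in>I. V t \<omega>)) \<in> borel_measurable Q"
        by (rule measurable_compose[OF measurable_restrict[OF V] fm])
      have "(\<lambda>\<omega>. Re (complex_of_real (p (\<lambda>t. V t \<omega>)))) \<in> borel_measurable Q"
        by (rule measurable_compose[OF trig_poly_measurable[OF p(1) V] borel_measurable_Re])
      then have [measurable]: "(\<lambda>\<omega>. p (\<lambda>t. V t \<omega>)) \<in> borel_measurable Q" by simp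
      have i1: "integrable Q (\<lambda>\<omega>. f (\<lambda>t\<in>I. V t \<omega>))"
        by (rule Q.integrable_const_bound[where B=B]) (use B in auto)
      have i2: "integrable Q (\<lambda>\<omega>. p (\<lambda>t. V t \<omega>))"
        by (rule Q.integrable_const_bound[where B="B + e"]) (use p(2) in auto)
      have i3: "integrable Q (\<lambda>\<omega>. tail_cutoff (real K) (V t \<omega>))" if "t \<in> I" for t
        by (rule Q.integrable_const_bound[where B=1]) (use that in \<open>auto simp: tail_cutoff_simps\<close>)
      have "\<bar>(\<integral>\<omega>. f (\<lambda>t\<in>I. V t \<omega>) \<partial>Q) - (\<integral>\<omega>. p (\<lambda>t. V t \<omega>) \<partial>Q)\<bar> =
          \<bar>\<integral>\<omega>. f (\<lambda>t\<in>I. V t \<omega>) - p (\<lambda>t. V t \<omega>) \<partial>Q\<bar>"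
        using i1 i2 by simp
      also have "\<dots> \<le> (\<integral>\<omega>. \<bar>f (\<lambda>t\<in>I. V t \<omega>) - p (\<lambda>t. V t \<omega>)\<bar> \<partial>Q)"
        by (rule integral_abs_bound)
      also have "\<dots> \<le> (\<integral>\<omega>. (2 * B + e) * (\<Sum>t\<in>I. tail_cutoff (real K) (V t \<omega>)) + e \<partial>Q)"
        using i1 i2 i3 pt[of "\<lambda>t. V t _"] by (intro integral_mono) auto
      also have "\<dots> = (2 * B + e) * (\<Sum>t\<in>I. \<integral>\<omega>. tail_cutoff (real K) (V t \<omega>) \<partial>Q) + e"
        using i3 by (simp add: Q.prob_space)
      finally show "\<bar>(\<integral>\<omega>. f (\<lambda>t\<in>I. V t \<omega>) \<partial>Q) - (\<integral>\<omega>. p (\<lambda>t. V t \<omega>) \<partial>Q)\<bar> \<le>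
        (2 * B + e) * (\<Sum>t\<in>I. \<integral>\<omega>. tail_cutoff (real K) (V t \<omega>) \<partial>Q) + e" .
    qed simp
    have "(\<lambda>n. \<integral>\<omega>. complex_of_real (p (\<lambda>t. X n t \<omega>)) \<partial>M) \<longlonglongrightarrow> (\<integral>\<omega>. complex_of_real (p (\<lambda>t. Z t \<omega>)) \<partial>M')"
      by (rule trig_poly_tendsto[OF _ _ X Z conv p(1)]) unfold_locales
    then have "(\<lambda>n. Re (\<integral>\<omega>. complex_of_real (p (\<lambda>t. X n t \<omega>)) \<partial>M)) \<longlonglongrightarrow> Re (\<integral>\<omega>. complex_of_real (p (\<lambda>t. Z t \<omega>)) \<partial>M')"
      by (rule tendsto_Re)
    then have "(\<lambda>n. \<integral>\<omega>. p (\<lambda>t. X n t \<omega>) \<partial>M) \<longlonglongrightarrow> (\<integral>\<omega>. p (\<lambda>t. Z t \<omega>) \<partial>M')"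
      by simp
    then have ev1: "\<forall>\<^sub>F n in sequentially. \<bar>(\<integral>\<omega>. p (\<lambda>t. X n t \<omega>) \<partial>M) - (\<integral>\<omega>. p (\<lambda>t. Z t \<omega>) \<partial>M')\<bar> < e"
      using e(1) by (simp add: tendsto_iff dist_real_def)
    have "(\<lambda>n. \<Sum>t\<in>I. \<integral>\<omega>. tail_cutoff (real K) (X n t \<omega>) \<partial>M) \<longlonglongrightarrow> (\<Sum>t\<in>I. \<integral>\<omega>. tail_cutoff (real K) (Z t \<omega>) \<partial>M')"
      by (rule tendsto_sum) (rule single[OF _ isCont_tail_cutoff tail_cutoff_simps(3)])
    then have ev2: "\<forall>\<^sub>F n in sequentially. (\<Sum>t\<in>I. \<integral>\<omega>. tail_cutoff (real K) (X n t \<omega>) \<partial>M) < e"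
      using K by (rule order_tendstoD)
    have "\<forall>\<^sub>F n in sequentially. norm ((\<integral>\<omega>. f (\<lambda>t\<in>I. X n t \<omega>) \<partial>M) - (\<integral>\<omega>. f (\<lambda>t\<in>I. Z t \<omega>) \<partial>M')) < e0"
      using ev1 ev2
    proof eventually_elim
      case (elim n)
      have be: "(2 * B + e) * s + e \<le> (2 * B + 2) * e" if "s < e" for s
      proof -
        have "(2 * B + e) * s \<le> (2 * B + e) * e" using that B1 e by (intro mult_left_mono) auto
        also have "\<dots> \<le> (2 * B + 1) * e" using e by (intro mult_right_mono) auto
        finally show ?thesis by (simp add: algebra_simps)
      qed
      have "\<bar>(\<integral>\<omega>. f (\<lambda>t\<in>I. X n t \<omega>) \<partial>M) - (\<integral>\<omega>. p (\<lambda>t. X n t \<omega>) \<partial>M)\<bar> \<le> (2 * B + 2) * e"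
        using order_trans[OF est(1)[OF M, of "X n", OF X] be[OF elim(2)]] by blast
      moreover have "\<bar>(\<integral>\<omega>. f (\<lambda>t\<in>I. Z t \<omega>) \<partial>M') - (\<integral>\<omega>. p (\<lambda>t. Z t \<omega>) \<partial>M')\<bar> \<le> (2 * B + 2) * e"
        using order_trans[OF est(1)[OF M', of Z, OF Z] be[OF K]] by blast
      moreover have "2 * ((2 * B + 2) * e) + e < e0"
      proof -
        have "(8 * B + 8) * e \<le> e0"
        proof -
          have "e \<le> e0 / (8 * B + 8)" by (simp add: e_def)
          moreover have "8 * B + 8 > 0" using B1 by simp
          ultimately show ?thesis by (simp add: pos_le_divide_eq mult.commute)
        qed
        moreover have "2 * ((2 * B + 2) * e) + e < (8 * B + 8) * e"
        proof -
          have "0 < B * e" using B1 e by simp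
          then show ?thesis using e(1) by (simp add: algebra_simps)
        qed
        ultimately show ?thesis by linarith
      qed
      ultimately show ?case using elim(1) unfolding real_norm_def by linarith
    qed
    then show "\<exists>no. \<forall>n\<ge>no. norm ((\<integral>\<omega>. f (\<lambda>t\<in>I. X n t \<omega>) \<partial>M) - (\<integral>\<omega>. f (\<lambda>t\<in>I. Z t \<omega>) \<partial>M')) < e0"
      by (simp add: eventually_sequentially)
  qed
  then show "(\<lambda>n. \<integral>x. f x \<partial>joint_law M I (X n)) \<longlonglongrightarrow> (\<integral>x. f x \<partial>joint_law M' I Z)"
    using X Z by (simp add: integral_joint_law[OF fm])
qed

text \<open>A degenerate variable has no density and is treated separately; otherwise
  standardisation reduces everything to the standard normal law. The second moment is included
  because the limit variance has to be read off from covariances later.\<close>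

lemma normal_rv_moments:
  assumes M: "prob_space M" and \<xi>: "normal_rv M \<xi> m \<sigma>"
  shows "integrable M (\<lambda>\<omega>. (\<xi> \<omega>)\<^sup>2)" "integrable M \<xi>"
    "(\<integral>\<omega>. \<xi> \<omega> \<partial>M) = m" "(\<integral>\<omega>. (\<xi> \<omega>)\<^sup>2 \<partial>M) = m\<^sup>2 + \<sigma>\<^sup>2"
    "(\<integral>\<omega>. iexp (\<xi> \<omega>) \<partial>M) = iexp m * complex_of_real (exp (- \<sigma>\<^sup>2 / 2))"
proof -
  interpret prob_space M by fact
  have [measurable]: "\<xi> \<in> borel_measurable M" and \<sigma>: "\<sigma> \<ge> 0" using \<xi> by (auto simp: normal_rv_def)
  have "integrable M (\<lambda>\<omega>. (\<xi> \<omega>)\<^sup>2) \<and> integrable M \<xi> \<and>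
    (\<integral>\<omega>. \<xi> \<omega> \<partial>M) = m \<and> (\<integral>\<omega>. (\<xi> \<omega>)\<^sup>2 \<partial>M) = m\<^sup>2 + \<sigma>\<^sup>2 \<and>
    (\<integral>\<omega>. iexp (\<xi> \<omega>) \<partial>M) = iexp m * complex_of_real (exp (- \<sigma>\<^sup>2 / 2))"
  proof (cases "\<sigma> = 0")
    case True
    then have ae: "AE \<omega> in M. \<xi> \<omega> = m" using \<xi> by (simp add: normal_rv_def)
    have "integrable M (\<lambda>\<omega>. (\<xi> \<omega>)\<^sup>2) \<longleftrightarrow> integrable M (\<lambda>\<omega>. m\<^sup>2)"
      by (rule integrable_cong_AE) (use ae in auto)
    moreover have "integrable M \<xi> \<longleftrightarrow> integrable M (\<lambda>\<omega>. m)"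
      by (rule integrable_cong_AE) (use ae in auto)
    moreover have "(\<integral>\<omega>. \<xi> \<omega> \<partial>M) = (\<integral>\<omega>. m \<partial>M)"
      by (rule integral_cong_AE) (use ae in auto)
    moreover have "(\<integral>\<omega>. (\<xi> \<omega>)\<^sup>2 \<partial>M) = (\<integral>\<omega>. m\<^sup>2 \<partial>M)"
      by (rule integral_cong_AE) (use ae in auto)
    moreover have "(\<integral>\<omega>. iexp (\<xi> \<omega>) \<partial>M) = (\<integral>\<omega>. iexp m \<partial>M)"
      by (rule integral_cong_AE) (use ae in auto)
    ultimately show ?thesis using True by (simp add: prob_space)
  next
    case False
    then have \<sigma>0: "\<sigma> > 0" using \<sigma> by simp
    define W where "W = (\<lambda>\<omega>. (\<xi> \<omega> - m) / \<sigma>)"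
    have D: "distributed M lborel W std_normal_density"
      using \<xi> False \<sigma>0 unfolding normal_rv_def W_def by (simp flip: normal_standard_normal_convert)
    have [measurable]: "W \<in> borel_measurable M" unfolding W_def by measurable
    have \<xi>W: "\<xi> = (\<lambda>\<omega>. m + \<sigma> * W \<omega>)" using \<sigma>0 by (auto simp: W_def)
    have i2: "integrable M (\<lambda>\<omega>. (W \<omega>)\<^sup>2)"
      using distributed_integrable[OF D, of "\<lambda>x. x\<^sup>2"] integrable_std_normal_moment[of 2] by simp
    have i1: "integrable M W"
      using distributed_integrable[OF D, of "\<lambda>x. x"] integrable_std_normal_moment[of 1] by simp
    have e1: "expectation W = 0" using standard_normal_distributed_expectation[OF D] .
    have e2: "expectation (\<lambda>\<omega>. (W \<omega>)\<^sup>2) = 1" using standard_normal_distributed_variance[OF D] e1 by simp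
    have sq: "(m + \<sigma> * w)\<^sup>2 = m\<^sup>2 + 2 * m * \<sigma> * w + \<sigma>\<^sup>2 * w\<^sup>2" for w
      by (simp add: power2_eq_square algebra_simps)
    have dist: "distr M borel W = std_normal_distribution"
      using D unfolding distributed_def by (metis distr_cong sets_lborel)
    have "(\<integral>\<omega>. iexp (\<sigma> * W \<omega>) \<partial>M) = char std_normal_distribution \<sigma>"
      unfolding char_def dist[symmetric] by (subst integral_distr) auto
    then have "(\<integral>\<omega>. iexp (\<sigma> * W \<omega>) \<partial>M) = complex_of_real (exp (- \<sigma>\<^sup>2 / 2))"
      by (simp add: char_std_normal_distribution)
    moreover have "(\<integral>\<omega>. iexp (\<xi> \<omega>) \<partial>M) = iexp m * (\<integral>\<omega>. iexp (\<sigma> * W \<omega>) \<partial>M)"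
      unfolding \<xi>W by (simp add: distrib_left exp_add)
    ultimately show ?thesis
      unfolding \<xi>W sq using i1 i2 e1 e2 by (simp add: prob_space)
  qed
  then show "integrable M (\<lambda>\<omega>. (\<xi> \<omega>)\<^sup>2)" "integrable M \<xi>"
    "(\<integral>\<omega>. \<xi> \<omega> \<partial>M) = m" "(\<integral>\<omega>. (\<xi> \<omega>)\<^sup>2 \<partial>M) = m\<^sup>2 + \<sigma>\<^sup>2"
    "(\<integral>\<omega>. iexp (\<xi> \<omega>) \<partial>M) = iexp m * complex_of_real (exp (- \<sigma>\<^sup>2 / 2))" by blast+
qed

section \<open>Path functionals of regularly varying time series\<close>

locale norm_fun =
  fixes N :: "real^'d \<Rightarrow> real"
  assumes is_norm: "is_norm N"
begin

lemma N_nonneg [simp]: "0 \<le> N x" and N_eq_0 [simp]: "N x = 0 \<longleftrightarrow> x = 0"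
  and N_scaleR [simp]: "N (a *\<^sub>R x) = \<bar>a\<bar> * N x" and N_triangle: "N (x + y) \<le> N x + N y"
  using is_norm by (auto simp: is_norm_def)

lemma N_0 [simp]: "N 0 = 0" by simp

lemma N_pos: "0 < N x \<longleftrightarrow> x \<noteq> 0"
  using N_nonneg[of x] N_eq_0[of x] by (metis less_le)

lemma N_sum_le: "N (sum f A) \<le> (\<Sum>a\<in>A. N (f a))"
proof (induction A rule: infinite_finite_induct)
  case (insert x F)
  then show ?case using N_triangle[of "f x" "sum f F"] by simp
qed auto

lemma N_diff: "\<bar>N x - N y\<bar> \<le> N (x - y)"
  using N_triangle[of "x - y" y] N_triangle[of "y - x" x] N_scaleR[of "-1" "x - y"] by simp

text \<open>Expansion in the standard basis bounds \<open>N\<close> by a multiple of the Euclidean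
  norm, so the triangle inequality makes it Lipschitz.\<close>

lemma continuous_N: "continuous_on A N"
proof (rule Lipschitz_real_imp_continuous_on)
  fix x y :: "real^'d"
  have "N (x - y) = N (\<Sum>b\<in>Basis. ((x - y) \<bullet> b) *\<^sub>R b)" by (simp add: euclidean_representation)
  also have "\<dots> \<le> (\<Sum>b\<in>Basis. N (((x - y) \<bullet> b) *\<^sub>R b))" by (rule N_sum_le)
  also have "\<dots> \<le> (\<Sum>b\<in>Basis. norm (x - y) * N b)"
    by (intro sum_mono) (simp add: mult_right_mono Basis_le_norm)
  also have "\<dots> = (\<Sum>b\<in>Basis. N b) * dist x y" by (simp add: dist_norm sum_distrib_right mult.commute)
  finally show "\<bar>N x - N y\<bar> \<le> (\<Sum>b\<in>Basis. N b) * dist x y" using N_diff[of x y] by linarith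
qed

lemma isCont_N [simp]: "isCont N x"
  using continuous_N[of UNIV] by (simp add: continuous_on_eq_continuous_at)

lemma measurable_N [measurable]: "N \<in> borel_measurable borel"
  by (rule borel_measurable_continuous_onI[OF continuous_N])

end

lemma measurable_coordinate:
  "(\<lambda>w::'i::countable \<Rightarrow> 'b::second_countable_topology. w t) \<in> borel_measurable borel"
  by (rule borel_measurable_continuous_onI) simp

lemma (in norm_fun) measurable_N_coordinate:
  "(\<lambda>w::'i::countable \<Rightarrow> real^'d. N (w t)) \<in> borel_measurable borel"
  by (rule measurable_compose[OF measurable_coordinate measurable_N])

lemma isCont_coordinate [simp]:
  fixes w :: "'i::countable \<Rightarrow> 'b::metric_space"
  shows "isCont (\<lambda>w. w t) w"
proof -
  have "continuous_on UNIV (\<lambda>w::'i \<Rightarrow> 'b. w t)" by (rule continuous_on_product_coordinates)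
  then show ?thesis by (rule continuous_on_interior) simp
qed

lemma isCont_of_bool_greater:
  fixes f :: "'a::t2_space \<Rightarrow> real"
  assumes "isCont f x" "f x \<noteq> c"
  shows "isCont (\<lambda>x. of_bool (f x > c) :: real) x"
proof -
  have "f \<midarrow>x\<rightarrow> f x" using assms(1) by (simp add: isCont_def)
  then have "\<forall>\<^sub>F y in at x. (of_bool (f y > c) :: real) = of_bool (f x > c)"
  proof (cases "f x > c")
    case True
    with \<open>f \<midarrow>x\<rightarrow> f x\<close> have "\<forall>\<^sub>F y in at x. f y > c" by (rule order_tendstoD)
    then show ?thesis by eventually_elim (use True in simp)
  next
    case False
    then have "f x < c" using assms(2) by simp
    with \<open>f \<midarrow>x\<rightarrow> f x\<close> have "\<forall>\<^sub>F y in at x. f y < c" by (rule order_tendstoD)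
    then show ?thesis by eventually_elim (use False in simp)
  qed
  then show ?thesis unfolding isCont_def by (rule tendsto_eventually)
qed

lemma integral_uniform_measure:
  fixes f :: "'a \<Rightarrow> real"
  assumes A: "A \<in> sets M" "emeasure M A \<noteq> 0" "emeasure M A \<noteq> \<infinity>" and f: "f \<in> borel_measurable M"
  shows "(\<integral>x. f x \<partial>uniform_measure M A) = (\<integral>x. f x * indicator A x \<partial>M) / measure M A"
proof -
  have pos: "measure M A > 0"
    using A(2,3) unfolding measure_def enn2real_positive_iff infinity_ennreal_def
    by (metis less_top zero_less_iff_neq_zero)
  have "emeasure M A = ennreal (measure M A)" using A(3) by (simp add: emeasure_eq_ennreal_measure)
  have e: "indicator A x / emeasure M A = ennreal (indicator A x / measure M A)" for x
    using pos unfolding \<open>emeasure M A = ennreal (measure M A)\<close>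
    by (cases "x \<in> A") (simp_all add: divide_ennreal[of 1, simplified])
  have "uniform_measure M A = density M (\<lambda>x. ennreal (indicator A x / measure M A))"
    unfolding uniform_measure_def e ..
  then have "(\<integral>x. f x \<partial>uniform_measure M A) = (\<integral>x. (indicator A x / measure M A) *\<^sub>R f x \<partial>M)"
    by (simp only:) (rule integral_density[OF f], use A in \<open>auto simp: pos less_imp_le\<close>)
  also have "\<dots> = (\<integral>x. (f x * indicator A x) / measure M A \<partial>M)" by (simp add: mult.commute)
  finally show ?thesis by simp
qed

text \<open>Uniformity over all paths is what lifts convergence of finite-dimensional distributions to
  path space, without a tightness argument.\<close>

lemma path_truncation:
  assumes "e > 0"
  obtains m :: nat where "\<And>w :: int \<Rightarrow> 'b::{metric_space,zero}. dist w (\<lambda>t. if \<bar>t\<bar> \<le> int m then w t else 0) \<le> e"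
proof -
  \<comment> \<open>The metric of the function space weights coordinates by powers of 1/2 along an
    enumeration of the index set, so agreement on an initial segment of the enumeration suffices;
    \<open>m\<close> bounds the integers in that segment.\<close>
  obtain k :: nat where k: "(1/2::real)^k < e" using real_arch_pow_inv[OF assms, of "1/2"] by auto
  define m where "m = Max ((\<lambda>n. nat \<bar>from_nat n :: int\<bar>) ` {..k})"
  have m: "\<bar>from_nat n :: int\<bar> \<le> int m" if "n \<le> k" for n
  proof -
    have "nat \<bar>from_nat n :: int\<bar> \<le> m" unfolding m_def using that by (intro Max_ge) auto
    then show ?thesis by linarith
  qed
  show ?thesis
  proof (rule that[of m])
    fix w :: "int \<Rightarrow> 'b"
    let ?v = "\<lambda>t. if \<bar>t\<bar> \<le> int m then w t else 0"
    have "{dist (w (from_nat n)) (?v (from_nat n)) | n. n \<le> k} = {0}" using m by force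
    then have "dist w ?v \<le> (1/2)^k" using dist_fun_le_dist_first_terms[of w ?v k] by simp
    then show "dist w ?v \<le> e" using k by linarith
  qed
qed

section \<open>Convergence of path functionals to the tail process\<close>

locale tail_setting = norm_fun N for N :: "real^'d \<Rightarrow> real" +
  fixes M :: "'w measure" and M' :: "'y measure" and \<alpha> :: real
    and X :: "int \<Rightarrow> 'w \<Rightarrow> real^'d" and Y :: "int \<Rightarrow> 'y \<Rightarrow> real^'d"
  assumes prob_M: "prob_space M" and prob_M': "prob_space M'"
    and RV: "regularly_varying M M' N \<alpha> X Y"
begin

sublocale M: prob_space M by (rule prob_M)
sublocale M': prob_space M' by (rule prob_M')

abbreviation "XP \<equiv> \<lambda>\<omega> t. X t \<omega>"
abbreviation "YP \<equiv> \<lambda>\<omega> t. Y t \<omega>"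
abbreviation "Q x \<equiv> cond_exceed M N X x"
definition "V x = measure M (exceed M N X 0 x)"

lemma alpha_pos: "\<alpha> > 0" and stationary: "stationary M X"
  using RV unfolding regularly_varying_def by blast+

lemma X_measurable [measurable]: "X t \<in> borel_measurable M"
  using stationary unfolding stationary_def by blast

lemma Y_measurable [measurable]: "Y t \<in> borel_measurable M'"
  using RV unfolding regularly_varying_def by blast

lemma XP_measurable [measurable]: "XP \<in> borel_measurable M"
  by (rule measurable_coordinatewise_then_product) simp

lemma YP_measurable [measurable]: "YP \<in> borel_measurable M'"
  by (rule measurable_coordinatewise_then_product) simp

lemma shift_measurable [measurable]: "(\<lambda>\<omega> t. X (t + k) \<omega>) \<in> borel_measurable M"
  "(\<lambda>\<omega> t. Y (t + k) \<omega>) \<in> borel_measurable M'"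
  by (rule measurable_coordinatewise_then_product, simp)+

lemma path_shift_measurable [measurable]:
  "(\<lambda>w::int \<Rightarrow> real^'d. \<lambda>t. w (t + k)) \<in> borel_measurable borel"
  by (rule measurable_coordinatewise_then_product) (rule measurable_coordinate)

lemma path_scale_measurable [measurable]:
  "(\<lambda>w::int \<Rightarrow> real^'d. \<lambda>t. c *\<^sub>R w t) \<in> borel_measurable borel"
  by (rule measurable_coordinatewise_then_product) (intro borel_measurable_scaleR borel_measurable_const measurable_coordinate)

lemma scaled_measurable [measurable]: "(\<lambda>\<omega> t. c *\<^sub>R X t \<omega>) \<in> borel_measurable M"
  "(\<lambda>\<omega> t. c *\<^sub>R Y t \<omega>) \<in> borel_measurable M'"
  by (rule measurable_coordinatewise_then_product, simp)+

lemma distr_shift: "distr M borel (\<lambda>\<omega> t. X (t + k) \<omega>) = distr M borel XP"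
proof -
  have "distr M borel (\<lambda>\<omega> t. Z t \<omega>) = joint_law M UNIV Z" for Z :: "int \<Rightarrow> 'w \<Rightarrow> real^'d"
    unfolding joint_law_def by (rule distr_cong[OF refl sets_PiM_equal_borel[symmetric]]) (simp add: restrict_def)
  moreover have "joint_law M UNIV (\<lambda>t. X (t + k)) = joint_law M UNIV X"
    using stationary unfolding stationary_def by blast
  ultimately show ?thesis by (simp only:)
qed

text \<open>The working form of stationarity. Values in a Banach space are allowed because real
  moments and complex exponentials are both shifted in this way.\<close>

lemma integral_shift:
  fixes f :: "(int \<Rightarrow> real^'d) \<Rightarrow> 'c::{banach,second_countable_topology}"
  assumes "f \<in> borel_measurable borel"
  shows "(\<integral>\<omega>. f (\<lambda>t. X (t + k) \<omega>) \<partial>M) = (\<integral>\<omega>. f (XP \<omega>) \<partial>M)"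
proof -
  have "(\<integral>\<omega>. f (\<lambda>t. X (t + k) \<omega>) \<partial>M) = integral\<^sup>L (distr M borel (\<lambda>\<omega> t. X (t + k) \<omega>)) f"
    by (rule integral_distr[symmetric]) (use assms in measurable)
  also have "\<dots> = (\<integral>\<omega>. f (XP \<omega>) \<partial>M)"
    unfolding distr_shift by (rule integral_distr) (use assms in measurable)
  finally show ?thesis .
qed

lemma exceed_sets [measurable]: "exceed M N X t x \<in> sets M"
  unfolding exceed_def by measurable

lemma measure_exceed: "measure M (exceed M N X t x) = V x"
proof -
  have "(\<integral>\<omega>. of_bool (N ((\<lambda>t'. X (t' + t) \<omega>) 0) > x) \<partial>M) = (\<integral>\<omega>. (of_bool (N (XP \<omega> 0) > x) :: real) \<partial>M)"
  proof (rule integral_shift[where f="\<lambda>w. of_bool (N (w 0) > x)"])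
    have [measurable]: "(\<lambda>w::int \<Rightarrow> real^'d. N (w 0)) \<in> borel_measurable borel"
      by (rule measurable_N_coordinate)
    show "(\<lambda>w::int \<Rightarrow> real^'d. of_bool (N (w 0) > x) :: real) \<in> borel_measurable borel" by measurable
  qed
  moreover have "(\<integral>\<omega>. (of_bool (N (X t \<omega>) > x) :: real) \<partial>M) = measure M (exceed M N X t x)" for t
  proof -
    have "(\<integral>\<omega>. (of_bool (N (X t \<omega>) > x) :: real) \<partial>M) = (\<integral>\<omega>. indicator (exceed M N X t x) \<omega> \<partial>M)"
      by (rule Bochner_Integration.integral_cong) (auto simp: exceed_def indicator_def)
    then show ?thesis by simp
  qed
  ultimately show ?thesis by (simp add: V_def)
qed

lemma v_seq_eq: "v_seq M N X u n = V (u n)"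
  by (simp add: v_seq_def measure_exceed)

text \<open>If the exceedance event is null, the convention \<open>0 / 0 = 0\<close> makes the total
  mass 0; otherwise it is 1.\<close>

lemma finite_Q: "finite_measure (Q x)"
proof
  have "emeasure (Q x) (space (Q x)) = emeasure M (exceed M N X 0 x) / emeasure M (exceed M N X 0 x)"
    unfolding cond_exceed_def using sets.sets_into_space[OF exceed_sets[of 0 x]]
    by (simp add: Int_absorb2)
  also have "\<dots> \<le> 1"
    by (cases "emeasure M (exceed M N X 0 x) = 0") (simp_all add: M.emeasure_eq_measure divide_ennreal)
  finally show "emeasure (Q x) (space (Q x)) \<noteq> \<infinity>" by (auto simp: top_unique)
qed

lemma measure_Q_le_1: "measure (Q x) (space (Q x)) \<le> 1"
proof -
  have "emeasure (Q x) (space (Q x)) = emeasure M (exceed M N X 0 x) / emeasure M (exceed M N X 0 x)"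
    unfolding cond_exceed_def using sets.sets_into_space[OF exceed_sets[of 0 x]]
    by (simp add: Int_absorb2)
  also have "\<dots> \<le> 1"
    by (cases "emeasure M (exceed M N X 0 x) = 0") (simp_all add: M.emeasure_eq_measure divide_ennreal)
  finally show ?thesis using finite_measure.emeasure_eq_measure[OF finite_Q, of x "space (Q x)"] by simp
qed

lemma sets_Q [measurable_cong]: "sets (Q x) = sets M" by (simp add: cond_exceed_def)

lemma window_tendsto:
  assumes f: "continuous_map (product_topology (\<lambda>_. euclidean) {-int m..int m}) euclideanreal f"
    and b: "\<And>w. \<bar>f w\<bar> \<le> C"
  shows "((\<lambda>x. \<integral>\<omega>. f (\<lambda>t\<in>{-int m..int m}. X t \<omega> /\<^sub>R x) \<partial>Q x) \<longlongrightarrow>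
      (\<integral>\<omega>. f (\<lambda>t\<in>{-int m..int m}. Y t \<omega>) \<partial>M')) at_top"
proof -
  have fm: "f \<in> borel_measurable (\<Pi>\<^sub>M t\<in>{-int m..int m}. borel)"
    by (rule continuous_map_imp_measurable_PiM[OF _ f]) simp
  have bd: "bounded (f ` (\<Pi>\<^sub>E t\<in>{-int m..int m}. UNIV))"
    using b by (intro boundedI[of _ C]) auto
  have "weakly_converges_PiM {- int m..int m}
        (\<lambda>x. joint_law (Q x) {- int m..int m} (\<lambda>t \<omega>. X t \<omega> /\<^sub>R x))
        (joint_law M' {- int m..int m} Y) at_top"
    using RV unfolding regularly_varying_def by blast
  then have "((\<lambda>x. \<integral>w. f w \<partial>joint_law (Q x) {- int m..int m} (\<lambda>t \<omega>. X t \<omega> /\<^sub>R x)) \<longlongrightarrow>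
      (\<integral>w. f w \<partial>joint_law M' {- int m..int m} Y)) at_top"
    unfolding weakly_converges_PiM_def using f bd by blast
  moreover have "(\<integral>w. f w \<partial>joint_law (Q x) {- int m..int m} (\<lambda>t \<omega>. X t \<omega> /\<^sub>R x)) =
      (\<integral>\<omega>. f (\<lambda>t\<in>{-int m..int m}. X t \<omega> /\<^sub>R x) \<partial>Q x)" for x
    by (rule integral_joint_law[OF fm]) measurable
  moreover have "(\<integral>w. f w \<partial>joint_law M' {- int m..int m} Y) = (\<integral>\<omega>. f (\<lambda>t\<in>{-int m..int m}. Y t \<omega>) \<partial>M')"
    by (rule integral_joint_law[OF fm]) measurable
  ultimately show ?thesis by simp
qed

text \<open>Testing regular variation with the constant 1 shows that the mass of \<open>Q x\<close>
  tends to 1, which is impossible for null measures; monotonicity of \<open>V\<close> then covers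
  every level.\<close>

lemma V_pos: "V x > 0"
proof -
  have "((\<lambda>x. \<integral>\<omega>. (1::real) \<partial>Q x) \<longlongrightarrow> (\<integral>\<omega>. 1 \<partial>M')) at_top"
    by (rule window_tendsto[where f="\<lambda>_. 1" and m=0 and C=1]) auto
  then have "\<forall>\<^sub>F x in at_top. measure (Q x) (space (Q x)) > 0"
    by (intro order_tendstoD(1)[where y="1"]) (auto simp: M'.prob_space)
  then obtain y where y: "y \<ge> x" "measure (Q y) (space (Q y)) > 0"
    by (auto simp: eventually_at_top_linorder) (metis le_cases)
  have "V y \<noteq> 0"
  proof
    assume "V y = 0"
    then have "emeasure M (exceed M N X 0 y) = 0" by (simp add: V_def M.emeasure_eq_measure)
    then have "emeasure (Q y) (space (Q y)) = 0"
      unfolding cond_exceed_def using sets.sets_into_space[OF exceed_sets[of 0 y]]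
      by (simp add: Int_absorb2)
    then show False using y(2) by (simp add: measure_def)
  qed
  moreover have "V y \<le> V x" unfolding V_def using y(1)
    by (intro M.finite_measure_mono) (auto simp: exceed_def)
  moreover have "0 \<le> V y" by (simp add: V_def)
  ultimately show ?thesis by linarith
qed

lemma integral_Q:
  assumes "f \<in> borel_measurable M"
  shows "(\<integral>\<omega>. f \<omega> \<partial>Q x) = (\<integral>\<omega>. f \<omega> * of_bool (N (X 0 \<omega>) > x) \<partial>M) / V x"
proof -
  have "(\<integral>\<omega>. f \<omega> \<partial>Q x) = (\<integral>\<omega>. f \<omega> * indicator (exceed M N X 0 x) \<omega> \<partial>M) / V x"
    unfolding cond_exceed_def V_def
    by (rule integral_uniform_measure) (use V_pos[of x] assms in \<open>auto simp: V_def M.emeasure_eq_measure\<close>)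
  also have "(\<integral>\<omega>. f \<omega> * indicator (exceed M N X 0 x) \<omega> \<partial>M) = (\<integral>\<omega>. f \<omega> * of_bool (N (X 0 \<omega>) > x) \<partial>M)"
    by (rule Bochner_Integration.integral_cong) (auto simp: exceed_def indicator_def)
  finally show ?thesis .
qed

text \<open>Setting the path to 0 outside a finite window changes a Lipschitz functional by a small
  amount uniformly in the path, hence under both laws, and what remains is a continuous function of
  finitely many coordinates.\<close>

lemma Lipschitz_tendsto:
  fixes g :: "(int \<Rightarrow> real^'d) \<Rightarrow> real"
  assumes L: "\<And>w w'. \<bar>g w - g w'\<bar> \<le> L * dist w w'" and C: "\<And>w. \<bar>g w\<bar> \<le> C"
  shows "((\<lambda>x. \<integral>\<omega>. g (\<lambda>t. X t \<omega> /\<^sub>R x) \<partial>Q x) \<longlongrightarrow> (\<integral>\<omega>. g (YP \<omega>) \<partial>M')) at_top"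
proof (rule tendstoI)
  fix e0 :: real assume e0: "e0 > 0"
  define e where "e = e0 / (3 * (\<bar>L\<bar> + 1))"
  have e: "e > 0" using e0 by (simp add: e_def divide_pos_pos)
  obtain m :: nat where m: "\<And>w :: int \<Rightarrow> real^'d. dist w (\<lambda>t. if \<bar>t\<bar> \<le> int m then w t else 0) \<le> e"
    using path_truncation[OF e] by blast
  define K where "K = {-int m..int m}"
  define E :: "(int \<Rightarrow> real^'d) \<Rightarrow> int \<Rightarrow> real^'d" where "E w = (\<lambda>t. if \<bar>t\<bar> \<le> int m then w t else 0)" for w
  have gc: "continuous_on A g" for A by (rule Lipschitz_real_imp_continuous_on[OF L])
  have [measurable]: "g \<in> borel_measurable borel" by (rule borel_measurable_continuous_onI[OF gc])
  have [measurable]: "E \<in> borel_measurable borel"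
  proof (rule measurable_coordinatewise_then_product)
    show "(\<lambda>w. E w t) \<in> borel_measurable borel" for t
      by (cases "\<bar>t\<bar> \<le> int m") (simp_all add: E_def measurable_coordinate)
  qed
  have "continuous_map (product_topology (\<lambda>_. euclidean) K) euclidean E"
    unfolding euclidean_product_topology[symmetric] continuous_map_componentwise_UNIV
  proof
    fix t
    show "continuous_map (product_topology (\<lambda>_. euclidean) K) euclidean (\<lambda>w. E w t)"
      by (cases "\<bar>t\<bar> \<le> int m") (auto simp: E_def K_def intro!: continuous_map_product_projection)
  qed
  then have cm: "continuous_map (product_topology (\<lambda>_. euclidean) K) euclideanreal (g \<circ> E)"
    by (rule continuous_map_compose) (use gc in auto)
  have ER: "E (restrict w K) = E w" for w unfolding E_def K_def by (rule ext) auto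
  have "((\<lambda>x. \<integral>\<omega>. g (E (\<lambda>t. X t \<omega> /\<^sub>R x)) \<partial>Q x) \<longlongrightarrow> (\<integral>\<omega>. g (E (YP \<omega>)) \<partial>M')) at_top"
    using window_tendsto[OF cm[unfolded K_def], of C] C ER unfolding K_def by simp
  then have "\<forall>\<^sub>F x in at_top. dist (\<integral>\<omega>. g (E (\<lambda>t. X t \<omega> /\<^sub>R x)) \<partial>Q x) (\<integral>\<omega>. g (E (YP \<omega>)) \<partial>M') < e0 / 3"
    using e0 by (intro tendstoD) auto
  have close: "\<bar>(\<integral>\<omega>. g (W \<omega>) \<partial>P) - (\<integral>\<omega>. g (E (W \<omega>)) \<partial>P)\<bar> \<le> e0 / 3"
    if P: "finite_measure P" "measure P (space P) \<le> 1" and [measurable]: "W \<in> borel_measurable P" for W and P :: "'p measure"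
  proof -
    interpret P: finite_measure P by fact
    have i: "integrable P (\<lambda>\<omega>. g (W \<omega>))" "integrable P (\<lambda>\<omega>. g (E (W \<omega>)))"
      by (rule finite_measure_integrable_bounded[where C=C]; use C P in auto)+
    have "\<bar>(\<integral>\<omega>. g (W \<omega>) \<partial>P) - (\<integral>\<omega>. g (E (W \<omega>)) \<partial>P)\<bar> = \<bar>\<integral>\<omega>. g (W \<omega>) - g (E (W \<omega>)) \<partial>P\<bar>"
      using i by simp
    also have "\<dots> \<le> (\<integral>\<omega>. \<bar>g (W \<omega>) - g (E (W \<omega>))\<bar> \<partial>P)" by (rule integral_abs_bound)
    also have "\<dots> \<le> (\<integral>\<omega>. \<bar>L\<bar> * e \<partial>P)"
    proof (rule integral_mono)
      fix \<omega>
      have "\<bar>g (W \<omega>) - g (E (W \<omega>))\<bar> \<le> L * dist (W \<omega>) (E (W \<omega>))" by (rule L)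
      also have "\<dots> \<le> \<bar>L\<bar> * e" unfolding E_def using m[of "W \<omega>"] by (intro mult_mono) auto
      finally show "\<bar>g (W \<omega>) - g (E (W \<omega>))\<bar> \<le> \<bar>L\<bar> * e" .
    qed (use i in auto)
    also have "\<dots> = \<bar>L\<bar> * e * measure P (space P)" by simp
    also have "\<dots> \<le> \<bar>L\<bar> * e * 1" using P(2) e by (intro mult_left_mono) auto
    also have "\<dots> \<le> e0 / 3" using e0 by (simp add: e_def field_simps)
    finally show ?thesis .
  qed
  show "\<forall>\<^sub>F x in at_top. dist (\<integral>\<omega>. g (\<lambda>t. X t \<omega> /\<^sub>R x) \<partial>Q x) (\<integral>\<omega>. g (YP \<omega>) \<partial>M') < e0"
    using \<open>\<forall>\<^sub>F x in at_top. dist (\<integral>\<omega>. g (E (\<lambda>t. X t \<omega> /\<^sub>R x)) \<partial>Q x) (\<integral>\<omega>. g (E (YP \<omega>)) \<partial>M') < e0 / 3\<close>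
  proof eventually_elim
    case (elim x)
    have "(\<lambda>\<omega> t. X t \<omega> /\<^sub>R x) \<in> borel_measurable (Q x)"
      unfolding measurable_cong_sets[OF sets_Q refl] by measurable
    note close[OF finite_Q measure_Q_le_1 this]
    moreover have "measure M' (space M') \<le> 1" by (simp add: M'.prob_space)
    note close[OF M'.finite_measure_axioms this YP_measurable]
    ultimately show ?case using elim unfolding dist_real_def by linarith
  qed
qed

lemma tail_tendsto:
  fixes f :: "(int \<Rightarrow> real^'d) \<Rightarrow> real"
  assumes f[measurable]: "f \<in> borel_measurable borel" and C: "\<And>w. \<bar>f w\<bar> \<le> C"
    and ae: "AE \<omega> in M'. isCont f (YP \<omega>)"
  shows "((\<lambda>x. \<integral>\<omega>. f (\<lambda>t. X t \<omega> /\<^sub>R x) \<partial>Q x) \<longlongrightarrow> (\<integral>\<omega>. f (YP \<omega>) \<partial>M')) at_top"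
proof -
  have m: "(\<lambda>\<omega> t. X t \<omega> /\<^sub>R x) \<in> borel_measurable (Q x)" for x
    unfolding measurable_cong_sets[OF sets_Q refl] by measurable
  define \<mu> where "\<mu> x = distr (Q x) borel (\<lambda>\<omega> t. X t \<omega> /\<^sub>R x)" for x
  define \<nu> where "\<nu> = distr M' borel YP"
  have I: "integral\<^sup>L (\<mu> x) h = (\<integral>\<omega>. h (\<lambda>t. X t \<omega> /\<^sub>R x) \<partial>Q x)" "integral\<^sup>L \<nu> h = (\<integral>\<omega>. h (YP \<omega>) \<partial>M')"
    if "h \<in> borel_measurable borel" for h :: "_ \<Rightarrow> real" and x
    unfolding \<mu>_def \<nu>_def using that m by (simp_all add: integral_distr)
  have "((\<lambda>x. integral\<^sup>L (\<mu> x) f) \<longlongrightarrow> integral\<^sup>L \<nu> f) at_top"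
  proof (rule tendsto_integral_if_AE_isCont[OF _ _ _ _ _ f C])
    show "finite_measure (\<mu> x)" for x unfolding \<mu>_def by (rule finite_measure.finite_measure_distr[OF finite_Q m])
    show "finite_measure \<nu>" unfolding \<nu>_def by (rule M'.finite_measure_distr) measurable
    show "AE w in \<nu>. isCont f w"
    proof -
      have "AE \<omega> in M'. YP \<omega> \<in> {w. isCont f w}" using ae by simp
      moreover have "{w. isCont f w} \<in> sets borel" using isCont_borel[of f] by (simp add: Collect_neg_eq[symmetric])
      ultimately show ?thesis unfolding \<nu>_def by (subst AE_distr_iff) auto
    qed
    show "((\<lambda>x. integral\<^sup>L (\<mu> x) g) \<longlongrightarrow> integral\<^sup>L \<nu> g) at_top"
      if g: "\<And>w w'. \<bar>g w - g w'\<bar> \<le> L * dist w w'" "\<And>w. \<bar>g w\<bar> \<le> C" for g L C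
    proof -
      have "g \<in> borel_measurable borel"
        by (rule borel_measurable_continuous_onI, rule Lipschitz_real_imp_continuous_on, rule g(1))
      then show ?thesis using Lipschitz_tendsto[OF g] by (simp add: I)
    qed
  qed (simp_all add: \<mu>_def \<nu>_def)
  then show ?thesis by (simp add: I)
qed

end

lemma isCont_path_shift:
  "isCont (\<lambda>w::int \<Rightarrow> 'b::metric_space. \<lambda>t. w (t + k)) w"
proof -
  have "continuous_on UNIV (\<lambda>w::int \<Rightarrow> 'b. \<lambda>t. w (t + k))"
    by (rule continuous_on_coordinatewise_then_product) (rule continuous_on_product_coordinates)
  then show ?thesis by (rule continuous_on_interior) simp
qed

lemma isCont_path_scale:
  "isCont (\<lambda>w::int \<Rightarrow> 'b::real_normed_vector. \<lambda>t. c *\<^sub>R w t) w"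
proof -
  have "continuous_on UNIV (\<lambda>w::int \<Rightarrow> 'b. \<lambda>t. c *\<^sub>R w t)"
    by (intro continuous_on_coordinatewise_then_product continuous_on_scaleR continuous_on_const continuous_on_product_coordinates)
  then show ?thesis by (rule continuous_on_interior) simp
qed

lemma (in norm_fun) isCont_N_coordinate:
  "isCont (\<lambda>w::'i::countable \<Rightarrow> real^'d. N (w t)) w"
  by (rule isCont_o2[OF isCont_coordinate]) simp

section \<open>Radius and direction of the tail process\<close>

context tail_setting begin

definition "R \<omega> = N (Y 0 \<omega>)"
definition "\<Theta> = spectral_tail N Y"

lemma Theta_eq: "\<Theta> t \<omega> = Y t \<omega> /\<^sub>R R \<omega>" by (simp add: \<Theta>_def R_def spectral_tail_def)

lemma R_measurable [measurable]: "R \<in> borel_measurable M'" unfolding R_def by measurable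

lemma Theta_measurable [measurable]: "\<Theta> t \<in> borel_measurable M'"
  unfolding Theta_eq[abs_def] by measurable

lemma prob_R_greater: "c \<ge> 1 \<Longrightarrow> M'.prob {\<omega> \<in> space M'. R \<omega> > c} = c powr (- \<alpha>)"
  using RV unfolding regularly_varying_def exceed_def R_def by blast

lemma AE_R_greater_1: "AE \<omega> in M'. R \<omega> > 1"
  using M'.AE_prob_1[of "{\<omega> \<in> space M'. R \<omega> > 1}"] prob_R_greater[of 1] by (auto elim: eventually_mono)

text \<open>Only the tail probabilities of \<open>R\<close> are given. An atom at \<open>c\<close>
  has to fit between the tails at \<open>c' < c\<close> and at \<open>c\<close>, whose difference
  vanishes as \<open>c'\<close> tends to \<open>c\<close>.\<close>

lemma AE_R_neq: "AE \<omega> in M'. R \<omega> \<noteq> c"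
proof (cases "c > 1")
  case False
  then show ?thesis using AE_R_greater_1 by (auto elim: eventually_mono)
next
  case True
  have "M'.prob {\<omega> \<in> space M'. R \<omega> = c} \<le> c' powr (- \<alpha>) - c powr (- \<alpha>)" if "1 \<le> c'" "c' < c" for c'
  proof -
    have "M'.prob {\<omega> \<in> space M'. R \<omega> = c} + M'.prob {\<omega> \<in> space M'. R \<omega> > c} =
        M'.prob ({\<omega> \<in> space M'. R \<omega> = c} \<union> {\<omega> \<in> space M'. R \<omega> > c})"
      by (rule M'.finite_measure_Union[symmetric]) auto
    also have "\<dots> \<le> M'.prob {\<omega> \<in> space M'. R \<omega> > c'}"
      by (rule M'.finite_measure_mono) (use that in auto)
    finally show ?thesis using that True by (simp add: prob_R_greater)
  qed
  then have "\<forall>\<^sub>F c' in at_left c. M'.prob {\<omega> \<in> space M'. R \<omega> = c} \<le> c' powr (- \<alpha>) - c powr (- \<alpha>)"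
    using True by (auto simp: eventually_at_left_field)
  moreover have "((\<lambda>c'. c' powr (- \<alpha>) - c powr (- \<alpha>)) \<longlongrightarrow> c powr (- \<alpha>) - c powr (- \<alpha>)) (at_left c)"
    using True by (intro tendsto_intros) auto
  ultimately have "M'.prob {\<omega> \<in> space M'. R \<omega> = c} \<le> c powr (- \<alpha>) - c powr (- \<alpha>)"
    by (intro tendsto_lowerbound[where F="at_left c"]) auto
  then have "M'.prob {\<omega> \<in> space M'. R \<omega> = c} = 0" by (simp add: measure_le_0_iff)
  then have "AE \<omega> in M'. \<omega> \<notin> {\<omega> \<in> space M'. R \<omega> = c}"
    by (subst M'.prob_eq_0[symmetric]) simp_all
  then show ?thesis by (rule AE_mp) (rule AE_I2, simp)
qed

text \<open>As \<open>c \<ge> 1\<close>, an exceedance of \<open>c * x\<close> is also one of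
  \<open>x\<close>, so the ratio is a conditional probability, and \<open>c\<close> is a continuity
  point of the law of \<open>R\<close>.\<close>

lemma V_ratio_ge_1:
  assumes c: "c \<ge> 1" shows "((\<lambda>x. V (c * x) / V x) \<longlongrightarrow> c powr (- \<alpha>)) at_top"
proof -
  have [measurable]: "(\<lambda>w::int \<Rightarrow> real^'d. N (w 0)) \<in> borel_measurable borel" by (rule measurable_N_coordinate)
  have lim: "((\<lambda>x. \<integral>\<omega>. (of_bool (N (X 0 \<omega> /\<^sub>R x) > c) :: real) \<partial>Q x) \<longlongrightarrow> (\<integral>\<omega>. of_bool (N (Y 0 \<omega>) > c) \<partial>M')) at_top"
  proof (rule tail_tendsto[where f="\<lambda>w. of_bool (N (w 0) > c)" and C=1])
    show "AE \<omega> in M'. isCont (\<lambda>w. of_bool (N (w 0) > c) :: real) (YP \<omega>)"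
      using AE_R_neq[of c] by eventually_elim (rule isCont_of_bool_greater[OF isCont_N_coordinate], simp add: R_def)
  qed auto
  have val: "(\<integral>\<omega>. (of_bool (N (Y 0 \<omega>) > c) :: real) \<partial>M') = c powr (- \<alpha>)"
  proof -
    have "(\<integral>\<omega>. (of_bool (N (Y 0 \<omega>) > c) :: real) \<partial>M') = (\<integral>\<omega>. indicator {\<omega> \<in> space M'. R \<omega> > c} \<omega> \<partial>M')"
      by (rule Bochner_Integration.integral_cong) (auto simp: R_def)
    then show ?thesis using prob_R_greater[OF c] by (simp add: Int_absorb2)
  qed
  have "\<forall>\<^sub>F x in at_top. (\<integral>\<omega>. of_bool (N (X 0 \<omega> /\<^sub>R x) > c) \<partial>Q x) = V (c * x) / V x"
    using eventually_gt_at_top[of 0]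
  proof eventually_elim
    case (elim x)
    have "(\<integral>\<omega>. of_bool (N (X 0 \<omega> /\<^sub>R x) > c) \<partial>Q x) =
        (\<integral>\<omega>. of_bool (N (X 0 \<omega> /\<^sub>R x) > c) * of_bool (N (X 0 \<omega>) > x) \<partial>M) / V x"
      by (rule integral_Q) measurable
    also have "(\<integral>\<omega>. of_bool (N (X 0 \<omega> /\<^sub>R x) > c) * of_bool (N (X 0 \<omega>) > x) \<partial>M) =
        (\<integral>\<omega>. indicat_real (exceed M N X 0 (c * x)) \<omega> \<partial>M)"
    proof (rule Bochner_Integration.integral_cong)
      fix \<omega> assume \<omega>: "\<omega> \<in> space M"
      have "x \<le> c * x" using c elim by simp
      moreover have "N (X 0 \<omega> /\<^sub>R x) > c \<longleftrightarrow> N (X 0 \<omega>) > c * x" using elim by (simp add: field_simps)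
      ultimately show "of_bool (N (X 0 \<omega> /\<^sub>R x) > c) * of_bool (N (X 0 \<omega>) > x) = indicat_real (exceed M N X 0 (c * x)) \<omega>"
        using \<omega> by (auto simp: exceed_def)
    qed simp
    also have "\<dots> = V (c * x)" by (simp add: V_def)
    finally show ?case .
  qed
  with lim show ?thesis unfolding val by (rule Lim_transform_eventually)
qed

text \<open>Below 1 the ratio is the reciprocal of the one for \<open>1 / c\<close>, taken at the
  level \<open>c * x\<close>.\<close>

lemma V_ratio:
  assumes c: "c > 0" shows "((\<lambda>x. V (c * x) / V x) \<longlongrightarrow> c powr (- \<alpha>)) at_top"
proof (cases "c \<ge> 1")
  case False
  have "((\<lambda>x. V (1 / c * x) / V x) \<longlongrightarrow> (1 / c) powr (- \<alpha>)) at_top"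
    by (rule V_ratio_ge_1) (use False c in simp)
  moreover have "filterlim (\<lambda>x. c * x) at_top at_top"
    by (rule filterlim_tendsto_pos_mult_at_top[OF tendsto_const c filterlim_ident])
  ultimately have "((\<lambda>x. V (1 / c * (c * x)) / V (c * x)) \<longlongrightarrow> (1 / c) powr (- \<alpha>)) at_top"
    by (rule filterlim_compose)
  then have "((\<lambda>x. inverse (V (1 / c * (c * x)) / V (c * x))) \<longlongrightarrow> inverse ((1 / c) powr (- \<alpha>))) at_top"
    by (rule tendsto_inverse) (use c in simp)
  then show ?thesis using c by (simp add: powr_minus powr_divide)
qed (rule V_ratio_ge_1)

text \<open>Multiplying by \<open>V (c x) / V x\<close> turns conditioning on an exceedance of \<open>x\<close> into
  conditioning on an exceedance of \<open>c x\<close>.\<close>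

lemma scaling_Lipschitz:
  fixes g :: "(int \<Rightarrow> real^'d) \<Rightarrow> real"
  assumes L: "\<And>w w'. \<bar>g w - g w'\<bar> \<le> L * dist w w'" and C: "\<And>w. \<bar>g w\<bar> \<le> C" and c: "c \<ge> 1"
  shows "(\<integral>\<omega>. g (YP \<omega>) * of_bool (R \<omega> > c) \<partial>M') = c powr (- \<alpha>) * (\<integral>\<omega>. g (\<lambda>t. c *\<^sub>R Y t \<omega>) \<partial>M')"
proof -
  have [measurable]: "(\<lambda>w::int \<Rightarrow> real^'d. N (w 0)) \<in> borel_measurable borel" by (rule measurable_N_coordinate)
  have gc: "continuous_on A g" for A by (rule Lipschitz_real_imp_continuous_on[OF L])
  have gC: "isCont g w" for w using gc[of UNIV] by (simp add: continuous_on_eq_continuous_at)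
  have gm[measurable]: "g \<in> borel_measurable borel" by (rule borel_measurable_continuous_onI[OF gc])
  have C0: "0 \<le> C" using C[of undefined] by linarith
  have 1: "((\<lambda>x. \<integral>\<omega>. g (\<lambda>t. X t \<omega> /\<^sub>R x) * of_bool (N (X 0 \<omega> /\<^sub>R x) > c) \<partial>Q x) \<longlongrightarrow>
      (\<integral>\<omega>. g (YP \<omega>) * of_bool (N (Y 0 \<omega>) > c) \<partial>M')) at_top"
  proof (rule tail_tendsto[where f="\<lambda>w. g w * of_bool (N (w 0) > c)" and C=C])
    show "\<bar>g w * of_bool (N (w 0) > c)\<bar> \<le> C" for w using C[of w] C0 by (simp add: of_bool_def)
    show "AE \<omega> in M'. isCont (\<lambda>w. g w * of_bool (N (w 0) > c) :: real) (YP \<omega>)"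
      using AE_R_neq[of c]
      by eventually_elim (intro isCont_mult gC isCont_of_bool_greater[OF isCont_N_coordinate], simp add: R_def)
  qed measurable
  have "((\<lambda>x. \<integral>\<omega>. g (\<lambda>t. c *\<^sub>R (X t \<omega> /\<^sub>R x)) \<partial>Q x) \<longlongrightarrow> (\<integral>\<omega>. g (\<lambda>t. c *\<^sub>R Y t \<omega>) \<partial>M')) at_top"
  proof (rule tail_tendsto[where f="\<lambda>w. g (\<lambda>t. c *\<^sub>R w t)" and C=C])
    show "AE \<omega> in M'. isCont (\<lambda>w. g (\<lambda>t. c *\<^sub>R w t)) (YP \<omega>)"
      by (intro AE_I2 isCont_o2[OF isCont_path_scale] gC)
    show "(\<lambda>w. g (\<lambda>t. c *\<^sub>R w t)) \<in> borel_measurable borel"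
      by (rule measurable_compose[OF path_scale_measurable gm])
  qed (rule C)
  moreover have "filterlim (\<lambda>x. c * x) at_top at_top"
    by (rule filterlim_tendsto_pos_mult_at_top[OF tendsto_const _ filterlim_ident]) (use c in simp)
  ultimately have "((\<lambda>x. \<integral>\<omega>. g (\<lambda>t. c *\<^sub>R (X t \<omega> /\<^sub>R (c * x))) \<partial>Q (c * x)) \<longlongrightarrow> (\<integral>\<omega>. g (\<lambda>t. c *\<^sub>R Y t \<omega>) \<partial>M')) at_top"
    by (rule filterlim_compose)
  from tendsto_mult[OF V_ratio_ge_1[OF c] this]
  have 2: "((\<lambda>x. V (c * x) / V x * (\<integral>\<omega>. g (\<lambda>t. c *\<^sub>R (X t \<omega> /\<^sub>R (c * x))) \<partial>Q (c * x))) \<longlongrightarrow>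
      c powr (- \<alpha>) * (\<integral>\<omega>. g (\<lambda>t. c *\<^sub>R Y t \<omega>) \<partial>M')) at_top" .
  have "\<forall>\<^sub>F x in at_top. (\<integral>\<omega>. g (\<lambda>t. X t \<omega> /\<^sub>R x) * of_bool (N (X 0 \<omega> /\<^sub>R x) > c) \<partial>Q x) =
      V (c * x) / V x * (\<integral>\<omega>. g (\<lambda>t. c *\<^sub>R (X t \<omega> /\<^sub>R (c * x))) \<partial>Q (c * x))"
    using eventually_gt_at_top[of 0]
  proof eventually_elim
    case (elim x)
    have gx [measurable]: "(\<lambda>\<omega>. g (\<lambda>t. X t \<omega> /\<^sub>R x)) \<in> borel_measurable M"
      by (rule measurable_compose[OF scaled_measurable(1) gm])
    have sx: "(\<lambda>t. c *\<^sub>R (X t \<omega> /\<^sub>R (c * x))) = (\<lambda>t. X t \<omega> /\<^sub>R x)" for \<omega>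
    proof -
      have "c * inverse (c * x) = inverse x" using c by (simp add: field_simps)
      then show ?thesis by (simp only: scaleR_scaleR)
    qed
    have "(\<integral>\<omega>. g (\<lambda>t. X t \<omega> /\<^sub>R x) * of_bool (N (X 0 \<omega> /\<^sub>R x) > c) \<partial>Q x) =
      (\<integral>\<omega>. g (\<lambda>t. X t \<omega> /\<^sub>R x) * of_bool (N (X 0 \<omega> /\<^sub>R x) > c) * of_bool (N (X 0 \<omega>) > x) \<partial>M) / V x"
      by (rule integral_Q) measurable
    also have "(\<integral>\<omega>. g (\<lambda>t. X t \<omega> /\<^sub>R x) * of_bool (N (X 0 \<omega> /\<^sub>R x) > c) * of_bool (N (X 0 \<omega>) > x) \<partial>M) =
      (\<integral>\<omega>. g (\<lambda>t. X t \<omega> /\<^sub>R x) * of_bool (N (X 0 \<omega>) > c * x) \<partial>M)"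
    proof (rule Bochner_Integration.integral_cong)
      fix \<omega>
      have "x \<le> c * x" using c elim by simp
      moreover have "N (X 0 \<omega> /\<^sub>R x) > c \<longleftrightarrow> N (X 0 \<omega>) > c * x" using elim by (simp add: field_simps)
      ultimately show "g (\<lambda>t. X t \<omega> /\<^sub>R x) * of_bool (N (X 0 \<omega> /\<^sub>R x) > c) * of_bool (N (X 0 \<omega>) > x) =
          g (\<lambda>t. X t \<omega> /\<^sub>R x) * of_bool (N (X 0 \<omega>) > c * x)" by auto
    qed simp
    also have "\<dots> / V x = V (c * x) / V x * ((\<integral>\<omega>. g (\<lambda>t. X t \<omega> /\<^sub>R x) * of_bool (N (X 0 \<omega>) > c * x) \<partial>M) / V (c * x))"
      using V_pos[of "c * x"] by simp
    also have "(\<integral>\<omega>. g (\<lambda>t. X t \<omega> /\<^sub>R x) * of_bool (N (X 0 \<omega>) > c * x) \<partial>M) / V (c * x) =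
        (\<integral>\<omega>. g (\<lambda>t. X t \<omega> /\<^sub>R x) \<partial>Q (c * x))"
      by (rule integral_Q[symmetric]) measurable
    finally show ?case unfolding sx .
  qed
  with 1 have "((\<lambda>x. V (c * x) / V x * (\<integral>\<omega>. g (\<lambda>t. c *\<^sub>R (X t \<omega> /\<^sub>R (c * x))) \<partial>Q (c * x))) \<longlongrightarrow>
      (\<integral>\<omega>. g (YP \<omega>) * of_bool (N (Y 0 \<omega>) > c) \<partial>M')) at_top"
    by (rule Lim_transform_eventually)
  from tendsto_unique[OF _ this 2] show ?thesis by (simp add: R_def)
qed

text \<open>Limit arguments yield identities for Lipschitz functionals. Bounded weights make both
  sides integrals against finite image measures, which such functionals determine, so the identity
  extends to all nonnegative measurable functionals.\<close>

lemma weighted_path_laws_eq: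
  fixes S T :: "'y \<Rightarrow> int \<Rightarrow> real^'d"
  assumes S[measurable]: "S \<in> borel_measurable M'" and T[measurable]: "T \<in> borel_measurable M'"
    and a[measurable]: "a \<in> borel_measurable M'" and b[measurable]: "b \<in> borel_measurable M'"
    and ab: "\<And>\<omega>. 0 \<le> a \<omega>" "\<And>\<omega>. a \<omega> \<le> A" "\<And>\<omega>. 0 \<le> b \<omega>" "\<And>\<omega>. b \<omega> \<le> A"
    and eq: "\<And>g L C. (\<And>w w'. \<bar>g w - g w'\<bar> \<le> L * dist w w') \<Longrightarrow> (\<And>w. \<bar>g w\<bar> \<le> C) \<Longrightarrow>
      (\<integral>\<omega>. a \<omega> * g (S \<omega>) \<partial>M') = (\<integral>\<omega>. b \<omega> * g (T \<omega>) \<partial>M')"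
    and f: "f \<in> borel_measurable borel"
  shows "(\<integral>\<^sup>+\<omega>. ennreal (a \<omega>) * f (S \<omega>) \<partial>M') = (\<integral>\<^sup>+\<omega>. ennreal (b \<omega>) * f (T \<omega>) \<partial>M')"
proof -
  have fin: "finite_measure (distr (density M' (\<lambda>\<omega>. ennreal (c \<omega>))) borel P)"
    if [measurable]: "c \<in> borel_measurable M'" "P \<in> borel_measurable M'" and c: "\<And>\<omega>. c \<omega> \<le> A" for c P
  proof
    have "emeasure (distr (density M' (\<lambda>\<omega>. ennreal (c \<omega>))) borel P) UNIV = (\<integral>\<^sup>+\<omega>. ennreal (c \<omega>) \<partial>M')"
      by (simp add: emeasure_distr emeasure_density cong: nn_integral_cong)
    also have "\<dots> \<le> (\<integral>\<^sup>+\<omega>. ennreal A \<partial>M')" by (intro nn_integral_mono ennreal_leI c)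
    also have "\<dots> < \<infinity>" by (simp add: M'.emeasure_space_1)
    finally show "emeasure (distr (density M' (\<lambda>\<omega>. ennreal (c \<omega>))) borel P) (space (distr (density M' (\<lambda>\<omega>. ennreal (c \<omega>))) borel P)) \<noteq> \<infinity>"
      by simp
  qed
  have "distr (density M' (\<lambda>\<omega>. ennreal (a \<omega>))) borel S = distr (density M' (\<lambda>\<omega>. ennreal (b \<omega>))) borel T"
  proof (rule measure_eqI_Lipschitz)
    fix g :: "(int \<Rightarrow> real^'d) \<Rightarrow> real" and L C
    assume g: "\<And>w w'. \<bar>g w - g w'\<bar> \<le> L * dist w w'" "\<And>w. \<bar>g w\<bar> \<le> C"
    have [measurable]: "g \<in> borel_measurable borel"
      by (rule borel_measurable_continuous_onI, rule Lipschitz_real_imp_continuous_on, rule g(1))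
    have "integral\<^sup>L (distr (density M' (\<lambda>\<omega>. ennreal (c \<omega>))) borel P) g = (\<integral>\<omega>. c \<omega> * g (P \<omega>) \<partial>M')"
      if [measurable]: "c \<in> borel_measurable M'" "P \<in> borel_measurable M'" and c: "\<And>\<omega>. 0 \<le> c \<omega>" for c P
      by (simp add: integral_distr integral_density c)
    from this[OF a S ab(1)] this[OF b T ab(3)] eq[OF g]
    show "integral\<^sup>L (distr (density M' (\<lambda>\<omega>. ennreal (a \<omega>))) borel S) g = integral\<^sup>L (distr (density M' (\<lambda>\<omega>. ennreal (b \<omega>))) borel T) g"
      by simp
  qed (use fin[OF a S ab(2)] fin[OF b T ab(4)] in simp_all)
  then have "integral\<^sup>N (distr (density M' (\<lambda>\<omega>. ennreal (a \<omega>))) borel S) f = integral\<^sup>N (distr (density M' (\<lambda>\<omega>. ennreal (b \<omega>))) borel T) f"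
    by simp
  moreover have "integral\<^sup>N (distr (density M' (\<lambda>\<omega>. ennreal (c \<omega>))) borel P) f = (\<integral>\<^sup>+\<omega>. ennreal (c \<omega>) * f (P \<omega>) \<partial>M')"
    if [measurable]: "c \<in> borel_measurable M'" "P \<in> borel_measurable M'" for c P
    using f by (simp add: nn_integral_distr nn_integral_density)
  ultimately show ?thesis by simp
qed

text \<open>Pareto homogeneity of the tail process. Integrals in the extended reals spare later uses
  every integrability check.\<close>

lemma scaling:
  assumes f: "f \<in> borel_measurable borel" and c: "c \<ge> 1"
  shows "(\<integral>\<^sup>+\<omega>. of_bool (R \<omega> > c) * f (YP \<omega>) \<partial>M') = ennreal (c powr (- \<alpha>)) * (\<integral>\<^sup>+\<omega>. f (\<lambda>t. c *\<^sub>R Y t \<omega>) \<partial>M')"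
proof -
  have c1: "c powr (- \<alpha>) \<le> 1" using c alpha_pos by (simp add: powr_mono2' powr_le_one_le powr_minus_divide ge_one_powr_ge_zero)
  have "(\<integral>\<^sup>+\<omega>. ennreal (of_bool (R \<omega> > c)) * f (YP \<omega>) \<partial>M') =
      (\<integral>\<^sup>+\<omega>. ennreal (c powr (- \<alpha>)) * f (\<lambda>t. c *\<^sub>R Y t \<omega>) \<partial>M')"
  proof (rule weighted_path_laws_eq[where A=1, OF _ _ _ _ _ _ _ _ _ f])
    fix g :: "(int \<Rightarrow> real^'d) \<Rightarrow> real" and L C
    assume "\<And>w w'. \<bar>g w - g w'\<bar> \<le> L * dist w w'" "\<And>w. \<bar>g w\<bar> \<le> C"
    from scaling_Lipschitz[OF this c]
    show "(\<integral>\<omega>. of_bool (R \<omega> > c) * g (YP \<omega>) \<partial>M') = (\<integral>\<omega>. c powr (- \<alpha>) * g (\<lambda>t. c *\<^sub>R Y t \<omega>) \<partial>M')"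
      by (simp add: mult.commute)
  qed (use c1 in auto)
  also have "\<dots> = ennreal (c powr (- \<alpha>)) * (\<integral>\<^sup>+\<omega>. f (\<lambda>t. c *\<^sub>R Y t \<omega>) \<partial>M')"
    by (rule nn_integral_cmult) (rule measurable_compose[OF scaled_measurable(2) f])
  finally show ?thesis by (simp add: of_bool_def if_distrib cong: if_cong)
qed

definition "\<Theta>P \<omega> = (\<lambda>t. \<Theta> t \<omega>)"

lemma Theta_path_measurable [measurable]: "\<Theta>P \<in> borel_measurable M'"
  unfolding \<Theta>P_def[abs_def] by (rule measurable_coordinatewise_then_product) (rule Theta_measurable)

lemma normalize_path_measurable:
  "(\<lambda>w::int \<Rightarrow> real^'d. \<lambda>t. w t /\<^sub>R N (w 0)) \<in> borel_measurable borel"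
proof (rule measurable_coordinatewise_then_product)
  fix t
  show "(\<lambda>w::int \<Rightarrow> real^'d. w t /\<^sub>R N (w 0)) \<in> borel_measurable borel"
    by (intro borel_measurable_scaleR borel_measurable_inverse measurable_N_coordinate measurable_coordinate)
qed

lemma Theta_path_eq: "\<Theta>P \<omega> = (\<lambda>t. YP \<omega> t /\<^sub>R N (YP \<omega> 0))"
  by (simp add: \<Theta>P_def Theta_eq R_def)

lemma Theta_path_scale: "c > 0 \<Longrightarrow> (\<lambda>t. (c *\<^sub>R Y t \<omega>) /\<^sub>R N (c *\<^sub>R Y 0 \<omega>)) = \<Theta>P \<omega>"
proof -
  assume c: "c > 0"
  have "inverse (\<bar>c\<bar> * n) * c = inverse n" for n :: real using c by (simp add: field_simps)
  then show ?thesis by (simp only: \<Theta>P_def Theta_eq R_def N_scaleR scaleR_scaleR)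
qed

text \<open>For a functional of the normalised path, which ignores scale, the scaling identity
  factorises the joint probability of \<open>R > x\<close> and any event for the direction. Rays
  determine a finite measure on the line, so the product form follows for all Borel sets.\<close>

lemma R_Theta_independent:
  "distr M' borel \<Theta>P \<Otimes>\<^sub>M distr M' borel R = distr M' (borel \<Otimes>\<^sub>M borel) (\<lambda>\<omega>. (\<Theta>P \<omega>, R \<omega>))"
proof (rule pair_measure_eqI)
  show "sigma_finite_measure (distr M' borel \<Theta>P)" "sigma_finite_measure (distr M' borel R)"
    by (intro finite_measure.axioms(1) M'.finite_measure_distr; measurable)+
  show "sets (distr M' borel \<Theta>P \<Otimes>\<^sub>M distr M' borel R) = sets (distr M' (borel \<Otimes>\<^sub>M borel) (\<lambda>\<omega>. (\<Theta>P \<omega>, R \<omega>)))"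
    by (simp cong: sets_pair_measure_cong)
  fix B :: "(int \<Rightarrow> real^'d) set" and A :: "real set"
  assume "B \<in> sets (distr M' borel \<Theta>P)" "A \<in> sets (distr M' borel R)"
  then have B[measurable]: "B \<in> sets borel" and A[measurable]: "A \<in> sets borel" by auto
  define q where "q = emeasure (distr M' borel \<Theta>P) B"
  have q: "q = (\<integral>\<^sup>+\<omega>. indicator B (\<Theta>P \<omega>) \<partial>M')"
  proof -
    have "(\<integral>\<^sup>+\<omega>. indicator B (\<Theta>P \<omega>) \<partial>M') = (\<integral>\<^sup>+w. indicator B w \<partial>distr M' borel \<Theta>P)"
      by (rule nn_integral_distr[symmetric]) measurable
    then show ?thesis by (simp add: q_def)
  qed
  have qfin: "q < \<infinity>" unfolding q_def by (simp add: emeasure_distr M'.emeasure_eq_measure)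
  have "distr (density M' (\<lambda>\<omega>. indicator B (\<Theta>P \<omega>))) borel R = density (distr M' borel R) (\<lambda>_. q)"
  proof (rule measure_eqI_lessThan)
    fix x :: real
    have l: "emeasure (distr (density M' (\<lambda>\<omega>. indicator B (\<Theta>P \<omega>))) borel R) {x<..} =
        (\<integral>\<^sup>+\<omega>. of_bool (R \<omega> > x) * indicator B (\<Theta>P \<omega>) \<partial>M')"
      by (simp add: emeasure_distr emeasure_density) (rule nn_integral_cong, auto simp: indicator_def)
    have r: "emeasure (density (distr M' borel R) (\<lambda>_. q)) {x<..} = q * emeasure M' {\<omega> \<in> space M'. R \<omega> > x}"
      by (simp add: emeasure_density_const emeasure_distr vimage_def Int_def conj_commute)
    have "(\<integral>\<^sup>+\<omega>. of_bool (R \<omega> > x) * indicator B (\<Theta>P \<omega>) \<partial>M') = q * emeasure M' {\<omega> \<in> space M'. R \<omega> > x}"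
    proof (cases "x \<ge> 1")
      case True
      have f: "(\<lambda>w. indicator B (\<lambda>t. w t /\<^sub>R N (w 0)) :: ennreal) \<in> borel_measurable borel"
        by (rule measurable_compose[OF normalize_path_measurable]) simp
      have "(\<integral>\<^sup>+\<omega>. of_bool (R \<omega> > x) * indicator B (\<Theta>P \<omega>) \<partial>M') = ennreal (x powr (- \<alpha>)) * q"
        using scaling[OF f True] True Theta_path_scale[of x] unfolding q Theta_path_eq by simp
      then show ?thesis using prob_R_greater[OF True] by (simp add: M'.emeasure_eq_measure mult.commute)
    next
      case False
      have "(\<integral>\<^sup>+\<omega>. of_bool (R \<omega> > x) * indicator B (\<Theta>P \<omega>) \<partial>M') = q"
        unfolding q by (rule nn_integral_cong_AE) (use AE_R_greater_1 False in \<open>auto elim!: eventually_mono\<close>)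
      moreover have "emeasure M' {\<omega> \<in> space M'. R \<omega> > x} = 1"
        by (rule M'.emeasure_eq_1_AE) (use AE_R_greater_1 False in \<open>auto elim!: eventually_mono\<close>)
      ultimately show ?thesis by simp
    qed
    then show "emeasure (distr (density M' (\<lambda>\<omega>. indicator B (\<Theta>P \<omega>))) borel R) {x<..} =
        emeasure (density (distr M' borel R) (\<lambda>_. q)) {x<..}" unfolding l r .
    show "emeasure (distr (density M' (\<lambda>\<omega>. indicator B (\<Theta>P \<omega>))) borel R) {x<..} < \<infinity>"
    proof -
      have "(\<integral>\<^sup>+\<omega>. of_bool (R \<omega> > x) * indicator B (\<Theta>P \<omega>) \<partial>M') \<le> (\<integral>\<^sup>+\<omega>. 1 \<partial>M')"
        by (rule nn_integral_mono) (auto simp: indicator_def)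
      also have "\<dots> < \<infinity>" by (simp add: M'.emeasure_space_1)
      finally show ?thesis unfolding l .
    qed
  qed simp_all
  then have "emeasure (distr (density M' (\<lambda>\<omega>. indicator B (\<Theta>P \<omega>))) borel R) A = emeasure (density (distr M' borel R) (\<lambda>_. q)) A"
    by simp
  also have "\<dots> = q * emeasure (distr M' borel R) A" by (simp add: emeasure_density_const)
  finally have "q * emeasure (distr M' borel R) A = emeasure (distr (density M' (\<lambda>\<omega>. indicator B (\<Theta>P \<omega>))) borel R) A" ..
  also have "\<dots> = (\<integral>\<^sup>+\<omega>. indicator B (\<Theta>P \<omega>) * indicator (R -` A \<inter> space M') \<omega> \<partial>M')"
    by (simp add: emeasure_distr emeasure_density)
  also have "\<dots> = (\<integral>\<^sup>+\<omega>. indicator ((\<lambda>\<omega>. (\<Theta>P \<omega>, R \<omega>)) -` (B \<times> A) \<inter> space M') \<omega> \<partial>M')"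
    by (rule nn_integral_cong) (auto simp: indicator_def)
  also have "\<dots> = emeasure (distr M' (borel \<Otimes>\<^sub>M borel) (\<lambda>\<omega>. (\<Theta>P \<omega>, R \<omega>))) (B \<times> A)"
    by (simp add: emeasure_distr)
  finally show "emeasure (distr M' borel \<Theta>P) B * emeasure (distr M' borel R) A =
      emeasure (distr M' (borel \<Otimes>\<^sub>M borel) (\<lambda>\<omega>. (\<Theta>P \<omega>, R \<omega>))) (B \<times> A)"
    by (simp add: q_def)
qed

lemma nn_integral_Theta_R:
  assumes H[measurable]: "H \<in> borel_measurable (borel \<Otimes>\<^sub>M borel)"
  shows "(\<integral>\<^sup>+\<omega>. H (\<Theta>P \<omega>, R \<omega>) \<partial>M') = (\<integral>\<^sup>+\<omega>. (\<integral>\<^sup>+\<omega>'. H (\<Theta>P \<omega>, R \<omega>') \<partial>M') \<partial>M')"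
proof -
  interpret R: finite_measure "distr M' borel R" by (rule M'.finite_measure_distr) measurable
  have "(\<integral>\<^sup>+\<omega>. H (\<Theta>P \<omega>, R \<omega>) \<partial>M') = integral\<^sup>N (distr M' borel \<Theta>P \<Otimes>\<^sub>M distr M' borel R) H"
    unfolding R_Theta_independent by (rule nn_integral_distr[symmetric]) measurable
  also have "\<dots> = (\<integral>\<^sup>+w. (\<integral>\<^sup>+r. H (w, r) \<partial>distr M' borel R) \<partial>distr M' borel \<Theta>P)"
    by (rule R.nn_integral_fst[symmetric]) (simp cong: measurable_cong_sets sets_pair_measure_cong)
  also have "\<dots> = (\<integral>\<^sup>+\<omega>. (\<integral>\<^sup>+r. H (\<Theta>P \<omega>, r) \<partial>distr M' borel R) \<partial>M')"
  proof (rule nn_integral_distr)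
    have "(\<lambda>w. \<integral>\<^sup>+r. H (w, r) \<partial>distr M' borel R) \<in> borel_measurable borel"
      by (rule R.borel_measurable_nn_integral_fst) (simp cong: measurable_cong_sets sets_pair_measure_cong)
    then show "(\<lambda>w. \<integral>\<^sup>+r. H (w, r) \<partial>distr M' borel R) \<in> borel_measurable (distr M' borel \<Theta>P)" by simp
  qed measurable
  also have "\<dots> = (\<integral>\<^sup>+\<omega>. (\<integral>\<^sup>+\<omega>'. H (\<Theta>P \<omega>, R \<omega>') \<partial>M') \<partial>M')"
    by (intro nn_integral_cong nn_integral_distr) measurable
  finally show ?thesis .
qed

end

section \<open>Sums over the integers\<close>

lemma summable_on_int_nonneg:
  fixes f :: "int \<Rightarrow> real"
  assumes "\<And>t. 0 \<le> f t" "summable (\<lambda>k. f (int k))" "summable (\<lambda>k. f (- int k))"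
  shows "f summable_on UNIV"
proof -
  have "(f \<circ> int) summable_on UNIV" "(f \<circ> (\<lambda>k. - int k)) summable_on UNIV"
    using assms by (auto simp: o_def summable_on_UNIV_nonneg_real_iff)
  moreover have "inj int" "inj (\<lambda>k. - int k)" by (auto intro!: injI)
  ultimately have "f summable_on range int" "f summable_on range (\<lambda>k. - int k)"
    by (simp_all add: summable_on_reindex)
  then have "f summable_on (range int \<union> range (\<lambda>k. - int k))"
    by (rule summable_on_union)
  moreover have "range int \<union> range (\<lambda>k. - int k) = UNIV"
  proof -
    have "t \<in> range int \<union> range (\<lambda>k. - int k)" for t :: int
      by (cases t rule: int_cases2) auto
    then show ?thesis by blast
  qed
  ultimately show ?thesis by simp
qed

text \<open>Summation along an enumeration makes monotone convergence for series applicable; by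
  \<open>esum_nn_integral\<close> the enumeration does not affect the value, so shifts and
  reflections are harmless.\<close>

definition esum :: "(int \<Rightarrow> ennreal) \<Rightarrow> ennreal" where "esum f = (\<Sum>n. f (int_decode n))"

lemma esum_nn_integral: "esum f = (\<integral>\<^sup>+t. f t \<partial>count_space UNIV)"
proof -
  have "(\<integral>\<^sup>+t. f t \<partial>count_space UNIV) = (\<integral>\<^sup>+n. f (int_decode n) \<partial>count_space UNIV)"
    by (rule nn_integral_bij_count_space[symmetric]) (rule bij_int_decode)
  then show ?thesis by (simp add: esum_def nn_integral_count_space_nat)
qed

lemma esum_bij:
  assumes "bij b" shows "esum (\<lambda>t. f (b t)) = esum f"
  unfolding esum_nn_integral by (rule nn_integral_bij_count_space) (rule assms)

lemma esum_shift: "esum (\<lambda>t. f (t + k)) = esum f" and esum_uminus: "esum (\<lambda>t. f (- t)) = esum f"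
  by (rule esum_bij, rule bijI', auto intro: exI[of _ "_ - k"], rule esum_bij, rule bijI', auto intro: exI[of _ "- _"])

lemma esum_measurable:
  assumes "\<And>t. (\<lambda>x. f x t) \<in> borel_measurable M" shows "(\<lambda>x. esum (f x)) \<in> borel_measurable M"
  unfolding esum_def by (rule borel_measurable_suminf_order) (rule assms)

lemma esum_cmult: "esum (\<lambda>t. c * f t) = c * esum f"
  unfolding esum_def by (rule ennreal_suminf_cmult)

lemma nn_integral_esum:
  assumes "\<And>t. (\<lambda>x. f x t) \<in> borel_measurable M"
  shows "(\<integral>\<^sup>+x. esum (f x) \<partial>M) = esum (\<lambda>t. \<integral>\<^sup>+x. f x t \<partial>M)"
  unfolding esum_def by (rule nn_integral_suminf) (rule assms)

lemma esum_ennreal: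
  assumes "\<And>t. 0 \<le> f t" "f summable_on UNIV"
  shows "esum (\<lambda>t. ennreal (f t)) = ennreal (\<Sum>\<^sub>\<infinity>t. f t)"
proof -
  have "(f \<circ> int_decode) summable_on UNIV"
    using assms(2) bij_int_decode by (subst summable_on_reindex[symmetric]) (auto simp: bij_def)
  then have s: "summable (\<lambda>n. f (int_decode n))"
    using assms(1) by (simp add: o_def summable_on_UNIV_nonneg_real_iff)
  have "(\<Sum>\<^sub>\<infinity>t. f t) = (\<Sum>\<^sub>\<infinity>n. f (int_decode n))"
    by (rule infsum_reindex_bij_betw[symmetric]) (rule bij_int_decode)
  also have "\<dots> = (\<Sum>n. f (int_decode n))"
    using has_sum_imp_sums[OF has_sum_infsum[OF \<open>(f \<circ> int_decode) summable_on UNIV\<close>]] by (simp add: sums_iff o_def)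
  finally show ?thesis using assms(1) s by (simp add: esum_def suminf_ennreal2)
qed

section \<open>The time change formula\<close>

context tail_setting begin

lemma AE_R_pos: "AE \<omega> in M'. R \<omega> > 0"
  using AE_R_greater_1 by (auto elim: eventually_mono)

lemma Y_eq_R_Theta: "R \<omega> > 0 \<Longrightarrow> Y t \<omega> = R \<omega> *\<^sub>R \<Theta> t \<omega>"
  by (simp add: Theta_eq)

lemma N_Y_eq: "R \<omega> > 0 \<Longrightarrow> N (Y t \<omega>) = R \<omega> * N (\<Theta> t \<omega>)"
  by (simp add: Y_eq_R_Theta)

lemma prob_R_greater': "y > 0 \<Longrightarrow> M'.prob {\<omega> \<in> space M'. R \<omega> > y} = min 1 (y powr (- \<alpha>))"
proof (cases "y \<ge> 1")
  case True
  assume "y > 0"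
  have "y powr (- \<alpha>) \<le> 1" using True alpha_pos by (simp add: powr_minus_divide ge_one_powr_ge_zero)
  then show ?thesis using prob_R_greater[OF True] by simp
next
  case False
  assume y: "y > 0"
  have "1 \<le> y powr (- \<alpha>)" using y False alpha_pos by (simp add: powr_minus_divide powr_le1)
  moreover have "M'.prob {\<omega> \<in> space M'. R \<omega> > y} = 1"
    by (subst M'.prob_Collect_eq_1) (use AE_R_greater_1 False in \<open>auto elim: eventually_mono\<close>)
  ultimately show ?thesis by simp
qed

text \<open>Given the direction, the event says that \<open>R\<close> exceeds
  \<open>c / N (\<Theta> j)\<close>, and by independence its probability is explicit. With
  \<open>c = 1\<close> this is the origin of the factor
  \<open>min (N (\<Theta> j) powr \<alpha>) 1\<close> in the covariance.\<close>

lemma nn_integral_Y_greater: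
  assumes G[measurable]: "G \<in> borel_measurable borel" and c: "c > 0"
  shows "(\<integral>\<^sup>+\<omega>. G (\<Theta>P \<omega>) * of_bool (N (Y j \<omega>) > c) \<partial>M') =
    (\<integral>\<^sup>+\<omega>. G (\<Theta>P \<omega>) * ennreal (min 1 ((N (\<Theta> j \<omega>) / c) powr \<alpha>)) \<partial>M')"
proof -
  have Nj[measurable]: "(\<lambda>w::int \<Rightarrow> real^'d. N (w j)) \<in> borel_measurable borel" by (rule measurable_N_coordinate)
  define H where "H = (\<lambda>(w, r). G w * of_bool (r * N (w j) > c))"
  have H: "H \<in> borel_measurable (borel \<Otimes>\<^sub>M borel)" unfolding H_def by measurable
  have "(\<integral>\<^sup>+\<omega>. G (\<Theta>P \<omega>) * of_bool (N (Y j \<omega>) > c) \<partial>M') = (\<integral>\<^sup>+\<omega>. H (\<Theta>P \<omega>, R \<omega>) \<partial>M')"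
    by (rule nn_integral_cong_AE) (use AE_R_pos in \<open>auto elim!: eventually_mono simp: H_def N_Y_eq \<Theta>P_def\<close>)
  also have "\<dots> = (\<integral>\<^sup>+\<omega>. (\<integral>\<^sup>+\<omega>'. H (\<Theta>P \<omega>, R \<omega>') \<partial>M') \<partial>M')" by (rule nn_integral_Theta_R[OF H])
  also have "\<dots> = (\<integral>\<^sup>+\<omega>. G (\<Theta>P \<omega>) * ennreal (min 1 ((N (\<Theta> j \<omega>) / c) powr \<alpha>)) \<partial>M')"
  proof (rule nn_integral_cong)
    fix \<omega>
    define n where "n = N (\<Theta> j \<omega>)"
    have n0: "n \<ge> 0" by (simp add: n_def)
    have "(\<integral>\<^sup>+\<omega>'. H (\<Theta>P \<omega>, R \<omega>') \<partial>M') = (\<integral>\<^sup>+\<omega>'. G (\<Theta>P \<omega>) * of_bool (R \<omega>' * n > c) \<partial>M')"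
      by (simp add: H_def n_def \<Theta>P_def)
    also have "\<dots> = G (\<Theta>P \<omega>) * (\<integral>\<^sup>+\<omega>'. of_bool (R \<omega>' * n > c) \<partial>M')"
      by (rule nn_integral_cmult) measurable
    also have "(\<integral>\<^sup>+\<omega>'. of_bool (R \<omega>' * n > c) \<partial>M') = ennreal (min 1 ((n / c) powr \<alpha>))"
    proof (cases "n = 0")
      case True
      then show ?thesis using c by simp
    next
      case False
      then have n: "n > 0" using n0 by simp
      have "(\<integral>\<^sup>+\<omega>'. of_bool (R \<omega>' * n > c) \<partial>M') = (\<integral>\<^sup>+\<omega>'. indicator {\<omega> \<in> space M'. R \<omega> > c / n} \<omega>' \<partial>M')"
        by (rule nn_integral_cong) (use n in \<open>auto simp: indicator_def field_simps\<close>)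
      also have "\<dots> = ennreal (min 1 ((c / n) powr (- \<alpha>)))"
        using prob_R_greater'[of "c / n"] c n by (simp add: M'.emeasure_eq_measure)
      also have "(c / n) powr (- \<alpha>) = (n / c) powr \<alpha>"
        using c n by (simp add: powr_minus_divide powr_divide)
      finally show ?thesis .
    qed
    finally show "(\<integral>\<^sup>+\<omega>'. H (\<Theta>P \<omega>, R \<omega>') \<partial>M') = G (\<Theta>P \<omega>) * ennreal (min 1 ((N (\<Theta> j \<omega>) / c) powr \<alpha>))"
      by (simp add: n_def)
  qed
  finally show ?thesis .
qed

text \<open>For every direction the independent radius almost surely avoids the single value at
  which \<open>N (Y j)\<close> equals \<open>c\<close>. Hence exceedance indicators are almost
  surely continuous along the tail process.\<close>

lemma AE_N_Y_neq:
  assumes c: "c > 0" shows "AE \<omega> in M'. N (Y j \<omega>) \<noteq> c"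
proof -
  have Nj[measurable]: "(\<lambda>w::int \<Rightarrow> real^'d. N (w j)) \<in> borel_measurable borel" by (rule measurable_N_coordinate)
  define H :: "(int \<Rightarrow> real^'d) \<times> real \<Rightarrow> ennreal" where "H = (\<lambda>(w, r). of_bool (r * N (w j) = c))"
  have H: "H \<in> borel_measurable (borel \<Otimes>\<^sub>M borel)" unfolding H_def by measurable
  have "(\<integral>\<^sup>+\<omega>. of_bool (N (Y j \<omega>) = c) \<partial>M') = (\<integral>\<^sup>+\<omega>. H (\<Theta>P \<omega>, R \<omega>) \<partial>M')"
    by (rule nn_integral_cong_AE) (use AE_R_pos in \<open>auto elim!: eventually_mono simp: H_def N_Y_eq \<Theta>P_def\<close>)
  also have "\<dots> = (\<integral>\<^sup>+\<omega>. (\<integral>\<^sup>+\<omega>'. H (\<Theta>P \<omega>, R \<omega>') \<partial>M') \<partial>M')" by (rule nn_integral_Theta_R[OF H])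
  also have "\<dots> = (\<integral>\<^sup>+\<omega>. 0 \<partial>M')"
  proof (rule nn_integral_cong)
    fix \<omega>
    define n where "n = N (\<Theta> j \<omega>)"
    have "(\<integral>\<^sup>+\<omega>'. H (\<Theta>P \<omega>, R \<omega>') \<partial>M') = (\<integral>\<^sup>+\<omega>'. 0 \<partial>M')"
    proof (rule nn_integral_cong_AE)
      show "AE \<omega>' in M'. H (\<Theta>P \<omega>, R \<omega>') = 0"
        using AE_R_neq[of "c / n"]
      proof (rule eventually_mono)
        fix \<omega>' assume "R \<omega>' \<noteq> c / n"
        then have "R \<omega>' * n \<noteq> c" using c by (metis nonzero_mult_div_cancel_right mult_zero_right order_less_irrefl)
        then show "H (\<Theta>P \<omega>, R \<omega>') = 0" by (simp add: H_def n_def \<Theta>P_def)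
      qed
    qed
    then show "(\<integral>\<^sup>+\<omega>'. H (\<Theta>P \<omega>, R \<omega>') \<partial>M') = 0" by simp
  qed
  finally have "(\<integral>\<^sup>+\<omega>. of_bool (N (Y j \<omega>) = c) \<partial>M') = 0" by simp
  then have "AE \<omega> in M'. (of_bool (N (Y j \<omega>) = c) :: ennreal) = 0"
    by (subst (asm) nn_integral_0_iff_AE) auto
  then show ?thesis by (rule eventually_mono) simp
qed

text \<open>Before the limit both sides describe exceedances at two times at distance
  \<open>h\<close>, with the same one of the two times as origin of the path. Stationarity
  identifies them, and the tail process inherits the identity.\<close>

lemma time_change:
  assumes f: "f \<in> borel_measurable borel"
  shows "(\<integral>\<^sup>+\<omega>. of_bool (N (Y h \<omega>) > 1) * f (\<lambda>t. Y (t + h) \<omega>) \<partial>M') =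
    (\<integral>\<^sup>+\<omega>. of_bool (N (Y (- h) \<omega>) > 1) * f (YP \<omega>) \<partial>M')"
proof -
  have Nc[measurable]: "(\<lambda>w::int \<Rightarrow> real^'d. N (w k)) \<in> borel_measurable borel" for k by (rule measurable_N_coordinate)
  have "(\<integral>\<^sup>+\<omega>. ennreal (of_bool (N (Y h \<omega>) > 1)) * f (\<lambda>t. Y (t + h) \<omega>) \<partial>M') =
    (\<integral>\<^sup>+\<omega>. ennreal (of_bool (N (Y (- h) \<omega>) > 1)) * f (YP \<omega>) \<partial>M')"
  proof (rule weighted_path_laws_eq[where A=1, OF _ _ _ _ _ _ _ _ _ f])
    fix g :: "(int \<Rightarrow> real^'d) \<Rightarrow> real" and L C
    assume L: "\<And>w w'. \<bar>g w - g w'\<bar> \<le> L * dist w w'" and C: "\<And>w. \<bar>g w\<bar> \<le> C"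
    have gc: "continuous_on A g" for A by (rule Lipschitz_real_imp_continuous_on[OF L])
    have gC: "isCont g w" for w using gc[of UNIV] by (simp add: continuous_on_eq_continuous_at)
    have gm[measurable]: "g \<in> borel_measurable borel" by (rule borel_measurable_continuous_onI[OF gc])
    have C0: "0 \<le> C" using C[of undefined] by linarith
    have ae: "AE \<omega> in M'. N (Y k \<omega>) \<noteq> 1" for k by (rule AE_N_Y_neq) simp
    have gs[measurable]: "(\<lambda>w::int \<Rightarrow> real^'d. g (\<lambda>t. w (t + h))) \<in> borel_measurable borel"
      by (rule measurable_compose[OF path_shift_measurable gm])
    have 1: "((\<lambda>x. \<integral>\<omega>. of_bool (N (X h \<omega> /\<^sub>R x) > 1) * g (\<lambda>t. X (t + h) \<omega> /\<^sub>R x) \<partial>Q x) \<longlongrightarrow>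
        (\<integral>\<omega>. of_bool (N (Y h \<omega>) > 1) * g (\<lambda>t. Y (t + h) \<omega>) \<partial>M')) at_top"
    proof (rule tail_tendsto[where f="\<lambda>w. of_bool (N (w h) > 1) * g (\<lambda>t. w (t + h))" and C=C])
      show "\<bar>of_bool (N (w h) > 1) * g (\<lambda>t. w (t + h))\<bar> \<le> C" for w using C C0 by (simp add: of_bool_def)
      show "AE \<omega> in M'. isCont (\<lambda>w. of_bool (N (w h) > 1) * g (\<lambda>t. w (t + h))) (YP \<omega>)"
        using ae[of h]
        by eventually_elim (intro isCont_mult isCont_o2[OF isCont_path_shift] gC isCont_of_bool_greater[OF isCont_N_coordinate], simp)
    qed measurable
    have 2: "((\<lambda>x. \<integral>\<omega>. of_bool (N (X (- h) \<omega> /\<^sub>R x) > 1) * g (\<lambda>t. X t \<omega> /\<^sub>R x) \<partial>Q x) \<longlongrightarrow>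
        (\<integral>\<omega>. of_bool (N (Y (- h) \<omega>) > 1) * g (YP \<omega>) \<partial>M')) at_top"
    proof (rule tail_tendsto[where f="\<lambda>w. of_bool (N (w (- h)) > 1) * g w" and C=C])
      show "\<bar>of_bool (N (w (- h)) > 1) * g w\<bar> \<le> C" for w using C C0 by (simp add: of_bool_def)
      show "AE \<omega> in M'. isCont (\<lambda>w. of_bool (N (w (- h)) > 1) * g w) (YP \<omega>)"
        using ae[of "- h"]
        by eventually_elim (intro isCont_mult gC isCont_of_bool_greater[OF isCont_N_coordinate], simp)
    qed measurable
    have "\<forall>\<^sub>F x in at_top. (\<integral>\<omega>. of_bool (N (X h \<omega> /\<^sub>R x) > 1) * g (\<lambda>t. X (t + h) \<omega> /\<^sub>R x) \<partial>Q x) =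
        (\<integral>\<omega>. of_bool (N (X (- h) \<omega> /\<^sub>R x) > 1) * g (\<lambda>t. X t \<omega> /\<^sub>R x) \<partial>Q x)"
      using eventually_gt_at_top[of 0]
    proof eventually_elim
      case (elim x)
      have iff: "N (v /\<^sub>R x) > 1 \<longleftrightarrow> N v > x" for v using elim by (simp add: field_simps)
      \<comment> \<open>Exceedances at times 0 and \<open>- h\<close> with the path seen from time
        0; after a shift by \<open>h\<close> they are exceedances at \<open>h\<close> and 0 with the
        path seen from \<open>h\<close>.\<close>
      define F where "F w = of_bool (N (w 0) > x) * g (\<lambda>t. w t /\<^sub>R x) * of_bool (N (w (- h)) > x)" for w
      have gx[measurable]: "(\<lambda>w. g (\<lambda>t. w t /\<^sub>R x)) \<in> borel_measurable borel"
        by (rule measurable_compose[OF path_scale_measurable gm])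
      have "F \<in> borel_measurable borel" unfolding F_def by measurable
      from integral_shift[OF this, of h]
      have F: "(\<integral>\<omega>. F (\<lambda>t. X (t + h) \<omega>) \<partial>M) = (\<integral>\<omega>. F (XP \<omega>) \<partial>M)" .
      have [measurable]: "(\<lambda>\<omega>. g (\<lambda>t. X t \<omega> /\<^sub>R x)) \<in> borel_measurable M"
          "(\<lambda>\<omega>. g (\<lambda>t. X (t + h) \<omega> /\<^sub>R x)) \<in> borel_measurable M"
        by (rule measurable_compose[OF XP_measurable gx], rule measurable_compose[OF shift_measurable(1) gx])
      have "(\<integral>\<omega>. of_bool (N (X h \<omega> /\<^sub>R x) > 1) * g (\<lambda>t. X (t + h) \<omega> /\<^sub>R x) \<partial>Q x) = (\<integral>\<omega>. F (\<lambda>t. X (t + h) \<omega>) \<partial>M) / V x"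
        by (subst integral_Q) (measurable, simp only: F_def iff add_0 add.left_inverse)
      moreover have "(\<integral>\<omega>. of_bool (N (X (- h) \<omega> /\<^sub>R x) > 1) * g (\<lambda>t. X t \<omega> /\<^sub>R x) \<partial>Q x) = (\<integral>\<omega>. F (XP \<omega>) \<partial>M) / V x"
        by (subst integral_Q) (measurable, simp only: F_def iff mult_ac)
      ultimately show ?case using F by simp
    qed
    with 1 have "((\<lambda>x. \<integral>\<omega>. of_bool (N (X (- h) \<omega> /\<^sub>R x) > 1) * g (\<lambda>t. X t \<omega> /\<^sub>R x) \<partial>Q x) \<longlongrightarrow>
        (\<integral>\<omega>. of_bool (N (Y h \<omega>) > 1) * g (\<lambda>t. Y (t + h) \<omega>) \<partial>M')) at_top"
      by (rule Lim_transform_eventually)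
    from tendsto_unique[OF _ this 2]
    show "(\<integral>\<omega>. of_bool (N (Y h \<omega>) > 1) * g (\<lambda>t. Y (t + h) \<omega>) \<partial>M') = (\<integral>\<omega>. of_bool (N (Y (- h) \<omega>) > 1) * g (YP \<omega>) \<partial>M')"
      by simp
  qed (auto simp: of_bool_def)
  then show ?thesis by (simp add: of_bool_def if_distrib cong: if_cong)
qed

lemma Y_path_homogeneous:
  assumes "\<And>c w. c > 0 \<Longrightarrow> G (\<lambda>t. c *\<^sub>R w t) = G w" "R \<omega> > 0"
  shows "G (\<Theta>P \<omega>) = G (YP \<omega>)"
  using assms(1)[of "inverse (R \<omega>)" "YP \<omega>"] assms(2) by (simp add: \<Theta>P_def Theta_eq)

text \<open>Follows from the time change formula of the tail process by lowering the threshold of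
  \<open>N (Y h)\<close> from 1 to \<open>1 / c\<close>.\<close>

lemma time_change_homogeneous:
  assumes G[measurable]: "G \<in> borel_measurable borel"
    and hom: "\<And>c w. c > 0 \<Longrightarrow> G (\<lambda>t. c *\<^sub>R w t) = G w"
  shows "(\<integral>\<^sup>+\<omega>. G (\<lambda>t. Y (t + h) \<omega>) * of_bool (Y h \<omega> \<noteq> 0) \<partial>M') =
    (\<integral>\<^sup>+\<omega>. G (YP \<omega>) * ennreal (N (\<Theta> (- h) \<omega>) powr \<alpha>) \<partial>M')"
proof -
  have Nc[measurable]: "(\<lambda>w::int \<Rightarrow> real^'d. N (w k)) \<in> borel_measurable borel" for k by (rule measurable_N_coordinate)
  have Gs[measurable]: "(\<lambda>w::int \<Rightarrow> real^'d. G (\<lambda>t. w (t + h))) \<in> borel_measurable borel"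
    by (rule measurable_compose[OF path_shift_measurable G])
  have [measurable]: "(\<lambda>\<omega>. G (\<lambda>t. Y (t + h) \<omega>)) \<in> borel_measurable M'" "(\<lambda>\<omega>. G (YP \<omega>)) \<in> borel_measurable M'"
    by (rule measurable_compose[OF shift_measurable(2) G], rule measurable_compose[OF YP_measurable G])
  have step: "(\<integral>\<^sup>+\<omega>. G (\<lambda>t. Y (t + h) \<omega>) * of_bool (N (Y h \<omega>) > 1 / c) \<partial>M') =
    (\<integral>\<^sup>+\<omega>. G (YP \<omega>) * ennreal (min (c powr \<alpha>) (N (\<Theta> (- h) \<omega>) powr \<alpha>)) \<partial>M')" if c: "c \<ge> 1" for c
  proof -
    define f where "f w = G (\<lambda>t. w (t + h)) * of_bool (N (w h) > 1)" for w
    have f: "f \<in> borel_measurable borel" unfolding f_def by measurable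
    have fc: "f (\<lambda>t. c *\<^sub>R Y t \<omega>) = G (\<lambda>t. Y (t + h) \<omega>) * of_bool (N (Y h \<omega>) > 1 / c)" for \<omega>
      using c hom[of c "\<lambda>t. Y (t + h) \<omega>"] by (simp add: f_def field_simps)
    define f' where "f' w = G w * of_bool (N (w (- h)) > c)" for w
    have f': "f' \<in> borel_measurable borel" unfolding f'_def by measurable
    have cc: "ennreal (c powr \<alpha>) * ennreal (c powr (- \<alpha>)) = 1"
      using c by (simp flip: ennreal_mult add: powr_add[symmetric])
    \<comment> \<open>Scaling by \<open>c\<close> lifts the threshold at time \<open>h\<close> from
      \<open>1 / c\<close> to 1 at the price of requiring \<open>R > c\<close>. After the time
      change this becomes \<open>N (Y (- h)) > c\<close>, which contains the exceedance of 1, and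
      the radius can be integrated out.\<close>
    have "(\<integral>\<^sup>+\<omega>. G (\<lambda>t. Y (t + h) \<omega>) * of_bool (N (Y h \<omega>) > 1 / c) \<partial>M') =
        ennreal (c powr \<alpha>) * (ennreal (c powr (- \<alpha>)) * (\<integral>\<^sup>+\<omega>. f (\<lambda>t. c *\<^sub>R Y t \<omega>) \<partial>M'))"
      by (simp add: fc cc flip: mult.assoc)
    also have "\<dots> = ennreal (c powr \<alpha>) * (\<integral>\<^sup>+\<omega>. of_bool (R \<omega> > c) * f (YP \<omega>) \<partial>M')"
      unfolding scaling[OF f c] ..
    also have "(\<integral>\<^sup>+\<omega>. of_bool (R \<omega> > c) * f (YP \<omega>) \<partial>M') = (\<integral>\<^sup>+\<omega>. of_bool (N (Y h \<omega>) > 1) * f' (\<lambda>t. Y (t + h) \<omega>) \<partial>M')"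
      by (simp add: f_def f'_def R_def mult_ac)
    also have "\<dots> = (\<integral>\<^sup>+\<omega>. of_bool (N (Y (- h) \<omega>) > 1) * f' (YP \<omega>) \<partial>M')" by (rule time_change[OF f'])
    also have "\<dots> = (\<integral>\<^sup>+\<omega>. G (\<Theta>P \<omega>) * of_bool (N (Y (- h) \<omega>) > c) \<partial>M')"
      by (rule nn_integral_cong_AE)
        (use AE_R_pos c in \<open>auto elim!: eventually_mono simp: f'_def Y_path_homogeneous[where G=G, OF hom]\<close>)
    also have "\<dots> = (\<integral>\<^sup>+\<omega>. G (\<Theta>P \<omega>) * ennreal (min 1 ((N (\<Theta> (- h) \<omega>) / c) powr \<alpha>)) \<partial>M')"
      by (rule nn_integral_Y_greater[OF G]) (use c in simp)
    also have "ennreal (c powr \<alpha>) * \<dots> = (\<integral>\<^sup>+\<omega>. ennreal (c powr \<alpha>) * (G (\<Theta>P \<omega>) * ennreal (min 1 ((N (\<Theta> (- h) \<omega>) / c) powr \<alpha>))) \<partial>M')"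
      by (rule nn_integral_cmult[symmetric]) measurable
    also have "\<dots> = (\<integral>\<^sup>+\<omega>. G (YP \<omega>) * ennreal (min (c powr \<alpha>) (N (\<Theta> (- h) \<omega>) powr \<alpha>)) \<partial>M')"
    proof (rule nn_integral_cong_AE)
      have m: "c powr \<alpha> * min 1 ((n / c) powr \<alpha>) = min (c powr \<alpha>) (n powr \<alpha>)" if "n \<ge> 0" for n
        using c that by (simp add: powr_divide min_mult_distrib_left)
      show "AE \<omega> in M'. ennreal (c powr \<alpha>) * (G (\<Theta>P \<omega>) * ennreal (min 1 ((N (\<Theta> (- h) \<omega>) / c) powr \<alpha>))) =
          G (YP \<omega>) * ennreal (min (c powr \<alpha>) (N (\<Theta> (- h) \<omega>) powr \<alpha>))"
        using AE_R_pos
      proof (rule eventually_mono)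
        fix \<omega> assume "R \<omega> > 0"
        then have g: "G (\<Theta>P \<omega>) = G (YP \<omega>)" using Y_path_homogeneous[where G=G and \<omega>=\<omega>] hom by blast
        have "ennreal (c powr \<alpha>) * ennreal (min 1 ((N (\<Theta> (- h) \<omega>) / c) powr \<alpha>)) =
            ennreal (min (c powr \<alpha>) (N (\<Theta> (- h) \<omega>) powr \<alpha>))"
          by (subst ennreal_mult[symmetric]) (simp_all add: m)
        then show "ennreal (c powr \<alpha>) * (G (\<Theta>P \<omega>) * ennreal (min 1 ((N (\<Theta> (- h) \<omega>) / c) powr \<alpha>))) =
          G (YP \<omega>) * ennreal (min (c powr \<alpha>) (N (\<Theta> (- h) \<omega>) powr \<alpha>))"
          unfolding g by (metis mult.left_commute)
      qed
    qed
    finally show ?thesis .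
  qed
  \<comment> \<open>Both sides of \<open>step\<close> increase with \<open>c\<close>, so monotone
    convergence performs the passage to the threshold 0.\<close>
  have "(\<lambda>k. \<integral>\<^sup>+\<omega>. G (\<lambda>t. Y (t + h) \<omega>) * of_bool (N (Y h \<omega>) > 1 / real (Suc k)) \<partial>M') \<longlonglongrightarrow>
      (\<integral>\<^sup>+\<omega>. G (\<lambda>t. Y (t + h) \<omega>) * of_bool (Y h \<omega> \<noteq> 0) \<partial>M')"
  proof (rule nn_integral_LIMSEQ)
    show "incseq (\<lambda>k \<omega>. G (\<lambda>t. Y (t + h) \<omega>) * of_bool (N (Y h \<omega>) > 1 / real (Suc k)))"
    proof (rule incseq_SucI, rule le_funI, rule mult_left_mono)
      fix k \<omega>
      have "1 / real (Suc (Suc k)) \<le> 1 / real (Suc k)" by (simp add: frac_le)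
      then show "(of_bool (1 / real (Suc k) < N (Y h \<omega>)) :: ennreal) \<le> of_bool (1 / real (Suc (Suc k)) < N (Y h \<omega>))"
        by auto
    qed simp
    show "(\<lambda>k. G (\<lambda>t. Y (t + h) \<omega>) * of_bool (N (Y h \<omega>) > 1 / real (Suc k))) \<longlonglongrightarrow> G (\<lambda>t. Y (t + h) \<omega>) * of_bool (Y h \<omega> \<noteq> 0)" for \<omega>
    proof (rule tendsto_eventually, cases "Y h \<omega> = 0")
      case False
      then obtain k where k: "1 / real (Suc k) < N (Y h \<omega>)" using N_pos nat_approx_posE by metis
      have "1 / real (Suc k') < N (Y h \<omega>)" if "k' \<ge> k" for k'
        using k that by (smt (verit) frac_le of_nat_0_less_iff of_nat_mono Suc_le_mono zero_less_Suc)
      then show "\<forall>\<^sub>F k in sequentially. G (\<lambda>t. Y (t + h) \<omega>) * of_bool (N (Y h \<omega>) > 1 / real (Suc k)) = G (\<lambda>t. Y (t + h) \<omega>) * of_bool (Y h \<omega> \<noteq> 0)"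
        using False by (intro eventually_sequentiallyI[of k]) simp
    qed simp
  qed measurable
  moreover have "(\<lambda>k. \<integral>\<^sup>+\<omega>. G (YP \<omega>) * ennreal (min (real (Suc k) powr \<alpha>) (N (\<Theta> (- h) \<omega>) powr \<alpha>)) \<partial>M') \<longlonglongrightarrow>
      (\<integral>\<^sup>+\<omega>. G (YP \<omega>) * ennreal (N (\<Theta> (- h) \<omega>) powr \<alpha>) \<partial>M')"
  proof (rule nn_integral_LIMSEQ)
    show "incseq (\<lambda>k \<omega>. G (YP \<omega>) * ennreal (min (real (Suc k) powr \<alpha>) (N (\<Theta> (- h) \<omega>) powr \<alpha>)))"
      using alpha_pos by (intro incseq_SucI le_funI mult_left_mono ennreal_leI min.mono powr_mono2) auto
    show "(\<lambda>k. G (YP \<omega>) * ennreal (min (real (Suc k) powr \<alpha>) (N (\<Theta> (- h) \<omega>) powr \<alpha>))) \<longlonglongrightarrow> G (YP \<omega>) * ennreal (N (\<Theta> (- h) \<omega>) powr \<alpha>)" for \<omega>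
    proof (rule tendsto_eventually)
      obtain k :: nat where k: "N (\<Theta> (- h) \<omega>) \<le> real k" using real_arch_simple by blast
      have "N (\<Theta> (- h) \<omega>) powr \<alpha> \<le> real (Suc k') powr \<alpha>" if "k' \<ge> k" for k'
        using k that alpha_pos by (intro powr_mono2) auto
      then show "\<forall>\<^sub>F k in sequentially. G (YP \<omega>) * ennreal (min (real (Suc k) powr \<alpha>) (N (\<Theta> (- h) \<omega>) powr \<alpha>)) = G (YP \<omega>) * ennreal (N (\<Theta> (- h) \<omega>) powr \<alpha>)"
        by (intro eventually_sequentiallyI[of k]) (simp add: min_absorb2)
    qed
  qed measurable
  ultimately show ?thesis using step[of "real (Suc _)"] by (simp add: LIMSEQ_unique)
qed

text \<open>The homogeneous time change, applied to the indicator of \<open>C\<close> at the ratio,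
  expresses the event seen from time \<open>h\<close> through the event for
  \<open>\<Theta> i\<close>. With the boundary of a set as \<open>C\<close> this provides continuity
  of the summands of the projection functional at all times \<open>h\<close>.\<close>

lemma AE_ratio_notin:
  assumes C[measurable]: "C \<in> sets borel" and null: "AE \<omega> in M'. \<Theta> i \<omega> \<notin> C"
  shows "AE \<omega> in M'. Y h \<omega> \<noteq> 0 \<longrightarrow> Y (h + i) \<omega> /\<^sub>R N (Y h \<omega>) \<notin> C"
proof -
  define G :: "(int \<Rightarrow> real^'d) \<Rightarrow> ennreal" where "G w = indicator C (w i /\<^sub>R N (w 0))" for w
  have c: "inverse (\<bar>c\<bar> * n) * c = inverse n" if "c > 0" for c n :: real using that by (simp add: field_simps)
  have "(\<lambda>w::int \<Rightarrow> real^'d. w i /\<^sub>R N (w 0)) \<in> borel_measurable borel"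
    by (intro borel_measurable_scaleR borel_measurable_inverse measurable_N_coordinate measurable_coordinate)
  then have G: "G \<in> borel_measurable borel" unfolding G_def by measurable
  have "(\<integral>\<^sup>+\<omega>. G (\<lambda>t. Y (t + h) \<omega>) * of_bool (Y h \<omega> \<noteq> 0) \<partial>M') =
    (\<integral>\<^sup>+\<omega>. G (YP \<omega>) * ennreal (N (\<Theta> (- h) \<omega>) powr \<alpha>) \<partial>M')"
    by (rule time_change_homogeneous[OF G]) (simp only: G_def N_scaleR scaleR_scaleR c)
  also have "\<dots> = (\<integral>\<^sup>+\<omega>. 0 \<partial>M')"
    by (rule nn_integral_cong_AE) (use null in \<open>auto elim!: eventually_mono simp: G_def Theta_eq R_def\<close>)
  finally have "(\<integral>\<^sup>+\<omega>. G (\<lambda>t. Y (t + h) \<omega>) * of_bool (Y h \<omega> \<noteq> 0) \<partial>M') = 0" by simp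
  moreover have "(\<lambda>\<omega>. G (\<lambda>t. Y (t + h) \<omega>)) \<in> borel_measurable M'"
    by (rule measurable_compose[OF shift_measurable(2) G])
  ultimately have "AE \<omega> in M'. G (\<lambda>t. Y (t + h) \<omega>) * of_bool (Y h \<omega> \<noteq> 0) = 0"
    by (subst (asm) nn_integral_0_iff_AE) auto
  then show ?thesis by (rule eventually_mono) (auto simp: G_def add.commute indicator_def split: if_splits)
qed

end

section \<open>Cluster functionals\<close>

locale extremal_setting = tail_setting N M M' \<alpha> X Y
  for N :: "real^'d \<Rightarrow> real" and M :: "'w measure" and M' :: "'y measure" and \<alpha> :: real
    and X :: "int \<Rightarrow> 'w \<Rightarrow> real^'d" and Y :: "int \<Rightarrow> 'y \<Rightarrow> real^'d" +
  fixes u :: "nat \<Rightarrow> real" and s l r :: "nat \<Rightarrow> nat"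
  assumes u_pos: "\<And>n. n \<ge> 1 \<Longrightarrow> u n > 0" and u_lim: "filterlim u at_top sequentially"
    and S: "condition_S M N X u s l r" and BC: "condition_BC M N X u r" and TC: "condition_TC M N \<alpha> X u s"
begin

definition "v n = V (u n)"

lemma v_pos: "v n > 0" by (simp add: v_def V_pos)

lemma S_facts: "filterlim s at_top sequentially" "filterlim (\<lambda>n. n * v n) at_top sequentially"
    "\<And>n. n \<ge> 1 \<Longrightarrow> s n \<le> l n" "(\<lambda>n. real (l n)) \<in> o(\<lambda>n. real (r n))"
    "(\<lambda>n. r n * v n) \<longlonglongrightarrow> 0" "(\<lambda>n. real (r n)) \<in> o(\<lambda>n. sqrt (n * v n))"
    "(\<lambda>n. beta_mixing M X (l n)) \<in> o(\<lambda>n. real (r n) / real n)"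
  using S by (auto simp: condition_S_def v_seq_eq v_def)

lemma l_le_r: "\<forall>\<^sub>F n in sequentially. l n \<le> r n"
  using landau_o.smallD[OF S_facts(4), of 1] by simp

lemma s_le_r: "\<forall>\<^sub>F n in sequentially. s n \<le> r n"
  using l_le_r eventually_ge_at_top[of 1] by eventually_elim (use S_facts(3) in \<open>meson le_trans\<close>)

lemma r_lim: "filterlim r at_top sequentially"
  by (rule filterlim_at_top_mono[OF S_facts(1) s_le_r])

definition "JP k x = M.prob {\<omega> \<in> space M. N (X k \<omega>) > x \<and> N (X 0 \<omega>) > x}"

lemma JP_nonneg [simp]: "0 \<le> JP k x" by (simp add: JP_def)

lemma JP_integral: "JP k x = (\<integral>\<omega>. of_bool (N (X k \<omega>) > x) * of_bool (N (X 0 \<omega>) > x) \<partial>M)"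
proof -
  have "(\<integral>\<omega>. of_bool (N (X k \<omega>) > x) * of_bool (N (X 0 \<omega>) > x) \<partial>M) =
      (\<integral>\<omega>. indicat_real {\<omega> \<in> space M. N (X k \<omega>) > x \<and> N (X 0 \<omega>) > x} \<omega> \<partial>M)"
    by (rule Bochner_Integration.integral_cong) auto
  also have "\<dots> = JP k x" by (simp add: JP_def)
  finally show ?thesis by simp
qed

lemma JP_uminus: "JP (- k) x = JP k x"
proof -
  have [measurable]: "(\<lambda>w::int \<Rightarrow> real^'d. N (w j)) \<in> borel_measurable borel" for j by (rule measurable_N_coordinate)
  have "(\<integral>\<omega>. (of_bool (N (X (- k + k) \<omega>) > x) * of_bool (N (X (0 + k) \<omega>) > x) :: real) \<partial>M) =
      (\<integral>\<omega>. of_bool (N (X (- k) \<omega>) > x) * of_bool (N (X 0 \<omega>) > x) \<partial>M)"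
    by (rule integral_shift[where f="\<lambda>w. of_bool (N (w (- k)) > x) * of_bool (N (w 0) > x)"]) measurable
  then show ?thesis unfolding JP_integral by (simp add: mult.commute)
qed

text \<open>The conditional probabilities are multiplied out. Nonnegativity of \<open>e\<close>,
  used when ranges of summation are enlarged, is inherited from the probabilities it
  dominates.\<close>

lemma BC_bound:
  assumes "0 < c" "c \<le> 1"
  obtains e e_inf where
    "\<And>n k. n \<ge> 1 \<Longrightarrow> 1 \<le> k \<Longrightarrow> k \<le> r n \<Longrightarrow> JP (int k) (c * u n) \<le> V (c * u n) * e n k"
    "\<And>n k. n \<ge> 1 \<Longrightarrow> 1 \<le> k \<Longrightarrow> k \<le> r n \<Longrightarrow> 0 \<le> e n k"
    "\<And>k. k \<ge> 1 \<Longrightarrow> (\<lambda>n. e n k) \<longlonglongrightarrow> e_inf k"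
    "summable (\<lambda>k. e_inf (Suc k))"
    "(\<lambda>n. \<Sum>k=1..r n. e n k) \<longlonglongrightarrow> (\<Sum>k. e_inf (Suc k))"
proof -
  obtain e e_inf where e: "\<forall>n\<ge>1. \<forall>k\<in>{1..r n}.
           e n k \<ge> cond_prob M (\<lambda>\<omega>. N (X (int k) \<omega>) > c * u n) (\<lambda>\<omega>. N (X 0 \<omega>) > c * u n)"
    "\<forall>k\<ge>1. (\<lambda>n. e n k) \<longlonglongrightarrow> e_inf k" "summable (\<lambda>k. e_inf (Suc k))"
    "(\<lambda>n. \<Sum>k=1..r n. e n k) \<longlonglongrightarrow> (\<Sum>k. e_inf (Suc k))"
  proof -
    have "c \<in> {0<..1}" using assms by simp
    from BC[unfolded condition_BC_def, rule_format, OF this] show ?thesis using that by blast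
  qed
  have cp: "cond_prob M (\<lambda>\<omega>. N (X k \<omega>) > x) (\<lambda>\<omega>. N (X 0 \<omega>) > x) = JP k x / V x" for k x
    by (simp add: cond_prob_def JP_def V_def exceed_def)
  show ?thesis
  proof (rule that[of e e_inf])
    fix n k :: nat assume n: "n \<ge> 1" "1 \<le> k" "k \<le> r n"
    have *: "JP (int k) (c * u n) / V (c * u n) \<le> e n k" using e(1) n unfolding cp by auto
    show "JP (int k) (c * u n) \<le> V (c * u n) * e n k"
      using * V_pos[of "c * u n"] by (simp add: pos_divide_le_eq mult.commute)
    have "0 \<le> JP (int k) (c * u n) / V (c * u n)" using V_pos[of "c * u n"] by simp
    then show "0 \<le> e n k" using * by linarith
  qed (use e in auto)
qed

definition "pY k = M'.prob {\<omega> \<in> space M'. N (Y k \<omega>) > 1}"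

lemma pY_nn_integral: "ennreal (pY k) = (\<integral>\<^sup>+\<omega>. of_bool (N (Y k \<omega>) > 1) \<partial>M')"
proof -
  have "(\<integral>\<^sup>+\<omega>. of_bool (N (Y k \<omega>) > 1) \<partial>M') = (\<integral>\<^sup>+\<omega>. indicator {\<omega> \<in> space M'. N (Y k \<omega>) > 1} \<omega> \<partial>M')"
    by (rule nn_integral_cong) auto
  then show ?thesis by (simp add: pY_def M'.emeasure_eq_measure)
qed

lemma pY_nonneg [simp]: "0 \<le> pY k" by (simp add: pY_def)

lemma pY_integral: "pY k = (\<integral>\<omega>. of_bool (N (Y k \<omega>) > 1) \<partial>M')"
proof -
  have "(\<integral>\<omega>. (of_bool (N (Y k \<omega>) > 1) :: real) \<partial>M') = (\<integral>\<omega>. indicator {\<omega> \<in> space M'. N (Y k \<omega>) > 1} \<omega> \<partial>M')"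
    by (rule Bochner_Integration.integral_cong) auto
  then show ?thesis by (simp add: pY_def)
qed

lemma pY_uminus: "pY (- k) = pY k"
proof -
  have "ennreal (pY (- k)) = ennreal (pY k)"
    unfolding pY_nn_integral using time_change[of "\<lambda>_. 1" k] by simp
  then show ?thesis by simp
qed

lemma JP_tendsto: "(\<lambda>n. JP k (u n) / v n) \<longlonglongrightarrow> pY k"
proof -
  have [measurable]: "(\<lambda>w::int \<Rightarrow> real^'d. N (w j)) \<in> borel_measurable borel" for j by (rule measurable_N_coordinate)
  have "((\<lambda>x. \<integral>\<omega>. (of_bool (N (X k \<omega> /\<^sub>R x) > 1) :: real) \<partial>Q x) \<longlongrightarrow> (\<integral>\<omega>. of_bool (N (Y k \<omega>) > 1) \<partial>M')) at_top"
  proof (rule tail_tendsto[where f="\<lambda>w. of_bool (N (w k) > 1)" and C=1])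
    have "AE \<omega> in M'. N (Y k \<omega>) \<noteq> 1" by (rule AE_N_Y_neq) simp
    then show "AE \<omega> in M'. isCont (\<lambda>w. of_bool (N (w k) > 1) :: real) (YP \<omega>)"
      by (rule eventually_mono) (rule isCont_of_bool_greater[OF isCont_N_coordinate])
  qed auto
  from filterlim_compose[OF this u_lim]
  have lim: "(\<lambda>n. \<integral>\<omega>. (of_bool (N (X k \<omega> /\<^sub>R u n) > 1) :: real) \<partial>Q (u n)) \<longlonglongrightarrow> pY k"
    by (simp only: pY_integral)
  have "\<forall>\<^sub>F n in sequentially. (\<integral>\<omega>. (of_bool (N (X k \<omega> /\<^sub>R u n) > 1) :: real) \<partial>Q (u n)) = JP k (u n) / v n"
    using eventually_ge_at_top[of 1]
  proof eventually_elim
    case (elim n)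
    have iff: "N (w /\<^sub>R u n) > 1 \<longleftrightarrow> N w > u n" for w using u_pos[OF elim] by (simp add: field_simps)
    show ?case unfolding iff JP_integral v_def by (rule integral_Q) measurable
  qed
  with lim show ?thesis by (rule Lim_transform_eventually)
qed

text \<open>At level \<open>c = 1\<close> the bounds of the anti-clustering condition pass to the
  limit termwise, so \<open>pY\<close> is dominated by the summable \<open>e_inf\<close>.\<close>

lemma summable_pY: "summable (\<lambda>k. pY (int k))"
proof -
  obtain e e_inf where e: "\<And>n k. n \<ge> 1 \<Longrightarrow> 1 \<le> k \<Longrightarrow> k \<le> r n \<Longrightarrow> JP (int k) (1 * u n) \<le> V (1 * u n) * e n k"
    "\<And>k. k \<ge> 1 \<Longrightarrow> (\<lambda>n. e n k) \<longlonglongrightarrow> e_inf k" "summable (\<lambda>k. e_inf (Suc k))"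
    by (rule BC_bound[of 1]) auto
  have le: "pY (int k) \<le> e_inf k" if k: "k \<ge> 1" for k
  proof (rule tendsto_le[OF _ e(2)[OF k] JP_tendsto])
    have "\<forall>\<^sub>F n in sequentially. k \<le> r n" using r_lim by (simp add: filterlim_at_top)
    then show "\<forall>\<^sub>F n in sequentially. JP (int k) (u n) / v n \<le> e n k"
      using eventually_ge_at_top[of 1]
    proof eventually_elim
      case (elim n)
      then show ?case using e(1)[of n k] k v_pos[of n] by (simp add: v_def pos_divide_le_eq mult.commute)
    qed
  qed simp
  have "summable (\<lambda>k. pY (int (Suc k)))"
    by (rule summable_comparison_test'[OF e(3), of 0]) (use le[of "Suc _"] in simp)
  then show ?thesis by (subst summable_Suc_iff[symmetric])
qed

text \<open>\<open>pY k\<close> is the mean of \<open>min 1 (N (\<Theta> k) powr \<alpha>)\<close>,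
  so the truncated powers almost surely have a finite sum. The terms of a convergent series are
  eventually below 1, where the truncation is inactive.\<close>

lemma AE_summable_along:
  assumes "summable (\<lambda>k. pY (b k))"
  shows "AE \<omega> in M'. summable (\<lambda>k. N (\<Theta> (b k) \<omega>) powr \<alpha>)"
proof -
  have p: "ennreal (pY k) = (\<integral>\<^sup>+\<omega>. ennreal (min 1 (N (\<Theta> k \<omega>) powr \<alpha>)) \<partial>M')" for k
    using nn_integral_Y_greater[of "\<lambda>_. 1" 1 k] by (simp add: pY_nn_integral)
  have "(\<integral>\<^sup>+\<omega>. (\<Sum>k. ennreal (min 1 (N (\<Theta> (b k) \<omega>) powr \<alpha>))) \<partial>M') = (\<Sum>k. ennreal (pY (b k)))"
    unfolding p by (rule nn_integral_suminf) measurable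
  also have "\<dots> = ennreal (\<Sum>k. pY (b k))" by (rule suminf_ennreal2[OF _ assms]) simp
  finally have "(\<integral>\<^sup>+\<omega>. (\<Sum>k. ennreal (min 1 (N (\<Theta> (b k) \<omega>) powr \<alpha>))) \<partial>M') \<noteq> \<infinity>" by simp
  then have "AE \<omega> in M'. (\<Sum>k. ennreal (min 1 (N (\<Theta> (b k) \<omega>) powr \<alpha>))) \<noteq> \<infinity>"
    by (intro nn_integral_noteq_infinite) measurable
  then show ?thesis
  proof (rule eventually_mono)
    fix \<omega> assume "(\<Sum>k. ennreal (min 1 (N (\<Theta> (b k) \<omega>) powr \<alpha>))) \<noteq> \<infinity>"
    then have su: "summable (\<lambda>k. min 1 (N (\<Theta> (b k) \<omega>) powr \<alpha>))"
      by (intro summable_suminf_not_top) auto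
    then have "\<forall>\<^sub>F k in sequentially. min 1 (N (\<Theta> (b k) \<omega>) powr \<alpha>) < 1"
      by (intro order_tendstoD(2)[OF summable_LIMSEQ_zero]) auto
    then have "\<forall>\<^sub>F k in sequentially. min 1 (N (\<Theta> (b k) \<omega>) powr \<alpha>) = N (\<Theta> (b k) \<omega>) powr \<alpha>"
      by eventually_elim (simp add: min_def split: if_splits)
    from summable_cong[OF this] su show "summable (\<lambda>k. N (\<Theta> (b k) \<omega>) powr \<alpha>)" by simp
  qed
qed

lemma AE_summable_Y: "AE \<omega> in M'. (\<lambda>t. N (Y t \<omega>) powr \<alpha>) summable_on UNIV"
proof -
  have 1: "AE \<omega> in M'. summable (\<lambda>k. N (\<Theta> (int k) \<omega>) powr \<alpha>)"
    by (rule AE_summable_along[OF summable_pY])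
  have 2: "AE \<omega> in M'. summable (\<lambda>k. N (\<Theta> (- int k) \<omega>) powr \<alpha>)"
    by (rule AE_summable_along) (simp only: pY_uminus summable_pY)
  show ?thesis using 1 2 AE_R_pos
  proof eventually_elim
    case (elim \<omega>)
    have "(\<lambda>t. N (\<Theta> t \<omega>) powr \<alpha>) summable_on UNIV"
      by (rule summable_on_int_nonneg) (use elim in auto)
    then have "(\<lambda>t. R \<omega> powr \<alpha> * N (\<Theta> t \<omega>) powr \<alpha>) summable_on UNIV"
      by (rule summable_on_cmult_right)
    then show ?case using elim by (simp add: N_Y_eq powr_mult)
  qed
qed

end

section \<open>Projection sums along a path\<close>

context tail_setting begin

text \<open>The real sum is 0 where it does not converge; the extended one has no junk values.\<close>

definition "pathsum w = esum (\<lambda>t. ennreal (N (w t) powr \<alpha>))" for w :: "int \<Rightarrow> real^'d"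

lemma pathsum_measurable: "pathsum \<in> borel_measurable borel"
  unfolding pathsum_def[abs_def]
proof (rule esum_measurable)
  fix t
  have [measurable]: "(\<lambda>w::int \<Rightarrow> real^'d. N (w t)) \<in> borel_measurable borel" by (rule measurable_N_coordinate)
  show "(\<lambda>w::int \<Rightarrow> real^'d. ennreal (N (w t) powr \<alpha>)) \<in> borel_measurable borel" by measurable
qed

lemma pathsum_shift: "pathsum (\<lambda>t. w (t + k)) = pathsum w"
  unfolding pathsum_def by (rule esum_shift)

lemma pathsum_scale: "c > 0 \<Longrightarrow> pathsum (\<lambda>t. c *\<^sub>R w t) = ennreal (c powr \<alpha>) * pathsum w"
  unfolding pathsum_def by (simp add: powr_mult ennreal_mult esum_cmult)

lemma alpha_norm_powr:
  "alpha_norm N \<alpha> w powr \<alpha> = (\<Sum>\<^sub>\<infinity>t. N (w t) powr \<alpha>)"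
  unfolding alpha_norm_def using alpha_pos by (simp add: powr_powr infsum_nonneg)

context
  fixes w :: "int \<Rightarrow> real^'d"
  assumes sw: "(\<lambda>t. N (w t) powr \<alpha>) summable_on UNIV" and w0: "N (w 0) > 0"
begin

lemma infsum_pos: "(\<Sum>\<^sub>\<infinity>t. N (w t) powr \<alpha>) > 0"
proof -
  have "0 < N (w 0) powr \<alpha>" using w0 by (simp only: powr_gt_zero)
  also have "\<dots> = (\<Sum>\<^sub>\<infinity>t\<in>{0}. N (w t) powr \<alpha>)" by simp
  also have "\<dots> \<le> (\<Sum>\<^sub>\<infinity>t. N (w t) powr \<alpha>)"
    using sw by (intro infsum_mono2) auto
  finally show ?thesis .
qed

lemma pathsum_eq: "pathsum w = ennreal (\<Sum>\<^sub>\<infinity>t. N (w t) powr \<alpha>)"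
  unfolding pathsum_def using sw by (intro esum_ennreal) auto

lemma projection_summable: "(\<lambda>h. N (w h) powr \<alpha> * indicator A (w (h + i) /\<^sub>R N (w h))) summable_on UNIV"
proof (rule summable_on_comparison_test[OF sw])
  show "N (w h) powr \<alpha> * indicator A (w (h + i) /\<^sub>R N (w h)) \<le> N (w h) powr \<alpha>" for h
    by (simp add: indicator_def)
qed simp

lemma projection_sum_eq: "projection_sum N \<alpha> i A w =
    (\<Sum>\<^sub>\<infinity>h. N (w h) powr \<alpha> * indicator A (w (h + i) /\<^sub>R N (w h))) / (\<Sum>\<^sub>\<infinity>t. N (w t) powr \<alpha>)"
proof -
  have "projection_sum N \<alpha> i A w =
      (\<Sum>\<^sub>\<infinity>h. (N (w h) powr \<alpha> * indicator A (w (h + i) /\<^sub>R N (w h))) * inverse (\<Sum>\<^sub>\<infinity>t. N (w t) powr \<alpha>))"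
    unfolding projection_sum_def alpha_norm_powr by (simp add: field_simps)
  also have "\<dots> = (\<Sum>\<^sub>\<infinity>h. N (w h) powr \<alpha> * indicator A (w (h + i) /\<^sub>R N (w h))) * inverse (\<Sum>\<^sub>\<infinity>t. N (w t) powr \<alpha>)"
    by (rule infsum_cmult_left) (use projection_summable in simp)
  finally show ?thesis by (simp add: field_simps)
qed

lemma projection_sum_bounds: "0 \<le> projection_sum N \<alpha> i A w" "projection_sum N \<alpha> i A w \<le> 1"
proof -
  have "(\<Sum>\<^sub>\<infinity>h. N (w h) powr \<alpha> * indicator A (w (h + i) /\<^sub>R N (w h))) \<le> (\<Sum>\<^sub>\<infinity>t. N (w t) powr \<alpha>)"
    by (rule infsum_mono[OF projection_summable sw]) (simp add: indicator_def)
  then show "projection_sum N \<alpha> i A w \<le> 1" using infsum_pos by (simp add: projection_sum_eq)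
  show "0 \<le> projection_sum N \<alpha> i A w"
    unfolding projection_sum_eq by (intro divide_nonneg_nonneg infsum_nonneg) auto
qed

lemma projection_sum_UNIV: "projection_sum N \<alpha> i UNIV w = 1"
  using infsum_pos by (simp add: projection_sum_eq)

text \<open>The form in which the sum may be exchanged with an expectation and the time change
  formula applied to each term.\<close>

lemma ennreal_projection_sum: "ennreal (projection_sum N \<alpha> i A w) =
    esum (\<lambda>h. indicator A (w (h + i) /\<^sub>R N (w h)) * (ennreal (N (w h) powr \<alpha>) / pathsum w))"
proof -
  have "ennreal (projection_sum N \<alpha> i A w) =
      ennreal (\<Sum>\<^sub>\<infinity>h. (N (w h) powr \<alpha> * indicator A (w (h + i) /\<^sub>R N (w h))) / (\<Sum>\<^sub>\<infinity>t. N (w t) powr \<alpha>))"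
    unfolding projection_sum_def alpha_norm_powr by simp
  also have "\<dots> = esum (\<lambda>h. ennreal ((N (w h) powr \<alpha> * indicator A (w (h + i) /\<^sub>R N (w h))) / (\<Sum>\<^sub>\<infinity>t. N (w t) powr \<alpha>)))"
    unfolding divide_inverse
    using infsum_pos projection_summable by (intro esum_ennreal[symmetric] summable_on_cmult_left) auto
  also have "\<dots> = esum (\<lambda>h. indicator A (w (h + i) /\<^sub>R N (w h)) * (ennreal (N (w h) powr \<alpha>) / pathsum w))"
  proof -
    have "ennreal (x * indicator A y / S) = indicator A y * (ennreal x / ennreal S)" if "x \<ge> 0" "S > 0" for x S y
      using that by (simp add: indicator_def divide_ennreal)
    then show ?thesis using infsum_pos by (simp add: pathsum_eq)
  qed
  finally show ?thesis .
qed

lemma projection_sum_shift: "projection_sum N \<alpha> i A (\<lambda>t. w (t + k)) = projection_sum N \<alpha> i A w"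
proof -
  have b: "bij_betw (\<lambda>t. t + k) UNIV (UNIV :: int set)"
    by (rule bij_betwI[where g="\<lambda>t. t - k"]) auto
  show ?thesis
    unfolding projection_sum_def alpha_norm_def
    using infsum_reindex_bij_betw[OF b, of "\<lambda>t. N (w t) powr \<alpha>"]
      infsum_reindex_bij_betw[OF b, of "\<lambda>h. N (w h) powr \<alpha> / ((\<Sum>\<^sub>\<infinity>t. N (w t) powr \<alpha>) powr (1 / \<alpha>)) powr \<alpha> * indicator A (w (h + i) /\<^sub>R N (w h))"]
    by (simp add: add_ac)
qed

end

end

context extremal_setting begin

lemma AE_regular_path: "AE \<omega> in M'. (\<lambda>t. N (Y t \<omega>) powr \<alpha>) summable_on UNIV \<and> R \<omega> > 1"
  using AE_summable_Y AE_R_greater_1 by eventually_elim simp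

text \<open>By the time change formula the mass of the shifted path is transported back to time 0.\<close>

lemma nn_integral_projection_sum:
  assumes A[measurable]: "A \<in> sets borel"
  shows "(\<integral>\<^sup>+\<omega>. ennreal (projection_sum N \<alpha> i A (YP \<omega>)) \<partial>M') = emeasure M' {\<omega> \<in> space M'. \<Theta> i \<omega> \<in> A}"
proof -
  \<comment> \<open>The weight of time \<open>h\<close> is split into the mass at time 0, kept in
    \<open>G h\<close>, and the factor \<open>N (\<Theta> h) powr \<alpha>\<close> that the
    homogeneous time change produces. \<open>G h\<close> is homogeneous of degree 0 because
    numerator and total mass scale alike.\<close>
  define G :: "int \<Rightarrow> (int \<Rightarrow> real^'d) \<Rightarrow> ennreal" where
    "G h w = indicator A (w (h + i) /\<^sub>R N (w h)) * (ennreal (N (w 0) powr \<alpha>) / pathsum w)" for h w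
  have [measurable]: "(\<lambda>w::int \<Rightarrow> real^'d. N (w k)) \<in> borel_measurable borel" for k by (rule measurable_N_coordinate)
  have [measurable]: "pathsum \<in> borel_measurable borel" by (rule pathsum_measurable)
  have [measurable]: "(\<lambda>w::int \<Rightarrow> real^'d. w j /\<^sub>R N (w k)) \<in> borel_measurable borel" for j k
    by (intro borel_measurable_scaleR borel_measurable_inverse measurable_N_coordinate measurable_coordinate)
  have G[measurable]: "G h \<in> borel_measurable borel" for h unfolding G_def by measurable
  have hom: "G h (\<lambda>t. c *\<^sub>R w t) = G h w" if c: "c > 0" for c w h
  proof -
    have i: "inverse (\<bar>c\<bar> * n) * c = inverse n" for n :: real using c by (simp add: field_simps)
    have "ennreal (N (c *\<^sub>R w 0) powr \<alpha>) / pathsum (\<lambda>t. c *\<^sub>R w t) =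
        (ennreal (N (w 0) powr \<alpha>) * ennreal (c powr \<alpha>)) / (pathsum w * ennreal (c powr \<alpha>))"
      using c by (simp add: pathsum_scale powr_mult ennreal_mult mult.commute)
    also have "\<dots> = ennreal (N (w 0) powr \<alpha>) / pathsum w"
      using c by (intro divide_mult_eq) auto
    finally show ?thesis by (simp only: G_def N_scaleR scaleR_scaleR i)
  qed
  have Ym[measurable]: "(\<lambda>\<omega>. G h (\<lambda>t. Y (t + k) \<omega>)) \<in> borel_measurable M'" "(\<lambda>\<omega>. G h (YP \<omega>)) \<in> borel_measurable M'" for h k
    by (rule measurable_compose[OF shift_measurable(2) G], rule measurable_compose[OF YP_measurable G])
  have tc: "(\<integral>\<^sup>+\<omega>. G h (\<lambda>t. Y (t + - h) \<omega>) * of_bool (Y (- h) \<omega> \<noteq> 0) \<partial>M') =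
      (\<integral>\<^sup>+\<omega>. G h (YP \<omega>) * ennreal (N (\<Theta> h \<omega>) powr \<alpha>) \<partial>M')" for h
    using time_change_homogeneous[of "G h" "- h", OF G hom] by simp
  have "(\<integral>\<^sup>+\<omega>. ennreal (projection_sum N \<alpha> i A (YP \<omega>)) \<partial>M') =
      (\<integral>\<^sup>+\<omega>. esum (\<lambda>h. G h (YP \<omega>) * ennreal (N (\<Theta> h \<omega>) powr \<alpha>)) \<partial>M')"
    using AE_regular_path
  proof (intro nn_integral_cong_AE, elim eventually_mono)
    fix \<omega> assume \<omega>: "(\<lambda>t. N (Y t \<omega>) powr \<alpha>) summable_on UNIV \<and> R \<omega> > 1"
    then have "N (YP \<omega> 0) > 0" by (simp add: R_def)
    then have "ennreal (projection_sum N \<alpha> i A (YP \<omega>)) =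
       esum (\<lambda>h. indicator A (Y (h + i) \<omega> /\<^sub>R N (Y h \<omega>)) * (ennreal (N (Y h \<omega>) powr \<alpha>) / pathsum (YP \<omega>)))"
      using \<omega> by (intro ennreal_projection_sum) auto
    moreover have "indicator A (Y (h + i) \<omega> /\<^sub>R N (Y h \<omega>)) * (ennreal (N (Y h \<omega>) powr \<alpha>) / pathsum (YP \<omega>)) =
        G h (YP \<omega>) * ennreal (N (\<Theta> h \<omega>) powr \<alpha>)" for h
    proof -
      have "ennreal (N (Y h \<omega>) powr \<alpha>) = ennreal (N (Y 0 \<omega>) powr \<alpha>) * ennreal (N (\<Theta> h \<omega>) powr \<alpha>)"
        using \<omega> by (simp add: N_Y_eq[of \<omega> h] R_def[symmetric] powr_mult ennreal_mult)
      then show ?thesis unfolding G_def divide_ennreal_def by (simp only: mult_ac)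
    qed
    ultimately show "ennreal (projection_sum N \<alpha> i A (YP \<omega>)) = esum (\<lambda>h. G h (YP \<omega>) * ennreal (N (\<Theta> h \<omega>) powr \<alpha>))"
      by (simp only:)
  qed
  also have "\<dots> = esum (\<lambda>h. \<integral>\<^sup>+\<omega>. G h (YP \<omega>) * ennreal (N (\<Theta> h \<omega>) powr \<alpha>) \<partial>M')"
    by (rule nn_integral_esum) measurable
  also have "\<dots> = esum (\<lambda>h. \<integral>\<^sup>+\<omega>. G h (\<lambda>t. Y (t + - h) \<omega>) * of_bool (Y (- h) \<omega> \<noteq> 0) \<partial>M')"
    by (simp only: tc)
  also have "\<dots> = (\<integral>\<^sup>+\<omega>. esum (\<lambda>h. G h (\<lambda>t. Y (t + - h) \<omega>) * of_bool (Y (- h) \<omega> \<noteq> 0)) \<partial>M')"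
    by (rule nn_integral_esum[symmetric]) measurable
  also have "\<dots> = (\<integral>\<^sup>+\<omega>. indicator {\<omega> \<in> space M'. \<Theta> i \<omega> \<in> A} \<omega> \<partial>M')"
  proof (rule nn_integral_cong_AE, rule AE_mp[OF AE_regular_path], rule AE_I2, rule impI)
    fix \<omega> assume sp: "\<omega> \<in> space M'" and \<omega>: "(\<lambda>t. N (Y t \<omega>) powr \<alpha>) summable_on UNIV \<and> R \<omega> > 1"
    then have w0: "N (YP \<omega> 0) > 0" by (simp add: R_def)
    note ps = pathsum_eq[of "YP \<omega>"] infsum_pos[of "YP \<omega>"]
    \<comment> \<open>After the shift the ratio no longer depends on \<open>h\<close>: every term
      carries the indicator for \<open>\<Theta> i\<close>, and the remaining weights sum to
      1.\<close>
    have "G h (\<lambda>t. Y (t + - h) \<omega>) * of_bool (Y (- h) \<omega> \<noteq> 0) =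
        indicator A (\<Theta> i \<omega>) / pathsum (YP \<omega>) * ennreal (N (Y (- h) \<omega>) powr \<alpha>)" for h
    proof -
      have "G h (\<lambda>t. Y (t + - h) \<omega>) = indicator A (\<Theta> i \<omega>) * (ennreal (N (Y (- h) \<omega>) powr \<alpha>) / pathsum (YP \<omega>))"
        unfolding G_def using pathsum_shift[of "YP \<omega>" "- h"] by (simp add: Theta_eq R_def)
      then show ?thesis by (cases "Y (- h) \<omega> = 0") (simp_all add: ennreal_times_divide mult.commute)
    qed
    then have "esum (\<lambda>h. G h (\<lambda>t. Y (t + - h) \<omega>) * of_bool (Y (- h) \<omega> \<noteq> 0)) =
        indicator A (\<Theta> i \<omega>) / pathsum (YP \<omega>) * esum (\<lambda>h. ennreal (N (Y (- h) \<omega>) powr \<alpha>))"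
      by (simp add: esum_cmult)
    also have "esum (\<lambda>h. ennreal (N (Y (- h) \<omega>) powr \<alpha>)) = pathsum (YP \<omega>)"
      unfolding pathsum_def by (rule esum_uminus)
    also have "indicator A (\<Theta> i \<omega>) / pathsum (YP \<omega>) * pathsum (YP \<omega>) = (indicator A (\<Theta> i \<omega>) :: ennreal)"
      using ps \<omega> w0 by (simp add: ennreal_divide_times divide_ennreal indicator_def)
    finally show "esum (\<lambda>h. G h (\<lambda>t. Y (t + - h) \<omega>) * of_bool (Y (- h) \<omega> \<noteq> 0)) = indicator {\<omega> \<in> space M'. \<Theta> i \<omega> \<in> A} \<omega>"
      using sp by (simp add: indicator_def)
  qed
  also have "\<dots> = emeasure M' {\<omega> \<in> space M'. \<Theta> i \<omega> \<in> A}" by simp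
  finally show ?thesis .
qed

end

text \<open>For a divergent series both sides are 0 by convention. Measurability of such sums can
  therefore be shown without an exceptional set.\<close>

lemma infsum_eq_enn2real_esum:
  fixes f :: "int \<Rightarrow> real"
  assumes "\<And>t. 0 \<le> f t"
  shows "(\<Sum>\<^sub>\<infinity>t. f t) = enn2real (esum (\<lambda>t. ennreal (f t)))"
proof (cases "f summable_on UNIV")
  case True
  then show ?thesis using assms by (simp add: esum_ennreal infsum_nonneg)
next
  case False
  have "esum (\<lambda>t. ennreal (f t)) = top"
  proof (rule ccontr)
    assume "esum (\<lambda>t. ennreal (f t)) \<noteq> top"
    then have "summable (\<lambda>n. f (int_decode n))"
      unfolding esum_def using assms by (intro summable_suminf_not_top) auto
    then have "(f \<circ> int_decode) summable_on UNIV"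
      using assms by (simp add: o_def summable_on_UNIV_nonneg_real_iff)
    then have "f summable_on UNIV"
      using summable_on_reindex[of int_decode UNIV f] bij_int_decode by (simp add: bij_def)
    then show False using False by simp
  qed
  then show ?thesis using False by (simp add: infsum_not_exists)
qed

lemma infsum_int_measurable:
  fixes f :: "'a \<Rightarrow> int \<Rightarrow> real"
  assumes "\<And>t x. 0 \<le> f x t" "\<And>t. (\<lambda>x. f x t) \<in> borel_measurable M"
  shows "(\<lambda>x. \<Sum>\<^sub>\<infinity>t. f x t) \<in> borel_measurable M"
  unfolding infsum_eq_enn2real_esum[OF assms(1)]
proof -
  have [measurable]: "(\<lambda>x. f x t) \<in> borel_measurable M" for t by (rule assms(2))
  have [measurable]: "(\<lambda>x. esum (\<lambda>t. ennreal (f x t))) \<in> borel_measurable M"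
    by (rule esum_measurable) measurable
  show "(\<lambda>x. enn2real (esum (\<lambda>t. ennreal (f x t)))) \<in> borel_measurable M" by measurable
qed

lemma filterlim_symmetric_intervals:
  "filterlim (\<lambda>m::nat. {- int m..int m}) (finite_subsets_at_top UNIV) sequentially"
  unfolding filterlim_finite_subsets_at_top
proof (intro allI impI)
  fix X :: "int set" assume X: "finite X \<and> X \<subseteq> UNIV"
  define m where "m = nat (Max (insert 0 (abs ` X)))"
  have "X \<subseteq> {- int k..int k}" if "k \<ge> m" for k
  proof
    fix x assume "x \<in> X"
    then have "\<bar>x\<bar> \<le> Max (insert 0 (abs ` X))" using X by (intro Max_ge) auto
    also have "\<dots> \<le> int k" using that unfolding m_def by linarith
    finally show "x \<in> {- int k..int k}" by auto
  qed
  then show "\<forall>\<^sub>F y in sequentially. finite {- int y..int y} \<and> X \<subseteq> {- int y..int y} \<and> {- int y..int y} \<subseteq> UNIV"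
    by (intro eventually_sequentiallyI[of m]) auto
qed

lemma has_sum_int_tendsto:
  fixes f :: "int \<Rightarrow> real"
  assumes "f summable_on UNIV"
  shows "(\<lambda>m. \<Sum>h=- int m..int m. f h) \<longlonglongrightarrow> (\<Sum>\<^sub>\<infinity>h. f h)"
  using filterlim_compose[OF has_sum_infsum[OF assms, unfolded has_sum_def] filterlim_symmetric_intervals] .

text \<open>Adding mass \<open>t\<close> to a weighted average of values in \<open>[0, 1]\<close>
  moves it by at most the share of the new mass.\<close>

lemma weighted_average_truncation:
  fixes a b d t :: real
  assumes "0 \<le> a" "a \<le> d" "0 \<le> b" "b \<le> t" "d > 0"
  shows "\<bar>(a + b) / (d + t) - a / d\<bar> \<le> t / (d + t)"
proof -
  have dt: "d + t > 0" using assms by linarith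
  have "(a + b) / (d + t) - a / d = (b - a / d * t) / (d + t)"
    using assms dt by (simp add: field_simps)
  moreover have "0 \<le> a / d * t" "a / d * t \<le> 1 * t"
    using assms by (auto intro!: mult_nonneg_nonneg mult_right_mono simp: field_simps)
  then have "\<bar>b - a / d * t\<bar> \<le> t" using assms by linarith
  ultimately show ?thesis using dt by (simp only: abs_divide abs_of_pos) (rule divide_right_mono, auto)
qed

section \<open>Truncation to a fixed window\<close>

context tail_setting begin

text \<open>Only the averaging times are restricted; the shifted time \<open>h + i\<close> may leave
  the window. At paths that do not vanish at 0, a quotient of finite sums has only the
  discontinuities caused by the frontier of \<open>A\<close>, whereas sums over all integers are not
  continuous in the product topology.\<close>

definition trunc_proj :: "int \<Rightarrow> nat \<Rightarrow> (real^'d) set \<Rightarrow> (int \<Rightarrow> real^'d) \<Rightarrow> real" where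
  "trunc_proj i m A w = (\<Sum>h=- int m..int m. N (w h) powr \<alpha> * indicator A (w (h + i) /\<^sub>R N (w h))) /
     (\<Sum>h=- int m..int m. N (w h) powr \<alpha>)"

definition tail_weight :: "nat \<Rightarrow> nat \<Rightarrow> (int \<Rightarrow> real^'d) \<Rightarrow> real" where
  "tail_weight m S w = (\<Sum>h | int m < \<bar>h\<bar> \<and> \<bar>h\<bar> \<le> int S. N (w h) powr \<alpha>) / (\<Sum>h=- int S..int S. N (w h) powr \<alpha>)"

text \<open>The restriction leaves an unspecified value outside the window; the factor
  \<open>of_bool (\<bar>h + i\<bar> \<le> int S)\<close> in \<open>g_fun\<close> removes it.\<close>

definition g_path :: "int \<Rightarrow> nat \<Rightarrow> real \<Rightarrow> (real^'d) set \<Rightarrow> (int \<Rightarrow> real^'d) \<Rightarrow> real" where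
  "g_path i S U A w = g_fun N \<alpha> i S A (\<lambda>h\<in>{- int S..int S}. w h /\<^sub>R U)"

lemma g_fun_bounds: "0 \<le> g_fun N \<alpha> i S A w" "g_fun N \<alpha> i S A w \<le> of_bool (N (w 0) > 1)"
proof -
  let ?D = "\<Sum>h=- int S..int S. N (w h) powr \<alpha>"
  let ?T = "\<Sum>h=- int S..int S. N (w h) powr \<alpha> *
        (indicator A (w (h + i) /\<^sub>R N (w h)) * of_bool (\<bar>h + i\<bar> \<le> int S) + indicator A 0 * of_bool (\<bar>h + i\<bar> > int S))"
  have T0: "0 \<le> ?T" by (intro sum_nonneg mult_nonneg_nonneg add_nonneg_nonneg) auto
  have "?T \<le> (\<Sum>h=- int S..int S. N (w h) powr \<alpha> * 1)"
    by (intro sum_mono mult_left_mono) (auto simp: indicator_def)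
  then have TD: "?T \<le> ?D" by simp
  have D0: "0 \<le> ?D" by (intro sum_nonneg) auto
  show "0 \<le> g_fun N \<alpha> i S A w"
    unfolding g_fun_def by (rule mult_nonneg_nonneg[OF divide_nonneg_nonneg[OF _ D0] T0]) simp
  have "?T / ?D \<le> 1" using TD D0 T0 by (cases "?D = 0") (auto simp: divide_le_eq_1)
  then show "g_fun N \<alpha> i S A w \<le> of_bool (N (w 0) > 1)"
    unfolding g_fun_def by (simp add: of_bool_def)
qed

lemma g_path_bounds:
  assumes "U > 0"
  shows "0 \<le> g_path i S U A w" "g_path i S U A w \<le> of_bool (N (w 0) > U)" "g_path i S U A w \<le> 1"
proof -
  have "N (w 0 /\<^sub>R U) > 1 \<longleftrightarrow> N (w 0) > U" using assms by (simp add: field_simps)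
  then show "g_path i S U A w \<le> of_bool (N (w 0) > U)"
    using g_fun_bounds(2)[of i S A "\<lambda>h\<in>{- int S..int S}. w h /\<^sub>R U"] unfolding g_path_def by simp
  then show "g_path i S U A w \<le> 1" by (rule order_trans) simp
qed (simp add: g_path_def g_fun_bounds)

text \<open>Numerator and denominator are homogeneous of the same degree and the ratios are scale
  free, so the level \<open>U\<close> survives only in the exceedance condition.\<close>

lemma g_path_eq:
  assumes U: "U > 0"
  shows "g_path i S U A w = of_bool (N (w 0) > U) / (\<Sum>h=- int S..int S. N (w h) powr \<alpha>) *
     (\<Sum>h=- int S..int S. N (w h) powr \<alpha> *
        (indicator A (w (h + i) /\<^sub>R N (w h)) * of_bool (\<bar>h + i\<bar> \<le> int S) + indicator A 0 * of_bool (\<bar>h + i\<bar> > int S)))"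
proof -
  let ?K = "{- int S..int S}"
  let ?w = "\<lambda>h\<in>?K. w h /\<^sub>R U"
  define b where "b h = indicat_real A (w (h + i) /\<^sub>R N (w h)) * of_bool (\<bar>h + i\<bar> \<le> int S) + indicat_real A 0 * of_bool (\<bar>h + i\<bar> > int S)" for h
  define k where "k = inverse U powr \<alpha>"
  have k: "k > 0" using U by (simp add: k_def)
  have n: "N (?w h) powr \<alpha> = k * N (w h) powr \<alpha>" if "h \<in> ?K" for h
    using that U by (simp add: k_def powr_mult)
  have rr: "?w (h + i) /\<^sub>R N (?w h) = w (h + i) /\<^sub>R N (w h)" if "h \<in> ?K" "h + i \<in> ?K" for h
  proof -
    have "inverse (inverse U * x) * inverse U = inverse x" for x using U by (simp add: field_simps)
    then show ?thesis using that U by simp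
  qed
  have bb: "indicat_real A (?w (h + i) /\<^sub>R N (?w h)) * of_bool (\<bar>h + i\<bar> \<le> int S) + indicat_real A 0 * of_bool (\<bar>h + i\<bar> > int S) = b h"
    if "h \<in> ?K" for h
  proof (cases "\<bar>h + i\<bar> \<le> int S")
    case True
    then have "h + i \<in> ?K" by auto
    then show ?thesis unfolding b_def by (simp only: rr[OF that])
  qed (simp add: b_def)
  have 0: "N (?w 0) > 1 \<longleftrightarrow> N (w 0) > U" using U by (simp add: field_simps)
  have "g_path i S U A w = of_bool (N (w 0) > U) / (\<Sum>h\<in>?K. k * N (w h) powr \<alpha>) * (\<Sum>h\<in>?K. k * N (w h) powr \<alpha> * b h)"
    unfolding g_path_def g_fun_def 0
    by (intro arg_cong2[where f="\<lambda>x y. _ / x * y"] sum.cong refl) (simp_all only: n bb)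
  also have "(\<Sum>h\<in>?K. k * N (w h) powr \<alpha>) = k * (\<Sum>h\<in>?K. N (w h) powr \<alpha>)" by (simp add: sum_distrib_left)
  also have "(\<Sum>h\<in>?K. k * N (w h) powr \<alpha> * b h) = k * (\<Sum>h\<in>?K. N (w h) powr \<alpha> * b h)" by (simp add: sum_distrib_left mult.assoc)
  also have "of_bool (N (w 0) > U) / (k * (\<Sum>h\<in>?K. N (w h) powr \<alpha>)) * (k * (\<Sum>h\<in>?K. N (w h) powr \<alpha> * b h)) =
      of_bool (N (w 0) > U) / (\<Sum>h\<in>?K. N (w h) powr \<alpha>) * (\<Sum>h\<in>?K. N (w h) powr \<alpha> * b h)"
    using k by simp
  finally show ?thesis by (simp add: b_def)
qed

text \<open>For the whole space the average equals 1. Numerator and denominator of the estimator are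
  thus sums of the same functional for two sets and obey one joint limit theorem.\<close>

lemma g_path_UNIV:
  assumes U: "U > 0" shows "g_path i S U UNIV w = of_bool (N (w 0) > U)"
proof -
  have "(\<Sum>h=- int S..int S. N (w h) powr \<alpha> * (1 * of_bool (\<bar>h + i\<bar> \<le> int S) + 1 * of_bool (\<bar>h + i\<bar> > int S))) =
      (\<Sum>h=- int S..int S. N (w h) powr \<alpha>)" by (intro sum.cong) auto
  moreover have "(\<Sum>h=- int S..int S. N (w h) powr \<alpha>) > 0" if "N (w 0) > U"
  proof (rule sum_pos2[where i=0])
    show "0 < N (w 0) powr \<alpha>" using that U by (simp only: powr_gt_zero)
  qed auto
  ultimately show ?thesis unfolding g_path_eq[OF U] by (cases "N (w 0) > U") auto
qed

lemma symmetric_interval_split: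
  fixes m S :: nat assumes "m \<le> S"
  shows "{- int S..int S} = {- int m..int m} \<union> {h. int m < \<bar>h\<bar> \<and> \<bar>h\<bar> \<le> int S}"
    "{- int m..int m} \<inter> {h. int m < \<bar>h\<bar> \<and> \<bar>h\<bar> \<le> int S} = {}"
  using assms by auto

lemma finite_outer [simp]: "finite {h. int m < \<bar>h\<bar> \<and> \<bar>h\<bar> \<le> int S}"
  by (rule finite_subset[of _ "{- int S..int S}"]) auto

lemma trunc_proj_bounds: "0 \<le> trunc_proj i m A w" "trunc_proj i m A w \<le> 1"
proof -
  have a: "(\<Sum>h=- int m..int m. N (w h) powr \<alpha> * indicator A (w (h + i) /\<^sub>R N (w h))) \<le> (\<Sum>h=- int m..int m. N (w h) powr \<alpha>)"
    by (intro sum_mono) (simp add: indicator_def)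
  have b: "0 \<le> (\<Sum>h=- int m..int m. N (w h) powr \<alpha> * indicator A (w (h + i) /\<^sub>R N (w h)))"
    by (intro sum_nonneg) auto
  show "0 \<le> trunc_proj i m A w" unfolding trunc_proj_def
    by (rule divide_nonneg_nonneg[OF b]) (intro sum_nonneg, simp)
  show "trunc_proj i m A w \<le> 1" unfolding trunc_proj_def using a b
    by (cases "(\<Sum>h=- int m..int m. N (w h) powr \<alpha>) = 0") (auto simp: divide_le_eq_1)
qed

lemma tail_weight_nonneg: "0 \<le> tail_weight m S w"
  unfolding tail_weight_def by (intro divide_nonneg_nonneg sum_nonneg) auto

text \<open>Since \<open>m + \<bar>i\<bar> \<le> S\<close>, the shifted times of the inner window
  stay inside the outer one, and the boundary convention affects only terms whose total share is
  \<open>tail_weight\<close>.\<close>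

lemma g_path_approx:
  assumes S: "int m + \<bar>i\<bar> \<le> int S" and U: "U > 0" and w: "N (w 0) > U"
  shows "\<bar>g_path i S U A w - trunc_proj i m A w\<bar> \<le> tail_weight m S w"
proof -
  define a where "a h = N (w h) powr \<alpha>" for h
  define b where "b h = indicat_real A (w (h + i) /\<^sub>R N (w h)) * of_bool (\<bar>h + i\<bar> \<le> int S) + indicat_real A 0 * of_bool (\<bar>h + i\<bar> > int S)" for h
  have b01: "0 \<le> b h" "b h \<le> 1" for h by (auto simp: b_def indicator_def)
  have a0: "0 \<le> a h" for h by (simp add: a_def)
  let ?I = "{- int m..int m}" and ?O = "{h. int m < \<bar>h\<bar> \<and> \<bar>h\<bar> \<le> int S}"
  have mS: "m \<le> S" using S by linarith
  have split: "(\<Sum>h=- int S..int S. f h) = (\<Sum>h\<in>?I. f h) + (\<Sum>h\<in>?O. f h)" for f :: "int \<Rightarrow> real"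
    unfolding symmetric_interval_split(1)[OF mS] by (rule sum.union_disjoint) auto
  have bI: "b h = indicator A (w (h + i) /\<^sub>R N (w h))" if "h \<in> ?I" for h
  proof -
    have "\<bar>h\<bar> \<le> int m" using that by auto
    then have "\<bar>h + i\<bar> \<le> int S" using S by linarith
    then show ?thesis by (simp add: b_def)
  qed
  have "0 < a 0" using w U by (simp only: a_def powr_gt_zero)
  then have d: "0 < (\<Sum>h\<in>?I. a h)" by (intro sum_pos2[where i=0]) (auto simp: a0)
  have "g_path i S U A w = ((\<Sum>h\<in>?I. a h * b h) + (\<Sum>h\<in>?O. a h * b h)) / ((\<Sum>h\<in>?I. a h) + (\<Sum>h\<in>?O. a h))"
    unfolding g_path_eq[OF U] using w by (simp add: split[symmetric] a_def b_def)
  moreover have "trunc_proj i m A w = (\<Sum>h\<in>?I. a h * b h) / (\<Sum>h\<in>?I. a h)"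
    unfolding trunc_proj_def a_def by (simp add: bI)
  moreover have "tail_weight m S w = (\<Sum>h\<in>?O. a h) / ((\<Sum>h\<in>?I. a h) + (\<Sum>h\<in>?O. a h))"
    unfolding tail_weight_def split by (simp add: a_def)
  moreover have "\<bar>((\<Sum>h\<in>?I. a h * b h) + (\<Sum>h\<in>?O. a h * b h)) / ((\<Sum>h\<in>?I. a h) + (\<Sum>h\<in>?O. a h)) - (\<Sum>h\<in>?I. a h * b h) / (\<Sum>h\<in>?I. a h)\<bar>
     \<le> (\<Sum>h\<in>?O. a h) / ((\<Sum>h\<in>?I. a h) + (\<Sum>h\<in>?O. a h))"
    using d a0 b01 by (intro weighted_average_truncation sum_nonneg sum_mono mult_nonneg_nonneg) (auto intro!: mult_left_le)
  ultimately show ?thesis by simp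
qed

lemma trunc_proj_tendsto:
  assumes "(\<lambda>t. N (w t) powr \<alpha>) summable_on UNIV" "N (w 0) > 0"
  shows "(\<lambda>m. trunc_proj i m A w) \<longlonglongrightarrow> projection_sum N \<alpha> i A w"
  unfolding trunc_proj_def projection_sum_eq[OF assms]
  using infsum_pos[OF assms]
  by (intro tendsto_divide has_sum_int_tendsto projection_summable[OF assms] assms(1)) simp

lemma trunc_proj_measurable:
  assumes [measurable]: "\<And>t. Z t \<in> borel_measurable P" "A \<in> sets borel"
  shows "(\<lambda>\<omega>. trunc_proj i m A (\<lambda>t. Z t \<omega>)) \<in> borel_measurable P"
  unfolding trunc_proj_def by measurable

lemma tail_weight_measurable:
  assumes [measurable]: "\<And>t. Z t \<in> borel_measurable P"
  shows "(\<lambda>\<omega>. tail_weight m S (\<lambda>t. Z t \<omega>)) \<in> borel_measurable P"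
  unfolding tail_weight_def by measurable

lemma projection_sum_measurable:
  assumes [measurable]: "\<And>t. Z t \<in> borel_measurable P" "A \<in> sets borel"
  shows "(\<lambda>\<omega>. projection_sum N \<alpha> i A (\<lambda>t. Z t \<omega>)) \<in> borel_measurable P"
proof -
  have [measurable]: "(\<lambda>\<omega>. \<Sum>\<^sub>\<infinity>t. N (Z t \<omega>) powr \<alpha>) \<in> borel_measurable P"
    by (rule infsum_int_measurable) auto
  show ?thesis unfolding projection_sum_def alpha_norm_powr
    by (rule infsum_int_measurable) (auto intro!: mult_nonneg_nonneg divide_nonneg_nonneg infsum_nonneg)
qed

lemma g_path_measurable:
  assumes Z: "\<And>t. t \<in> {- int S..int S} \<Longrightarrow> Z t \<in> borel_measurable P" and [measurable]: "A \<in> sets borel"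
  shows "(\<lambda>\<omega>. g_path i S U A (\<lambda>t. Z t \<omega>)) \<in> borel_measurable P"
proof -
  let ?K = "{- int S..int S}"
  have m: "(\<lambda>\<omega>. (\<lambda>h\<in>?K. Z h \<omega> /\<^sub>R U) t) \<in> borel_measurable P" for t
  proof (cases "t \<in> ?K")
    case True
    then have [measurable]: "Z t \<in> borel_measurable P" by (rule Z)
    show ?thesis using True by simp
  next
    case False
    then show ?thesis by (simp only: restrict_apply if_False) simp
  qed
  define W where "W t \<omega> = (\<lambda>h\<in>?K. Z h \<omega> /\<^sub>R U) t" for t \<omega>
  have [measurable]: "W t \<in> borel_measurable P" for t unfolding W_def[abs_def] by (rule m)
  have "(\<lambda>\<omega>. g_fun N \<alpha> i S A (\<lambda>t. W t \<omega>)) \<in> borel_measurable P"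
    unfolding g_fun_def by measurable
  then show ?thesis unfolding W_def g_path_def .
qed

lemma isCont_N_powr: "isCont (\<lambda>w::int \<Rightarrow> real^'d. N (w h) powr \<alpha>) w"
  unfolding isCont_def
  by (rule tendsto_powr') (use isCont_N_coordinate[where t=h and w=w] alpha_pos in \<open>auto simp: isCont_def\<close>)

text \<open>Where \<open>w h = 0\<close> the ratio may jump, but the vanishing weight forces the
  summand to 0; elsewhere the ratio is continuous and avoids the frontier.\<close>

lemma isCont_trunc_summand:
  assumes "w h = 0 \<or> w (h + i) /\<^sub>R N (w h) \<notin> frontier A"
  shows "isCont (\<lambda>w::int \<Rightarrow> real^'d. N (w h) powr \<alpha> * indicator A (w (h + i) /\<^sub>R N (w h))) w"
proof (cases "w h = 0")
  case True
  have "(\<lambda>w::int \<Rightarrow> real^'d. N (w h) powr \<alpha>) \<midarrow>w\<rightarrow> 0"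
    using isCont_N_powr[where h=h and w=w] True by (simp add: isCont_def)
  then have "(\<lambda>w::int \<Rightarrow> real^'d. N (w h) powr \<alpha> * indicator A (w (h + i) /\<^sub>R N (w h))) \<midarrow>w\<rightarrow> 0"
    by (rule Lim_null_comparison[rotated]) (auto simp: indicator_def intro!: always_eventually)
  then show ?thesis using True by (simp add: isCont_def)
next
  case False
  have c1: "isCont (\<lambda>w::int \<Rightarrow> real^'d. w (h + i) /\<^sub>R N (w h)) w"
    using False by (intro isCont_scaleR continuous_at_within_inverse isCont_N_coordinate isCont_coordinate) simp
  have c2: "isCont (indicat_real A) (w (h + i) /\<^sub>R N (w h))"
    using assms False by (simp only: isCont_indicator) simp
  have "isCont (\<lambda>w::int \<Rightarrow> real^'d. indicat_real A (w (h + i) /\<^sub>R N (w h))) w"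
    unfolding isCont_def by (rule isCont_tendsto_compose[OF c2 c1[unfolded isCont_def]])
  then show ?thesis by (intro isCont_mult isCont_N_powr)
qed

lemma isCont_trunc_proj:
  assumes "N (w 0) > 0" "\<And>h. w h = 0 \<or> w (h + i) /\<^sub>R N (w h) \<notin> frontier A"
  shows "isCont (trunc_proj i m A) w"
proof -
  have "(\<Sum>h=- int m..int m. N (w h) powr \<alpha>) > 0"
    by (rule sum_pos2[where i=0]) (use assms(1) in auto)
  then show ?thesis unfolding trunc_proj_def[abs_def]
    by (intro isCont_divide isCont_sum ballI isCont_trunc_summand isCont_N_powr assms(2)) simp
qed

lemma trunc_proj_scale: "c > 0 \<Longrightarrow> trunc_proj i m A (\<lambda>t. c *\<^sub>R w t) = trunc_proj i m A w"
proof -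
  assume c: "c > 0"
  have i: "inverse (\<bar>c\<bar> * n) * c = inverse n" for n :: real using c by (simp add: field_simps)
  have p: "(\<bar>c\<bar> * N x) powr \<alpha> = c powr \<alpha> * N x powr \<alpha>" for x using c by (simp add: powr_mult)
  have "c powr \<alpha> > 0" using c by simp
  then show ?thesis
    unfolding trunc_proj_def N_scaleR scaleR_scaleR i p mult.assoc sum_distrib_left[symmetric] by simp
qed

lemma projection_sum_scale: "c > 0 \<Longrightarrow> projection_sum N \<alpha> i A (\<lambda>t. c *\<^sub>R w t) = projection_sum N \<alpha> i A w"
proof -
  assume c: "c > 0"
  have i: "inverse (\<bar>c\<bar> * n) * c = inverse n" for n :: real using c by (simp add: field_simps)
  have p: "(\<bar>c\<bar> * N x) powr \<alpha> = c powr \<alpha> * N x powr \<alpha>" for x using c by (simp add: powr_mult)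
  have c0: "c powr \<alpha> > 0" using c by simp
  have s: "(\<Sum>\<^sub>\<infinity>t. c powr \<alpha> * N (w t) powr \<alpha>) = c powr \<alpha> * (\<Sum>\<^sub>\<infinity>t. N (w t) powr \<alpha>)"
    using c0 by (intro infsum_cmult_right') 
  show ?thesis
    unfolding projection_sum_def alpha_norm_powr N_scaleR scaleR_scaleR i p s using c0 by simp
qed

end

lemma sum_outer:
  fixes f :: "int \<Rightarrow> real"
  shows "(\<Sum>h | int m < \<bar>h\<bar> \<and> \<bar>h\<bar> \<le> int S. f h) = (\<Sum>k=Suc m..S. f (int k) + f (- int k))"
proof -
  have "{h. int m < \<bar>h\<bar> \<and> \<bar>h\<bar> \<le> int S} = int ` {Suc m..S} \<union> (\<lambda>k. - int k) ` {Suc m..S}"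
  proof (intro set_eqI iffI)
    fix h assume h: "h \<in> {h. int m < \<bar>h\<bar> \<and> \<bar>h\<bar> \<le> int S}"
    show "h \<in> int ` {Suc m..S} \<union> (\<lambda>k. - int k) ` {Suc m..S}"
    proof (cases "h \<ge> 0")
      case True
      then have "h = int (nat h)" "nat h \<in> {Suc m..S}" using h by auto
      then show ?thesis by blast
    next
      case False
      then have "h = - int (nat (- h))" "nat (- h) \<in> {Suc m..S}" using h by auto
      then show ?thesis by blast
    qed
  qed auto
  moreover have "int ` {Suc m..S} \<inter> (\<lambda>k. - int k) ` {Suc m..S} = {}" by auto
  ultimately have "(\<Sum>h | int m < \<bar>h\<bar> \<and> \<bar>h\<bar> \<le> int S. f h) = (\<Sum>h\<in>int ` {Suc m..S}. f h) + (\<Sum>h\<in>(\<lambda>k. - int k) ` {Suc m..S}. f h)"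
    by (simp add: sum.union_disjoint)
  also have "\<dots> = (\<Sum>k=Suc m..S. f (int k)) + (\<Sum>k=Suc m..S. f (- int k))"
    by (subst (1 2) sum.reindex) (auto simp: inj_on_def)
  finally show ?thesis by (simp add: sum.distrib)
qed

lemma symmetric_abs_interval: "{h::int. \<bar>h\<bar> \<le> int S} = {- int S..int S}" by auto

section \<open>Weight outside the window\<close>

context tail_setting begin

lemma tail_weight_le_1: "tail_weight m S w \<le> 1"
proof (cases "(\<Sum>h=- int S..int S. N (w h) powr \<alpha>) = 0")
  case True
  then show ?thesis by (simp add: tail_weight_def)
next
  case False
  have "(\<Sum>h | int m < \<bar>h\<bar> \<and> \<bar>h\<bar> \<le> int S. N (w h) powr \<alpha>) \<le> (\<Sum>h=- int S..int S. N (w h) powr \<alpha>)"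
    by (rule sum_mono2) auto
  moreover have "0 \<le> (\<Sum>h=- int S..int S. N (w h) powr \<alpha>)" by (intro sum_nonneg) auto
  ultimately show ?thesis using False by (simp add: tail_weight_def divide_le_eq_1)
qed

text \<open>With \<open>c * u n\<close> in the place of \<open>c\<close>, this is the random
  quantity of (TC) at \<open>j = 0\<close>.\<close>

definition small_weight :: "nat \<Rightarrow> nat \<Rightarrow> real \<Rightarrow> (int \<Rightarrow> real^'d) \<Rightarrow> real" where
  "small_weight m S c w = (\<Sum>h | int m < \<bar>h\<bar> \<and> \<bar>h\<bar> \<le> int S. N (w h) powr \<alpha> * of_bool (N (w h) \<le> c)) /
      (\<Sum>h=- int S..int S. N (w h) powr \<alpha>)"

lemma small_weight_bounds: "0 \<le> small_weight m S c w" "small_weight m S c w \<le> 1"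
proof -
  show "0 \<le> small_weight m S c w" unfolding small_weight_def by (intro divide_nonneg_nonneg sum_nonneg) auto
  have "small_weight m S c w \<le> tail_weight m S w"
    unfolding small_weight_def tail_weight_def
    by (intro divide_right_mono sum_mono sum_nonneg) (auto simp: of_bool_def)
  then show "small_weight m S c w \<le> 1" using tail_weight_le_1 by (rule order_trans)
qed

lemma small_weight_measurable:
  assumes [measurable]: "\<And>t. Z t \<in> borel_measurable P"
  shows "(\<lambda>\<omega>. small_weight m S c (\<lambda>t. Z t \<omega>)) \<in> borel_measurable P"
  unfolding small_weight_def by measurable

text \<open>A term with \<open>N (w h) > c\<close> has share at most 1 and is merely counted. The
  small terms are left to (TC), the number of large ones to (BC).\<close>

lemma tail_weight_split:
  "tail_weight m S w \<le> small_weight m S c w + (\<Sum>h | int m < \<bar>h\<bar> \<and> \<bar>h\<bar> \<le> int S. of_bool (N (w h) > c))"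
proof -
  let ?O = "{h. int m < \<bar>h\<bar> \<and> \<bar>h\<bar> \<le> int S}"
  define D where "D = (\<Sum>h=- int S..int S. N (w h) powr \<alpha>)"
  have D: "N (w h) powr \<alpha> / D \<le> 1" if "h \<in> ?O" for h
  proof (cases "D = 0")
    case False
    have "N (w h) powr \<alpha> \<le> D" unfolding D_def by (rule member_le_sum) (use that in auto)
    moreover have "0 \<le> D" unfolding D_def by (intro sum_nonneg) auto
    ultimately show ?thesis using False by (simp add: divide_le_eq_1)
  qed simp
  have "tail_weight m S w = (\<Sum>h\<in>?O. N (w h) powr \<alpha> / D)"
    by (simp add: tail_weight_def D_def sum_divide_distrib)
  also have "\<dots> = (\<Sum>h\<in>?O. N (w h) powr \<alpha> * of_bool (N (w h) \<le> c) / D + N (w h) powr \<alpha> / D * of_bool (N (w h) > c))"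
    by (rule sum.cong) (auto simp: of_bool_def)
  also have "\<dots> = small_weight m S c w + (\<Sum>h\<in>?O. N (w h) powr \<alpha> / D * of_bool (N (w h) > c))"
    by (simp only: sum.distrib small_weight_def D_def sum_divide_distrib)
  also have "\<dots> \<le> small_weight m S c w + (\<Sum>h\<in>?O. of_bool (N (w h) > c))"
    using D by (intro add_left_mono sum_mono) (auto simp: of_bool_def)
  finally show ?thesis .
qed

lemma integrable_bounded:
  fixes f :: "'w \<Rightarrow> real"
  assumes "f \<in> borel_measurable M" "\<And>\<omega>. 0 \<le> f \<omega>" "\<And>\<omega>. f \<omega> \<le> C"
  shows "integrable M f"
  using assms by (intro M.integrable_const_bound[where B=C]) auto

end

context extremal_setting begin

definition "rho n m = (\<integral>\<omega>. tail_weight m (s n) (XP \<omega>) * of_bool (N (X 0 \<omega>) > u n) \<partial>M) / v n"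

lemma rho_bound:
  assumes n: "n \<ge> 1" and c: "0 < c" "c < 1"
  shows "rho n m \<le> (\<integral>\<omega>. small_weight m (s n) (c * u n) (XP \<omega>) \<partial>Q (u n)) +
      (\<Sum>k=Suc m..s n. 2 * JP (int k) (c * u n)) / v n"
proof -
  let ?I = "\<lambda>\<omega>. of_bool (N (X 0 \<omega>) > u n) :: real"
  let ?O = "{h. int m < \<bar>h\<bar> \<and> \<bar>h\<bar> \<le> int (s n)}"
  note [measurable] = tail_weight_measurable[of X M, OF X_measurable] small_weight_measurable[of X M, OF X_measurable]
  have cu: "c * u n \<le> u n" using u_pos[OF n] c by simp
  have i1: "integrable M (\<lambda>\<omega>. tail_weight m (s n) (XP \<omega>) * ?I \<omega>)"
    by (rule integrable_bounded[where C=1]) (auto simp: tail_weight_nonneg tail_weight_le_1 of_bool_def)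
  have i2: "integrable M (\<lambda>\<omega>. small_weight m (s n) (c * u n) (XP \<omega>) * ?I \<omega>)"
    by (rule integrable_bounded[where C=1]) (auto simp: small_weight_bounds of_bool_def)
  have i3: "integrable M (\<lambda>\<omega>. of_bool (N (X h \<omega>) > c * u n) * of_bool (N (X 0 \<omega>) > c * u n) :: real)" for h
    by (rule integrable_bounded[where C=1]) auto
  have "(\<integral>\<omega>. tail_weight m (s n) (XP \<omega>) * ?I \<omega> \<partial>M) \<le>
      (\<integral>\<omega>. small_weight m (s n) (c * u n) (XP \<omega>) * ?I \<omega> + (\<Sum>h\<in>?O. of_bool (N (X h \<omega>) > c * u n) * of_bool (N (X 0 \<omega>) > c * u n)) \<partial>M)"
  proof (rule integral_mono[OF i1])
    fix \<omega>
    show "tail_weight m (s n) (XP \<omega>) * ?I \<omega> \<le> small_weight m (s n) (c * u n) (XP \<omega>) * ?I \<omega> +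
        (\<Sum>h\<in>?O. of_bool (N (X h \<omega>) > c * u n) * of_bool (N (X 0 \<omega>) > c * u n))"
    proof (cases "N (X 0 \<omega>) > u n")
      case True
      then have "N (X 0 \<omega>) > c * u n" using cu by linarith
      then show ?thesis using True tail_weight_split[of m "s n" "XP \<omega>" "c * u n"] by simp
    next
      case False
      then show ?thesis by (simp add: sum_nonneg)
    qed
  qed (intro Bochner_Integration.integrable_add i2 Bochner_Integration.integrable_sum i3)
  also have "\<dots> = (\<integral>\<omega>. small_weight m (s n) (c * u n) (XP \<omega>) * ?I \<omega> \<partial>M) + (\<Sum>h\<in>?O. JP h (c * u n))"
    using i2 i3 by (simp only: Bochner_Integration.integral_add Bochner_Integration.integral_sum Bochner_Integration.integrable_sum JP_integral)
  also have "(\<Sum>h\<in>?O. JP h (c * u n)) = (\<Sum>k=Suc m..s n. 2 * JP (int k) (c * u n))"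
    unfolding sum_outer JP_uminus by simp
  finally have "rho n m \<le> ((\<integral>\<omega>. small_weight m (s n) (c * u n) (XP \<omega>) * ?I \<omega> \<partial>M) + (\<Sum>k=Suc m..s n. 2 * JP (int k) (c * u n))) / v n"
    unfolding rho_def using v_pos[of n] by (simp add: divide_right_mono)
  also have "\<dots> = (\<integral>\<omega>. small_weight m (s n) (c * u n) (XP \<omega>) * ?I \<omega> \<partial>M) / v n + (\<Sum>k=Suc m..s n. 2 * JP (int k) (c * u n)) / v n"
    by (rule add_divide_distrib)
  also have "(\<integral>\<omega>. small_weight m (s n) (c * u n) (XP \<omega>) * ?I \<omega> \<partial>M) / v n = (\<integral>\<omega>. small_weight m (s n) (c * u n) (XP \<omega>) \<partial>Q (u n))"
    unfolding v_def by (rule integral_Q[symmetric]) measurable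
  finally show ?thesis .
qed

text \<open>(TC) handles the small terms. The expected number of large ones is bounded by a tail of
  the sums in (BC) at level \<open>c * u n\<close>, and \<open>V_ratio\<close> translates this level
  back to \<open>u n\<close>.\<close>

lemma rho_small:
  assumes \<epsilon>: "\<epsilon> > 0" shows "\<exists>m0. \<forall>m\<ge>m0. \<forall>\<^sub>F n in sequentially. rho n m < \<epsilon>"
proof -
  obtain c where cc: "c \<in> {0<..<1}" and TCj: "\<forall>j. (\<lambda>m::nat. limsup (\<lambda>n. ereal (\<integral>\<omega>.
          (\<Sum>h | int m < \<bar>h\<bar> \<and> \<bar>h\<bar> \<le> int (s n). N (X (h + j) \<omega>) powr \<alpha> * of_bool (N (X (h + j) \<omega>) \<le> c * u n))
          / (\<Sum>h | \<bar>h\<bar> \<le> int (s n). N (X (h + j) \<omega>) powr \<alpha>) \<partial>cond_exceed M N X (u n)))) \<longlonglongrightarrow> 0"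
    by (rule bexE[OF TC[unfolded condition_TC_def]])
  have c: "0 < c" "c < 1" using cc by auto
  note TC0 = TCj[THEN spec, of 0]
  have TC1: "(\<lambda>m::nat. limsup (\<lambda>n. ereal (\<integral>\<omega>. small_weight m (s n) (c * u n) (XP \<omega>) \<partial>Q (u n)))) \<longlonglongrightarrow> 0"
    using TC0 by (simp add: small_weight_def symmetric_abs_interval)
  have "\<forall>\<^sub>F m in sequentially. limsup (\<lambda>n. ereal (\<integral>\<omega>. small_weight m (s n) (c * u n) (XP \<omega>) \<partial>Q (u n))) < ereal (\<epsilon> / 2)"
    by (rule order_tendstoD(2)[OF TC1]) (use \<epsilon> in simp)
  then obtain m1 where m1': "\<And>m. m \<ge> m1 \<Longrightarrow> limsup (\<lambda>n. ereal (\<integral>\<omega>. small_weight m (s n) (c * u n) (XP \<omega>) \<partial>Q (u n))) < ereal (\<epsilon> / 2)"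
    unfolding eventually_sequentially by blast
  then have m1: "\<forall>\<^sub>F n in sequentially. (\<integral>\<omega>. small_weight m (s n) (c * u n) (XP \<omega>) \<partial>Q (u n)) < \<epsilon> / 2" if "m \<ge> m1" for m
  proof -
    have "\<forall>\<^sub>F n in sequentially. ereal (\<integral>\<omega>. small_weight m (s n) (c * u n) (XP \<omega>) \<partial>Q (u n)) < ereal (\<epsilon> / 2)"
      using m1'[OF that] by (rule Limsup_lessD)
    then show ?thesis by simp
  qed
  obtain e e_inf where e: "\<And>n k. n \<ge> 1 \<Longrightarrow> 1 \<le> k \<Longrightarrow> k \<le> r n \<Longrightarrow> JP (int k) (c * u n) \<le> V (c * u n) * e n k"
    "\<And>n k. n \<ge> 1 \<Longrightarrow> 1 \<le> k \<Longrightarrow> k \<le> r n \<Longrightarrow> 0 \<le> e n k"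
    "\<And>k. k \<ge> 1 \<Longrightarrow> (\<lambda>n. e n k) \<longlonglongrightarrow> e_inf k" "summable (\<lambda>k. e_inf (Suc k))"
    "(\<lambda>n. \<Sum>k=1..r n. e n k) \<longlonglongrightarrow> (\<Sum>k. e_inf (Suc k))"
    using BC_bound[OF c(1) less_imp_le[OF c(2)]] by blast
  \<comment> \<open>The tail of the limiting series is written as total minus initial part, because
    (BC) gives convergence of the full sums and of the single terms.\<close>
  define t where "t m = (\<Sum>k. e_inf (Suc k)) - (\<Sum>k<m. e_inf (Suc k))" for m
  have "(\<lambda>m. 2 * (c powr (- \<alpha>) * t m)) \<longlonglongrightarrow> 2 * (c powr (- \<alpha>) * ((\<Sum>k. e_inf (Suc k)) - (\<Sum>k. e_inf (Suc k))))"
    unfolding t_def by (intro tendsto_intros summable_LIMSEQ e(4))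
  then have "\<forall>\<^sub>F m in sequentially. 2 * (c powr (- \<alpha>) * t m) < \<epsilon> / 2"
    by (rule order_tendstoD) (use \<epsilon> in simp)
  then obtain m2 where m2: "\<And>m. m \<ge> m2 \<Longrightarrow> 2 * (c powr (- \<alpha>) * t m) < \<epsilon> / 2"
    unfolding eventually_sequentially by blast
  show ?thesis
  proof (intro exI[of _ "max m1 m2"] allI impI)
    fix m assume m: "m \<ge> max m1 m2"
    have "(\<lambda>n. V (c * u n) / V (u n)) \<longlonglongrightarrow> c powr (- \<alpha>)"
      using filterlim_compose[OF V_ratio[OF c(1)] u_lim] .
    moreover have "(\<lambda>n. (\<Sum>k=1..r n. e n k) - (\<Sum>k<m. e n (Suc k))) \<longlonglongrightarrow> t m"
      unfolding t_def by (intro tendsto_diff e(5) tendsto_sum e(3)) simp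
    ultimately have "(\<lambda>n. 2 * (V (c * u n) / V (u n) * ((\<Sum>k=1..r n. e n k) - (\<Sum>k<m. e n (Suc k))))) \<longlonglongrightarrow> 2 * (c powr (- \<alpha>) * t m)"
      by (intro tendsto_intros)
    then have ev: "\<forall>\<^sub>F n in sequentially. 2 * (V (c * u n) / V (u n) * ((\<Sum>k=1..r n. e n k) - (\<Sum>k<m. e n (Suc k)))) < \<epsilon> / 2"
      by (rule order_tendstoD) (use m2 m in simp)
    have rm: "\<forall>\<^sub>F n in sequentially. m \<le> r n" using r_lim by (simp add: filterlim_at_top)
    have ev1: "\<forall>\<^sub>F n in sequentially. (\<integral>\<omega>. small_weight m (s n) (c * u n) (XP \<omega>) \<partial>Q (u n)) < \<epsilon> / 2"
      by (rule m1) (use m in simp)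
    show "\<forall>\<^sub>F n in sequentially. rho n m < \<epsilon>"
      using ev ev1 rm s_le_r eventually_ge_at_top[of 1]
    proof eventually_elim
      case (elim n)
      have n: "n \<ge> 1" using elim by simp
      have "(\<Sum>k=Suc m..s n. 2 * JP (int k) (c * u n)) \<le> (\<Sum>k=Suc m..s n. 2 * (V (c * u n) * e n k))"
        using e(1)[OF n] elim by (intro sum_mono) auto
      also have "\<dots> \<le> (\<Sum>k=Suc m..r n. 2 * (V (c * u n) * e n k))"
        using e(2)[OF n] elim V_pos[of "c * u n"] by (intro sum_mono2) auto
      also have "\<dots> = 2 * (V (c * u n) * (\<Sum>k=Suc m..r n. e n k))" by (simp add: sum_distrib_left)
      also have "(\<Sum>k=Suc m..r n. e n k) = (\<Sum>k=1..r n. e n k) - (\<Sum>k<m. e n (Suc k))"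
      proof -
        have "(\<Sum>k<m. e n (Suc k)) = (\<Sum>k=1..m. e n k)"
          by (simp add: sum.atLeast_Suc_atMost_Suc_shift lessThan_Suc_atMost[symmetric] sum.atLeast1_atMost_eq)
        moreover have "(\<Sum>k=1..r n. e n k) = (\<Sum>k=1..m. e n k) + (\<Sum>k=Suc m..r n. e n k)"
        proof -
          have "{1..r n} = {1..m} \<union> {Suc m..r n}" using elim by auto
          then show ?thesis by (simp add: sum.union_disjoint)
        qed
        ultimately show ?thesis by simp
      qed
      finally have "(\<Sum>k=Suc m..s n. 2 * JP (int k) (c * u n)) / v n \<le>
          2 * (V (c * u n) * ((\<Sum>k=1..r n. e n k) - (\<Sum>k<m. e n (Suc k)))) / v n"
        using v_pos[of n] by (simp add: divide_right_mono)
      also have "\<dots> = 2 * (V (c * u n) / V (u n) * ((\<Sum>k=1..r n. e n k) - (\<Sum>k<m. e n (Suc k))))"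
        by (simp add: v_def)
      also have "\<dots> < \<epsilon> / 2" using elim by simp
      finally show ?case using rho_bound[OF n c, of m] elim by linarith
    qed
  qed
qed

text \<open>The exceedance is required at time \<open>j\<close> and the window is centred there, so
  stationarity moves both to time 0.\<close>

lemma rho_shift:
  "(\<integral>\<omega>. tail_weight m (s n) (\<lambda>t. X (t + j) \<omega>) * of_bool (N (X j \<omega>) > u n) \<partial>M) = rho n m * v n"
proof -
  have [measurable]: "(\<lambda>w::int \<Rightarrow> real^'d. N (w 0)) \<in> borel_measurable borel" by (rule measurable_N_coordinate)
  have [measurable]: "(\<lambda>w::int \<Rightarrow> real^'d. tail_weight m (s n) w) \<in> borel_measurable borel"
    using tail_weight_measurable[of "\<lambda>t w. w t" borel] measurable_coordinate by blast
  have "(\<integral>\<omega>. tail_weight m (s n) (\<lambda>t. X (t + j) \<omega>) * of_bool (N (X (0 + j) \<omega>) > u n) \<partial>M) =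
    (\<integral>\<omega>. tail_weight m (s n) (XP \<omega>) * of_bool (N (X 0 \<omega>) > u n) \<partial>M)"
    by (rule integral_shift[where f="\<lambda>w. tail_weight m (s n) w * of_bool (N (w 0) > u n)"]) measurable
  then show ?thesis using v_pos[of n] by (simp add: rho_def)
qed

section \<open>Limits of the lagged moments\<close>

definition "cov_summand i A B j =
  (\<integral>\<omega>. min (N (\<Theta> j \<omega>) powr \<alpha>) 1 * projection_sum N \<alpha> i A (\<Theta>P \<omega>) * projection_sum N \<alpha> i B (\<Theta>P \<omega>) \<partial>M')"

lemma projection_sum_nonneg: "0 \<le> projection_sum N \<alpha> i A w"
  unfolding projection_sum_def by (intro infsum_nonneg mult_nonneg_nonneg) auto

text \<open>Undoing the integration over the radius replaces
  \<open>min (N (\<Theta> j) powr \<alpha>) 1\<close> by the indicator of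
  \<open>N (Y j) > 1\<close>. The factor for \<open>B\<close> is written along the path shifted by
  \<open>j\<close>, which leaves it unchanged, in order to match the lagged products before the
  limit.\<close>

lemma cov_summand_eq:
  assumes A: "A \<in> sets borel" and B: "B \<in> sets borel"
  shows "cov_summand i A B j =
    (\<integral>\<omega>. of_bool (N (Y j \<omega>) > 1) * (projection_sum N \<alpha> i A (YP \<omega>) * projection_sum N \<alpha> i B (\<lambda>t. Y (t + j) \<omega>)) \<partial>M')"
proof -
  note [measurable] = projection_sum_measurable[of Y M', OF Y_measurable A] projection_sum_measurable[of Y M', OF Y_measurable B]
    projection_sum_measurable[of \<Theta> M', OF Theta_measurable A] projection_sum_measurable[of \<Theta> M', OF Theta_measurable B]
    projection_sum_measurable[of "\<lambda>t. Y (t + j)" M', OF Y_measurable B]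
  have [measurable]: "(\<lambda>\<omega>. projection_sum N \<alpha> i A (\<Theta>P \<omega>)) \<in> borel_measurable M'" "(\<lambda>\<omega>. projection_sum N \<alpha> i B (\<Theta>P \<omega>)) \<in> borel_measurable M'"
    unfolding \<Theta>P_def by measurable
  define G where "G w = ennreal (projection_sum N \<alpha> i A w * projection_sum N \<alpha> i B w)" for w
  have G: "G \<in> borel_measurable borel"
    unfolding G_def using projection_sum_measurable[of "\<lambda>t w. w t" borel, OF measurable_coordinate A]
      projection_sum_measurable[of "\<lambda>t w. w t" borel, OF measurable_coordinate B] by (intro measurable_compose[OF _ measurable_ennreal] borel_measurable_times)
  have "cov_summand i A B j = enn2real (\<integral>\<^sup>+\<omega>. ennreal (min (N (\<Theta> j \<omega>) powr \<alpha>) 1 * projection_sum N \<alpha> i A (\<Theta>P \<omega>) * projection_sum N \<alpha> i B (\<Theta>P \<omega>)) \<partial>M')"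
    unfolding cov_summand_def by (rule integral_eq_nn_integral) (auto simp: projection_sum_nonneg)
  also have "(\<integral>\<^sup>+\<omega>. ennreal (min (N (\<Theta> j \<omega>) powr \<alpha>) 1 * projection_sum N \<alpha> i A (\<Theta>P \<omega>) * projection_sum N \<alpha> i B (\<Theta>P \<omega>)) \<partial>M')
     = (\<integral>\<^sup>+\<omega>. G (\<Theta>P \<omega>) * ennreal (min 1 ((N (\<Theta> j \<omega>) / 1) powr \<alpha>)) \<partial>M')"
    by (intro nn_integral_cong) (simp add: G_def ennreal_mult[symmetric] projection_sum_nonneg mult_ac min.commute)
  also have "\<dots> = (\<integral>\<^sup>+\<omega>. G (\<Theta>P \<omega>) * of_bool (N (Y j \<omega>) > 1) \<partial>M')"
    by (rule nn_integral_Y_greater[OF G, symmetric]) simp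
  also have "\<dots> = (\<integral>\<^sup>+\<omega>. ennreal (of_bool (N (Y j \<omega>) > 1) * (projection_sum N \<alpha> i A (YP \<omega>) * projection_sum N \<alpha> i B (\<lambda>t. Y (t + j) \<omega>))) \<partial>M')"
    using AE_regular_path
  proof (intro nn_integral_cong_AE, elim eventually_mono)
    fix \<omega> assume \<omega>: "(\<lambda>t. N (Y t \<omega>) powr \<alpha>) summable_on UNIV \<and> R \<omega> > 1"
    have "projection_sum N \<alpha> i D (\<Theta>P \<omega>) = projection_sum N \<alpha> i D (YP \<omega>)" for D
      using Y_path_homogeneous[of "projection_sum N \<alpha> i D" \<omega>] projection_sum_scale \<omega> by simp
    moreover have "projection_sum N \<alpha> i B (\<lambda>t. YP \<omega> (t + j)) = projection_sum N \<alpha> i B (YP \<omega>)"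
      by (rule projection_sum_shift) (use \<omega> in \<open>auto simp: R_def\<close>)
    ultimately show "G (\<Theta>P \<omega>) * of_bool (N (Y j \<omega>) > 1) =
        ennreal (of_bool (N (Y j \<omega>) > 1) * (projection_sum N \<alpha> i A (YP \<omega>) * projection_sum N \<alpha> i B (\<lambda>t. Y (t + j) \<omega>)))"
      by (simp add: G_def of_bool_def)
  qed
  also have "enn2real \<dots> = (\<integral>\<omega>. of_bool (N (Y j \<omega>) > 1) * (projection_sum N \<alpha> i A (YP \<omega>) * projection_sum N \<alpha> i B (\<lambda>t. Y (t + j) \<omega>)) \<partial>M')"
    by (rule integral_eq_nn_integral[symmetric]) (auto simp: projection_sum_nonneg)
  finally show ?thesis .
qed

text \<open>A double limit: for fixed \<open>m\<close> the truncated functionals converge along the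
  tail process, then \<open>m\<close> tends to infinity by dominated convergence. The truncation
  error is bounded by \<open>rho\<close> uniformly over large \<open>n\<close>, so the limits may be
  interchanged.\<close>

lemma g_path_tendsto:
  assumes A[measurable]: "A \<in> sets borel" and B[measurable]: "B \<in> sets borel"
    and nullA: "AE \<omega> in M'. \<Theta> i \<omega> \<notin> frontier A" and nullB: "AE \<omega> in M'. \<Theta> i \<omega> \<notin> frontier B"
  shows "(\<lambda>n. (\<integral>\<omega>. g_path i (s n) (u n) A (XP \<omega>) * g_path i (s n) (u n) B (\<lambda>t. X (t + j) \<omega>) \<partial>M) / v n) \<longlonglongrightarrow> cov_summand i A B j"
proof -
  define f where "f m w = of_bool (N (w j) > 1) * (trunc_proj i m A w * trunc_proj i m B (\<lambda>t. w (t + j)))" for m and w :: "int \<Rightarrow> real^'d"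
  have tpm[measurable]: "(\<lambda>w. trunc_proj i m A w) \<in> borel_measurable borel" "(\<lambda>w. trunc_proj i m B (\<lambda>t. w (t + j))) \<in> borel_measurable borel" for m
    using trunc_proj_measurable[of "\<lambda>t w. w t" borel, OF measurable_coordinate A]
      trunc_proj_measurable[of "\<lambda>t w. w (t + j)" borel, OF measurable_coordinate B] by simp_all
  have [measurable]: "(\<lambda>w::int \<Rightarrow> real^'d. N (w k)) \<in> borel_measurable borel" for k by (rule measurable_N_coordinate)
  have fm[measurable]: "f m \<in> borel_measurable borel" for m unfolding f_def by measurable
  have f01: "0 \<le> f m w" "f m w \<le> 1" "\<bar>f m w\<bar> \<le> 1" for m w
  proof -
    show "0 \<le> f m w" unfolding f_def by (intro mult_nonneg_nonneg trunc_proj_bounds) simp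
    show "f m w \<le> 1" unfolding f_def
      using mult_le_one[OF trunc_proj_bounds(2)[of i m A w] trunc_proj_bounds(1)[of i m B "\<lambda>t. w (t + j)"] trunc_proj_bounds(2)[of i m B "\<lambda>t. w (t + j)"]]
      by (simp add: of_bool_def)
    with \<open>0 \<le> f m w\<close> show "\<bar>f m w\<bar> \<le> 1" by simp
  qed
  define F where "F m \<omega> = f m (YP \<omega>)" for m \<omega>
  have aeA: "AE \<omega> in M'. \<forall>h. Y h \<omega> \<noteq> 0 \<longrightarrow> Y (h + i) \<omega> /\<^sub>R N (Y h \<omega>) \<notin> frontier A"
    unfolding AE_all_countable by (intro allI AE_ratio_notin nullA borel_closed frontier_closed)
  have aeB: "AE \<omega> in M'. \<forall>h. Y h \<omega> \<noteq> 0 \<longrightarrow> Y (h + i) \<omega> /\<^sub>R N (Y h \<omega>) \<notin> frontier B"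
    unfolding AE_all_countable by (intro allI AE_ratio_notin nullB borel_closed frontier_closed)
  have aeN: "AE \<omega> in M'. N (Y j \<omega>) \<noteq> 1" by (rule AE_N_Y_neq) simp
  have step1: "(\<lambda>n. \<integral>\<omega>. f m (\<lambda>t. X t \<omega> /\<^sub>R u n) \<partial>Q (u n)) \<longlonglongrightarrow> (\<integral>\<omega>. F m \<omega> \<partial>M')" for m
  proof -
    have "((\<lambda>x. \<integral>\<omega>. f m (\<lambda>t. X t \<omega> /\<^sub>R x) \<partial>Q x) \<longlongrightarrow> (\<integral>\<omega>. f m (YP \<omega>) \<partial>M')) at_top"
    proof (rule tail_tendsto[OF fm f01(3)])
      show "AE \<omega> in M'. isCont (f m) (YP \<omega>)"
        using aeA aeB aeN AE_regular_path
      proof eventually_elim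
        case (elim \<omega>)
        show ?case
        proof (cases "N (Y j \<omega>) > 1")
          case True
          have 1: "isCont (trunc_proj i m A) (YP \<omega>)"
            by (rule isCont_trunc_proj) (use elim in \<open>auto simp: R_def\<close>)
          have "isCont (trunc_proj i m B) (\<lambda>t. YP \<omega> (t + j))"
          proof (rule isCont_trunc_proj)
            show "0 < N (YP \<omega> (0 + j))" using True by simp
            show "YP \<omega> (h + j) = 0 \<or> YP \<omega> (h + i + j) /\<^sub>R N (YP \<omega> (h + j)) \<notin> frontier B" for h
              using elim(2)[THEN spec, of "h + j"] by (auto simp: add_ac)
          qed
          then have 2: "isCont (\<lambda>w. trunc_proj i m B (\<lambda>t. w (t + j))) (YP \<omega>)"
            by (rule isCont_o2[OF isCont_path_shift])
          have 3: "isCont (\<lambda>w::int \<Rightarrow> real^'d. of_bool (N (w j) > 1) :: real) (YP \<omega>)"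
            by (rule isCont_of_bool_greater[OF isCont_N_coordinate]) (use elim in simp)
          show ?thesis unfolding f_def[abs_def] by (rule isCont_mult[OF 3 isCont_mult[OF 1 2]])
        next
          case False
          \<comment> \<open>Near such a path the indicator vanishes identically, so
            \<open>f m\<close> is locally 0, although the denominator of the second average may
            vanish there.\<close>
          then have lt: "N (Y j \<omega>) < 1" using elim(3) by simp
          have "(\<lambda>w::int \<Rightarrow> real^'d. N (w j)) \<midarrow>YP \<omega>\<rightarrow> N (YP \<omega> j)"
            using isCont_N_coordinate[where t=j and w="YP \<omega>"] unfolding isCont_def .
          then have "\<forall>\<^sub>F w in at (YP \<omega>). N (w j) < 1" by (rule order_tendstoD) (rule lt)
          then have "\<forall>\<^sub>F w in at (YP \<omega>). f m w = f m (YP \<omega>)"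
            by (rule eventually_mono) (use lt in \<open>simp add: f_def\<close>)
          then show ?thesis unfolding isCont_def by (rule tendsto_eventually)
        qed
      qed
    qed
    from filterlim_compose[OF this u_lim] show ?thesis by (simp only: F_def)
  qed
  have step2: "(\<lambda>m. \<integral>\<omega>. F m \<omega> \<partial>M') \<longlonglongrightarrow> cov_summand i A B j"
    unfolding cov_summand_eq[OF A B]
  proof (rule integral_dominated_convergence[where w="\<lambda>_. 1"])
    show "(\<lambda>\<omega>. of_bool (N (Y j \<omega>) > 1) * (projection_sum N \<alpha> i A (YP \<omega>) * projection_sum N \<alpha> i B (\<lambda>t. Y (t + j) \<omega>))) \<in> borel_measurable M'"
      using projection_sum_measurable[of Y M', OF Y_measurable A] projection_sum_measurable[of "\<lambda>t. Y (t + j)" M', OF Y_measurable B]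
      by measurable
    show "F m \<in> borel_measurable M'" for m
      unfolding F_def[abs_def] by (rule measurable_compose[OF YP_measurable fm])
    show "AE \<omega> in M'. norm (F m \<omega>) \<le> 1" for m using f01 by (simp add: F_def)
    show "AE \<omega> in M'. (\<lambda>m. F m \<omega>) \<longlonglongrightarrow>
        of_bool (N (Y j \<omega>) > 1) * (projection_sum N \<alpha> i A (YP \<omega>) * projection_sum N \<alpha> i B (\<lambda>t. Y (t + j) \<omega>))"
      using AE_regular_path
    proof (rule eventually_mono)
      fix \<omega> assume \<omega>: "(\<lambda>t. N (Y t \<omega>) powr \<alpha>) summable_on UNIV \<and> R \<omega> > 1"
      show "(\<lambda>m. F m \<omega>) \<longlonglongrightarrow>
        of_bool (N (Y j \<omega>) > 1) * (projection_sum N \<alpha> i A (YP \<omega>) * projection_sum N \<alpha> i B (\<lambda>t. Y (t + j) \<omega>))"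
      proof (cases "N (Y j \<omega>) > 1")
        case True
        have b: "bij_betw (\<lambda>t. t + j) UNIV (UNIV :: int set)"
          by (rule bij_betwI[where g="\<lambda>t. t - j"]) auto
        have "(\<lambda>t. N (YP \<omega> (t + j)) powr \<alpha>) summable_on UNIV"
          using summable_on_reindex_bij_betw[OF b, of "\<lambda>t. N (Y t \<omega>) powr \<alpha>"] \<omega> by simp
        then have "(\<lambda>m. trunc_proj i m B (\<lambda>t. YP \<omega> (t + j))) \<longlonglongrightarrow> projection_sum N \<alpha> i B (\<lambda>t. YP \<omega> (t + j))"
          by (rule trunc_proj_tendsto) (use True in simp)
        moreover have "(\<lambda>m. trunc_proj i m A (YP \<omega>)) \<longlonglongrightarrow> projection_sum N \<alpha> i A (YP \<omega>)"
          by (rule trunc_proj_tendsto) (use \<omega> in \<open>auto simp: R_def\<close>)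
        ultimately show ?thesis unfolding F_def f_def by (intro tendsto_mult tendsto_const)
      qed (simp add: F_def f_def)
    qed
  qed simp
  define a where "a n = (\<integral>\<omega>. g_path i (s n) (u n) A (XP \<omega>) * g_path i (s n) (u n) B (\<lambda>t. X (t + j) \<omega>) \<partial>M) / v n" for n
  define b where "b n m = (\<integral>\<omega>. f m (\<lambda>t. X t \<omega> /\<^sub>R u n) \<partial>Q (u n))" for n m
  have approx: "\<bar>a n - b n m\<bar> \<le> 2 * rho n m" if n: "n \<ge> 1" and sm: "int m + \<bar>i\<bar> \<le> int (s n)" for n m
  proof -
    have U: "u n > 0" by (rule u_pos[OF n])
    define gA where "gA \<omega> = g_path i (s n) (u n) A (XP \<omega>)" for \<omega>
    define gB where "gB \<omega> = g_path i (s n) (u n) B (\<lambda>t. X (t + j) \<omega>)" for \<omega>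
    define hA where "hA \<omega> = trunc_proj i m A (XP \<omega>)" for \<omega>
    define hB where "hB \<omega> = trunc_proj i m B (\<lambda>t. X (t + j) \<omega>)" for \<omega>
    define R0 where "R0 \<omega> = tail_weight m (s n) (XP \<omega>)" for \<omega>
    define Rj where "Rj \<omega> = tail_weight m (s n) (\<lambda>t. X (t + j) \<omega>)" for \<omega>
    define I0 where "I0 \<omega> = (of_bool (N (X 0 \<omega>) > u n) :: real)" for \<omega>
    define Ij where "Ij \<omega> = (of_bool (N (X j \<omega>) > u n) :: real)" for \<omega>
    have [measurable]: "gA \<in> borel_measurable M" "gB \<in> borel_measurable M" "hA \<in> borel_measurable M" "hB \<in> borel_measurable M"
      "R0 \<in> borel_measurable M" "Rj \<in> borel_measurable M"
      unfolding gA_def[abs_def] gB_def[abs_def] hA_def[abs_def] hB_def[abs_def] R0_def[abs_def] Rj_def[abs_def]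
      by ((rule g_path_measurable trunc_proj_measurable tail_weight_measurable; rule X_measurable A B)+)
    have [measurable]: "I0 \<in> borel_measurable M" "Ij \<in> borel_measurable M"
      unfolding I0_def[abs_def] Ij_def[abs_def] by measurable
    have I: "I0 \<omega> = 0 \<or> I0 \<omega> = 1" "Ij \<omega> = 0 \<or> Ij \<omega> = 1" for \<omega> by (simp_all add: I0_def Ij_def)
    have gA: "0 \<le> gA \<omega>" "gA \<omega> \<le> I0 \<omega>" and gB: "0 \<le> gB \<omega>" "gB \<omega> \<le> Ij \<omega>" for \<omega>
      using g_path_bounds[OF U, of i "s n" A "XP \<omega>"] g_path_bounds[OF U, of i "s n" B "\<lambda>t. X (t + j) \<omega>"]
      by (simp_all add: gA_def gB_def I0_def Ij_def)
    have hA: "0 \<le> hA \<omega>" "hA \<omega> \<le> 1" and hB: "0 \<le> hB \<omega>" "hB \<omega> \<le> 1" for \<omega>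
      by (simp_all add: hA_def hB_def trunc_proj_bounds)
    have R01: "0 \<le> R0 \<omega>" "R0 \<omega> \<le> 1" "0 \<le> Rj \<omega>" "Rj \<omega> \<le> 1" for \<omega>
      by (simp_all add: R0_def Rj_def tail_weight_nonneg tail_weight_le_1)
    have dA: "\<bar>gA \<omega> - hA \<omega>\<bar> \<le> R0 \<omega>" if "I0 \<omega> = 1" for \<omega>
      using g_path_approx[OF sm U, of "XP \<omega>" A] that by (simp add: gA_def hA_def R0_def I0_def)
    have dB: "\<bar>gB \<omega> - hB \<omega>\<bar> \<le> Rj \<omega>" if "Ij \<omega> = 1" for \<omega>
      using g_path_approx[OF sm U, of "\<lambda>t. X (t + j) \<omega>" B] that by (simp add: gB_def hB_def Rj_def Ij_def)
    \<comment> \<open>Unless both exceedances occur, both products are 0. Otherwise one factor is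
      replaced at a time, all factors lying in \<open>[0, 1]\<close>.\<close>
    have pt: "\<bar>gA \<omega> * gB \<omega> - Ij \<omega> * (hA \<omega> * hB \<omega>) * I0 \<omega>\<bar> \<le> R0 \<omega> * I0 \<omega> + Rj \<omega> * Ij \<omega>" for \<omega>
    proof (cases "I0 \<omega> = 1 \<and> Ij \<omega> = 1")
      case True
      have "gA \<omega> * gB \<omega> - hA \<omega> * hB \<omega> = (gA \<omega> - hA \<omega>) * gB \<omega> + hA \<omega> * (gB \<omega> - hB \<omega>)"
        by (simp add: algebra_simps)
      then have "\<bar>gA \<omega> * gB \<omega> - hA \<omega> * hB \<omega>\<bar> \<le> \<bar>gA \<omega> - hA \<omega>\<bar> * gB \<omega> + hA \<omega> * \<bar>gB \<omega> - hB \<omega>\<bar>"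
        using abs_triangle_ineq[of "(gA \<omega> - hA \<omega>) * gB \<omega>" "hA \<omega> * (gB \<omega> - hB \<omega>)"] gB(1)[of \<omega>] hA(1)[of \<omega>]
        by (simp add: abs_mult)
      also have "\<dots> \<le> R0 \<omega> * 1 + 1 * Rj \<omega>"
        using dA[of \<omega>] dB[of \<omega>] True gB[of \<omega>] hA[of \<omega>] R01[of \<omega>] by (intro add_mono mult_mono) auto
      finally show ?thesis using True by simp
    next
      case False
      then have "I0 \<omega> = 0 \<or> Ij \<omega> = 0" using I[of \<omega>] by auto
      then have "gA \<omega> * gB \<omega> = 0" "Ij \<omega> * (hA \<omega> * hB \<omega>) * I0 \<omega> = 0" using gA[of \<omega>] gB[of \<omega>] by auto
      moreover have "0 \<le> R0 \<omega> * I0 \<omega> + Rj \<omega> * Ij \<omega>" using R01[of \<omega>] I[of \<omega>] by auto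
      ultimately show ?thesis by linarith
    qed
    have I01: "0 \<le> I0 \<omega>" "I0 \<omega> \<le> 1" "0 \<le> Ij \<omega>" "Ij \<omega> \<le> 1" for \<omega> by (simp_all add: I0_def Ij_def)
    have i1: "integrable M (\<lambda>\<omega>. gA \<omega> * gB \<omega>)"
      by (rule integrable_bounded[where C=1])
        (use gA gB order_trans[OF gA(2) I01(2)] order_trans[OF gB(2) I01(4)] in \<open>auto intro!: mult_nonneg_nonneg mult_le_one\<close>)
    have i2: "integrable M (\<lambda>\<omega>. Ij \<omega> * (hA \<omega> * hB \<omega>) * I0 \<omega>)"
      by (rule integrable_bounded[where C=1]) (use hA hB I01 in \<open>auto intro!: mult_nonneg_nonneg mult_le_one\<close>)
    have i3: "integrable M (\<lambda>\<omega>. R0 \<omega> * I0 \<omega>)" "integrable M (\<lambda>\<omega>. Rj \<omega> * Ij \<omega>)"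
      by (rule integrable_bounded[where C=1]; use R01 I01 in \<open>auto intro!: mult_nonneg_nonneg mult_le_one\<close>)+
    have b: "b n m = (\<integral>\<omega>. Ij \<omega> * (hA \<omega> * hB \<omega>) * I0 \<omega> \<partial>M) / v n"
    proof -
      have sA: "trunc_proj i m A (\<lambda>t. X t \<omega> /\<^sub>R u n) = hA \<omega>" "trunc_proj i m B (\<lambda>t. X (t + j) \<omega> /\<^sub>R u n) = hB \<omega>" for \<omega>
        unfolding hA_def hB_def by (rule trunc_proj_scale, use U in simp)+
      have sI: "N (X j \<omega> /\<^sub>R u n) > 1 \<longleftrightarrow> N (X j \<omega>) > u n" for \<omega> using U by (simp add: field_simps)
      have e: "f m (\<lambda>t. X t \<omega> /\<^sub>R u n) = Ij \<omega> * (hA \<omega> * hB \<omega>)" for \<omega>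
        unfolding f_def sA sI Ij_def ..
      show ?thesis unfolding b_def e v_def I0_def by (rule integral_Q) measurable
    qed
    have "a n - b n m = ((\<integral>\<omega>. gA \<omega> * gB \<omega> \<partial>M) - (\<integral>\<omega>. Ij \<omega> * (hA \<omega> * hB \<omega>) * I0 \<omega> \<partial>M)) / v n"
      unfolding b a_def gA_def gB_def by (simp add: diff_divide_distrib)
    also have "\<dots> = (\<integral>\<omega>. gA \<omega> * gB \<omega> - Ij \<omega> * (hA \<omega> * hB \<omega>) * I0 \<omega> \<partial>M) / v n"
      using i1 i2 by simp
    finally have "\<bar>a n - b n m\<bar> = \<bar>\<integral>\<omega>. gA \<omega> * gB \<omega> - Ij \<omega> * (hA \<omega> * hB \<omega>) * I0 \<omega> \<partial>M\<bar> / v n"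
      using v_pos[of n] by simp
    also have "\<dots> \<le> (\<integral>\<omega>. R0 \<omega> * I0 \<omega> + Rj \<omega> * Ij \<omega> \<partial>M) / v n"
    proof (rule divide_right_mono)
      have "\<bar>\<integral>\<omega>. gA \<omega> * gB \<omega> - Ij \<omega> * (hA \<omega> * hB \<omega>) * I0 \<omega> \<partial>M\<bar> \<le> (\<integral>\<omega>. \<bar>gA \<omega> * gB \<omega> - Ij \<omega> * (hA \<omega> * hB \<omega>) * I0 \<omega>\<bar> \<partial>M)"
        by (rule integral_abs_bound)
      also have "\<dots> \<le> (\<integral>\<omega>. R0 \<omega> * I0 \<omega> + Rj \<omega> * Ij \<omega> \<partial>M)"
        using i1 i2 i3 pt by (intro integral_mono) auto
      finally show "\<bar>\<integral>\<omega>. gA \<omega> * gB \<omega> - Ij \<omega> * (hA \<omega> * hB \<omega>) * I0 \<omega> \<partial>M\<bar> \<le> (\<integral>\<omega>. R0 \<omega> * I0 \<omega> + Rj \<omega> * Ij \<omega> \<partial>M)" .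
    qed (use v_pos[of n] in simp)
    also have "(\<integral>\<omega>. R0 \<omega> * I0 \<omega> + Rj \<omega> * Ij \<omega> \<partial>M) = (\<integral>\<omega>. R0 \<omega> * I0 \<omega> \<partial>M) + (\<integral>\<omega>. Rj \<omega> * Ij \<omega> \<partial>M)"
      using i3 by simp
    also have "(\<integral>\<omega>. R0 \<omega> * I0 \<omega> \<partial>M) = rho n m * v n"
      using v_pos[of n] by (simp add: rho_def R0_def I0_def)
    also have "(\<integral>\<omega>. Rj \<omega> * Ij \<omega> \<partial>M) = rho n m * v n" unfolding Rj_def Ij_def by (rule rho_shift)
    finally show ?thesis using v_pos[of n] by simp
  qed
  have "a \<longlonglongrightarrow> cov_summand i A B j"
  proof (rule tendstoI)
    fix e :: real assume e: "e > 0"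
    obtain m0 where m0: "\<And>m. m \<ge> m0 \<Longrightarrow> \<forall>\<^sub>F n in sequentially. rho n m < e / 6"
      using rho_small[of "e / 6"] e by auto
    have "\<forall>\<^sub>F m in sequentially. dist (\<integral>\<omega>. F m \<omega> \<partial>M') (cov_summand i A B j) < e / 3"
      using step2 e by (intro tendstoD) auto
    then obtain m1 where m1: "\<And>m. m \<ge> m1 \<Longrightarrow> dist (\<integral>\<omega>. F m \<omega> \<partial>M') (cov_summand i A B j) < e / 3"
      unfolding eventually_sequentially by blast
    define m where "m = max m0 m1"
    have 1: "\<forall>\<^sub>F n in sequentially. rho n m < e / 6" by (rule m0) (simp add: m_def)
    have 2: "dist (\<integral>\<omega>. F m \<omega> \<partial>M') (cov_summand i A B j) < e / 3" by (rule m1) (simp add: m_def)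
    have 3: "\<forall>\<^sub>F n in sequentially. dist (b n m) (\<integral>\<omega>. F m \<omega> \<partial>M') < e / 3"
      using step1[of m] e unfolding b_def by (intro tendstoD) auto
    have 4: "\<forall>\<^sub>F n in sequentially. m + nat \<bar>i\<bar> \<le> s n" using S_facts(1) by (simp add: filterlim_at_top)
    show "\<forall>\<^sub>F n in sequentially. dist (a n) (cov_summand i A B j) < e"
      using 1 3 4 eventually_ge_at_top[of 1]
    proof eventually_elim
      case (elim n)
      have "\<bar>a n - b n m\<bar> \<le> 2 * rho n m" by (rule approx) (use elim in linarith)+
      then show ?case using 2 elim unfolding dist_real_def by linarith
    qed
  qed
  then show ?thesis unfolding a_def[abs_def] .
qed

text \<open>At lag 0 with \<open>B\<close> the whole space, the product is the functional itself.
  The limit becomes the mean of the projection sum, which \<open>nn_integral_projection_sum\<close>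
  evaluates.\<close>

lemma g_path_mean_tendsto:
  assumes A: "A \<in> sets borel" and nullA: "AE \<omega> in M'. \<Theta> i \<omega> \<notin> frontier A"
  shows "(\<lambda>n. (\<integral>\<omega>. g_path i (s n) (u n) A (XP \<omega>) \<partial>M) / v n) \<longlonglongrightarrow> M'.prob {\<omega> \<in> space M'. \<Theta> i \<omega> \<in> A}"
proof -
  have "cov_summand i A UNIV 0 = M'.prob {\<omega> \<in> space M'. \<Theta> i \<omega> \<in> A}"
  proof -
    have "cov_summand i A UNIV 0 = (\<integral>\<omega>. of_bool (N (Y 0 \<omega>) > 1) * (projection_sum N \<alpha> i A (YP \<omega>) * projection_sum N \<alpha> i UNIV (\<lambda>t. Y (t + 0) \<omega>)) \<partial>M')"
      by (rule cov_summand_eq[OF A]) simp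
    also have "\<dots> = (\<integral>\<omega>. projection_sum N \<alpha> i A (YP \<omega>) \<partial>M')"
    proof (rule integral_cong_AE)
      note [measurable] = projection_sum_measurable[of Y M', OF Y_measurable A] projection_sum_measurable[of "\<lambda>t. Y (t + 0)" M' UNIV, OF Y_measurable]
      show "(\<lambda>\<omega>. of_bool (N (Y 0 \<omega>) > 1) * (projection_sum N \<alpha> i A (YP \<omega>) * projection_sum N \<alpha> i UNIV (\<lambda>t. Y (t + 0) \<omega>))) \<in> borel_measurable M'"
        by measurable
      show "(\<lambda>\<omega>. projection_sum N \<alpha> i A (YP \<omega>)) \<in> borel_measurable M'" by measurable
      show "AE \<omega> in M'. of_bool (N (Y 0 \<omega>) > 1) * (projection_sum N \<alpha> i A (YP \<omega>) * projection_sum N \<alpha> i UNIV (\<lambda>t. Y (t + 0) \<omega>)) = projection_sum N \<alpha> i A (YP \<omega>)"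
        using AE_regular_path
      proof (rule eventually_mono)
        fix \<omega> assume \<omega>: "(\<lambda>t. N (Y t \<omega>) powr \<alpha>) summable_on UNIV \<and> R \<omega> > 1"
        then have "projection_sum N \<alpha> i UNIV (YP \<omega>) = 1" by (intro projection_sum_UNIV) (auto simp: R_def)
        then show "of_bool (N (Y 0 \<omega>) > 1) * (projection_sum N \<alpha> i A (YP \<omega>) * projection_sum N \<alpha> i UNIV (\<lambda>t. Y (t + 0) \<omega>)) = projection_sum N \<alpha> i A (YP \<omega>)"
          using \<omega> by (simp add: R_def)
      qed
    qed
    also have "\<dots> = enn2real (\<integral>\<^sup>+\<omega>. ennreal (projection_sum N \<alpha> i A (YP \<omega>)) \<partial>M')"
      using projection_sum_measurable[of Y M', OF Y_measurable A]
      by (intro integral_eq_nn_integral) (auto simp: projection_sum_nonneg)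
    also have "\<dots> = M'.prob {\<omega> \<in> space M'. \<Theta> i \<omega> \<in> A}"
      unfolding nn_integral_projection_sum[OF A] by (simp add: measure_def)
    finally show ?thesis .
  qed
  moreover have "(\<lambda>n. (\<integral>\<omega>. g_path i (s n) (u n) A (XP \<omega>) * g_path i (s n) (u n) UNIV (\<lambda>t. X (t + 0) \<omega>) \<partial>M) / v n) \<longlonglongrightarrow> cov_summand i A UNIV 0"
    by (rule g_path_tendsto[OF A _ nullA]) auto
  moreover have "\<forall>\<^sub>F n in sequentially. (\<integral>\<omega>. g_path i (s n) (u n) A (XP \<omega>) * g_path i (s n) (u n) UNIV (\<lambda>t. X (t + 0) \<omega>) \<partial>M) / v n
      = (\<integral>\<omega>. g_path i (s n) (u n) A (XP \<omega>) \<partial>M) / v n"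
    using eventually_ge_at_top[of 1]
  proof eventually_elim
    case (elim n)
    have "g_path i (s n) (u n) A (XP \<omega>) * g_path i (s n) (u n) UNIV (\<lambda>t. X (t + 0) \<omega>) = g_path i (s n) (u n) A (XP \<omega>)" for \<omega>
      using g_path_bounds[OF u_pos[OF elim], of i "s n" A "XP \<omega>"] by (simp add: g_path_UNIV[OF u_pos[OF elim]] of_bool_def split: if_splits)
    then show ?case by (simp only:)
  qed
  ultimately show ?thesis using Lim_transform_eventually by fastforce
qed

text \<open>Projection sums lie in \<open>[0, 1]\<close> along regular paths, which leaves the
  exceedance probability. As \<open>pY\<close> is summable, the series of the covariance function
  converges absolutely.\<close>

lemma cov_summand_bound:
  assumes A: "A \<in> sets borel" and B: "B \<in> sets borel"
  shows "0 \<le> cov_summand i A B j" "cov_summand i A B j \<le> pY j"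
proof -
  note [measurable] = projection_sum_measurable[of Y M', OF Y_measurable A] projection_sum_measurable[of "\<lambda>t. Y (t + j)" M', OF Y_measurable B]
  let ?f = "\<lambda>\<omega>. of_bool (N (Y j \<omega>) > 1) * (projection_sum N \<alpha> i A (YP \<omega>) * projection_sum N \<alpha> i B (\<lambda>t. Y (t + j) \<omega>))"
  show "0 \<le> cov_summand i A B j" unfolding cov_summand_eq[OF A B]
    by (intro Bochner_Integration.integral_nonneg mult_nonneg_nonneg projection_sum_nonneg) simp
  have ae: "AE \<omega> in M'. ?f \<omega> \<le> of_bool (N (Y j \<omega>) > 1)"
    using AE_regular_path
  proof (rule eventually_mono)
    fix \<omega> assume \<omega>: "(\<lambda>t. N (Y t \<omega>) powr \<alpha>) summable_on UNIV \<and> R \<omega> > 1"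
    then have r: "(\<lambda>t. N (YP \<omega> t) powr \<alpha>) summable_on UNIV" "N (YP \<omega> 0) > 0" by (auto simp: R_def)
    have "projection_sum N \<alpha> i A (YP \<omega>) * projection_sum N \<alpha> i B (YP \<omega>) \<le> 1"
      by (intro mult_le_one projection_sum_bounds[OF r])
    then show "?f \<omega> \<le> of_bool (N (Y j \<omega>) > 1)"
      using projection_sum_shift[OF r, of i B j] by (simp add: of_bool_def)
  qed
  have int: "integrable M' (\<lambda>\<omega>. of_bool (N (Y j \<omega>) > 1) :: real)"
    by (rule M'.integrable_const_bound[where B=1]) auto
  show "cov_summand i A B j \<le> pY j" unfolding cov_summand_eq[OF A B] pY_integral
    by (rule integral_mono_AE[OF _ int ae], rule Bochner_Integration.integrable_bound[OF int])
      (use ae in \<open>auto elim!: eventually_mono simp: projection_sum_nonneg\<close>)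
qed

end

section \<open>Mixing and big blocks\<close>

text \<open>Averages of indicators of \<open>m\<close> level sets approximate a function with values
  in \<open>[0, 1]\<close>. A covariance bound thereby passes from events to functions without loss
  in the constant.\<close>

lemma staircase:
  fixes y :: real
  assumes y: "0 \<le> y" "y \<le> 1" and m: "m > 0"
  shows "\<bar>y - (\<Sum>k<m. of_bool (real (Suc k) \<le> real m * y)) / real m\<bar> \<le> 1 / real m"
proof -
  define q where "q = nat \<lfloor>real m * y\<rfloor>"
  have my: "0 \<le> real m * y" "real m * y \<le> real m" using y m by (auto simp: mult_left_le)
  have q: "real q \<le> real m * y" "real m * y < real q + 1" unfolding q_def using my by linarith+
  have qm: "q \<le> m" using q my by linarith
  have "(\<Sum>k<m. of_bool (real (Suc k) \<le> real m * y) :: real) = (\<Sum>k<m. of_bool (k < q))"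
  proof (rule sum.cong[OF refl])
    fix k
    have "real (Suc k) \<le> real m * y \<longleftrightarrow> k < q"
    proof
      assume "real (Suc k) \<le> real m * y"
      then have "real (Suc k) < real q + 1" using q by linarith
      then show "k < q" by linarith
    next
      assume "k < q"
      then have "real (Suc k) \<le> real q" by simp
      then show "real (Suc k) \<le> real m * y" using q by linarith
    qed
    then show "(of_bool (real (Suc k) \<le> real m * y) :: real) = of_bool (k < q)" by simp
  qed
  also have "\<dots> = real (card ({..<m} \<inter> {k. k < q}))" by simp
  also have "{..<m} \<inter> {k. k < q} = {..<q}" using qm by auto
  finally have s: "(\<Sum>k<m. of_bool (real (Suc k) \<le> real m * y) :: real) = real q" by simp
  have "y - real q / real m = (real m * y - real q) / real m" using m by (simp add: field_simps)
  then have "\<bar>y - real q / real m\<bar> = \<bar>real m * y - real q\<bar> / real m" by simp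
  also have "\<dots> \<le> 1 / real m" using q by (intro divide_right_mono) auto
  finally show ?thesis unfolding s .
qed

section \<open>Covariance inequalities from beta-mixing\<close>

context tail_setting begin

lemma space_sigma_gen: "space (sigma_gen M X T) = space M"
  by (simp add: sigma_gen_def space_measure_of_conv)

lemma sigma_gen_generators: "(\<Union>t\<in>T. {X t -` B \<inter> space M | B. B \<in> sets borel}) \<subseteq> Pow (space M)"
  by auto

lemma sets_sigma_gen: "sets (sigma_gen M X T) = sigma_sets (space M) (\<Union>t\<in>T. {X t -` B \<inter> space M | B. B \<in> sets borel})"
  unfolding sigma_gen_def by (rule sets_measure_of[OF sigma_gen_generators])

lemma subalgebra_sigma_gen: "subalgebra M (sigma_gen M X T)"
proof -
  have "(\<Union>t\<in>T. {X t -` B \<inter> space M | B. B \<in> sets borel}) \<subseteq> sets M"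
    using measurable_sets[OF X_measurable] by auto
  then show ?thesis
    unfolding subalgebra_def space_sigma_gen sets_sigma_gen by (simp add: sets.sigma_sets_subset)
qed

lemma sigma_gen_mono:
  assumes "T \<subseteq> T'" "f \<in> measurable (sigma_gen M X T) P" shows "f \<in> measurable (sigma_gen M X T') P"
proof (rule measurable_from_subalg[OF _ assms(2)])
  show "subalgebra (sigma_gen M X T') (sigma_gen M X T)"
    unfolding subalgebra_def space_sigma_gen sets_sigma_gen
    by (intro conjI refl sigma_sets_mono' UN_mono assms(1) order_refl)
qed

lemma X_sigma_gen_measurable: "t \<in> T \<Longrightarrow> X t \<in> borel_measurable (sigma_gen M X T)"
  by (rule measurableI) (auto simp: space_sigma_gen sets_sigma_gen intro!: sigma_sets.Basic)

text \<open>By conditioning on the past, the difference is the mean of \<open>f\<close> times the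
  deviation of the conditional from the unconditional probability of \<open>B\<close>. As
  \<open>\<bar>f\<bar> \<le> 1\<close>, the mean of the essential supremum over all future events
  bounds it.\<close>

lemma beta_mixing_indicator:
  assumes f: "f \<in> borel_measurable (sigma_gen M X {..0})" "\<And>\<omega>. \<bar>f \<omega>\<bar> \<le> 1"
    and B: "B \<in> sets (sigma_gen M X {int k + 1..})"
  shows "\<bar>(\<integral>\<omega>. f \<omega> * indicator B \<omega> \<partial>M) - (\<integral>\<omega>. f \<omega> \<partial>M) * M.prob B\<bar> \<le> beta_mixing M X k"
proof -
  let ?F = "sigma_gen M X {..0}"
  have "finite_measure_subalgebra M ?F"
    by (intro finite_measure_subalgebra.intro finite_measure_subalgebra_axioms.intro subalgebra_sigma_gen M.finite_measure_axioms)
  then interpret finite_measure_subalgebra M ?F .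
  have BM[measurable]: "B \<in> sets M" using B subalgebra_sigma_gen[of "{int k + 1..}"] by (auto simp: subalgebra_def)
  have fM[measurable]: "f \<in> borel_measurable M" by (rule measurable_from_subalg[OF subalgebra_sigma_gen f(1)])
  define h where "h \<omega> = real_cond_exp M ?F (indicator B) \<omega> - M.prob B" for \<omega>
  define E where "E = essential_sup M (beta_family M X k)"
  have es: "is_essential_sup M (beta_family M X k) E"
    unfolding E_def by (rule beta_family_essential_sup[OF prob_M X_measurable])
  have Em[measurable]: "E \<in> borel_measurable M" using es unfolding is_essential_sup_def by (elim conjE)
  have le1: "AE \<omega> in M. \<bar>real_cond_exp M ?F (indicator D) \<omega> - M.prob D\<bar> \<le> 1" if "D \<in> sets M" for D
  proof -
    have int: "integrable M (indicator D :: 'w \<Rightarrow> real)"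
      using that by (intro integrable_real_indicator) (auto simp: less_top[symmetric])
    have "AE \<omega> in M. real_cond_exp M ?F (indicator D) \<omega> \<ge> 0"
      by (rule real_cond_exp_ge_c[OF int]) auto
    moreover have "AE \<omega> in M. real_cond_exp M ?F (indicator D) \<omega> \<le> 1"
      by (rule real_cond_exp_le_c[OF int]) (auto simp: indicator_def)
    ultimately show ?thesis
    proof eventually_elim
      case (elim \<omega>)
      then show ?case using M.prob_le_1[of D] measure_nonneg[of M D] by linarith
    qed
  qed
  \<comment> \<open>The constant 1 dominates the whole family, so minimality bounds the essential
    supremum by 1 and makes it integrable.\<close>
  have E1: "AE \<omega> in M. E \<omega> \<le> 1"
  proof -
    have "AE \<omega> in M. g \<omega> \<le> 1" if gB: "g \<in> beta_family M X k" for g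
    proof -
      obtain D where g: "g = (\<lambda>\<omega>. \<bar>real_cond_exp M ?F (indicator D) \<omega> - M.prob D\<bar>)"
        and D: "D \<in> sets (sigma_gen M X {int k + 1..})"
        using gB unfolding beta_family_def by (rule imageE)
      have "D \<in> sets M" using D subalgebra_sigma_gen[of "{int k + 1..}"] by (auto simp: subalgebra_def)
      then show ?thesis unfolding g by (rule le1)
    qed
    moreover have "\<forall>h\<in>borel_measurable M. (\<forall>f\<in>beta_family M X k. AE \<omega> in M. f \<omega> \<le> h \<omega>) \<longrightarrow> (AE \<omega> in M. E \<omega> \<le> h \<omega>)"
      using es unfolding is_essential_sup_def by (elim conjE)
    from this[rule_format, of "\<lambda>_. 1"] have "(\<And>g. g \<in> beta_family M X k \<Longrightarrow> AE \<omega> in M. g \<omega> \<le> 1) \<Longrightarrow> AE \<omega> in M. E \<omega> \<le> 1"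
      by simp
    ultimately show ?thesis by blast
  qed
  have hE: "AE \<omega> in M. \<bar>h \<omega>\<bar> \<le> E \<omega>"
  proof -
    have "\<forall>f\<in>beta_family M X k. AE \<omega> in M. f \<omega> \<le> E \<omega>" using es unfolding is_essential_sup_def by (elim conjE)
    moreover have "(\<lambda>\<omega>. \<bar>h \<omega>\<bar>) \<in> beta_family M X k" unfolding beta_family_def h_def using B by (rule imageI)
    ultimately show ?thesis by (rule bspec)
  qed
  have intE: "integrable M E"
    by (rule M.integrable_const_bound[where B=1]) (use E1 hE in \<open>auto elim: eventually_elim2\<close>)
  have hm[measurable]: "h \<in> borel_measurable M" unfolding h_def by measurable
  have inth: "integrable M h" by (rule Bochner_Integration.integrable_bound[OF intE hm]) (use hE in \<open>auto elim: eventually_mono\<close>)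
  have intf: "integrable M f" by (rule M.integrable_const_bound[where B=1]) (use f in auto)
  have intfB: "integrable M (\<lambda>\<omega>. f \<omega> * indicator B \<omega>)"
    by (rule M.integrable_const_bound[where B=1]) (use f in \<open>auto simp: indicator_def\<close>)
  have ce: "integrable M (\<lambda>\<omega>. f \<omega> * real_cond_exp M ?F (indicator B) \<omega>)"
    "(\<integral>\<omega>. f \<omega> * real_cond_exp M ?F (indicator B) \<omega> \<partial>M) = (\<integral>\<omega>. f \<omega> * indicator B \<omega> \<partial>M)"
    by (rule real_cond_exp_intg[OF intfB f(1)], simp)+
  have "(\<integral>\<omega>. f \<omega> * indicator B \<omega> \<partial>M) - (\<integral>\<omega>. f \<omega> \<partial>M) * M.prob B = (\<integral>\<omega>. f \<omega> * h \<omega> \<partial>M)"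
    unfolding h_def right_diff_distrib using ce intf by simp
  also have "\<bar>\<dots>\<bar> \<le> (\<integral>\<omega>. \<bar>f \<omega> * h \<omega>\<bar> \<partial>M)" by (rule integral_abs_bound)
  also have "\<dots> \<le> (\<integral>\<omega>. E \<omega> \<partial>M)"
  proof (rule integral_mono_AE[OF _ intE])
    show ae: "AE \<omega> in M. \<bar>f \<omega> * h \<omega>\<bar> \<le> E \<omega>"
      using hE
    proof (rule eventually_mono)
      fix \<omega> assume "\<bar>h \<omega>\<bar> \<le> E \<omega>"
      moreover have "\<bar>f \<omega> * h \<omega>\<bar> \<le> 1 * \<bar>h \<omega>\<bar>" unfolding abs_mult using f(2)[of \<omega>] by (intro mult_right_mono) auto
      ultimately show "\<bar>f \<omega> * h \<omega>\<bar> \<le> E \<omega>" by linarith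
    qed
    show "integrable M (\<lambda>\<omega>. \<bar>f \<omega> * h \<omega>\<bar>)"
      by (rule Bochner_Integration.integrable_bound[OF intE]) (use ae in \<open>auto elim: eventually_mono\<close>)
  qed
  finally show ?thesis by (simp add: beta_mixing_def E_def)
qed

lemma beta_mixing_unit:
  assumes f: "f \<in> borel_measurable (sigma_gen M X {..0})" "\<And>\<omega>. \<bar>f \<omega>\<bar> \<le> 1"
    and g: "g \<in> borel_measurable (sigma_gen M X {int k + 1..})" "\<And>\<omega>. 0 \<le> g \<omega>" "\<And>\<omega>. g \<omega> \<le> 1"
  shows "\<bar>(\<integral>\<omega>. f \<omega> * g \<omega> \<partial>M) - (\<integral>\<omega>. f \<omega> \<partial>M) * (\<integral>\<omega>. g \<omega> \<partial>M)\<bar> \<le> beta_mixing M X k"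
proof -
  have fM[measurable]: "f \<in> borel_measurable M" by (rule measurable_from_subalg[OF subalgebra_sigma_gen f(1)])
  have gM[measurable]: "g \<in> borel_measurable M" by (rule measurable_from_subalg[OF subalgebra_sigma_gen g(1)])
  have intf: "integrable M f" by (rule M.integrable_const_bound[where B=1]) (use f in auto)
  have intg: "integrable M g" by (rule M.integrable_const_bound[where B=1]) (use g in auto)
  have intfg: "integrable M (\<lambda>\<omega>. f \<omega> * g \<omega>)"
    by (rule M.integrable_const_bound[where B=1]) (use f g in \<open>auto simp: abs_mult intro!: mult_le_one\<close>)
  have f1: "\<bar>\<integral>\<omega>. f \<omega> \<partial>M\<bar> \<le> 1"
  proof -
    have "\<bar>\<integral>\<omega>. f \<omega> \<partial>M\<bar> \<le> (\<integral>\<omega>. \<bar>f \<omega>\<bar> \<partial>M)" by (rule integral_abs_bound)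
    also have "\<dots> \<le> (\<integral>\<omega>. 1 \<partial>M)" using intf f by (intro integral_mono) auto
    finally show ?thesis by (simp add: M.prob_space)
  qed
  \<comment> \<open>Each of the two terms changes by at most \<open>1 / real m\<close> when
    \<open>g\<close> is replaced by its staircase \<open>G\<close>.\<close>
  have step: "\<bar>(\<integral>\<omega>. f \<omega> * g \<omega> \<partial>M) - (\<integral>\<omega>. f \<omega> \<partial>M) * (\<integral>\<omega>. g \<omega> \<partial>M)\<bar> \<le> beta_mixing M X k + 2 * (1 / real m)"
    if m: "m > 0" for m :: nat
  proof -
    define D where "D j = {\<omega> \<in> space M. real (Suc j) \<le> real m * g \<omega>}" for j
    have D: "D j \<in> sets (sigma_gen M X {int k + 1..})" for j
    proof -
      have "{\<omega> \<in> space (sigma_gen M X {int k + 1..}). real (Suc j) \<le> real m * g \<omega>} \<in> sets (sigma_gen M X {int k + 1..})"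
        using g(1) by measurable
      then show ?thesis by (simp add: D_def space_sigma_gen)
    qed
    have DM[measurable]: "D j \<in> sets M" for j unfolding D_def by measurable
    have indD: "integrable M (\<lambda>\<omega>. indicator (D j) \<omega> :: real)" for j
      by (rule M.integrable_const_bound[where B=1]) auto
    have Dint: "(\<integral>\<omega>. indicator (D j) \<omega> \<partial>M) = M.prob (D j)" for j by simp
    define G where "G \<omega> = (\<Sum>j<m. indicator (D j) \<omega>) / real m" for \<omega>
    have Gm[measurable]: "G \<in> borel_measurable M" unfolding G_def by measurable
    have gG: "\<bar>g \<omega> - G \<omega>\<bar> \<le> 1 / real m" if "\<omega> \<in> space M" for \<omega>
    proof -
      have "G \<omega> = (\<Sum>j<m. of_bool (real (Suc j) \<le> real m * g \<omega>)) / real m"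
        unfolding G_def using that by (intro arg_cong2[where f="(/)"] sum.cong refl) (simp add: D_def indicator_def)
      then show ?thesis using staircase[OF g(2,3) m] by simp
    qed
    have fD: "integrable M (\<lambda>\<omega>. f \<omega> * indicator (D j) \<omega>)" for j
      by (rule M.integrable_const_bound[where B=1]) (use f in \<open>auto simp: indicator_def\<close>)
    have G1: "(\<integral>\<omega>. f \<omega> * G \<omega> \<partial>M) = (\<Sum>j<m. \<integral>\<omega>. f \<omega> * indicator (D j) \<omega> \<partial>M) / real m"
      unfolding G_def times_divide_eq_right sum_distrib_left integral_divide_zero
      by (subst Bochner_Integration.integral_sum) (simp_all only: fD)
    have G2: "(\<integral>\<omega>. G \<omega> \<partial>M) = (\<Sum>j<m. M.prob (D j)) / real m"
    proof -
      have "(\<integral>\<omega>. (\<Sum>j<m. indicat_real (D j) \<omega>) \<partial>M) = (\<Sum>j<m. \<integral>\<omega>. indicat_real (D j) \<omega> \<partial>M)"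
        by (rule Bochner_Integration.integral_sum) (rule indD)
      then show ?thesis unfolding G_def integral_divide_zero by (simp only: Dint)
    qed
    have "(\<integral>\<omega>. f \<omega> * G \<omega> \<partial>M) - (\<integral>\<omega>. f \<omega> \<partial>M) * (\<integral>\<omega>. G \<omega> \<partial>M) =
        (\<Sum>j<m. (\<integral>\<omega>. f \<omega> * indicator (D j) \<omega> \<partial>M) - (\<integral>\<omega>. f \<omega> \<partial>M) * M.prob (D j)) / real m"
      unfolding G1 G2 by (simp add: sum_subtractf sum_distrib_left diff_divide_distrib)
    also have "\<bar>\<dots>\<bar> \<le> (\<Sum>j<m. beta_mixing M X k) / real m"
      unfolding abs_divide using beta_mixing_indicator[OF f D]
      by (simp only: abs_of_nat) (intro divide_right_mono order_trans[OF sum_abs] sum_mono, auto)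
    also have "\<dots> = beta_mixing M X k" using m by simp
    finally have cG: "\<bar>(\<integral>\<omega>. f \<omega> * G \<omega> \<partial>M) - (\<integral>\<omega>. f \<omega> \<partial>M) * (\<integral>\<omega>. G \<omega> \<partial>M)\<bar> \<le> beta_mixing M X k" .
    have intG: "integrable M G" unfolding G_def[abs_def]
      by (intro integrable_divide_zero Bochner_Integration.integrable_sum indD)
    have intfG: "integrable M (\<lambda>\<omega>. f \<omega> * G \<omega>)" unfolding G_def times_divide_eq_right sum_distrib_left
      by (intro integrable_divide_zero Bochner_Integration.integrable_sum fD)
    have dg: "\<bar>(\<integral>\<omega>. g \<omega> \<partial>M) - (\<integral>\<omega>. G \<omega> \<partial>M)\<bar> \<le> 1 / real m"
    proof -
      have "\<bar>(\<integral>\<omega>. g \<omega> \<partial>M) - (\<integral>\<omega>. G \<omega> \<partial>M)\<bar> = \<bar>\<integral>\<omega>. g \<omega> - G \<omega> \<partial>M\<bar>" using intg intG by simp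
      also have "\<dots> \<le> (\<integral>\<omega>. \<bar>g \<omega> - G \<omega>\<bar> \<partial>M)" by (rule integral_abs_bound)
      also have "\<dots> \<le> (\<integral>\<omega>. 1 / real m \<partial>M)" using intg intG gG by (intro integral_mono) auto
      finally show ?thesis by (simp add: M.prob_space)
    qed
    have dfg: "\<bar>(\<integral>\<omega>. f \<omega> * g \<omega> \<partial>M) - (\<integral>\<omega>. f \<omega> * G \<omega> \<partial>M)\<bar> \<le> 1 / real m"
    proof -
      have "\<bar>(\<integral>\<omega>. f \<omega> * g \<omega> \<partial>M) - (\<integral>\<omega>. f \<omega> * G \<omega> \<partial>M)\<bar> = \<bar>\<integral>\<omega>. f \<omega> * g \<omega> - f \<omega> * G \<omega> \<partial>M\<bar>" using intfg intfG by simp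
      also have "\<dots> \<le> (\<integral>\<omega>. \<bar>f \<omega> * g \<omega> - f \<omega> * G \<omega>\<bar> \<partial>M)" by (rule integral_abs_bound)
      also have "\<dots> \<le> (\<integral>\<omega>. 1 / real m \<partial>M)"
      proof (rule integral_mono)
        fix \<omega> assume "\<omega> \<in> space M"
        then have "\<bar>f \<omega>\<bar> * \<bar>g \<omega> - G \<omega>\<bar> \<le> 1 * (1 / real m)" using f gG by (intro mult_mono) auto
        then show "\<bar>f \<omega> * g \<omega> - f \<omega> * G \<omega>\<bar> \<le> 1 / real m" by (simp add: abs_mult flip: right_diff_distrib)
      qed (use intfg intfG in auto)
      finally show ?thesis by (simp add: M.prob_space)
    qed
    have "\<bar>(\<integral>\<omega>. f \<omega> \<partial>M) * ((\<integral>\<omega>. g \<omega> \<partial>M) - (\<integral>\<omega>. G \<omega> \<partial>M))\<bar> \<le> 1 * (1 / real m)"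
      unfolding abs_mult using f1 dg by (intro mult_mono) auto
    then show ?thesis using cG dfg by (simp add: right_diff_distrib)
  qed
  have "(\<lambda>m. beta_mixing M X k + 2 * (1 / real m)) \<longlonglongrightarrow> beta_mixing M X k + 2 * 0"
    by (intro tendsto_intros lim_1_over_n)
  then show ?thesis
    by (intro tendsto_lowerbound[where F=sequentially and f="\<lambda>m. beta_mixing M X k + 2 * (1 / real m)"])
      (use step in \<open>auto intro!: eventually_sequentiallyI[of 1]\<close>)
qed

lemma beta_mixing_nonneg: "0 \<le> beta_mixing M X k"
  by (rule order_trans[OF abs_ge_zero beta_mixing_unit[of "\<lambda>_. 0" "\<lambda>_. 0"]]) (rule borel_measurable_const | simp only: abs_zero zero_le_one order_refl)+

text \<open>The affine map onto \<open>[0, 1]\<close> halves the covariance, which accounts for the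
  factor 2.\<close>

lemma beta_mixing_real:
  assumes f: "f \<in> borel_measurable (sigma_gen M X {..0})" "\<And>\<omega>. \<bar>f \<omega>\<bar> \<le> 1"
    and g: "g \<in> borel_measurable (sigma_gen M X {int k + 1..})" "\<And>\<omega>. \<bar>g \<omega>\<bar> \<le> 1"
  shows "\<bar>(\<integral>\<omega>. f \<omega> * g \<omega> \<partial>M) - (\<integral>\<omega>. f \<omega> \<partial>M) * (\<integral>\<omega>. g \<omega> \<partial>M)\<bar> \<le> 2 * beta_mixing M X k"
proof -
  have fM[measurable]: "f \<in> borel_measurable M" by (rule measurable_from_subalg[OF subalgebra_sigma_gen f(1)])
  have gM[measurable]: "g \<in> borel_measurable M" by (rule measurable_from_subalg[OF subalgebra_sigma_gen g(1)])
  have intf: "integrable M f" by (rule M.integrable_const_bound[where B=1]) (use f in auto)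
  have intg: "integrable M g" by (rule M.integrable_const_bound[where B=1]) (use g in auto)
  have intfg: "integrable M (\<lambda>\<omega>. f \<omega> * g \<omega>)"
    by (rule M.integrable_const_bound[where B=1]) (use f g in \<open>auto simp: abs_mult intro!: mult_le_one\<close>)
  define h where "h \<omega> = (g \<omega> + 1) / 2" for \<omega>
  have "\<bar>(\<integral>\<omega>. f \<omega> * h \<omega> \<partial>M) - (\<integral>\<omega>. f \<omega> \<partial>M) * (\<integral>\<omega>. h \<omega> \<partial>M)\<bar> \<le> beta_mixing M X k"
  proof (rule beta_mixing_unit[OF f])
    show "h \<in> borel_measurable (sigma_gen M X {int k + 1..})" unfolding h_def using g(1) by measurable
    show "0 \<le> h \<omega>" "h \<omega> \<le> 1" for \<omega> using g(2)[of \<omega>] by (auto simp: h_def abs_le_iff)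
  qed
  moreover have "(\<integral>\<omega>. f \<omega> * h \<omega> \<partial>M) = ((\<integral>\<omega>. f \<omega> * g \<omega> \<partial>M) + (\<integral>\<omega>. f \<omega> \<partial>M)) / 2"
    using intfg intf by (simp add: h_def distrib_left)
  moreover have "(\<integral>\<omega>. h \<omega> \<partial>M) = ((\<integral>\<omega>. g \<omega> \<partial>M) + 1) / 2"
    using intg by (simp add: h_def M.prob_space)
  ultimately have "\<bar>((\<integral>\<omega>. f \<omega> * g \<omega> \<partial>M) - (\<integral>\<omega>. f \<omega> \<partial>M) * (\<integral>\<omega>. g \<omega> \<partial>M)) / 2\<bar> \<le> beta_mixing M X k"
    by (simp add: field_simps)
  then show ?thesis by simp
qed

text \<open>Real and imaginary part consist of two real covariances each, and each of the four is at
  most \<open>2 * beta_mixing M X k\<close>.\<close>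

lemma beta_mixing_complex:
  fixes f g :: "'w \<Rightarrow> complex"
  assumes f: "f \<in> borel_measurable (sigma_gen M X {..0})" "\<And>\<omega>. norm (f \<omega>) \<le> 1"
    and g: "g \<in> borel_measurable (sigma_gen M X {int k + 1..})" "\<And>\<omega>. norm (g \<omega>) \<le> 1"
  shows "norm ((\<integral>\<omega>. f \<omega> * g \<omega> \<partial>M) - (\<integral>\<omega>. f \<omega> \<partial>M) * (\<integral>\<omega>. g \<omega> \<partial>M)) \<le> 8 * beta_mixing M X k"
proof -
  have fM[measurable]: "f \<in> borel_measurable M" by (rule measurable_from_subalg[OF subalgebra_sigma_gen f(1)])
  have gM[measurable]: "g \<in> borel_measurable M" by (rule measurable_from_subalg[OF subalgebra_sigma_gen g(1)])
  have intf: "integrable M f" by (rule M.integrable_const_bound[where B=1]) (use f in auto)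
  have intg: "integrable M g" by (rule M.integrable_const_bound[where B=1]) (use g in auto)
  have intfg: "integrable M (\<lambda>\<omega>. f \<omega> * g \<omega>)"
    by (rule M.integrable_const_bound[where B=1]) (use f g in \<open>auto simp: norm_mult intro!: mult_le_one\<close>)
  define D where "D a b = (\<integral>\<omega>. a \<omega> * b \<omega> \<partial>M) - (\<integral>\<omega>. a \<omega> \<partial>M) * (\<integral>\<omega>. b \<omega> \<partial>M)" for a b :: "'w \<Rightarrow> real"
  have fr: "(\<lambda>\<omega>. Re (f \<omega>)) \<in> borel_measurable (sigma_gen M X {..0})" "(\<lambda>\<omega>. Im (f \<omega>)) \<in> borel_measurable (sigma_gen M X {..0})"
    "(\<lambda>\<omega>. Re (g \<omega>)) \<in> borel_measurable (sigma_gen M X {int k + 1..})" "(\<lambda>\<omega>. Im (g \<omega>)) \<in> borel_measurable (sigma_gen M X {int k + 1..})"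
    using f(1) g(1) by measurable
  have b: "\<bar>Re (f \<omega>)\<bar> \<le> 1" "\<bar>Im (f \<omega>)\<bar> \<le> 1" "\<bar>Re (g \<omega>)\<bar> \<le> 1" "\<bar>Im (g \<omega>)\<bar> \<le> 1" for \<omega>
    using f(2)[of \<omega>] g(2)[of \<omega>] abs_Re_le_cmod[of "f \<omega>"] abs_Im_le_cmod[of "f \<omega>"] abs_Re_le_cmod[of "g \<omega>"] abs_Im_le_cmod[of "g \<omega>"]
    by linarith+
  have ip: "integrable M (\<lambda>\<omega>. Re (f \<omega>) * Re (g \<omega>))" "integrable M (\<lambda>\<omega>. Re (f \<omega>) * Im (g \<omega>))"
     "integrable M (\<lambda>\<omega>. Im (f \<omega>) * Re (g \<omega>))" "integrable M (\<lambda>\<omega>. Im (f \<omega>) * Im (g \<omega>))"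
    by (rule M.integrable_const_bound[where B=1]; use b in \<open>auto simp: abs_mult intro!: mult_le_one\<close>)+
  let ?E = "(\<integral>\<omega>. f \<omega> * g \<omega> \<partial>M) - (\<integral>\<omega>. f \<omega> \<partial>M) * (\<integral>\<omega>. g \<omega> \<partial>M)"
  have re: "Re ?E = D (\<lambda>\<omega>. Re (f \<omega>)) (\<lambda>\<omega>. Re (g \<omega>)) - D (\<lambda>\<omega>. Im (f \<omega>)) (\<lambda>\<omega>. Im (g \<omega>))"
    using intf intg intfg ip by (simp add: D_def integral_Re[symmetric] integral_Im[symmetric] del: integral_Re integral_Im)
  have im: "Im ?E = D (\<lambda>\<omega>. Re (f \<omega>)) (\<lambda>\<omega>. Im (g \<omega>)) + D (\<lambda>\<omega>. Im (f \<omega>)) (\<lambda>\<omega>. Re (g \<omega>))"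
    using intf intg intfg ip by (simp add: D_def integral_Re[symmetric] integral_Im[symmetric] del: integral_Re integral_Im)
  have "\<bar>D (\<lambda>\<omega>. Re (f \<omega>)) (\<lambda>\<omega>. Re (g \<omega>))\<bar> \<le> 2 * beta_mixing M X k"
    "\<bar>D (\<lambda>\<omega>. Im (f \<omega>)) (\<lambda>\<omega>. Im (g \<omega>))\<bar> \<le> 2 * beta_mixing M X k"
    "\<bar>D (\<lambda>\<omega>. Re (f \<omega>)) (\<lambda>\<omega>. Im (g \<omega>))\<bar> \<le> 2 * beta_mixing M X k"
    "\<bar>D (\<lambda>\<omega>. Im (f \<omega>)) (\<lambda>\<omega>. Re (g \<omega>))\<bar> \<le> 2 * beta_mixing M X k"
    unfolding D_def by (rule beta_mixing_real; fact fr b)+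
  then show ?thesis using cmod_le[of ?E] unfolding re im by linarith
qed

end

section \<open>Elementary estimates for the block argument\<close>

lemma double_sum_abs_diff:
  fixes f :: "nat \<Rightarrow> real"
  shows "(\<Sum>i<k. \<Sum>j<k. f (nat \<bar>int i - int j\<bar>)) = real k * f 0 + 2 * (\<Sum>j=1..<k. real (k - j) * f j)"
proof (induction k)
  case (Suc k)
  \<comment> \<open>The induction adds one row and one column to the double sum, each running once
    through the distances 1 to \<open>k\<close>, and one diagonal term.\<close>
  have a: "(\<Sum>i<k. f (nat \<bar>int i - int k\<bar>)) = (\<Sum>j=1..<Suc k. f j)"
  proof -
    have "(\<Sum>i<k. f (nat \<bar>int i - int k\<bar>)) = (\<Sum>i<k. f (k - i))"
      by (intro sum.cong refl arg_cong[where f=f]) auto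
    also have "\<dots> = (\<Sum>j=1..<Suc k. f j)"
      by (rule sum.reindex_bij_witness[where i="\<lambda>j. k - j" and j="\<lambda>i. k - i"]) auto
    finally show ?thesis .
  qed
  have b: "(\<Sum>j<k. f (nat \<bar>int k - int j\<bar>)) = (\<Sum>j=1..<Suc k. f j)"
    unfolding a[symmetric] by (simp add: abs_minus_commute)
  have "(\<Sum>i<Suc k. \<Sum>j<Suc k. f (nat \<bar>int i - int j\<bar>)) =
     (\<Sum>i<k. \<Sum>j<k. f (nat \<bar>int i - int j\<bar>)) + (\<Sum>i<k. f (nat \<bar>int i - int k\<bar>)) + (\<Sum>j<k. f (nat \<bar>int k - int j\<bar>)) + f 0"
    by (simp add: sum.distrib)
  also have "\<dots> = real k * f 0 + 2 * (\<Sum>j=1..<k. real (k - j) * f j) + 2 * (\<Sum>j=1..<Suc k. f j) + f 0"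
    unfolding Suc.IH a b by simp
  finally have c: "(\<Sum>i<Suc k. \<Sum>j<Suc k. f (nat \<bar>int i - int j\<bar>)) =
     real k * f 0 + 2 * (\<Sum>j=1..<k. real (k - j) * f j) + 2 * (\<Sum>j=1..<Suc k. f j) + f 0" .
  have "(\<Sum>j=1..<k. real (k - j) * f j) = (\<Sum>j=1..<Suc k. real (k - j) * f j)"
    by (cases k) (auto simp: sum.atLeastLessThan_Suc)
  moreover have "(\<Sum>j=1..<Suc k. real (Suc k - j) * f j) = (\<Sum>j=1..<Suc k. real (k - j) * f j + f j)"
    by (intro sum.cong refl) (auto simp: Suc_diff_le distrib_right)
  ultimately have d: "(\<Sum>j=1..<Suc k. real (Suc k - j) * f j) = (\<Sum>j=1..<k. real (k - j) * f j) + (\<Sum>j=1..<Suc k. f j)"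
    by (simp only: sum.distrib)
  show ?case unfolding c d by (simp add: distrib_right)
qed simp

text \<open>Dominated convergence for sums whose dominating sequences vary with \<open>n\<close>:
  convergence of the terms and of the total sums forces the tails to be small for all large
  \<open>n\<close>. This is exactly the kind of information that (BC) provides.\<close>

lemma tendsto_sum_dominated:
  fixes x e :: "nat \<Rightarrow> nat \<Rightarrow> real"
  assumes x: "\<And>j. (\<lambda>n. x n j) \<longlonglongrightarrow> y j" and e: "\<And>j. (\<lambda>n. e n j) \<longlonglongrightarrow> f j"
    and dom: "\<forall>\<^sub>F n in sequentially. \<forall>j<r n. \<bar>x n j\<bar> \<le> e n j"
    and sums: "summable f" "(\<lambda>n. \<Sum>j<r n. e n j) \<longlonglongrightarrow> suminf f"
    and r: "filterlim r at_top sequentially"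
    and k: "filterlim k at_top sequentially" "\<forall>\<^sub>F n in sequentially. k n \<le> r n"
  shows "summable y" "(\<lambda>n. \<Sum>j<k n. x n j) \<longlonglongrightarrow> suminf y"
proof -
  have yf: "\<bar>y j\<bar> \<le> f j" for j
  proof (rule tendsto_le[OF _ e tendsto_rabs[OF x]])
    have "\<forall>\<^sub>F n in sequentially. Suc j \<le> r n" using r unfolding filterlim_at_top by blast
    with dom show "\<forall>\<^sub>F n in sequentially. \<bar>x n j\<bar> \<le> e n j" by eventually_elim auto
  qed simp
  show sy: "summable y"
    by (rule summable_comparison_test'[OF sums(1), of 0]) (use yf in auto)
  show "(\<lambda>n. \<Sum>j<k n. x n j) \<longlonglongrightarrow> suminf y"
  proof (rule tendstoI)
    fix \<epsilon> :: real assume \<epsilon>: "\<epsilon> > 0"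
    have "(\<lambda>J. suminf f - (\<Sum>j<J. f j)) \<longlonglongrightarrow> suminf f - suminf f"
      by (intro tendsto_intros summable_LIMSEQ sums)
    then have "\<forall>\<^sub>F J in sequentially. suminf f - (\<Sum>j<J. f j) < \<epsilon> / 4"
      by (rule order_tendstoD) (use \<epsilon> in simp)
    then obtain J where J: "suminf f - (\<Sum>j<J. f j) < \<epsilon> / 4"
      by (auto simp: eventually_sequentially)
    have ytail: "\<bar>suminf y - (\<Sum>j<J. y j)\<bar> < \<epsilon> / 4"
    proof -
      have s: "summable (\<lambda>j. \<bar>y (j + J)\<bar>)"
        by (rule summable_comparison_test'[OF summable_ignore_initial_segment[OF sums(1), of J], of 0]) (use yf in auto)
      have "\<bar>suminf y - (\<Sum>j<J. y j)\<bar> = \<bar>\<Sum>j. y (j + J)\<bar>" by (simp add: suminf_minus_initial_segment[OF sy])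
      also have "\<dots> \<le> (\<Sum>j. \<bar>y (j + J)\<bar>)" by (rule summable_rabs[OF s])
      also have "\<dots> \<le> (\<Sum>j. f (j + J))"
        by (rule suminf_le[OF _ s summable_ignore_initial_segment[OF sums(1)]]) (rule yf)
      also have "\<dots> = suminf f - (\<Sum>j<J. f j)" by (simp add: suminf_minus_initial_segment[OF sums(1)])
      finally show ?thesis using J by linarith
    qed
    have "(\<lambda>n. (\<Sum>j<r n. e n j) - (\<Sum>j<J. e n j)) \<longlonglongrightarrow> suminf f - (\<Sum>j<J. f j)"
      by (intro tendsto_intros sums e)
    then have ev1: "\<forall>\<^sub>F n in sequentially. (\<Sum>j<r n. e n j) - (\<Sum>j<J. e n j) < \<epsilon> / 4"
      using J by (rule order_tendstoD)
    have "(\<lambda>n. \<Sum>j<J. x n j) \<longlonglongrightarrow> (\<Sum>j<J. y j)" by (intro tendsto_sum x)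
    then have ev2: "\<forall>\<^sub>F n in sequentially. dist (\<Sum>j<J. x n j) (\<Sum>j<J. y j) < \<epsilon> / 4"
      by (rule tendstoD) (use \<epsilon> in simp)
    have ev3: "\<forall>\<^sub>F n in sequentially. J \<le> k n" using k(1) by (simp add: filterlim_at_top)
    show "\<forall>\<^sub>F n in sequentially. dist (\<Sum>j<k n. x n j) (suminf y) < \<epsilon>"
      using ev1 ev2 ev3 k(2) dom
    proof eventually_elim
      case (elim n)
      have sp: "(\<Sum>j<b. g j) = (\<Sum>j<J. g j) + (\<Sum>j=J..<b. g j)" if "J \<le> b" for b and g :: "nat \<Rightarrow> real"
        using that sum.atLeastLessThan_concat[of 0 J b g] by (simp add: atLeast0LessThan)
      have "\<bar>\<Sum>j=J..<k n. x n j\<bar> \<le> (\<Sum>j=J..<k n. \<bar>x n j\<bar>)" by (rule sum_abs)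
      also have "\<dots> \<le> (\<Sum>j=J..<k n. e n j)" using elim by (intro sum_mono) auto
      also have "\<dots> \<le> (\<Sum>j=J..<r n. e n j)"
      proof (rule sum_mono2)
        show "0 \<le> e n b" if "b \<in> {J..<r n} - {J..<k n}" for b
          using elim(5) that by (meson DiffD1 abs_ge_zero atLeastLessThan_iff order_trans)
      qed (use elim in auto)
      also have "\<dots> < \<epsilon> / 4" using elim sp[of "r n" "e n"] by linarith
      finally show ?case using ytail elim sp[of "k n" "x n"] unfolding dist_real_def by linarith
    qed
  qed
qed

lemma exp_minus_quadratic:
  assumes "0 \<le> (y::real)" shows "\<bar>exp (- y) - (1 - y)\<bar> \<le> y\<^sup>2"
proof -
  have "1 - y \<le> exp (- y)" using exp_ge_add_one_self[of "- y"] by simp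
  moreover have "exp (- y) \<le> 1 - y + y\<^sup>2"
  proof -
    have "exp (- y) \<le> 1 / (1 + y)"
      using exp_ge_add_one_self[of y] assms by (simp add: exp_minus inverse_eq_divide frac_le)
    also have "\<dots> \<le> 1 - y + y\<^sup>2"
    proof -
      have "1 \<le> (1 - y + y\<^sup>2) * (1 + y)"
        using assms by (simp add: algebra_simps power2_eq_square)
      then show ?thesis using assms by (simp add: pos_divide_le_eq)
    qed
    finally show ?thesis .
  qed
  ultimately show ?thesis by simp
qed

lemma (in prob_space) expectation_abs_le_sqrt:
  fixes f :: "'a \<Rightarrow> real"
  assumes "integrable M f" "integrable M (\<lambda>x. (f x)\<^sup>2)"
  shows "expectation (\<lambda>x. \<bar>f x\<bar>) \<le> sqrt (expectation (\<lambda>x. (f x)\<^sup>2))"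
proof -
  have i: "integrable M (\<lambda>x. \<bar>f x\<bar>)" "integrable M (\<lambda>x. \<bar>f x\<bar>\<^sup>2)" using assms by auto
  have "(expectation (\<lambda>x. \<bar>f x\<bar>))\<^sup>2 \<le> expectation (\<lambda>x. (f x)\<^sup>2)"
    using variance_positive[of "\<lambda>x. \<bar>f x\<bar>"] variance_eq[OF i] by simp
  then show ?thesis by (simp add: real_le_rsqrt)
qed

lemma (in prob_space) norm_expectation_iexp_diff:
  fixes f g :: "'a \<Rightarrow> real"
  assumes [measurable]: "f \<in> borel_measurable M" "g \<in> borel_measurable M"
  shows "norm ((CLINT x|M. iexp (f x + g x)) - (CLINT x|M. iexp (f x))) \<le> expectation (\<lambda>x. norm (iexp (g x) - 1))"
proof -
  have i: "integrable M (\<lambda>x. iexp (f x + g x))" "integrable M (\<lambda>x. iexp (f x))"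
    by (rule integrable_const_bound[where B=1]; simp)+
  have "norm ((CLINT x|M. iexp (f x + g x)) - (CLINT x|M. iexp (f x))) = norm (CLINT x|M. iexp (f x + g x) - iexp (f x))"
    using i by simp
  also have "\<dots> \<le> expectation (\<lambda>x. norm (iexp (f x + g x) - iexp (f x)))" by (rule integral_norm_bound)
  also have "(\<lambda>x. norm (iexp (f x + g x) - iexp (f x))) = (\<lambda>x. norm (iexp (g x) - 1))"
  proof
    fix x
    have "iexp (f x + g x) - iexp (f x) = iexp (f x) * (iexp (g x) - 1)"
      by (simp add: distrib_left exp_add right_diff_distrib)
    then show "norm (iexp (f x + g x) - iexp (f x)) = norm (iexp (g x) - 1)" by (simp add: norm_mult)
  qed
  finally show ?thesis .
qed

lemma norm_iexp_minus_1_le: "norm (iexp x - 1) \<le> \<bar>x\<bar>" and norm_iexp_minus_1_le_2: "norm (iexp x - 1) \<le> 2"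
  using iexp_approx1[of x 0] norm_triangle_ineq4[of "iexp x" 1] by auto

lemma norm_iexp_minus_1_sq: "(norm (iexp x - 1))\<^sup>2 = 2 - 2 * cos x"
proof -
  have "(norm (iexp x - 1))\<^sup>2 = (cos x - 1)\<^sup>2 + (sin x)\<^sup>2"
    by (simp add: cmod_power2 Re_exp Im_exp)
  also have "\<dots> = (sin x)\<^sup>2 + (cos x)\<^sup>2 + 1 - 2 * cos x" by (simp add: power2_eq_square algebra_simps)
  finally show ?thesis by simp
qed

text \<open>The squared modulus of \<open>iexp x - 1\<close> is \<open>2 - 2 * cos x\<close>.
  Convergence of a characteristic function to 1 therefore makes a summand negligible inside any
  other characteristic function, with no moment bound.\<close>

lemma (in prob_space) expectation_iexp_minus_1_le:
  fixes g :: "'a \<Rightarrow> real"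
  assumes [measurable]: "g \<in> borel_measurable M"
  shows "expectation (\<lambda>x. norm (iexp (g x) - 1)) \<le> sqrt (2 - 2 * Re (CLINT x|M. iexp (g x)))"
proof -
  have i: "integrable M (\<lambda>x. norm (iexp (g x) - 1))" "integrable M (\<lambda>x. (norm (iexp (g x) - 1))\<^sup>2)"
    "integrable M (\<lambda>x. iexp (g x))" "integrable M (\<lambda>x. cos (g x))"
  proof -
    show "integrable M (\<lambda>x. norm (iexp (g x) - 1))"
      by (rule integrable_const_bound[where B=2]) (simp_all add: norm_iexp_minus_1_le_2)
    show "integrable M (\<lambda>x. cos (g x))" by (rule integrable_const_bound[where B=1]) simp_all
    then show "integrable M (\<lambda>x. (norm (iexp (g x) - 1))\<^sup>2)" unfolding norm_iexp_minus_1_sq by simp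
    show "integrable M (\<lambda>x. iexp (g x))" by (rule integrable_const_bound[where B=1]) simp_all
  qed
  have "Re (CLINT x|M. iexp (g x)) = expectation (\<lambda>x. cos (g x))"
    using i(3) by (simp add: integral_Re[symmetric] Re_exp del: integral_Re)
  then have "expectation (\<lambda>x. (norm (iexp (g x) - 1))\<^sup>2) = 2 - 2 * Re (CLINT x|M. iexp (g x))"
    unfolding norm_iexp_minus_1_sq using i(4) by (simp add: prob_space)
  then show ?thesis using expectation_abs_le_sqrt[OF i(1,2)] by simp
qed

section \<open>Asymptotics of the number and length of blocks\<close>

context extremal_setting begin

lemma nv_pos: "n \<ge> 1 \<Longrightarrow> real n * v n > 0" using v_pos[of n] by simp

text \<open>The quotient of \<open>r n * v n\<close>, which vanishes, and \<open>n * v n\<close>,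
  which diverges.\<close>

lemma r_over_n: "(\<lambda>n. real (r n) / real n) \<longlonglongrightarrow> 0"
proof -
  have "(\<lambda>n. (real (r n) * v n) / (real n * v n)) \<longlonglongrightarrow> 0"
    by (rule real_tendsto_divide_at_top[OF S_facts(5,2)])
  then show ?thesis using v_pos by (simp add: less_imp_neq[THEN not_sym])
qed

lemma r_pos: "\<forall>\<^sub>F n in sequentially. r n \<ge> 1"
  using r_lim by (simp add: filterlim_at_top)

lemma l_over_r: "(\<lambda>n. real (l n) / real (r n)) \<longlonglongrightarrow> 0"
proof (rule smalloD_tendsto[OF S_facts(4)])
qed

lemma r_over_sqrt: "(\<lambda>n. real (r n) / sqrt (real n * v n)) \<longlonglongrightarrow> 0"
  by (rule smalloD_tendsto[OF S_facts(6)])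

lemma blocks_at_top: "filterlim (\<lambda>n. real (n div r n)) at_top sequentially"
proof -
  have "filterlim (\<lambda>n. inverse (real (r n) / real n)) at_top sequentially"
  proof (rule filterlim_inverse_at_top[OF r_over_n])
    show "\<forall>\<^sub>F n in sequentially. 0 < real (r n) / real n"
      using r_pos eventually_ge_at_top[of 1] by eventually_elim simp
  qed
  then have 1: "filterlim (\<lambda>n. (- 1) + inverse (real (r n) / real n)) at_top sequentially"
    by (rule filterlim_tendsto_add_at_top[OF tendsto_const])
  show ?thesis
  proof (rule filterlim_at_top_mono[OF 1])
    show "\<forall>\<^sub>F n in sequentially. (- 1) + inverse (real (r n) / real n) \<le> real (n div r n)"
      using r_pos
    proof eventually_elim
      case (elim n)
      have "n < (n div r n + 1) * r n"
        using elim dividend_less_div_times[of "r n" n] by (simp add: distrib_right)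
      then have "real n < real ((n div r n + 1) * r n)" by (simp only: of_nat_less_iff)
      then have "real n < (real (n div r n) + 1) * real (r n)" by (simp add: distrib_right)
      then show ?case using elim by (simp add: pos_divide_less_eq[symmetric])
    qed
  qed
qed

lemma blocks_ratio: "(\<lambda>n. real (n div r n) * real (r n) / real n) \<longlonglongrightarrow> 1"
proof (rule tendsto_sandwich[where f="\<lambda>n. 1 - real (r n) / real n" and h="\<lambda>_. 1"])
  have "real (n div r n) * real (r n) = real n - real (n mod r n)" for n
    by (metis add_diff_cancel_right' div_mult_mod_eq of_nat_add of_nat_mult)
  then have e: "real (n div r n) * real (r n) / real n = 1 - real (n mod r n) / real n" if "n \<ge> 1" for n
    using that by (simp add: field_simps)
  show "\<forall>\<^sub>F n in sequentially. 1 - real (r n) / real n \<le> real (n div r n) * real (r n) / real n"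
    using r_pos eventually_ge_at_top[of 1]
  proof eventually_elim
    case (elim n)
    have "real (n mod r n) \<le> real (r n)" using elim by (simp add: less_imp_le)
    then have "real (n mod r n) / real n \<le> real (r n) / real n" by (simp add: divide_right_mono)
    then show ?case using e[of n] elim by simp
  qed
  show "\<forall>\<^sub>F n in sequentially. real (n div r n) * real (r n) / real n \<le> 1"
    using eventually_ge_at_top[of 1] by eventually_elim (simp add: e)
  show "(\<lambda>n. 1 - real (r n) / real n) \<longlonglongrightarrow> 1" using tendsto_diff[OF tendsto_const r_over_n, of 1] by simp
qed simp

text \<open>The number of blocks is at most \<open>n / r n\<close>, so the rate of the mixing
  coefficients in (S) is just what makes the accumulated mixing error vanish.\<close>

lemma blocks_beta: "(\<lambda>n. real (n div r n) * beta_mixing M X (l n)) \<longlonglongrightarrow> 0"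
proof -
  have b: "(\<lambda>n. beta_mixing M X (l n) / (real (r n) / real n)) \<longlonglongrightarrow> 0"
    by (rule smalloD_tendsto[OF S_facts(7)])
  show ?thesis
  proof (rule tendsto_sandwich[OF _ _ tendsto_const b])
    show "\<forall>\<^sub>F n in sequentially. 0 \<le> real (n div r n) * beta_mixing M X (l n)"
      by (simp add: beta_mixing_nonneg)
    show "\<forall>\<^sub>F n in sequentially. real (n div r n) * beta_mixing M X (l n) \<le> beta_mixing M X (l n) / (real (r n) / real n)"
    proof (rule always_eventually, rule allI)
      fix n
      have "real (n div r n) \<le> real n / real (r n)" by (rule of_nat_div_le_of_nat)
      then have "real (n div r n) * beta_mixing M X (l n) \<le> (real n / real (r n)) * beta_mixing M X (l n)"
        by (intro mult_right_mono beta_mixing_nonneg)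
      then show "real (n div r n) * beta_mixing M X (l n) \<le> beta_mixing M X (l n) / (real (r n) / real n)"
        by (simp add: mult.commute)
    qed
  qed
qed

end

text \<open>The intended \<open>\<phi> n\<close> are linear combinations of the functionals \<open>g\<^sub>A\<close>, with coefficients
  depending on \<open>n\<close>.\<close>

locale cluster_array = extremal_setting N M M' \<alpha> X Y u s l r
  for N :: "real^'d \<Rightarrow> real" and M :: "'w measure" and M' :: "'y measure" and \<alpha> :: real
    and X :: "int \<Rightarrow> 'w \<Rightarrow> real^'d" and Y :: "int \<Rightarrow> 'y \<Rightarrow> real^'d"
    and u :: "nat \<Rightarrow> real" and s l r :: "nat \<Rightarrow> nat" +
  fixes \<phi> :: "nat \<Rightarrow> (int \<Rightarrow> real^'d) \<Rightarrow> real" and K :: real and \<gamma> :: "nat \<Rightarrow> real"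
  assumes phi_measurable [measurable]: "\<And>n. \<phi> n \<in> borel_measurable borel"
    and phi_window: "\<And>n t. (\<lambda>\<omega>. \<phi> n (\<lambda>h. X (h + t) \<omega>)) \<in> borel_measurable (sigma_gen M X {t - int (s n)..t + int (s n)})"
    and phi_bound: "\<And>n w. n \<ge> 1 \<Longrightarrow> \<bar>\<phi> n w\<bar> \<le> K * of_bool (N (w 0) > u n)"
    and K_nonneg: "0 \<le> K"
    and phi_covariance: "\<And>j. (\<lambda>n. (\<integral>\<omega>. \<phi> n (XP \<omega>) * \<phi> n (\<lambda>h. X (h + int j) \<omega>) \<partial>M) / v n) \<longlonglongrightarrow> \<gamma> j"
begin

definition "mu n = (\<integral>\<omega>. \<phi> n (XP \<omega>) \<partial>M)"
definition "eta n t w = (\<phi> n (\<lambda>h. w (h + t)) - mu n) / sqrt (real n * v n)" for t :: int and w :: "int \<Rightarrow> real^'d"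
definition "block n a k w = (\<Sum>i<k. eta n (a + int i) w)" for a :: int and w :: "int \<Rightarrow> real^'d"
text \<open>There are \<open>m\<close> blocks of length \<open>len\<close>, with starting points
  \<open>d\<close> apart. Both the big blocks and the gaps between them are of this form.\<close>

definition "blocks n q d len m w = (\<Sum>j<m. block n (q + int j * int d) len w)" for q :: int and w :: "int \<Rightarrow> real^'d"
definition "cf n k = (\<integral>\<omega>. iexp (block n 0 k (XP \<omega>)) \<partial>M)"

lemma phi_le_K: "n \<ge> 1 \<Longrightarrow> \<bar>\<phi> n w\<bar> \<le> K"
  using phi_bound[of n w] K_nonneg by (auto simp: of_bool_def split: if_splits)

lemma eta_measurable [measurable]: "eta n t \<in> borel_measurable borel"
  unfolding eta_def[abs_def] by measurable

lemma block_measurable [measurable]: "block n a k \<in> borel_measurable borel"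
  unfolding block_def[abs_def] by measurable

lemma blocks_measurable [measurable]: "blocks n q d len m \<in> borel_measurable borel"
  unfolding blocks_def[abs_def] by measurable

lemma block_X_measurable [measurable]: "(\<lambda>\<omega>. block n a k (XP \<omega>)) \<in> borel_measurable M"
  "(\<lambda>\<omega>. blocks n q d len m (XP \<omega>)) \<in> borel_measurable M"
  by (rule measurable_compose[OF XP_measurable block_measurable], rule measurable_compose[OF XP_measurable blocks_measurable])

lemma block_shift: "block n a k (\<lambda>t. w (t + b)) = block n (a + b) k w"
  unfolding block_def eta_def by (simp add: ac_simps)

lemma blocks_shift: "blocks n q d len m (\<lambda>t. w (t + b)) = blocks n (q + b) d len m w"
  unfolding blocks_def block_shift by (simp add: ac_simps)

lemma iexp_block: "(\<integral>\<omega>. iexp (block n a k (XP \<omega>)) \<partial>M) = cf n k"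
proof -
  have "(\<lambda>w. iexp (block n 0 k w)) \<in> borel_measurable borel" by measurable
  from integral_shift[OF this, of a] show ?thesis
    unfolding block_shift[of n 0 k "XP _" a] by (simp add: cf_def)
qed

lemma iexp_blocks_shift: "(\<integral>\<omega>. iexp (blocks n q d len m (XP \<omega>)) \<partial>M) = (\<integral>\<omega>. iexp (blocks n q' d len m (XP \<omega>)) \<partial>M)"
proof -
  have "(\<lambda>w. iexp (blocks n q' d len m w)) \<in> borel_measurable borel" by measurable
  from integral_shift[OF this, of "q - q'"] show ?thesis
    unfolding blocks_shift[of n q' d len m "XP _" "q - q'"] by simp
qed

lemma norm_cf_le_1: "norm (cf n k) \<le> 1"
proof -
  have "norm (cf n k) \<le> (\<integral>\<omega>. norm (iexp (block n 0 k (XP \<omega>))) \<partial>M)"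
    unfolding cf_def by (rule integral_norm_bound)
  then show ?thesis by (simp add: M.prob_space)
qed

lemma block_window:
  assumes "\<And>i. i < k \<Longrightarrow> {a + int i - int (s n)..a + int i + int (s n)} \<subseteq> T"
  shows "(\<lambda>\<omega>. block n a k (XP \<omega>)) \<in> borel_measurable (sigma_gen M X T)"
  unfolding block_def eta_def
proof (intro borel_measurable_sum borel_measurable_divide borel_measurable_diff borel_measurable_const)
  fix i assume "i \<in> {..<k}"
  then show "(\<lambda>\<omega>. \<phi> n (\<lambda>h. X (h + (a + int i)) \<omega>)) \<in> borel_measurable (sigma_gen M X T)"
    using sigma_gen_mono[OF assms phi_window] by simp
qed

text \<open>By stationarity the last block may be assumed to start right after time \<open>L\<close>, the preceding
  blocks to end at time 0.\<close>

lemma blocks_nearly_independent: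
  assumes d: "len + 2 * s n + L \<le> d"
  shows "norm ((\<integral>\<omega>. iexp (blocks n q d len m (XP \<omega>)) \<partial>M) - cf n len ^ m) \<le> 8 * real m * beta_mixing M X L"
proof (induction m arbitrary: q)
  case 0
  then show ?case by (simp add: blocks_def M.prob_space)
next
  case (Suc m)
  \<comment> \<open>With this start the windows of the first \<open>m\<close> blocks end at time 0,
    and the next block starts at \<open>1 + d - len - s n\<close>, so its windows begin at
    \<open>L + 1\<close> or later.\<close>
  define q0 where "q0 = 1 - int m * int d + int d - int len - int (s n)"
  define U where "U \<omega> = iexp (blocks n q0 d len m (XP \<omega>))" for \<omega>
  define W where "W \<omega> = iexp (block n (q0 + int m * int d) len (XP \<omega>))" for \<omega>
  have "(\<lambda>\<omega>. blocks n q0 d len m (XP \<omega>)) \<in> borel_measurable (sigma_gen M X {..0})"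
    unfolding blocks_def
  proof (rule borel_measurable_sum, rule block_window)
    fix j i assume ji: "j \<in> {..<m}" "i < len"
    have "int j * int d \<le> (int m - 1) * int d" using ji by (intro mult_right_mono) auto
    then have "q0 + int j * int d + int i + int (s n) \<le> 0" using ji by (simp add: q0_def left_diff_distrib)
    then show "{q0 + int j * int d + int i - int (s n)..q0 + int j * int d + int i + int (s n)} \<subseteq> {..0}" by auto
  qed
  then have Um: "U \<in> borel_measurable (sigma_gen M X {..0})" unfolding U_def[abs_def] by measurable
  have "(\<lambda>\<omega>. block n (q0 + int m * int d) len (XP \<omega>)) \<in> borel_measurable (sigma_gen M X {int L + 1..})"
    by (rule block_window) (use d in \<open>auto simp: q0_def\<close>)
  then have Wm: "W \<in> borel_measurable (sigma_gen M X {int L + 1..})" unfolding W_def[abs_def] by measurable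
  have mix: "norm ((\<integral>\<omega>. U \<omega> * W \<omega> \<partial>M) - (\<integral>\<omega>. U \<omega> \<partial>M) * (\<integral>\<omega>. W \<omega> \<partial>M)) \<le> 8 * beta_mixing M X L"
    by (rule beta_mixing_complex[OF Um _ Wm]) (simp_all add: U_def W_def)
  have "(\<integral>\<omega>. iexp (blocks n q d len (Suc m) (XP \<omega>)) \<partial>M) = (\<integral>\<omega>. iexp (blocks n q0 d len (Suc m) (XP \<omega>)) \<partial>M)"
    by (rule iexp_blocks_shift)
  also have "\<dots> = (\<integral>\<omega>. U \<omega> * W \<omega> \<partial>M)"
    by (simp add: blocks_def U_def W_def distrib_left exp_add)
  finally have e: "(\<integral>\<omega>. iexp (blocks n q d len (Suc m) (XP \<omega>)) \<partial>M) = (\<integral>\<omega>. U \<omega> * W \<omega> \<partial>M)" .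
  have W: "(\<integral>\<omega>. W \<omega> \<partial>M) = cf n len" unfolding W_def by (rule iexp_block)
  \<comment> \<open>As \<open>cf\<close> has modulus at most 1, the errors of the successive
    separations merely add up.\<close>
  have "norm ((\<integral>\<omega>. U \<omega> \<partial>M) * cf n len - cf n len ^ m * cf n len) = norm ((\<integral>\<omega>. U \<omega> \<partial>M) - cf n len ^ m) * norm (cf n len)"
    by (simp add: norm_mult flip: left_diff_distrib)
  also have "\<dots> \<le> norm ((\<integral>\<omega>. U \<omega> \<partial>M) - cf n len ^ m) * 1"
    by (intro mult_left_mono norm_cf_le_1) simp
  also have "\<dots> \<le> 8 * real m * beta_mixing M X L" using Suc.IH[of q0] by (simp add: U_def)
  finally have "norm ((\<integral>\<omega>. U \<omega> \<partial>M) * cf n len - cf n len ^ m * cf n len) \<le> 8 * real m * beta_mixing M X L" .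
  then have "norm ((\<integral>\<omega>. U \<omega> * W \<omega> \<partial>M) - cf n len ^ m * cf n len) \<le> 8 * beta_mixing M X L + 8 * real m * beta_mixing M X L"
    using norm_triangle_mono[OF mix[unfolded W]] by (metis (no_types, lifting) diff_add_cancel add_diff_eq)
  then show ?case unfolding e by (simp add: algebra_simps)
qed

end

lemma iexp_quadratic: "norm (iexp x - (1 + \<i> * complex_of_real x - complex_of_real (x\<^sup>2 / 2))) \<le> \<bar>x\<bar> ^ 3 / 6"
proof -
  have "(\<Sum>k\<le>2. (\<i> * complex_of_real x) ^ k / fact k) = 1 + \<i> * complex_of_real x - complex_of_real (x\<^sup>2 / 2)"
  proof -
    have ii: "\<i> * c * (\<i> * c) = - (c * c)" for c by (simp add: complex_eq_iff)
    show ?thesis by (simp add: numeral_2_eq_2 power2_eq_square fact_reduce ii)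
  qed
  then show ?thesis using iexp_approx1[of x 2] by (simp add: fact_numeral numeral_eq_Suc)
qed

section \<open>Variance and characteristic function of a single block\<close>

context cluster_array begin

definition "Gam n j = (\<integral>\<omega>. \<phi> n (XP \<omega>) * \<phi> n (\<lambda>h. X (h + int j) \<omega>) \<partial>M) / v n"
text \<open>The second moment of a block divided by \<open>k / n\<close>: the triangular weights
  count the pairs at distance \<open>j\<close>, and the last term comes from the centring.\<close>

definition "var_factor n k = Gam n 0 + 2 * (\<Sum>j=1..<k. (1 - real j / real k) * Gam n j) - real k * (mu n)\<^sup>2 / v n"
definition "second_moment n k = (\<integral>\<omega>. (block n 0 k (XP \<omega>))\<^sup>2 \<partial>M)"

lemma integrable_phi: "n \<ge> 1 \<Longrightarrow> integrable M (\<lambda>\<omega>. \<phi> n (\<lambda>h. X (h + t) \<omega>))"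
  by (rule M.integrable_const_bound[where B=K]) (auto simp: phi_le_K)

lemma integrable_phi_mult: "n \<ge> 1 \<Longrightarrow> integrable M (\<lambda>\<omega>. \<phi> n (\<lambda>h. X (h + t) \<omega>) * \<phi> n (\<lambda>h. X (h + t') \<omega>))"
  by (rule M.integrable_const_bound[where B="K * K"]) (auto simp: abs_mult phi_le_K K_nonneg intro!: mult_mono)

lemma phi_mean: "(\<integral>\<omega>. \<phi> n (\<lambda>h. X (h + t) \<omega>) \<partial>M) = mu n"
  unfolding mu_def by (rule integral_shift) measurable

lemma phi_product_mean: "(\<integral>\<omega>. \<phi> n (\<lambda>h. X (h + int i) \<omega>) * \<phi> n (\<lambda>h. X (h + int j) \<omega>) \<partial>M) = v n * Gam n (nat \<bar>int i - int j\<bar>)"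
proof -
  have *: "(\<integral>\<omega>. \<phi> n (\<lambda>h. X (h + int a) \<omega>) * \<phi> n (\<lambda>h. X (h + int (a + d)) \<omega>) \<partial>M) = v n * Gam n d" for a d
  proof -
    have "(\<lambda>w. \<phi> n w * \<phi> n (\<lambda>h. w (h + int d))) \<in> borel_measurable borel" by measurable
    from integral_shift[OF this, of "int a"]
    have "(\<integral>\<omega>. \<phi> n (\<lambda>h. X (h + int a) \<omega>) * \<phi> n (\<lambda>h. X (h + int d + int a) \<omega>) \<partial>M) =
        (\<integral>\<omega>. \<phi> n (XP \<omega>) * \<phi> n (\<lambda>h. X (h + int d) \<omega>) \<partial>M)" .
    then show ?thesis using v_pos[of n] by (simp add: Gam_def ac_simps)
  qed
  show ?thesis
  proof (cases "i \<le> j")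
    case True
    then have "nat \<bar>int i - int j\<bar> = j - i" "i + (j - i) = j" by auto
    then show ?thesis using *[of i "j - i"] by simp
  next
    case False
    then have "nat \<bar>int i - int j\<bar> = i - j" "j + (i - j) = i" by auto
    then show ?thesis using *[of j "i - j"] by (simp add: mult.commute)
  qed
qed

lemma second_moment_eq:
  assumes n: "n \<ge> 1" and k: "k \<ge> 1"
  shows "second_moment n k = real k / real n * var_factor n k"
proof -
  let ?f = "\<lambda>i \<omega>. \<phi> n (\<lambda>h. X (h + int i) \<omega>)"
  define T where "T \<omega> = (\<Sum>i<k. ?f i \<omega>)" for \<omega>
  have nv: "real n * v n > 0" by (rule nv_pos[OF n])
  have T2: "(T \<omega>)\<^sup>2 = (\<Sum>i<k. \<Sum>j<k. ?f i \<omega> * ?f j \<omega>)" for \<omega>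
    unfolding T_def power2_eq_square by (rule sum_product)
  have i1: "integrable M T" unfolding T_def[abs_def] by (intro Bochner_Integration.integrable_sum integrable_phi n)
  have i2: "integrable M (\<lambda>\<omega>. (T \<omega>)\<^sup>2)" unfolding T2 by (intro Bochner_Integration.integrable_sum integrable_phi_mult n)
  have e1: "(\<integral>\<omega>. T \<omega> \<partial>M) = real k * mu n"
    unfolding T_def by (subst Bochner_Integration.integral_sum) (simp_all add: integrable_phi[OF n] phi_mean)
  have e2: "(\<integral>\<omega>. (T \<omega>)\<^sup>2 \<partial>M) = v n * (\<Sum>i<k. \<Sum>j<k. Gam n (nat \<bar>int i - int j\<bar>))"
  proof -
    have "(\<integral>\<omega>. (T \<omega>)\<^sup>2 \<partial>M) = (\<Sum>i<k. \<Sum>j<k. \<integral>\<omega>. ?f i \<omega> * ?f j \<omega> \<partial>M)"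
      unfolding T2 using integrable_phi_mult[OF n]
      by (simp only: Bochner_Integration.integral_sum Bochner_Integration.integrable_sum)
    then show ?thesis by (simp only: phi_product_mean sum_distrib_left)
  qed
  have b: "block n 0 k (XP \<omega>) = (T \<omega> - real k * mu n) / sqrt (real n * v n)" for \<omega>
    by (simp add: block_def eta_def T_def sum_subtractf flip: sum_divide_distrib)
  have "(block n 0 k (XP \<omega>))\<^sup>2 = ((T \<omega>)\<^sup>2 - 2 * (real k * mu n) * T \<omega> + (real k * mu n)\<^sup>2) / (real n * v n)" for \<omega>
    unfolding b using nv by (simp add: power_divide power2_diff algebra_simps)
  then have "second_moment n k = (\<integral>\<omega>. ((T \<omega>)\<^sup>2 - 2 * (real k * mu n) * T \<omega> + (real k * mu n)\<^sup>2) / (real n * v n) \<partial>M)"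
    by (simp only: second_moment_def)
  also have "\<dots> = ((\<integral>\<omega>. (T \<omega>)\<^sup>2 \<partial>M) - 2 * (real k * mu n) * (\<integral>\<omega>. T \<omega> \<partial>M) + (real k * mu n)\<^sup>2) / (real n * v n)"
    using i1 i2 by (simp add: M.prob_space)
  also have "\<dots> = (v n * (real k * Gam n 0 + 2 * (\<Sum>j=1..<k. real (k - j) * Gam n j)) - (real k * mu n)\<^sup>2) / (real n * v n)"
    unfolding e1 e2 double_sum_abs_diff by (simp add: power2_eq_square)
  also have "(\<Sum>j=1..<k. real (k - j) * Gam n j) = real k * (\<Sum>j=1..<k. (1 - real j / real k) * Gam n j)"
    unfolding sum_distrib_left
  proof (rule sum.cong[OF refl])
    fix j assume "j \<in> {1..<k}"
    then have "real (k - j) = real k * (1 - real j / real k)" using k by (simp add: of_nat_diff field_simps)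
    then show "real (k - j) * Gam n j = real k * ((1 - real j / real k) * Gam n j)" by simp
  qed
  also have "(v n * (real k * Gam n 0 + 2 * (real k * (\<Sum>j=1..<k. (1 - real j / real k) * Gam n j))) - (real k * mu n)\<^sup>2) / (real n * v n) =
      real k / real n * var_factor n k"
    unfolding var_factor_def using n v_pos[of n] by (simp add: field_simps power2_eq_square)
  finally show ?thesis .
qed

lemma second_moment_nonneg: "0 \<le> second_moment n k"
  unfolding second_moment_def by (intro Bochner_Integration.integral_nonneg) simp

text \<open>The functional vanishes without an exceedance at its reference time; a lagged product
  thus requires a joint exceedance, to which (BC) applies.\<close>

lemma phi_abs_bounds:
  assumes n: "n \<ge> 1"
  shows "\<bar>mu n\<bar> \<le> K * v n" "\<bar>Gam n j\<bar> \<le> K\<^sup>2 * (JP (int j) (u n) / v n)"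
proof -
  have ib: "integrable M (\<lambda>\<omega>. K * of_bool (N (X 0 \<omega>) > u n))"
    by (rule integrable_bounded[where C=K]) (auto simp: K_nonneg of_bool_def)
  have "\<bar>mu n\<bar> \<le> (\<integral>\<omega>. \<bar>\<phi> n (XP \<omega>)\<bar> \<partial>M)" unfolding mu_def by (rule integral_abs_bound)
  also have "\<dots> \<le> (\<integral>\<omega>. K * of_bool (N (X 0 \<omega>) > u n) \<partial>M)"
  proof (rule integral_mono[OF _ ib])
    show "integrable M (\<lambda>\<omega>. \<bar>\<phi> n (XP \<omega>)\<bar>)" using integrable_phi[OF n, of 0] by simp
  qed (rule phi_bound[OF n])
  also have "\<dots> = K * v n"
  proof -
    have "(\<integral>\<omega>. (of_bool (N (X 0 \<omega>) > u n) :: real) \<partial>M) = (\<integral>\<omega>. indicator (exceed M N X 0 (u n)) \<omega> \<partial>M)"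
      by (rule Bochner_Integration.integral_cong) (auto simp: exceed_def indicator_def)
    then show ?thesis by (simp add: v_def V_def)
  qed
  finally show "\<bar>mu n\<bar> \<le> K * v n" .
  let ?g = "\<lambda>\<omega>. \<phi> n (XP \<omega>) * \<phi> n (\<lambda>h. X (h + int j) \<omega>)"
  have ib2: "integrable M (\<lambda>\<omega>. K\<^sup>2 * (of_bool (N (X (int j) \<omega>) > u n) * of_bool (N (X 0 \<omega>) > u n)))"
    by (rule integrable_bounded[where C="K\<^sup>2"]) (auto simp: of_bool_def)
  have "\<bar>\<integral>\<omega>. ?g \<omega> \<partial>M\<bar> \<le> (\<integral>\<omega>. \<bar>?g \<omega>\<bar> \<partial>M)" by (rule integral_abs_bound)
  also have "\<dots> \<le> (\<integral>\<omega>. K\<^sup>2 * (of_bool (N (X (int j) \<omega>) > u n) * of_bool (N (X 0 \<omega>) > u n)) \<partial>M)"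
  proof (rule integral_mono[OF _ ib2])
    show "integrable M (\<lambda>\<omega>. \<bar>?g \<omega>\<bar>)" using integrable_phi_mult[OF n, of 0 "int j"] by simp
    fix \<omega>
    have "\<bar>\<phi> n (XP \<omega>)\<bar> * \<bar>\<phi> n (\<lambda>h. X (h + int j) \<omega>)\<bar> \<le>
        (K * of_bool (N (X 0 \<omega>) > u n)) * (K * of_bool (N (X (0 + int j) \<omega>) > u n))"
      by (intro mult_mono phi_bound[OF n] mult_nonneg_nonneg K_nonneg) simp_all
    then show "\<bar>?g \<omega>\<bar> \<le> K\<^sup>2 * (of_bool (N (X (int j) \<omega>) > u n) * of_bool (N (X 0 \<omega>) > u n))"
      by (simp add: abs_mult power2_eq_square mult_ac)
  qed
  also have "\<dots> = K\<^sup>2 * JP (int j) (u n)" by (simp only: JP_integral integral_mult_right_zero)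
  finally have "\<bar>\<integral>\<omega>. ?g \<omega> \<partial>M\<bar> / v n \<le> K\<^sup>2 * JP (int j) (u n) / v n"
    using v_pos[of n] by (simp add: divide_right_mono)
  then show "\<bar>Gam n j\<bar> \<le> K\<^sup>2 * (JP (int j) (u n) / v n)" using v_pos[of n] by (simp add: Gam_def)
qed

lemma JP_0: "JP 0 (u n) / v n = 1"
proof -
  have "JP 0 (u n) = V (u n)" unfolding JP_def V_def exceed_def by (rule arg_cong[where f=M.prob]) auto
  then show ?thesis using v_pos[of n] by (simp add: v_def)
qed

text \<open>(BC) at level 1 dominates the lagged moments, so the triangularly weighted sums converge
  as for a stationary series with absolutely summable covariances. The centring term is at most of
  order \<open>r n * v n\<close> and vanishes.\<close>

lemma block_variance:
  shows summable_gamma: "summable (\<lambda>j. \<gamma> (Suc j))"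
    and var_factor_bounded: "\<exists>C. \<forall>\<^sub>F n in sequentially. \<forall>k. 1 \<le> k \<and> k \<le> r n \<longrightarrow> \<bar>var_factor n k\<bar> \<le> C"
    and var_factor_tendsto: "\<And>k. filterlim k at_top sequentially \<Longrightarrow> \<forall>\<^sub>F n in sequentially. k n \<le> r n \<Longrightarrow>
      (\<lambda>n. var_factor n (k n)) \<longlonglongrightarrow> \<gamma> 0 + 2 * (\<Sum>j. \<gamma> (Suc j))"
proof -
  obtain e f where e: "\<And>n k. n \<ge> 1 \<Longrightarrow> 1 \<le> k \<Longrightarrow> k \<le> r n \<Longrightarrow> JP (int k) (1 * u n) \<le> V (1 * u n) * e n k"
    "\<And>n k. n \<ge> 1 \<Longrightarrow> 1 \<le> k \<Longrightarrow> k \<le> r n \<Longrightarrow> 0 \<le> e n k"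
    "\<And>k. k \<ge> 1 \<Longrightarrow> (\<lambda>n. e n k) \<longlonglongrightarrow> f k" "summable (\<lambda>k. f (Suc k))"
    "(\<lambda>n. \<Sum>k=1..r n. e n k) \<longlonglongrightarrow> (\<Sum>k. f (Suc k))"
    by (rule BC_bound[of 1]) auto
  have Ge: "\<bar>Gam n j\<bar> \<le> K\<^sup>2 * e n j" if "n \<ge> 1" "1 \<le> j" "j \<le> r n" for n j
  proof -
    have "JP (int j) (u n) / v n \<le> e n j"
      using e(1)[OF that] v_pos[of n] by (simp add: v_def pos_divide_le_eq mult.commute)
    then have "K\<^sup>2 * (JP (int j) (u n) / v n) \<le> K\<^sup>2 * e n j" by (intro mult_left_mono) auto
    then show ?thesis using phi_abs_bounds(2)[OF that(1), of j] by linarith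
  qed
  have esum: "(\<lambda>n. \<Sum>j<r n. K\<^sup>2 * e n (Suc j)) \<longlonglongrightarrow> (\<Sum>j. K\<^sup>2 * f (Suc j))"
  proof -
    have "(\<lambda>n. K\<^sup>2 * (\<Sum>k=1..r n. e n k)) \<longlonglongrightarrow> K\<^sup>2 * (\<Sum>k. f (Suc k))" by (intro tendsto_intros e(5))
    moreover have "K\<^sup>2 * (\<Sum>k=1..r n. e n k) = (\<Sum>j<r n. K\<^sup>2 * e n (Suc j))" for n
      by (simp add: sum.atLeast1_atMost_eq sum_distrib_left)
    ultimately show ?thesis using suminf_mult[OF e(4), of "K\<^sup>2"] by simp
  qed
  have Glim: "(\<lambda>n. Gam n j) \<longlonglongrightarrow> \<gamma> j" for j unfolding Gam_def by (rule phi_covariance)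
  \<comment> \<open>The term with \<open>Suc j = k\<close> has weight 0 and may be added. Cutting
    the weight off at 0 gives summands that obey the domination for all \<open>j < r n\<close>, also
    beyond \<open>k\<close>.\<close>
  have sum_form: "(\<Sum>j=1..<k. (1 - real j / real k) * Gam n j) = (\<Sum>j<k. max 0 (1 - real (Suc j) / real k) * Gam n (Suc j))" for n k
  proof (cases k)
    case (Suc k')
    have "(\<Sum>j=1..<Suc k'. (1 - real j / real k) * Gam n j) = (\<Sum>j<k'. (1 - real (Suc j) / real k) * Gam n (Suc j))"
      by (simp only: One_nat_def sum.atLeast_Suc_lessThan_Suc_shift atLeast0LessThan o_def)
    also have "\<dots> = (\<Sum>j<k'. max 0 (1 - real (Suc j) / real k) * Gam n (Suc j))"
      using Suc by (intro sum.cong refl) (simp add: max_def field_simps)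
    also have "\<dots> = (\<Sum>j<Suc k'. max 0 (1 - real (Suc j) / real k) * Gam n (Suc j))" using Suc by simp
    finally show ?thesis using Suc by simp
  qed simp
  have dom: "\<forall>\<^sub>F n in sequentially. \<forall>j<r n. \<bar>max 0 (1 - real (Suc j) / real (k n)) * Gam n (Suc j)\<bar> \<le> K\<^sup>2 * e n (Suc j)" for k :: "nat \<Rightarrow> nat"
    using eventually_ge_at_top[of 1]
  proof eventually_elim
    case (elim n)
    show ?case
    proof (intro allI impI)
      fix j assume j: "j < r n"
      have "\<bar>max 0 (1 - real (Suc j) / real (k n)) * Gam n (Suc j)\<bar> \<le> 1 * \<bar>Gam n (Suc j)\<bar>"
        unfolding abs_mult by (intro mult_right_mono) (auto simp: max_def)
      then show "\<bar>max 0 (1 - real (Suc j) / real (k n)) * Gam n (Suc j)\<bar> \<le> K\<^sup>2 * e n (Suc j)"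
        using Ge[OF elim, of "Suc j"] j by simp
    qed
  qed
  have main: "summable (\<lambda>j. \<gamma> (Suc j))" "(\<lambda>n. \<Sum>j<k n. max 0 (1 - real (Suc j) / real (k n)) * Gam n (Suc j)) \<longlonglongrightarrow> (\<Sum>j. \<gamma> (Suc j))"
    if k: "filterlim k at_top sequentially" "\<forall>\<^sub>F n in sequentially. k n \<le> r n" for k
  proof -
    have x: "(\<lambda>n. max 0 (1 - real (Suc j) / real (k n)) * Gam n (Suc j)) \<longlonglongrightarrow> \<gamma> (Suc j)" for j
    proof -
      have "filterlim (\<lambda>n. real (k n)) at_top sequentially"
        by (rule filterlim_compose[OF filterlim_real_sequentially k(1)])
      then have "(\<lambda>n. max 0 (1 - real (Suc j) / real (k n)) * Gam n (Suc j)) \<longlonglongrightarrow> max 0 (1 - 0) * \<gamma> (Suc j)"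
        by (intro tendsto_mult tendsto_max tendsto_diff tendsto_const Glim real_tendsto_divide_at_top[OF tendsto_const])
      then show ?thesis by simp
    qed
    note d = tendsto_sum_dominated[OF x tendsto_mult_left[OF e(3), of "Suc _" "K\<^sup>2"] dom summable_mult[OF e(4), of "K\<^sup>2"] esum r_lim k]
    show "summable (\<lambda>j. \<gamma> (Suc j))" "(\<lambda>n. \<Sum>j<k n. max 0 (1 - real (Suc j) / real (k n)) * Gam n (Suc j)) \<longlonglongrightarrow> (\<Sum>j. \<gamma> (Suc j))"
      using d by simp_all
  qed
  show "summable (\<lambda>j. \<gamma> (Suc j))" by (rule main(1)[OF r_lim]) simp
  have kmu: "\<bar>real k * (mu n)\<^sup>2 / v n\<bar> \<le> K\<^sup>2 * (real (r n) * v n)" if "n \<ge> 1" "k \<le> r n" for n k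
  proof -
    have "(mu n)\<^sup>2 \<le> (K * v n)\<^sup>2" using phi_abs_bounds(1)[OF that(1)] by (metis abs_ge_zero power2_abs power_mono)
    then have "real k * (mu n)\<^sup>2 \<le> real (r n) * (K * v n)\<^sup>2" using that by (intro mult_mono) auto
    then have "real k * (mu n)\<^sup>2 / v n \<le> real (r n) * (K * v n)\<^sup>2 / v n" using v_pos[of n] by (intro divide_right_mono) auto
    also have "\<dots> = K\<^sup>2 * (real (r n) * v n)" using v_pos[of n] by (simp add: power2_eq_square)
    finally show ?thesis using v_pos[of n] by simp
  qed
  have rv0: "(\<lambda>n. K\<^sup>2 * (real (r n) * v n)) \<longlonglongrightarrow> 0" using tendsto_mult_left[OF S_facts(5), of "K\<^sup>2"] by simp
  show "\<exists>C. \<forall>\<^sub>F n in sequentially. \<forall>k. 1 \<le> k \<and> k \<le> r n \<longrightarrow> \<bar>var_factor n k\<bar> \<le> C"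
  proof (intro exI)
    have ev1: "\<forall>\<^sub>F n in sequentially. (\<Sum>j<r n. K\<^sup>2 * e n (Suc j)) < (\<Sum>j. K\<^sup>2 * f (Suc j)) + 1"
      by (rule order_tendstoD(2)[OF esum]) simp
    have ev2: "\<forall>\<^sub>F n in sequentially. K\<^sup>2 * (real (r n) * v n) < 1" by (rule order_tendstoD(2)[OF rv0]) simp
    show "\<forall>\<^sub>F n in sequentially. \<forall>k. 1 \<le> k \<and> k \<le> r n \<longrightarrow> \<bar>var_factor n k\<bar> \<le> K\<^sup>2 + 2 * ((\<Sum>j. K\<^sup>2 * f (Suc j)) + 1) + 1"
      using ev1 ev2 eventually_ge_at_top[of 1]
    proof eventually_elim
      case (elim n)
      show ?case
      proof (intro allI impI)
        fix k assume k: "1 \<le> k \<and> k \<le> r n"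
        have G0: "\<bar>Gam n 0\<bar> \<le> K\<^sup>2" using phi_abs_bounds(2)[OF elim(3), of 0] JP_0[of n] by simp
        have "\<bar>\<Sum>j<k. max 0 (1 - real (Suc j) / real k) * Gam n (Suc j)\<bar> \<le> (\<Sum>j<k. \<bar>max 0 (1 - real (Suc j) / real k) * Gam n (Suc j)\<bar>)"
          by (rule sum_abs)
        also have "\<dots> \<le> (\<Sum>j<k. K\<^sup>2 * e n (Suc j))"
        proof (rule sum_mono)
          fix j assume "j \<in> {..<k}"
          then have j: "Suc j \<le> r n" using k by auto
          have "\<bar>max 0 (1 - real (Suc j) / real k) * Gam n (Suc j)\<bar> \<le> 1 * \<bar>Gam n (Suc j)\<bar>"
            unfolding abs_mult by (intro mult_right_mono) (auto simp: max_def)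
          then show "\<bar>max 0 (1 - real (Suc j) / real k) * Gam n (Suc j)\<bar> \<le> K\<^sup>2 * e n (Suc j)"
            using Ge[OF elim(3), of "Suc j"] j by simp
        qed
        also have "\<dots> \<le> (\<Sum>j<r n. K\<^sup>2 * e n (Suc j))"
          using k e(2)[OF elim(3)] by (intro sum_mono2) auto
        finally have S: "\<bar>\<Sum>j=1..<k. (1 - real j / real k) * Gam n j\<bar> \<le> (\<Sum>j. K\<^sup>2 * f (Suc j)) + 1"
          unfolding sum_form using elim(1) by linarith
        have "\<bar>real k * (mu n)\<^sup>2 / v n\<bar> \<le> 1" using kmu[OF elim(3), of k] k elim(2) by linarith
        moreover have "\<bar>a + 2 * b - c\<bar> \<le> A + 2 * B + 1" if "\<bar>a\<bar> \<le> A" "\<bar>b\<bar> \<le> B" "\<bar>c\<bar> \<le> 1" for a b c A B :: real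
          using that by linarith
        ultimately show "\<bar>var_factor n k\<bar> \<le> K\<^sup>2 + 2 * ((\<Sum>j. K\<^sup>2 * f (Suc j)) + 1) + 1"
          unfolding var_factor_def using G0 S by blast
      qed
    qed
  qed
  fix k :: "nat \<Rightarrow> nat" assume k: "filterlim k at_top sequentially" "\<forall>\<^sub>F n in sequentially. k n \<le> r n"
  have "(\<lambda>n. real (k n) * (mu n)\<^sup>2 / v n) \<longlonglongrightarrow> 0"
  proof (rule Lim_null_comparison[OF _ rv0])
    show "\<forall>\<^sub>F n in sequentially. norm (real (k n) * (mu n)\<^sup>2 / v n) \<le> K\<^sup>2 * (real (r n) * v n)"
      using k(2) eventually_ge_at_top[of 1] by eventually_elim (simp only: real_norm_def kmu)
  qed
  then have "(\<lambda>n. Gam n 0 + 2 * (\<Sum>j<k n. max 0 (1 - real (Suc j) / real (k n)) * Gam n (Suc j)) - real (k n) * (mu n)\<^sup>2 / v n) \<longlonglongrightarrow>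
      \<gamma> 0 + 2 * (\<Sum>j. \<gamma> (Suc j)) - 0"
    by (intro tendsto_diff tendsto_add tendsto_mult tendsto_const Glim main(2)[OF k])
  then show "(\<lambda>n. var_factor n (k n)) \<longlonglongrightarrow> \<gamma> 0 + 2 * (\<Sum>j. \<gamma> (Suc j))"
    unfolding var_factor_def sum_form by simp
qed

lemma block_bound:
  assumes n: "n \<ge> 1" shows "\<bar>block n 0 k w\<bar> \<le> real k * (2 * K) / sqrt (real n * v n)"
proof -
  have "\<bar>mu n\<bar> \<le> (\<integral>\<omega>. \<bar>\<phi> n (XP \<omega>)\<bar> \<partial>M)" unfolding mu_def by (rule integral_abs_bound)
  also have "\<dots> \<le> (\<integral>\<omega>. K \<partial>M)" using integrable_phi[OF n, of 0] phi_le_K[OF n] by (intro integral_mono) auto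
  finally have m: "\<bar>mu n\<bar> \<le> K" by (simp add: M.prob_space)
  have "\<bar>block n 0 k w\<bar> \<le> (\<Sum>i<k. \<bar>eta n (0 + int i) w\<bar>)" unfolding block_def by (rule sum_abs)
  also have "\<dots> \<le> (\<Sum>i<k. 2 * K / sqrt (real n * v n))"
  proof (rule sum_mono)
    fix i
    have "\<bar>\<phi> n (\<lambda>h. w (h + (0 + int i))) - mu n\<bar> \<le> 2 * K" using m phi_le_K[OF n, of "\<lambda>h. w (h + (0 + int i))"] by linarith
    then show "\<bar>eta n (0 + int i) w\<bar> \<le> 2 * K / sqrt (real n * v n)"
      unfolding eta_def using nv_pos[OF n] by (simp add: divide_right_mono)
  qed
  finally show ?thesis by simp
qed

text \<open>The block has mean 0 and is bounded by a multiple of \<open>k / sqrt (n * v n)\<close>,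
  so its third absolute moment is at most that bound times the second moment. Passing from
  \<open>1 - y\<close> to \<open>exp (- y)\<close> costs the square of the second moment.\<close>

lemma cf_approx:
  assumes n: "n \<ge> 1" and k: "k \<ge> 1"
  shows "norm (cf n k - complex_of_real (exp (- (second_moment n k / 2)))) \<le>
     (real k * (2 * K) / sqrt (real n * v n)) * second_moment n k + (second_moment n k)\<^sup>2"
proof -
  define \<delta> where "\<delta> = real k * (2 * K) / sqrt (real n * v n)"
  define y where "y = second_moment n k / 2"
  let ?B = "\<lambda>\<omega>. block n 0 k (XP \<omega>)"
  have B: "\<bar>?B \<omega>\<bar> \<le> \<delta>" for \<omega> unfolding \<delta>_def by (rule block_bound[OF n])
  have \<delta>0: "0 \<le> \<delta>" using B[of undefined] by linarith
  have y0: "0 \<le> y" by (simp add: y_def second_moment_nonneg)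
  have i1: "integrable M ?B" by (rule M.integrable_const_bound[where B=\<delta>]) (use B in auto)
  have i2: "integrable M (\<lambda>\<omega>. (?B \<omega>)\<^sup>2)"
    by (rule M.integrable_const_bound[where B="\<delta>\<^sup>2"]) (use B \<delta>0 in \<open>auto simp: abs_le_square_iff[symmetric]\<close>)
  have i3: "integrable M (\<lambda>\<omega>. \<bar>?B \<omega>\<bar> ^ 3)"
    by (rule M.integrable_const_bound[where B="\<delta> ^ 3"]) (use B in \<open>auto intro!: power_mono\<close>)
  have ie: "integrable M (\<lambda>\<omega>. iexp (?B \<omega>))" by (rule M.integrable_const_bound[where B=1]) auto
  have mean: "(\<integral>\<omega>. ?B \<omega> \<partial>M) = 0"
    unfolding block_def eta_def
    by (subst Bochner_Integration.integral_sum) (simp_all add: integrable_phi[OF n] phi_mean M.prob_space)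
  let ?Q = "\<lambda>\<omega>. 1 + \<i> * complex_of_real (?B \<omega>) - complex_of_real ((?B \<omega>)\<^sup>2 / 2)"
  have ia: "integrable M (\<lambda>\<omega>. 1 + \<i> * complex_of_real (?B \<omega>))" using i1 by simp
  have ib: "integrable M (\<lambda>\<omega>. complex_of_real ((?B \<omega>)\<^sup>2 / 2))"
    by (rule integrable_of_real) (use i2 in simp)
  have iQ: "integrable M ?Q" by (rule Bochner_Integration.integrable_diff[OF ia ib])
  have "(\<integral>\<omega>. ?Q \<omega> \<partial>M) = (\<integral>\<omega>. 1 + \<i> * complex_of_real (?B \<omega>) \<partial>M) - (\<integral>\<omega>. complex_of_real ((?B \<omega>)\<^sup>2 / 2) \<partial>M)"
    by (rule Bochner_Integration.integral_diff[OF ia ib])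
  also have "(\<integral>\<omega>. 1 + \<i> * complex_of_real (?B \<omega>) \<partial>M) = 1"
    using i1 mean by (simp add: M.prob_space)
  also have "(\<integral>\<omega>. complex_of_real ((?B \<omega>)\<^sup>2 / 2) \<partial>M) = complex_of_real (\<integral>\<omega>. (?B \<omega>)\<^sup>2 / 2 \<partial>M)"
    by (rule integral_of_real) (use i2 in simp)
  also have "(\<integral>\<omega>. (?B \<omega>)\<^sup>2 / 2 \<partial>M) = y" by (simp add: y_def second_moment_def)
  finally have "(\<integral>\<omega>. ?Q \<omega> \<partial>M) = 1 - complex_of_real y" .
  then have "cf n k - complex_of_real (1 - y) = (\<integral>\<omega>. iexp (?B \<omega>) - ?Q \<omega> \<partial>M)"
    unfolding cf_def Bochner_Integration.integral_diff[OF ie iQ] by (simp only: of_real_diff of_real_1)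
  then have "norm (cf n k - complex_of_real (1 - y)) = norm (\<integral>\<omega>. iexp (?B \<omega>) - ?Q \<omega> \<partial>M)" by (rule arg_cong)
  also have "\<dots> \<le> (\<integral>\<omega>. norm (iexp (?B \<omega>) - ?Q \<omega>) \<partial>M)" by (rule integral_norm_bound)
  also have "\<dots> \<le> (\<integral>\<omega>. \<delta> * (?B \<omega>)\<^sup>2 \<partial>M)"
  proof (rule integral_mono)
    fix \<omega>
    have "norm (iexp (?B \<omega>) - ?Q \<omega>) \<le> \<bar>?B \<omega>\<bar> ^ 3 / 6" by (rule iexp_quadratic)
    also have "\<dots> \<le> \<bar>?B \<omega>\<bar> ^ 3" by simp
    also have "\<dots> = \<bar>?B \<omega>\<bar> * (?B \<omega>)\<^sup>2" by (simp add: power3_eq_cube power2_eq_square)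
    also have "\<dots> \<le> \<delta> * (?B \<omega>)\<^sup>2" by (intro mult_right_mono B) simp
    finally show "norm (iexp (?B \<omega>) - ?Q \<omega>) \<le> \<delta> * (?B \<omega>)\<^sup>2" .
  next
    show "integrable M (\<lambda>\<omega>. norm (iexp (?B \<omega>) - ?Q \<omega>))"
      by (intro integrable_norm Bochner_Integration.integrable_diff ie iQ)
    show "integrable M (\<lambda>\<omega>. \<delta> * (?B \<omega>)\<^sup>2)" by (intro integrable_mult_right i2)
  qed
  also have "\<dots> = \<delta> * second_moment n k" by (simp add: second_moment_def)
  finally have 1: "norm (cf n k - complex_of_real (1 - y)) \<le> \<delta> * second_moment n k" .
  have "norm (complex_of_real (1 - y) - complex_of_real (exp (- y))) = \<bar>exp (- y) - (1 - y)\<bar>"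
    by (simp flip: of_real_diff add: abs_minus_commute)
  also have "\<dots> \<le> y\<^sup>2" by (rule exp_minus_quadratic[OF y0])
  also have "\<dots> \<le> (second_moment n k)\<^sup>2" using second_moment_nonneg[of n k] by (intro power_mono) (auto simp: y_def)
  finally have 2: "norm (complex_of_real (1 - y) - complex_of_real (exp (- y))) \<le> (second_moment n k)\<^sup>2" .
  have "norm (cf n k - complex_of_real (exp (- y))) \<le> norm (cf n k - complex_of_real (1 - y)) + norm (complex_of_real (1 - y) - complex_of_real (exp (- y)))"
    using norm_triangle_ineq[of "cf n k - complex_of_real (1 - y)" "complex_of_real (1 - y) - complex_of_real (exp (- y))"] by (simp only: diff_add_cancel add_diff_eq)
  then show ?thesis using 1 2 unfolding \<delta>_def y_def by linarith
qed

end

lemma sum_shift_lessThan: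
  fixes f :: "nat \<Rightarrow> 'a::comm_monoid_add"
  shows "sum f {b..<b + k} = (\<Sum>i<k. f (b + i))"
  by (rule sum.reindex_bij_witness[where i="\<lambda>i. b + i" and j="\<lambda>i. i - b"]) auto

section \<open>Central limit theorem for block sums\<close>

context cluster_array begin

text \<open>For numbers of modulus at most 1, the difference of \<open>m\<close>-th powers is at
  most \<open>m\<close> times the difference. The number of blocks times the second moment stays
  bounded, while the relative error \<open>\<delta> n + sm n\<close> vanishes.\<close>

lemma cf_power_tendsto:
  assumes k: "\<forall>\<^sub>F n in sequentially. 1 \<le> k n \<and> k n \<le> r n"
    and lim: "(\<lambda>n. real (n div r n) * second_moment n (k n)) \<longlonglongrightarrow> \<tau>"
  shows "(\<lambda>n. cf n (k n) ^ (n div r n)) \<longlonglongrightarrow> complex_of_real (exp (- (\<tau> / 2)))"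
proof -
  define m where "m n = n div r n" for n
  define sm where "sm n = second_moment n (k n)" for n
  define \<delta> where "\<delta> n = real (k n) * (2 * K) / sqrt (real n * v n)" for n
  have ev: "\<forall>\<^sub>F n in sequentially. n \<ge> 1 \<and> 1 \<le> k n \<and> k n \<le> r n \<and> m n \<ge> 1"
  proof -
    have "\<forall>\<^sub>F n in sequentially. 1 \<le> real (m n)" using blocks_at_top unfolding m_def filterlim_at_top by blast
    with k eventually_ge_at_top[of 1] show ?thesis by eventually_elim simp
  qed
  have sm0: "sm \<longlonglongrightarrow> 0"
  proof -
    have "(\<lambda>n. (real (m n) * sm n) / real (m n)) \<longlonglongrightarrow> 0"
      unfolding m_def sm_def by (rule real_tendsto_divide_at_top[OF lim blocks_at_top])
    moreover have "\<forall>\<^sub>F n in sequentially. (real (m n) * sm n) / real (m n) = sm n"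
      using ev by eventually_elim simp
    ultimately show ?thesis by (rule Lim_transform_eventually)
  qed
  have \<delta>0: "\<delta> \<longlonglongrightarrow> 0"
  proof (rule Lim_null_comparison)
    show "(\<lambda>n. 2 * K * (real (r n) / sqrt (real n * v n))) \<longlonglongrightarrow> 0"
      using tendsto_mult_left[OF r_over_sqrt, of "2 * K"] by simp
    show "\<forall>\<^sub>F n in sequentially. norm (\<delta> n) \<le> 2 * K * (real (r n) / sqrt (real n * v n))"
      using ev
    proof eventually_elim
      case (elim n)
      have "real (k n) * (2 * K) / sqrt (real n * v n) \<le> real (r n) * (2 * K) / sqrt (real n * v n)"
        using elim K_nonneg nv_pos[of n] by (intro divide_right_mono mult_right_mono) auto
      moreover have "0 \<le> \<delta> n" unfolding \<delta>_def using K_nonneg nv_pos[of n] elim by simp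
      ultimately show ?case by (simp add: \<delta>_def mult_ac)
    qed
  qed
  have "(\<lambda>n. cf n (k n) ^ m n - complex_of_real (exp (- (sm n / 2))) ^ m n) \<longlonglongrightarrow> 0"
  proof (rule Lim_null_comparison)
    show "(\<lambda>n. (real (m n) * sm n) * (\<delta> n + sm n)) \<longlonglongrightarrow> 0"
      using tendsto_mult[OF lim tendsto_add[OF \<delta>0 sm0]] unfolding m_def sm_def by simp
    show "\<forall>\<^sub>F n in sequentially. norm (cf n (k n) ^ m n - complex_of_real (exp (- (sm n / 2))) ^ m n) \<le> (real (m n) * sm n) * (\<delta> n + sm n)"
      using ev
    proof eventually_elim
      case (elim n)
      have "norm (cf n (k n) ^ m n - complex_of_real (exp (- (sm n / 2))) ^ m n) \<le> real (m n) * norm (cf n (k n) - complex_of_real (exp (- (sm n / 2))))"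
        by (rule norm_power_diff) (simp_all add: norm_cf_le_1 sm_def second_moment_nonneg)
      also have "\<dots> \<le> real (m n) * (\<delta> n * sm n + (sm n)\<^sup>2)"
        unfolding \<delta>_def sm_def by (intro mult_left_mono cf_approx) (use elim in auto)
      also have "\<dots> = (real (m n) * sm n) * (\<delta> n + sm n)" by (simp add: power2_eq_square algebra_simps)
      finally show ?case .
    qed
  qed
  moreover have "(\<lambda>n. complex_of_real (exp (- (sm n / 2))) ^ m n) \<longlonglongrightarrow> complex_of_real (exp (- (\<tau> / 2)))"
  proof -
    have "complex_of_real (exp (- (sm n / 2))) ^ m n = complex_of_real (exp (- (real (m n) * sm n / 2)))" for n
      by (simp flip: of_real_power exp_of_nat_mult)
    moreover have "(\<lambda>n. complex_of_real (exp (- (real (m n) * sm n / 2)))) \<longlonglongrightarrow> complex_of_real (exp (- (\<tau> / 2)))"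
      unfolding m_def sm_def by (intro tendsto_intros lim) simp
    ultimately show ?thesis by simp
  qed
  ultimately have "(\<lambda>n. (cf n (k n) ^ m n - complex_of_real (exp (- (sm n / 2))) ^ m n) + complex_of_real (exp (- (sm n / 2))) ^ m n) \<longlonglongrightarrow> 0 + complex_of_real (exp (- (\<tau> / 2)))"
    by (rule tendsto_add)
  then show ?thesis by (simp add: m_def)
qed

lemma block_decomposition:
  fixes w :: "int \<Rightarrow> real^'d"
  assumes "3 * l n \<le> r n"
  shows "block n 1 n w = blocks n 1 (r n) (r n - 3 * l n) (n div r n) w +
    (blocks n (1 + int (r n - 3 * l n)) (r n) (3 * l n) (n div r n) w + block n (1 + int (n div r n * r n)) (n mod r n) w)"
proof -
  define f where "f i = eta n (1 + int i) w" for i :: nat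
  define m where "m = n div r n"
  have b: "block n (1 + int a) k w = sum f {a..<a + k}" for a k
    unfolding block_def f_def sum_shift_lessThan by (simp add: add.assoc)
  have n: "n = m * r n + n mod r n" by (simp add: m_def)
  have "block n 1 n w = sum f {0..<n}" using b[of 0 n] by simp
  also have "\<dots> = sum f {0..<m * r n} + sum f {m * r n..<n}"
    using n by (intro sum.atLeastLessThan_concat[symmetric]) auto
  also have "sum f {m * r n..<n} = block n (1 + int (m * r n)) (n mod r n) w" unfolding b using n by simp
  also have "sum f {0..<m * r n} = (\<Sum>j<m. sum f {j * r n..<j * r n + r n})"
    by (simp add: sum.nat_group atLeast0LessThan)
  also have "\<dots> = (\<Sum>j<m. sum f {j * r n..<j * r n + (r n - 3 * l n)} + sum f {j * r n + (r n - 3 * l n)..<j * r n + r n})"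
    by (intro sum.cong refl sum.atLeastLessThan_concat[symmetric]) auto
  also have "\<dots> = blocks n 1 (r n) (r n - 3 * l n) m w + blocks n (1 + int (r n - 3 * l n)) (r n) (3 * l n) m w"
  proof -
    have 1: "block n (1 + int j * int (r n)) (r n - 3 * l n) w = sum f {j * r n..<j * r n + (r n - 3 * l n)}" for j
      using b[of "j * r n"] by simp
    have 2: "block n (1 + int (r n - 3 * l n) + int j * int (r n)) (3 * l n) w = sum f {j * r n + (r n - 3 * l n)..<j * r n + r n}" for j
    proof -
      have "1 + int (r n - 3 * l n) + int j * int (r n) = 1 + int (j * r n + (r n - 3 * l n))" by (simp only: of_nat_add of_nat_mult ac_simps)
      moreover have "j * r n + (r n - 3 * l n) + 3 * l n = j * r n + r n" using assms by simp
      ultimately show ?thesis using b[of "j * r n + (r n - 3 * l n)" "3 * l n"] by (simp only:)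
    qed
    show ?thesis unfolding blocks_def 1 2 by (rule sum.distrib)
  qed
  finally show ?thesis by (simp add: m_def)
qed

lemma block_second_moment: "(\<integral>\<omega>. (block n a k (XP \<omega>))\<^sup>2 \<partial>M) = second_moment n k"
proof -
  have "(\<lambda>w. (block n 0 k w)\<^sup>2) \<in> borel_measurable borel" by measurable
  from integral_shift[OF this, of a] show ?thesis
    unfolding block_shift[of n 0 k "XP _" a] by (simp add: second_moment_def)
qed

lemma block_abs_mean:
  assumes n: "n \<ge> 1" shows "(\<integral>\<omega>. \<bar>block n a k (XP \<omega>)\<bar> \<partial>M) \<le> sqrt (second_moment n k)"
proof -
  have B: "\<bar>block n a k w\<bar> \<le> real k * (2 * K) / sqrt (real n * v n)" for w
    using block_bound[OF n, of k "\<lambda>t. w (t + a)"] unfolding block_shift by simp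
  have 1: "integrable M (\<lambda>\<omega>. block n a k (XP \<omega>))"
    by (rule M.integrable_const_bound) (use B in auto)
  have "(block n a k w)\<^sup>2 \<le> (real k * (2 * K) / sqrt (real n * v n))\<^sup>2" for w
    using power_mono[OF B abs_ge_zero, of w 2] by simp
  then have 2: "integrable M (\<lambda>\<omega>. (block n a k (XP \<omega>))\<^sup>2)"
    by (intro M.integrable_const_bound[where B="(real k * (2 * K) / sqrt (real n * v n))\<^sup>2"]) auto
  show ?thesis using M.expectation_abs_le_sqrt[OF 1 2] unfolding block_second_moment .
qed

lemma blocks_tendsto:
  assumes k: "\<forall>\<^sub>F n in sequentially. 1 \<le> k n \<and> k n \<le> r n"
    and sep: "\<forall>\<^sub>F n in sequentially. k n + 2 * s n + l n \<le> r n"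
    and lim: "(\<lambda>n. real (n div r n) * second_moment n (k n)) \<longlonglongrightarrow> \<tau>"
  shows "(\<lambda>n. \<integral>\<omega>. iexp (blocks n (q n) (r n) (k n) (n div r n) (XP \<omega>)) \<partial>M) \<longlonglongrightarrow> complex_of_real (exp (- (\<tau> / 2)))"
proof -
  have "(\<lambda>n. (\<integral>\<omega>. iexp (blocks n (q n) (r n) (k n) (n div r n) (XP \<omega>)) \<partial>M) - cf n (k n) ^ (n div r n)) \<longlonglongrightarrow> 0"
  proof (rule Lim_null_comparison)
    show "(\<lambda>n. 8 * (real (n div r n) * beta_mixing M X (l n))) \<longlonglongrightarrow> 0"
      using tendsto_mult_left[OF blocks_beta, of 8] by simp
    show "\<forall>\<^sub>F n in sequentially. norm ((\<integral>\<omega>. iexp (blocks n (q n) (r n) (k n) (n div r n) (XP \<omega>)) \<partial>M) - cf n (k n) ^ (n div r n)) \<le>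
        8 * (real (n div r n) * beta_mixing M X (l n))"
      using sep
    proof eventually_elim
      case (elim n)
      show ?case using blocks_nearly_independent[OF elim, of "q n" "n div r n"] by (simp only: mult.assoc)
    qed
  qed
  from tendsto_add[OF this cf_power_tendsto[OF k lim]] show ?thesis by simp
qed

theorem cluster_array_clt:
  "(\<lambda>n. \<integral>\<omega>. iexp (block n 1 n (XP \<omega>)) \<partial>M) \<longlonglongrightarrow> complex_of_real (exp (- ((\<gamma> 0 + 2 * (\<Sum>j. \<gamma> (Suc j))) / 2)))"
proof -
  \<comment> \<open>A gap of \<open>3 * l n\<close> accommodates the windows on both of its sides,
    as \<open>s n \<le> l n\<close>, and a mixing distance \<open>l n\<close>.\<close>
  define kb where "kb n = r n - 3 * l n" for n
  define kg where "kg n = 3 * l n" for n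
  define \<sigma>2 where "\<sigma>2 = \<gamma> 0 + 2 * (\<Sum>j. \<gamma> (Suc j))"
  obtain C where C: "\<forall>\<^sub>F n in sequentially. \<forall>k. 1 \<le> k \<and> k \<le> r n \<longrightarrow> \<bar>var_factor n k\<bar> \<le> C"
    using var_factor_bounded by blast
  \<comment> \<open>Separating the gaps from each other requires \<open>6 * l n \<le> r n\<close>;
    the factor 8 leaves some slack.\<close>
  have ev: "\<forall>\<^sub>F n in sequentially. n \<ge> 1 \<and> r n \<ge> 1 \<and> 8 * l n \<le> r n \<and> 1 \<le> l n \<and> s n \<le> l n"
  proof -
    have "\<forall>\<^sub>F n in sequentially. real (l n) / real (r n) < 1 / 8" by (rule order_tendstoD(2)[OF l_over_r]) simp
    moreover have "\<forall>\<^sub>F n in sequentially. 1 \<le> s n" using S_facts(1) unfolding filterlim_at_top by blast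
    ultimately show ?thesis using r_pos eventually_ge_at_top[of 1]
    proof eventually_elim
      case (elim n)
      have "s n \<le> l n" by (rule S_facts(3)) (use elim in simp)
      moreover have "8 * real (l n) \<le> real (r n)" using elim by (simp add: pos_divide_less_eq)
      then have "8 * l n \<le> r n" by linarith
      ultimately show ?case using elim by simp
    qed
  qed
  have kb: "\<forall>\<^sub>F n in sequentially. 1 \<le> kb n \<and> kb n \<le> r n" and kg: "\<forall>\<^sub>F n in sequentially. 1 \<le> kg n \<and> kg n \<le> r n"
    and sb: "\<forall>\<^sub>F n in sequentially. kb n + 2 * s n + l n \<le> r n" and sg: "\<forall>\<^sub>F n in sequentially. kg n + 2 * s n + l n \<le> r n"
    using ev by (auto elim!: eventually_mono simp: kb_def kg_def)
  have kb_top: "filterlim kb at_top sequentially"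
    by (rule filterlim_at_top_mono[OF S_facts(1)]) (use ev in \<open>auto elim!: eventually_mono simp: kb_def\<close>)
  have sm_eq: "\<forall>\<^sub>F n in sequentially. real (n div r n) * second_moment n (k n) = (real (n div r n) * real (r n) / real n) * (real (k n) / real (r n)) * var_factor n (k n)"
    if "\<forall>\<^sub>F n in sequentially. 1 \<le> k n \<and> k n \<le> r n" for k
    using that ev
  proof eventually_elim
    case (elim n)
    then have e: "second_moment n (k n) = real (k n) / real n * var_factor n (k n)" by (intro second_moment_eq) auto
    show ?case unfolding e using elim by (simp add: field_simps)
  qed
  have big: "(\<lambda>n. real (n div r n) * second_moment n (kb n)) \<longlonglongrightarrow> \<sigma>2"
  proof -
    have "(\<lambda>n. 1 - 3 * (real (l n) / real (r n))) \<longlonglongrightarrow> 1 - 3 * 0" by (intro tendsto_intros l_over_r)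
    moreover have "\<forall>\<^sub>F n in sequentially. 1 - 3 * (real (l n) / real (r n)) = real (kb n) / real (r n)"
      using ev by eventually_elim (simp add: kb_def of_nat_diff field_simps)
    ultimately have "(\<lambda>n. real (kb n) / real (r n)) \<longlonglongrightarrow> 1" by (simp add: Lim_transform_eventually)
    moreover have "(\<lambda>n. var_factor n (kb n)) \<longlonglongrightarrow> \<sigma>2"
      unfolding \<sigma>2_def by (rule var_factor_tendsto[OF kb_top]) (use kb in \<open>auto elim: eventually_mono\<close>)
    ultimately have "(\<lambda>n. (real (n div r n) * real (r n) / real n) * (real (kb n) / real (r n)) * var_factor n (kb n)) \<longlonglongrightarrow> 1 * 1 * \<sigma>2"
      by (intro tendsto_mult blocks_ratio)
    then show ?thesis by (simp add: tendsto_cong[OF sm_eq[OF kb]])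
  qed
  \<comment> \<open>The gaps fill the share \<open>3 * l n / r n\<close> of each period, so their
    second moments add up to a vanishing quantity.\<close>
  have gap: "(\<lambda>n. real (n div r n) * second_moment n (kg n)) \<longlonglongrightarrow> 0"
  proof -
    have "(\<lambda>n. (real (n div r n) * real (r n) / real n) * (3 * (real (l n) / real (r n))) * \<bar>C\<bar>) \<longlonglongrightarrow> 1 * (3 * 0) * \<bar>C\<bar>"
      by (intro tendsto_intros blocks_ratio l_over_r)
    then have z: "(\<lambda>n. (real (n div r n) * real (r n) / real n) * (3 * (real (l n) / real (r n))) * \<bar>C\<bar>) \<longlonglongrightarrow> 0" by simp
    have "(\<lambda>n. (real (n div r n) * real (r n) / real n) * (real (kg n) / real (r n)) * var_factor n (kg n)) \<longlonglongrightarrow> 0"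
    proof (rule Lim_null_comparison[OF _ z])
      show "\<forall>\<^sub>F n in sequentially. norm ((real (n div r n) * real (r n) / real n) * (real (kg n) / real (r n)) * var_factor n (kg n)) \<le>
          (real (n div r n) * real (r n) / real n) * (3 * (real (l n) / real (r n))) * \<bar>C\<bar>"
        using C kg
      proof eventually_elim
        case (elim n)
        then have "\<bar>var_factor n (kg n)\<bar> \<le> \<bar>C\<bar>" by (meson abs_ge_self order_trans)
        then have "(real (n div r n) * real (r n) / real n) * (real (kg n) / real (r n)) * \<bar>var_factor n (kg n)\<bar> \<le>
            (real (n div r n) * real (r n) / real n) * (real (kg n) / real (r n)) * \<bar>C\<bar>"
          by (intro mult_left_mono) auto
        then show ?case by (simp add: abs_mult kg_def)
      qed
    qed
    then show ?thesis by (simp add: tendsto_cong[OF sm_eq[OF kg]])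
  qed
  define S1 where "S1 n \<omega> = blocks n 1 (r n) (kb n) (n div r n) (XP \<omega>)" for n \<omega>
  define S2 where "S2 n \<omega> = blocks n (1 + int (kb n)) (r n) (kg n) (n div r n) (XP \<omega>)" for n \<omega>
  define S3 where "S3 n \<omega> = block n (1 + int (n div r n * r n)) (n mod r n) (XP \<omega>)" for n \<omega>
  have [measurable]: "S1 n \<in> borel_measurable M" "S2 n \<in> borel_measurable M" "S3 n \<in> borel_measurable M" for n
    unfolding S1_def[abs_def] S2_def[abs_def] S3_def[abs_def] by (rule block_X_measurable)+
  have l1: "(\<lambda>n. \<integral>\<omega>. iexp (S1 n \<omega>) \<partial>M) \<longlonglongrightarrow> complex_of_real (exp (- (\<sigma>2 / 2)))"
    unfolding S1_def by (rule blocks_tendsto[OF kb sb big])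
  have l2: "(\<lambda>n. \<integral>\<omega>. norm (iexp (S2 n \<omega>) - 1) \<partial>M) \<longlonglongrightarrow> 0"
  proof (rule Lim_null_comparison)
    have "(\<lambda>n. \<integral>\<omega>. iexp (S2 n \<omega>) \<partial>M) \<longlonglongrightarrow> complex_of_real (exp (- (0 / 2)))"
      unfolding S2_def by (rule blocks_tendsto[OF kg sg gap])
    then have "(\<lambda>n. sqrt (2 - 2 * Re (\<integral>\<omega>. iexp (S2 n \<omega>) \<partial>M))) \<longlonglongrightarrow> sqrt (2 - 2 * Re (complex_of_real (exp (- (0 / 2)))))"
      by (intro tendsto_intros)
    then show "(\<lambda>n. sqrt (2 - 2 * Re (\<integral>\<omega>. iexp (S2 n \<omega>) \<partial>M))) \<longlonglongrightarrow> 0" by simp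
    have "norm (\<integral>\<omega>. norm (iexp (S2 n \<omega>) - 1) \<partial>M) = (\<integral>\<omega>. norm (iexp (S2 n \<omega>) - 1) \<partial>M)" for n
      by (simp only: real_norm_def) (intro abs_of_nonneg Bochner_Integration.integral_nonneg, simp)
    then show "\<forall>\<^sub>F n in sequentially. norm (\<integral>\<omega>. norm (iexp (S2 n \<omega>) - 1) \<partial>M) \<le> sqrt (2 - 2 * Re (\<integral>\<omega>. iexp (S2 n \<omega>) \<partial>M))"
      using M.expectation_iexp_minus_1_le[of "S2 _"] by (intro always_eventually allI) simp
  qed
  \<comment> \<open>The remainder is shorter than one period, so for large \<open>n\<close> its
    second moment is at most a constant times \<open>r n / n\<close>.\<close>
  have l3: "(\<lambda>n. \<integral>\<omega>. norm (iexp (S3 n \<omega>) - 1) \<partial>M) \<longlonglongrightarrow> 0"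
  proof (rule Lim_null_comparison)
    have "(\<lambda>n. sqrt (real (r n) / real n * \<bar>C\<bar>)) \<longlonglongrightarrow> sqrt (0 * \<bar>C\<bar>)" by (intro tendsto_intros r_over_n)
    then show "(\<lambda>n. sqrt (real (r n) / real n * \<bar>C\<bar>)) \<longlonglongrightarrow> 0" by simp
    show "\<forall>\<^sub>F n in sequentially. norm (\<integral>\<omega>. norm (iexp (S3 n \<omega>) - 1) \<partial>M) \<le> sqrt (real (r n) / real n * \<bar>C\<bar>)"
      using C ev
    proof eventually_elim
      case (elim n)
      let ?k = "n mod r n"
      have n: "n \<ge> 1" using elim by simp
      have sm: "second_moment n ?k \<le> real (r n) / real n * \<bar>C\<bar>"
      proof (cases "?k = 0")
        case True
        then show ?thesis by (simp add: second_moment_def block_def)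
      next
        case False
        have kr: "?k \<le> r n" using elim by (simp add: less_imp_le)
        have "second_moment n ?k = real ?k / real n * var_factor n ?k" by (rule second_moment_eq[OF n]) (use False in simp)
        also have "\<dots> \<le> real ?k / real n * \<bar>C\<bar>"
        proof (intro mult_left_mono)
          have "\<bar>var_factor n ?k\<bar> \<le> C" using elim kr False by simp
          then show "var_factor n ?k \<le> \<bar>C\<bar>" by linarith
        qed simp
        also have "\<dots> \<le> real (r n) / real n * \<bar>C\<bar>" using kr by (intro mult_right_mono divide_right_mono) auto
        finally show ?thesis .
      qed
      have iS3: "integrable M (\<lambda>\<omega>. \<bar>S3 n \<omega>\<bar>)"
      proof -
        have "\<bar>S3 n \<omega>\<bar> \<le> real ?k * (2 * K) / sqrt (real n * v n)" for \<omega>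
          unfolding S3_def using block_bound[OF n, of ?k "\<lambda>t. X (t + (1 + int (n div r n * r n))) \<omega>"]
          unfolding block_shift[of n 0 ?k "XP \<omega>"] by simp
        then show ?thesis by (intro M.integrable_const_bound[where B="real ?k * (2 * K) / sqrt (real n * v n)"]) auto
      qed
      have "(\<integral>\<omega>. norm (iexp (S3 n \<omega>) - 1) \<partial>M) \<le> (\<integral>\<omega>. \<bar>S3 n \<omega>\<bar> \<partial>M)"
      proof (rule integral_mono[OF _ iS3])
        show "integrable M (\<lambda>\<omega>. norm (iexp (S3 n \<omega>) - 1))"
          by (rule M.integrable_const_bound[where B=2]) (simp_all add: norm_iexp_minus_1_le_2)
      qed (rule norm_iexp_minus_1_le)
      also have "\<dots> \<le> sqrt (second_moment n ?k)" unfolding S3_def by (rule block_abs_mean[OF n])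
      also have "\<dots> \<le> sqrt (real (r n) / real n * \<bar>C\<bar>)" using sm by simp
      finally have "(\<integral>\<omega>. norm (iexp (S3 n \<omega>) - 1) \<partial>M) \<le> sqrt (real (r n) / real n * \<bar>C\<bar>)" .
      moreover have "0 \<le> (\<integral>\<omega>. norm (iexp (S3 n \<omega>) - 1) \<partial>M)" by (intro Bochner_Integration.integral_nonneg) simp
      ultimately show ?case by (simp only: real_norm_def abs_of_nonneg)
    qed
  qed
  have "(\<lambda>n. (\<integral>\<omega>. iexp (block n 1 n (XP \<omega>)) \<partial>M) - (\<integral>\<omega>. iexp (S1 n \<omega>) \<partial>M)) \<longlonglongrightarrow> 0"
  proof (rule Lim_null_comparison)
    show "(\<lambda>n. (\<integral>\<omega>. norm (iexp (S2 n \<omega>) - 1) \<partial>M) + (\<integral>\<omega>. norm (iexp (S3 n \<omega>) - 1) \<partial>M)) \<longlonglongrightarrow> 0"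
      using tendsto_add[OF l2 l3] by simp
    show "\<forall>\<^sub>F n in sequentially. norm ((\<integral>\<omega>. iexp (block n 1 n (XP \<omega>)) \<partial>M) - (\<integral>\<omega>. iexp (S1 n \<omega>) \<partial>M)) \<le>
        (\<integral>\<omega>. norm (iexp (S2 n \<omega>) - 1) \<partial>M) + (\<integral>\<omega>. norm (iexp (S3 n \<omega>) - 1) \<partial>M)"
      using ev
    proof eventually_elim
      case (elim n)
      have d: "block n 1 n (XP \<omega>) = S1 n \<omega> + (S2 n \<omega> + S3 n \<omega>)" for \<omega>
        unfolding S1_def S2_def S3_def kb_def kg_def by (rule block_decomposition) (use elim in simp)
      have i: "integrable M (\<lambda>\<omega>. norm (iexp (f \<omega>) - 1))" if [measurable]: "f \<in> borel_measurable M" for f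
        by (rule M.integrable_const_bound[where B=2]) (simp_all add: norm_iexp_minus_1_le_2)
      have "norm ((\<integral>\<omega>. iexp (block n 1 n (XP \<omega>)) \<partial>M) - (\<integral>\<omega>. iexp (S1 n \<omega>) \<partial>M)) \<le> (\<integral>\<omega>. norm (iexp (S2 n \<omega> + S3 n \<omega>) - 1) \<partial>M)"
        unfolding d by (rule M.norm_expectation_iexp_diff) measurable
      also have "\<dots> \<le> (\<integral>\<omega>. norm (iexp (S2 n \<omega>) - 1) + norm (iexp (S3 n \<omega>) - 1) \<partial>M)"
      proof (rule integral_mono)
        show "integrable M (\<lambda>\<omega>. norm (iexp (S2 n \<omega> + S3 n \<omega>) - 1))" by (rule i) measurable
        show "integrable M (\<lambda>\<omega>. norm (iexp (S2 n \<omega>) - 1) + norm (iexp (S3 n \<omega>) - 1))"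
          by (intro Bochner_Integration.integrable_add i) measurable
        fix \<omega>
        have "iexp (S2 n \<omega> + S3 n \<omega>) - 1 = iexp (S2 n \<omega>) * (iexp (S3 n \<omega>) - 1) + (iexp (S2 n \<omega>) - 1)"
          by (simp add: distrib_left exp_add right_diff_distrib)
        then have "norm (iexp (S2 n \<omega> + S3 n \<omega>) - 1) \<le> norm (iexp (S2 n \<omega>) * (iexp (S3 n \<omega>) - 1)) + norm (iexp (S2 n \<omega>) - 1)"
          by (simp only: norm_triangle_ineq)
        then show "norm (iexp (S2 n \<omega> + S3 n \<omega>) - 1) \<le> norm (iexp (S2 n \<omega>) - 1) + norm (iexp (S3 n \<omega>) - 1)"
          by (simp add: norm_mult)
      qed
      also have "\<dots> = (\<integral>\<omega>. norm (iexp (S2 n \<omega>) - 1) \<partial>M) + (\<integral>\<omega>. norm (iexp (S3 n \<omega>) - 1) \<partial>M)"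
        by (rule Bochner_Integration.integral_add) (rule i, measurable)+
      finally show ?case .
    qed
  qed
  from tendsto_add[OF this l1] show ?thesis by (simp add: \<sigma>2_def)
qed

end

section \<open>The projection based estimator\<close>

lemma has_sum_sum:
  fixes f :: "'i \<Rightarrow> 'a \<Rightarrow> 'b::topological_comm_monoid_add"
  assumes "\<And>i. i \<in> I \<Longrightarrow> (f i has_sum S i) A"
  shows "((\<lambda>x. \<Sum>i\<in>I. f i x) has_sum (\<Sum>i\<in>I. S i)) A"
  using assms by (induction I rule: infinite_finite_induct) (auto intro: has_sum_add)

text \<open>The block variance produces the one-sided form, whereas the covariance function is a sum
  over all integers; evenness of the summand reconciles them.\<close>

lemma infsum_int_even:
  fixes G :: "int \<Rightarrow> real"
  assumes even: "\<And>j. G (- j) = G j" and su: "summable (\<lambda>k. \<bar>G (int k)\<bar>)"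
  shows "(\<Sum>\<^sub>\<infinity>j. G j) = G 0 + 2 * (\<Sum>k. G (int (Suc k)))"
proof -
  let ?t = "\<lambda>k. G (int (Suc k))"
  define T where "T = (\<Sum>k. ?t k)"
  have su': "summable (\<lambda>k. norm (?t k))"
    using summable_Suc_iff[of "\<lambda>k. \<bar>G (int k)\<bar>"] su by simp
  have T: "(?t has_sum T) UNIV" "?t sums T"
    using norm_summable_imp_has_sum[OF su' summable_sums[OF summable_norm_cancel[OF su']]]
      summable_sums[OF summable_norm_cancel[OF su']] by (simp_all add: T_def)
  have "(\<lambda>k. G (int k)) sums (T + G 0)" using sums_Suc_iff[of "\<lambda>k. G (int k)" T] T(2) by simp
  then have 1: "((\<lambda>k. G (int k)) has_sum (T + G 0)) UNIV"
    using su by (intro norm_summable_imp_has_sum) simp_all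
  have "(G has_sum (T + G 0)) (range int)"
    using 1 by (subst has_sum_reindex) (simp_all add: o_def)
  moreover have "(G has_sum T) (range (\<lambda>k. - int (Suc k)))"
  proof (subst has_sum_reindex)
    show "inj (\<lambda>k. - int (Suc k))" by (simp add: inj_def)
    have "G \<circ> (\<lambda>k. - int (Suc k)) = ?t" by (simp only: o_def even)
    then show "(G \<circ> (\<lambda>k. - int (Suc k)) has_sum T) UNIV" using T(1) by simp
  qed
  moreover have "range int \<inter> range (\<lambda>k. - int (Suc k)) = {}" by auto
  ultimately have "(G has_sum (T + G 0 + T)) (range int \<union> range (\<lambda>k. - int (Suc k)))" by (rule has_sum_Un_disjoint)
  moreover have "range int \<union> range (\<lambda>k. - int (Suc k)) = UNIV"
  proof -
    have "j \<in> range int \<union> range (\<lambda>k. - int (Suc k))" for j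
      by (cases j) auto
    then show ?thesis by blast
  qed
  ultimately show ?thesis by (simp add: infsumI T_def)
qed

section \<open>Joint limit of the centred sums\<close>

context extremal_setting begin

definition "g_mean i n A = (\<integral>\<omega>. g_path i (s n) (u n) A (XP \<omega>) \<partial>M)"
definition "g_sum i n A \<omega> = (\<Sum>k<n. g_path i (s n) (u n) A (\<lambda>h. X (h + (1 + int k)) \<omega>) - g_mean i n A) / sqrt (real n * v n)"

lemma g_path_path_measurable:
  assumes "A \<in> sets borel" shows "g_path i S U A \<in> borel_measurable borel"
  using g_path_measurable[where Z="\<lambda>t w. w t" and S=S and P=borel and A=A and i=i and U=U] measurable_coordinate assms by simp

lemma g_path_X_measurable:
  assumes "A \<in> sets borel" shows "(\<lambda>\<omega>. g_path i S U A (\<lambda>h. X (h + t) \<omega>)) \<in> borel_measurable M"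
  by (rule g_path_measurable[OF _ assms]) simp

lemma g_sum_measurable:
  assumes "A \<in> sets borel" shows "g_sum i n A \<in> borel_measurable M"
  unfolding g_sum_def[abs_def]
  by (intro borel_measurable_divide borel_measurable_sum borel_measurable_diff borel_measurable_const g_path_X_measurable assms)

text \<open>Evenness is shown for the quadratic form rather than termwise: before the limit,
  stationarity turns lag \<open>- j\<close> for the pair \<open>A\<close>, \<open>B\<close> into lag
  \<open>j\<close> for \<open>B\<close>, \<open>A\<close>. Summation over both sets restores the
  symmetry.\<close>

lemma cov_summand_quadratic_even:
  assumes J: "finite J" "J \<subseteq> sets borel" "\<And>A. A \<in> J \<Longrightarrow> AE \<omega> in M'. \<Theta> i \<omega> \<notin> frontier A"
  shows "(\<Sum>A\<in>J. \<Sum>B\<in>J. b A * b B * cov_summand i A B (- j)) = (\<Sum>A\<in>J. \<Sum>B\<in>J. b A * b B * cov_summand i A B j)"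
proof -
  have "cov_summand i A B (- j) = cov_summand i B A j" if "A \<in> J" "B \<in> J" for A B
  proof -
    have [measurable]: "A \<in> sets borel" "B \<in> sets borel" using that J(2) by blast+
    let ?g = "\<lambda>n. g_path i (s n) (u n)"
    have "(\<integral>\<omega>. ?g n A (XP \<omega>) * ?g n B (\<lambda>t. X (t + - j) \<omega>) \<partial>M) = (\<integral>\<omega>. ?g n B (XP \<omega>) * ?g n A (\<lambda>t. X (t + j) \<omega>) \<partial>M)" for n
    proof -
      have [measurable]: "?g n A \<in> borel_measurable borel" "?g n B \<in> borel_measurable borel" by (rule g_path_path_measurable, measurable)+
      have "(\<lambda>w. ?g n B w * ?g n A (\<lambda>t. w (t + j))) \<in> borel_measurable borel" by measurable
      from integral_shift[OF this, of "- j"] show ?thesis by (simp add: mult.commute)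
    qed
    note shift = this
    have "(\<lambda>n. (\<integral>\<omega>. ?g n A (XP \<omega>) * ?g n B (\<lambda>t. X (t + - j) \<omega>) \<partial>M) / v n) \<longlonglongrightarrow> cov_summand i A B (- j)"
      by (rule g_path_tendsto) (use that J in auto)
    moreover have "(\<lambda>n. (\<integral>\<omega>. ?g n A (XP \<omega>) * ?g n B (\<lambda>t. X (t + - j) \<omega>) \<partial>M) / v n) \<longlonglongrightarrow> cov_summand i B A j"
      unfolding shift by (rule g_path_tendsto) (use that J in auto)
    ultimately show ?thesis by (rule LIMSEQ_unique)
  qed
  then have "(\<Sum>A\<in>J. \<Sum>B\<in>J. b A * b B * cov_summand i A B (- j)) = (\<Sum>A\<in>J. \<Sum>B\<in>J. b A * b B * cov_summand i B A j)"
    by (intro sum.cong refl) simp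
  also have "\<dots> = (\<Sum>A\<in>J. \<Sum>B\<in>J. b A * b B * cov_summand i A B j)"
    by (subst sum.swap) (intro sum.cong refl, simp)
  finally show ?thesis .
qed

lemma cov_fun_eq: "cov_fun M' N \<alpha> i \<Theta> A B = (\<Sum>\<^sub>\<infinity>j. cov_summand i A B j)"
  by (simp only: cov_fun_def cov_summand_def \<Theta>P_def)

lemma cov_summand_summable:
  assumes "A \<in> sets borel" "B \<in> sets borel"
  shows "(\<lambda>j. cov_summand i A B j) summable_on UNIV" "summable (\<lambda>k. cov_summand i A B (int k))"
proof -
  note b = cov_summand_bound[OF assms, of i]
  show "summable (\<lambda>k. cov_summand i A B (int k))"
    by (rule summable_comparison_test'[OF summable_pY, of 0]) (simp add: b)
  have "pY summable_on UNIV" using summable_pY by (intro summable_on_int_nonneg) (simp_all add: pY_uminus)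
  then show "(\<lambda>j. cov_summand i A B j) summable_on UNIV"
    by (rule summable_on_comparison_test) (simp_all add: b)
qed

text \<open>The coefficients may vary with \<open>n\<close> because the centring of the estimator
  does. Being convergent they are bounded, which provides the constant \<open>K\<close> of the
  array, and by linearity the lagged moments converge to a quadratic form in the covariance
  summands.\<close>

theorem g_sum_combination_clt:
  assumes J: "finite J" "J \<subseteq> sets borel" "\<And>A. A \<in> J \<Longrightarrow> AE \<omega> in M'. \<Theta> i \<omega> \<notin> frontier A"
    and b: "\<And>A. A \<in> J \<Longrightarrow> (\<lambda>n. b n A) \<longlonglongrightarrow> b' A"
  shows "(\<lambda>n. \<integral>\<omega>. iexp (\<Sum>A\<in>J. b n A * g_sum i n A \<omega>) \<partial>M) \<longlonglongrightarrow>
    complex_of_real (exp (- ((\<Sum>A\<in>J. \<Sum>B\<in>J. b' A * b' B * cov_fun M' N \<alpha> i \<Theta> A B) / 2)))"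
proof -
  define \<phi> where "\<phi> n w = (\<Sum>A\<in>J. b n A * g_path i (s n) (u n) A w)" for n and w :: "int \<Rightarrow> real^'d"
  define G where "G j = (\<Sum>A\<in>J. \<Sum>B\<in>J. b' A * b' B * cov_summand i A B j)" for j
  have gm: "g_path i S U A \<in> borel_measurable borel" if "A \<in> J" for A S U
    using that J(2) by (intro g_path_path_measurable) auto
  have "\<exists>k. \<forall>n. \<bar>b n A\<bar> \<le> k" if "A \<in> J" for A
    using convergent_imp_Bseq[of "\<lambda>n. b n A"] b[OF that] by (auto simp: convergent_def Bseq_def)
  then obtain k where k: "\<And>A n. A \<in> J \<Longrightarrow> \<bar>b n A\<bar> \<le> k A" by metis
  define K where "K = (\<Sum>A\<in>J. k A)"
  have phi_meas: "\<phi> n \<in> borel_measurable borel" for n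
    unfolding \<phi>_def[abs_def] by (intro borel_measurable_sum borel_measurable_times borel_measurable_const gm)
  have arr: "cluster_array N M M' \<alpha> X Y u s l r \<phi> K (\<lambda>j. G (int j))"
  proof (intro cluster_array.intro cluster_array_axioms.intro)
    show "extremal_setting N M M' \<alpha> X Y u s l r" by unfold_locales
    show "\<phi> n \<in> borel_measurable borel" for n by (rule phi_meas)
    show "(\<lambda>\<omega>. \<phi> n (\<lambda>h. X (h + t) \<omega>)) \<in> borel_measurable (sigma_gen M X {t - int (s n)..t + int (s n)})" for n t
      unfolding \<phi>_def
    proof (intro borel_measurable_sum borel_measurable_times borel_measurable_const)
      fix A assume A: "A \<in> J"
      show "(\<lambda>\<omega>. g_path i (s n) (u n) A (\<lambda>h. X (h + t) \<omega>)) \<in> borel_measurable (sigma_gen M X {t - int (s n)..t + int (s n)})"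
        by (rule g_path_measurable) (use A J(2) in \<open>auto intro!: X_sigma_gen_measurable\<close>)
    qed
    show "0 \<le> K" unfolding K_def using k by (intro sum_nonneg) (meson abs_ge_zero order_trans)
    show "\<bar>\<phi> n w\<bar> \<le> K * of_bool (N (w 0) > u n)" if "n \<ge> 1" for n w
    proof -
      have "\<bar>\<phi> n w\<bar> \<le> (\<Sum>A\<in>J. \<bar>b n A * g_path i (s n) (u n) A w\<bar>)" unfolding \<phi>_def by (rule sum_abs)
      also have "\<dots> \<le> (\<Sum>A\<in>J. k A * of_bool (N (w 0) > u n))"
      proof (rule sum_mono)
        fix A assume A: "A \<in> J"
        have "\<bar>b n A\<bar> * \<bar>g_path i (s n) (u n) A w\<bar> \<le> k A * of_bool (N (w 0) > u n)"
          using g_path_bounds(1,2)[OF u_pos[OF that], of i "s n" A w] k[OF A, of n]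
          by (intro mult_mono) auto
        then show "\<bar>b n A * g_path i (s n) (u n) A w\<bar> \<le> k A * of_bool (N (w 0) > u n)" by (simp add: abs_mult)
      qed
      finally show ?thesis by (simp add: K_def sum_distrib_right)
    qed
    show "(\<lambda>n. (\<integral>\<omega>. \<phi> n (XP \<omega>) * \<phi> n (\<lambda>h. X (h + int j) \<omega>) \<partial>M) / v n) \<longlonglongrightarrow> G (int j)" for j
    proof (rule Lim_transform_eventually)
      let ?I = "\<lambda>n A B. (\<integral>\<omega>. g_path i (s n) (u n) A (XP \<omega>) * g_path i (s n) (u n) B (\<lambda>h. X (h + int j) \<omega>) \<partial>M)"
      show "(\<lambda>n. \<Sum>A\<in>J. \<Sum>B\<in>J. b n A * b n B * (?I n A B / v n)) \<longlonglongrightarrow> G (int j)"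
        unfolding G_def by (intro tendsto_sum tendsto_mult b g_path_tendsto) (use J in auto)
      show "\<forall>\<^sub>F n in sequentially. (\<Sum>A\<in>J. \<Sum>B\<in>J. b n A * b n B * (?I n A B / v n)) =
          (\<integral>\<omega>. \<phi> n (XP \<omega>) * \<phi> n (\<lambda>h. X (h + int j) \<omega>) \<partial>M) / v n"
        using eventually_ge_at_top[of 1]
      proof eventually_elim
        case (elim n)
        note gb = g_path_bounds[OF u_pos[OF elim], of i "s n"]
        have int: "integrable M (\<lambda>\<omega>. b n A * b n B * (g_path i (s n) (u n) A (XP \<omega>) * g_path i (s n) (u n) B (\<lambda>h. X (h + int j) \<omega>)))"
          if "A \<in> J" "B \<in> J" for A B
        proof (intro integrable_mult_right M.integrable_const_bound[where B=1])
          note [measurable] = gm[OF that(1)] gm[OF that(2)]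
          show "AE \<omega> in M. norm (g_path i (s n) (u n) A (XP \<omega>) * g_path i (s n) (u n) B (\<lambda>h. X (h + int j) \<omega>)) \<le> 1"
            using gb(1,3) by (auto simp: abs_mult intro!: mult_le_one)
          show "(\<lambda>\<omega>. g_path i (s n) (u n) A (XP \<omega>) * g_path i (s n) (u n) B (\<lambda>h. X (h + int j) \<omega>)) \<in> borel_measurable M"
            by measurable
        qed
        have "\<phi> n (XP \<omega>) * \<phi> n (\<lambda>h. X (h + int j) \<omega>) =
            (\<Sum>A\<in>J. \<Sum>B\<in>J. b n A * b n B * (g_path i (s n) (u n) A (XP \<omega>) * g_path i (s n) (u n) B (\<lambda>h. X (h + int j) \<omega>)))" for \<omega>
          unfolding \<phi>_def sum_product by (intro sum.cong refl) (simp only: ac_simps)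
        then have "(\<integral>\<omega>. \<phi> n (XP \<omega>) * \<phi> n (\<lambda>h. X (h + int j) \<omega>) \<partial>M) = (\<integral>\<omega>. (\<Sum>A\<in>J. \<Sum>B\<in>J. b n A * b n B * (g_path i (s n) (u n) A (XP \<omega>) * g_path i (s n) (u n) B (\<lambda>h. X (h + int j) \<omega>))) \<partial>M)"
          by (simp only:)
        also have "\<dots> = (\<Sum>A\<in>J. \<Sum>B\<in>J. b n A * b n B * ?I n A B)"
        proof (subst Bochner_Integration.integral_sum)
          show "integrable M (\<lambda>\<omega>. \<Sum>B\<in>J. b n A * b n B * (g_path i (s n) (u n) A (XP \<omega>) * g_path i (s n) (u n) B (\<lambda>h. X (h + int j) \<omega>)))" if "A \<in> J" for A
            by (rule Bochner_Integration.integrable_sum) (rule int[OF that])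
          show "(\<Sum>A\<in>J. \<integral>\<omega>. (\<Sum>B\<in>J. b n A * b n B * (g_path i (s n) (u n) A (XP \<omega>) * g_path i (s n) (u n) B (\<lambda>h. X (h + int j) \<omega>))) \<partial>M) =
              (\<Sum>A\<in>J. \<Sum>B\<in>J. b n A * b n B * ?I n A B)"
          proof (rule sum.cong[OF refl])
            fix A assume A: "A \<in> J"
            show "(\<integral>\<omega>. (\<Sum>B\<in>J. b n A * b n B * (g_path i (s n) (u n) A (XP \<omega>) * g_path i (s n) (u n) B (\<lambda>h. X (h + int j) \<omega>))) \<partial>M) =
              (\<Sum>B\<in>J. b n A * b n B * ?I n A B)"
              by (subst Bochner_Integration.integral_sum, rule int[OF A], assumption) (simp only: integral_mult_right_zero)
          qed
        qed
        finally show ?case by (simp add: sum_divide_distrib)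
      qed
    qed
  qed
  interpret C: cluster_array N M M' \<alpha> X Y u s l r \<phi> K "\<lambda>j. G (int j)" by (rule arr)
  have blk: "C.block n 1 n (XP \<omega>) = (\<Sum>A\<in>J. b n A * g_sum i n A \<omega>)" if "n \<ge> 1" for n \<omega>
  proof -
    have "integrable M (\<lambda>\<omega>. b n A * g_path i (s n) (u n) A (XP \<omega>))" if "A \<in> J" for A
    proof (intro integrable_mult_right M.integrable_const_bound[where B=1])
      note [measurable] = gm[OF that]
      show "(\<lambda>\<omega>. g_path i (s n) (u n) A (XP \<omega>)) \<in> borel_measurable M" by measurable
      show "AE \<omega> in M. norm (g_path i (s n) (u n) A (XP \<omega>)) \<le> 1"
        using g_path_bounds(1,3)[OF u_pos[OF \<open>n \<ge> 1\<close>]] by simp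
    qed
    note int = this
    have mu: "C.mu n = (\<Sum>A\<in>J. b n A * g_mean i n A)"
      unfolding C.mu_def \<phi>_def g_mean_def
      by (subst Bochner_Integration.integral_sum, rule int, assumption) (simp only: integral_mult_right_zero)
    have "C.block n 1 n (XP \<omega>) = (\<Sum>k<n. (\<Sum>A\<in>J. b n A * ((g_path i (s n) (u n) A (\<lambda>h. X (h + (1 + int k)) \<omega>) - g_mean i n A) / sqrt (real n * v n))))"
      unfolding C.block_def C.eta_def mu unfolding \<phi>_def
      by (simp only: sum_subtractf[symmetric] sum_divide_distrib right_diff_distrib[symmetric] times_divide_eq_right)
    also have "\<dots> = (\<Sum>A\<in>J. \<Sum>k<n. b n A * ((g_path i (s n) (u n) A (\<lambda>h. X (h + (1 + int k)) \<omega>) - g_mean i n A) / sqrt (real n * v n)))"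
      by (rule sum.swap)
    also have "\<dots> = (\<Sum>A\<in>J. b n A * g_sum i n A \<omega>)"
      by (simp only: g_sum_def sum_distrib_left[symmetric] sum_divide_distrib[symmetric])
    finally show ?thesis .
  qed
  have Gsum: "(\<Sum>A\<in>J. \<Sum>B\<in>J. b' A * b' B * cov_fun M' N \<alpha> i \<Theta> A B) = G (int 0) + 2 * (\<Sum>j. G (int (Suc j)))"
  proof -
    have "summable (\<lambda>k. \<bar>G (int k)\<bar>)"
    proof (rule summable_comparison_test'[where N=0])
      show "summable (\<lambda>k. \<Sum>A\<in>J. \<Sum>B\<in>J. \<bar>b' A * b' B\<bar> * cov_summand i A B (int k))"
        using J(2) by (intro summable_sum summable_mult cov_summand_summable(2)) auto
      show "norm \<bar>G (int k)\<bar> \<le> (\<Sum>A\<in>J. \<Sum>B\<in>J. \<bar>b' A * b' B\<bar> * cov_summand i A B (int k))" for k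
      proof -
        have "\<bar>G (int k)\<bar> \<le> (\<Sum>A\<in>J. \<Sum>B\<in>J. \<bar>b' A * b' B * cov_summand i A B (int k)\<bar>)"
          unfolding G_def by (intro order_trans[OF sum_abs] sum_mono order_trans[OF sum_abs] order_refl)
        also have "\<dots> = (\<Sum>A\<in>J. \<Sum>B\<in>J. \<bar>b' A * b' B\<bar> * cov_summand i A B (int k))"
        proof (intro sum.cong refl)
          fix A B assume "A \<in> J" "B \<in> J"
          then have "0 \<le> cov_summand i A B (int k)" using J(2) by (intro cov_summand_bound(1)) auto
          then show "\<bar>b' A * b' B * cov_summand i A B (int k)\<bar> = \<bar>b' A * b' B\<bar> * cov_summand i A B (int k)" by (simp add: abs_mult)
        qed
        finally show ?thesis by simp
      qed
    qed
    moreover have "G (- j) = G j" for j unfolding G_def by (rule cov_summand_quadratic_even[OF J])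
    ultimately have "(\<Sum>\<^sub>\<infinity>j. G j) = G 0 + 2 * (\<Sum>k. G (int (Suc k)))" by (intro infsum_int_even)
    moreover have "(\<Sum>\<^sub>\<infinity>j. G j) = (\<Sum>A\<in>J. \<Sum>B\<in>J. b' A * b' B * cov_fun M' N \<alpha> i \<Theta> A B)"
    proof -
      have "(G has_sum (\<Sum>A\<in>J. \<Sum>B\<in>J. b' A * b' B * cov_fun M' N \<alpha> i \<Theta> A B)) UNIV"
        unfolding G_def[abs_def] cov_fun_eq
        using J(2) by (intro has_sum_sum has_sum_cmult_right has_sum_infsum cov_summand_summable(1)) auto
      then show ?thesis by (rule infsumI)
    qed
    ultimately show ?thesis by simp
  qed
  have "\<forall>\<^sub>F n in sequentially. (\<integral>\<omega>. iexp (C.block n 1 n (XP \<omega>)) \<partial>M) = (\<integral>\<omega>. iexp (\<Sum>A\<in>J. b n A * g_sum i n A \<omega>) \<partial>M)"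
    using eventually_ge_at_top[of 1] by eventually_elim (simp only: blk)
  from Lim_transform_eventually[OF C.cluster_array_clt this] show ?thesis
    unfolding Gsum .
qed

end

text \<open>Turns terms centred by multiples of \<open>g c\<close> into a plain combination over
  \<open>insert c I\<close>. The coefficient is a sum of two conditional parts because
  \<open>c\<close> may itself belong to \<open>I\<close>, as the whole space may belong to the
  family of sets.\<close>

lemma sum_subtract_multiple:
  fixes a q g :: "'i \<Rightarrow> real"
  assumes "finite I"
  shows "(\<Sum>t\<in>insert c I. ((if t \<in> I then a t else 0) - (if t = c then \<Sum>t\<in>I. a t * q t else 0)) * g t) =
    (\<Sum>t\<in>I. a t * (g t - q t * g c))"
proof -
  have "(\<Sum>t\<in>insert c I. (if t \<in> I then a t else 0) * g t) = (\<Sum>t\<in>I. a t * g t)"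
    using assms by (intro sum.mono_neutral_cong_right) auto
  moreover have "(\<Sum>t\<in>insert c I. (if t = c then \<Sum>t\<in>I. a t * q t else 0) * g t) = (\<Sum>t\<in>insert c I. if t = c then (\<Sum>t\<in>I. a t * q t) * g t else 0)"
    by (intro sum.cong) auto
  moreover have "\<dots> = (\<Sum>t\<in>I. a t * q t) * g c" using assms by simp
  ultimately show ?thesis
    by (simp add: left_diff_distrib right_diff_distrib sum_subtractf sum_distrib_right mult.assoc)
qed

text \<open>The mean of \<open>min 1 \<bar>U\<bar>\<close> measures convergence to 0 in probability,
  and its integrand is a bounded continuous function of \<open>U\<close>, so Levy's theorem with
  limit 0 applies.\<close>

lemma (in prob_space) tendsto_0_in_prob_if_char_tendsto_1:
  fixes U :: "nat \<Rightarrow> 'a \<Rightarrow> real"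
  assumes U: "\<And>n. U n \<in> borel_measurable M" and conv: "\<And>t. (\<lambda>n. CLINT x|M. iexp (t * U n x)) \<longlonglongrightarrow> 1"
  shows "(\<lambda>n. expectation (\<lambda>x. min 1 \<bar>U n x\<bar>)) \<longlonglongrightarrow> 0"
proof -
  have "(\<lambda>n. expectation (\<lambda>x. min 1 \<bar>U n x\<bar>)) \<longlonglongrightarrow> expectation (\<lambda>x. min 1 \<bar>0\<bar>)"
  proof (rule expectation_tendsto_if_char_tendsto[where f="\<lambda>x. min 1 \<bar>x\<bar>" and B=1 and Z="\<lambda>_. 0" and M'=M])
    show "(\<lambda>n. CLINT x|M. iexp (t * U n x)) \<longlonglongrightarrow> (CLINT x|M. iexp (t * 0))" for t
      using conv[of t] by (simp add: prob_space)
    show "isCont (\<lambda>x::real. min 1 \<bar>x\<bar>) x" for x by (intro continuous_intros)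
  qed (use U prob_space_axioms in auto)
  then show ?thesis by simp
qed

text \<open>In the application \<open>T\<close> is the actual error, \<open>S\<close> its
  linearisation, \<open>U\<close> the centred denominator and \<open>k\<close> the fourth root of
  \<open>n * v n\<close>, so that \<open>S / k\<close> and \<open>U / k\<close> vanish in
  probability. If \<open>\<bar>U / k\<bar> < 1 / 2\<close>, the denominator exceeds 1/2 and
  \<open>\<bar>T - S\<bar>\<close> is at most \<open>\<bar>S / k\<bar>\<close>; otherwise the second
  term of the bound is at least 2.\<close>

lemma iexp_quotient_bound:
  fixes S T U k :: real
  assumes k: "k \<ge> 1" and T: "1 + U / (k * k) \<noteq> 0 \<Longrightarrow> T = S / (1 + U / (k * k))"
  shows "norm (iexp (T - S) - 1) \<le> 2 * min 1 \<bar>inverse k * S\<bar> + 4 * min 1 \<bar>inverse k * U\<bar>"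
proof -
  define x where "x = \<bar>inverse k * S\<bar>"
  define y where "y = \<bar>inverse k * U\<bar>"
  have xy: "x \<ge> 0" "y \<ge> 0" by (simp_all add: x_def y_def)
  have "norm (iexp (T - S) - 1) \<le> x" if y2: "y < 1 / 2"
  proof -
    define D where "D = 1 + U / (k * k)"
    have "\<bar>U / (k * k)\<bar> = y / k" using k by (simp add: y_def abs_mult divide_inverse)
    also have "\<dots> \<le> y" using k xy by (simp add: divide_le_eq mult_left_le mult_le_cancel_left1)
    finally have "\<bar>U / (k * k)\<bar> < 1 / 2" using y2 by linarith
    then have D: "D > 1 / 2" unfolding D_def by linarith
    then have "D \<noteq> 0" by simp
    then have "T = S / D" using T unfolding D_def by blast
    then have "(T - S) * D = S * (1 - D)" using \<open>D \<noteq> 0\<close> by (simp add: field_simps)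
    then have "\<bar>T - S\<bar> * D = \<bar>S * (1 - D)\<bar>" using D by (metis abs_mult abs_of_pos half_gt_zero_iff less_trans zero_less_one)
    also have "\<dots> = x * y" using k by (simp add: D_def x_def y_def abs_mult divide_inverse ac_simps)
    also have "\<dots> \<le> x * (1 / 2)" using xy y2 by (intro mult_left_mono) auto
    finally have "\<bar>T - S\<bar> * D \<le> x * (1 / 2)" .
    moreover have "\<bar>T - S\<bar> * (1 / 2) \<le> \<bar>T - S\<bar> * D" using D by (intro mult_left_mono) auto
    ultimately have "\<bar>T - S\<bar> * (1 / 2) \<le> x * (1 / 2)" by (rule order_trans[rotated])
    then have "\<bar>T - S\<bar> \<le> x" by simp
    then show ?thesis using norm_iexp_minus_1_le[of "T - S"] by linarith
  qed
  moreover note norm_iexp_minus_1_le_2[of "T - S"]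
  ultimately have "norm (iexp (T - S) - 1) \<le> 2 * min 1 x + 4 * min 1 y"
    using xy by (cases "y < 1 / 2"; cases "x < 1"; cases "y < 1") (auto simp: min_def)
  then show ?thesis unfolding x_def y_def .
qed

text \<open>The mean vanishes and the second moment of the combination is the quadratic form of
  \<open>c\<close>; comparison with the moments of a normal law identifies the variance. Degenerate
  combinations are covered.\<close>

lemma centered_gaussian_process_char:
  assumes M: "prob_space M" and Z: "centered_gaussian_process M T Z c" and J: "finite J" "J \<subseteq> T"
  shows "(\<integral>\<omega>. iexp (\<Sum>t\<in>J. b t * Z t \<omega>) \<partial>M) = complex_of_real (exp (- ((\<Sum>s\<in>J. \<Sum>t\<in>J. b s * b t * c s t) / 2)))"
proof -
  interpret prob_space M by fact
  have gp: "gaussian_process M T Z" and mean: "\<And>t. t \<in> T \<Longrightarrow> (\<integral>\<omega>. Z t \<omega> \<partial>M) = 0"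
    and cov: "\<And>s t. s \<in> T \<Longrightarrow> t \<in> T \<Longrightarrow> covariance M (Z s) (Z t) = c s t"
    using Z by (auto simp: centered_gaussian_process_def)
  have normal: "\<exists>m \<sigma>. normal_rv M (\<lambda>\<omega>. \<Sum>t\<in>I. a t * Z t \<omega>) m \<sigma>" if "finite I" "I \<subseteq> T" for I a
    using gp that unfolding gaussian_process_def by blast
  have Zm: "Z t \<in> borel_measurable M" if "t \<in> T" for t using gp that by (auto simp: gaussian_process_def)
  have sq: "integrable M (\<lambda>\<omega>. (Z t \<omega>)\<^sup>2)" "integrable M (Z t)" if t: "t \<in> T" for t
  proof -
    obtain m \<sigma> where "normal_rv M (\<lambda>\<omega>. \<Sum>t\<in>{t}. 1 * Z t \<omega>) m \<sigma>" using normal[of "{t}" "\<lambda>_. 1"] t by blast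
    then have "normal_rv M (Z t) m \<sigma>" by simp
    from normal_rv_moments(1,2)[OF M this] show "integrable M (\<lambda>\<omega>. (Z t \<omega>)\<^sup>2)" "integrable M (Z t)" .
  qed
  have prod: "integrable M (\<lambda>\<omega>. Z s \<omega> * Z t \<omega>)" if "s \<in> T" "t \<in> T" for s t
  proof (rule Bochner_Integration.integrable_bound)
    show "integrable M (\<lambda>\<omega>. (Z s \<omega>)\<^sup>2 + (Z t \<omega>)\<^sup>2)" by (intro Bochner_Integration.integrable_add sq that)
    show "(\<lambda>\<omega>. Z s \<omega> * Z t \<omega>) \<in> borel_measurable M" by (intro borel_measurable_times Zm that)
    have "\<bar>x * y\<bar> \<le> x\<^sup>2 + y\<^sup>2" for x y :: real
    proof -
      have "2 * (\<bar>x\<bar> * \<bar>y\<bar>) \<le> x\<^sup>2 + y\<^sup>2" using sum_squares_bound[of "\<bar>x\<bar>" "\<bar>y\<bar>"] by (simp add: mult.assoc)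
      moreover have "0 \<le> \<bar>x\<bar> * \<bar>y\<bar>" by simp
      ultimately show ?thesis unfolding abs_mult by linarith
    qed
    then show "AE \<omega> in M. norm (Z s \<omega> * Z t \<omega>) \<le> norm ((Z s \<omega>)\<^sup>2 + (Z t \<omega>)\<^sup>2)" by simp
  qed
  obtain m \<sigma> where ms: "normal_rv M (\<lambda>\<omega>. \<Sum>t\<in>J. b t * Z t \<omega>) m \<sigma>" using normal[OF J, of b] by blast
  note mom = normal_rv_moments[OF M ms]
  have JT: "t \<in> T" if "t \<in> J" for t using that J(2) by blast
  have "m = (\<Sum>t\<in>J. \<integral>\<omega>. b t * Z t \<omega> \<partial>M)"
    unfolding mom(3)[symmetric] by (rule Bochner_Integration.integral_sum) (rule integrable_mult_right, rule sq(2), rule JT)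
  then have m: "m = 0" by (simp add: mean JT)
  have cst: "(\<integral>\<omega>. Z s \<omega> * Z t \<omega> \<partial>M) = c s t" if "s \<in> J" "t \<in> J" for s t
    using cov[OF JT[OF that(1)] JT[OF that(2)]] by (simp add: covariance_def mean JT that)
  have "(\<Sum>t\<in>J. b t * Z t \<omega>)\<^sup>2 = (\<Sum>s\<in>J. \<Sum>t\<in>J. b s * b t * (Z s \<omega> * Z t \<omega>))" for \<omega>
    unfolding power2_eq_square sum_product by (intro sum.cong refl) (simp only: ac_simps)
  then have "m\<^sup>2 + \<sigma>\<^sup>2 = (\<integral>\<omega>. (\<Sum>s\<in>J. \<Sum>t\<in>J. b s * b t * (Z s \<omega> * Z t \<omega>)) \<partial>M)"
    using mom(4) by (simp only:)
  also have "\<dots> = (\<Sum>s\<in>J. \<integral>\<omega>. (\<Sum>t\<in>J. b s * b t * (Z s \<omega> * Z t \<omega>)) \<partial>M)"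
    by (rule Bochner_Integration.integral_sum)
      (rule Bochner_Integration.integrable_sum, rule integrable_mult_right, rule prod, erule JT, erule JT)
  also have "\<dots> = (\<Sum>s\<in>J. \<Sum>t\<in>J. b s * b t * c s t)"
  proof (rule sum.cong[OF refl])
    fix s assume s: "s \<in> J"
    have "(\<integral>\<omega>. (\<Sum>t\<in>J. b s * b t * (Z s \<omega> * Z t \<omega>)) \<partial>M) = (\<Sum>t\<in>J. \<integral>\<omega>. b s * b t * (Z s \<omega> * Z t \<omega>) \<partial>M)"
      by (rule Bochner_Integration.integral_sum) (rule integrable_mult_right, rule prod, rule JT[OF s], erule JT)
    also have "\<dots> = (\<Sum>t\<in>J. b s * b t * c s t)"
      by (intro sum.cong refl) (simp only: integral_mult_right_zero cst[OF s])
    finally show "(\<integral>\<omega>. (\<Sum>t\<in>J. b s * b t * (Z s \<omega> * Z t \<omega>)) \<partial>M) = (\<Sum>t\<in>J. b s * b t * c s t)" .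
  qed
  finally have "\<sigma>\<^sup>2 = (\<Sum>s\<in>J. \<Sum>t\<in>J. b s * b t * c s t)" using m by simp
  then show ?thesis using mom(5) m by simp
qed

section \<open>Linearisation of the ratio estimator\<close>

context extremal_setting begin

abbreviation "cond_mean i n A \<equiv> cond_mean_g M N \<alpha> i X u s n A"

lemma g_fun_W_block: "g_fun N \<alpha> i (s n) A (W_block X u s n t \<omega>) = g_path i (s n) (u n) A (\<lambda>h. X (h + t) \<omega>)"
  unfolding W_block_def g_path_def by (simp add: add.commute)

text \<open>The functional already contains the exceedance indicator, so conditioning amounts to
  division by \<open>v n\<close>.\<close>

lemma cond_mean_eq:
  assumes A: "A \<in> sets borel" and n: "n \<ge> 1" shows "cond_mean i n A = g_mean i n A / v n"
proof -
  have [measurable]: "(\<lambda>\<omega>. g_path i (s n) (u n) A (XP \<omega>)) \<in> borel_measurable M"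
    using g_path_X_measurable[OF A, of i "s n" "u n" 0] by simp
  have eq: "g_path i (s n) (u n) A (XP \<omega>) * of_bool (N (X 0 \<omega>) > u n) = g_path i (s n) (u n) A (XP \<omega>)" for \<omega>
    using g_path_bounds(1,2)[OF u_pos[OF n], of i "s n" A "XP \<omega>"] by (auto simp: of_bool_def split: if_splits)
  have "cond_mean i n A = (\<integral>\<omega>. g_path i (s n) (u n) A (XP \<omega>) \<partial>Q (u n))"
    unfolding cond_mean_g_def g_fun_W_block by simp
  also have "\<dots> = g_mean i n A / v n"
    by (subst integral_Q) (measurable, simp only: eq g_mean_def v_def)
  finally show ?thesis .
qed

lemma cond_mean_tendsto:
  assumes A: "A \<in> sets borel" and nullA: "AE \<omega> in M'. \<Theta> i \<omega> \<notin> frontier A"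
  shows "(\<lambda>n. cond_mean i n A) \<longlonglongrightarrow> M'.prob {\<omega> \<in> space M'. \<Theta> i \<omega> \<in> A}"
proof (rule Lim_transform_eventually[OF g_path_mean_tendsto[OF assms]])
  show "\<forall>\<^sub>F n in sequentially. (\<integral>\<omega>. g_path i (s n) (u n) A (XP \<omega>) \<partial>M) / v n = cond_mean i n A"
    using eventually_ge_at_top[of 1] by eventually_elim (simp add: cond_mean_eq[OF A] g_mean_def)
qed

lemma g_mean_UNIV: assumes n: "n \<ge> 1" shows "g_mean i n UNIV = v n"
proof -
  have "g_mean i n UNIV = (\<integral>\<omega>. indicator (exceed M N X 0 (u n)) \<omega> \<partial>M)"
    unfolding g_mean_def g_path_UNIV[OF u_pos[OF n]]
    by (rule Bochner_Integration.integral_cong) (auto simp: exceed_def indicator_def)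
  then show ?thesis using exceed_sets[of 0 "u n"] by (simp add: v_def V_def sets.Int_space_eq1)
qed

lemma p_hat_eq:
  assumes n: "n \<ge> 1"
  shows "p_hat N \<alpha> i X u s n A \<omega> = (\<Sum>k<n. g_path i (s n) (u n) A (\<lambda>h. X (h + (1 + int k)) \<omega>)) /
    (\<Sum>k<n. g_path i (s n) (u n) UNIV (\<lambda>h. X (h + (1 + int k)) \<omega>))"
proof -
  have re: "(\<Sum>t=1..int n. f t) = (\<Sum>k<n. f (1 + int k))" for f :: "int \<Rightarrow> real"
    by (rule sum.reindex_bij_witness[of _ "\<lambda>k. 1 + int k" "\<lambda>t. nat (t - 1)"]) auto
  show ?thesis
    unfolding p_hat_def re g_fun_W_block g_path_UNIV[OF u_pos[OF n]] by simp
qed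

lemma p_hat_measurable:
  assumes "A \<in> sets borel" shows "p_hat N \<alpha> i X u s n A \<in> borel_measurable M"
  unfolding p_hat_def[abs_def] g_fun_W_block
  by (intro borel_measurable_divide borel_measurable_sum g_path_X_measurable assms) simp

text \<open>The denominator of the estimator is \<open>n v\<^sub>n + O\<^sub>P(\<surd>(n v\<^sub>n))\<close>, so the estimation error is
  the centred numerator up to a factor tending to 1.\<close>

lemma Z_n_eq:
  assumes A: "A \<in> sets borel" and n: "n \<ge> 1" and D: "1 + g_sum i n UNIV \<omega> / sqrt (n * v n) \<noteq> 0"
  shows "Z_n M N \<alpha> i X u s n A \<omega> = (g_sum i n A \<omega> - cond_mean i n A * g_sum i n UNIV \<omega>) / (1 + g_sum i n UNIV \<omega> / sqrt (n * v n))"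
proof -
  define a where "a B = (\<Sum>k<n. g_path i (s n) (u n) B (\<lambda>h. X (h + (1 + int k)) \<omega>))" for B
  define c where "c = sqrt (n * v n)"
  define q where "q = cond_mean i n A"
  have c: "c > 0" "n * v n = c * c" using nv_pos[OF n] by (auto simp: c_def)
  have g: "g_sum i n B \<omega> = (a B - n * g_mean i n B) / c" for B
    by (simp add: g_sum_def a_def c_def sum_subtractf)
  have gA: "g_mean i n A = v n * q" using cond_mean_eq[OF A n, of i] v_pos[of n] by (simp add: q_def)
  have U: "g_sum i n UNIV \<omega> = (a UNIV - c * c) / c" unfolding g g_mean_UNIV[OF n] c(2) ..
  have "n * g_mean i n A = c * c * q" unfolding gA c(2)[symmetric] by simp
  then have S: "g_sum i n A \<omega> = (a A - c * c * q) / c" unfolding g by simp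
  have D': "1 + g_sum i n UNIV \<omega> / c = a UNIV / (c * c)" unfolding U using c(1) by (simp add: field_simps)
  then have aU: "a UNIV \<noteq> 0" using D by (auto simp: c_def)
  have "Z_n M N \<alpha> i X u s n A \<omega> = c * (a A / a UNIV - q)"
    unfolding Z_n_def p_hat_eq[OF n] a_def q_def c_def by (simp add: v_seq_eq v_def)
  also have "\<dots> = (g_sum i n A \<omega> - q * g_sum i n UNIV \<omega>) / (a UNIV / (c * c))"
    unfolding S U using c(1) aU by (simp add: field_simps)
  finally show ?thesis unfolding D'[symmetric] unfolding q_def c_def .
qed

theorem Z_n_char_tendsto:
  fixes a :: "(real^'d) set \<Rightarrow> real"
  assumes I: "finite I" "I \<subseteq> sets borel" "\<And>A. A \<in> I \<Longrightarrow> AE \<omega> in M'. \<Theta> i \<omega> \<notin> frontier A"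
  defines "b \<equiv> \<lambda>A. (if A \<in> I then a A else 0) - (if A = UNIV then \<Sum>A\<in>I. a A * M'.prob {\<omega> \<in> space M'. \<Theta> i \<omega> \<in> A} else 0)"
  shows "(\<lambda>n. \<integral>\<omega>. iexp (\<Sum>A\<in>I. a A * Z_n M N \<alpha> i X u s n A \<omega>) \<partial>M) \<longlonglongrightarrow>
    complex_of_real (exp (- ((\<Sum>A\<in>insert UNIV I. \<Sum>B\<in>insert UNIV I. b A * b B * cov_fun M' N \<alpha> i \<Theta> A B) / 2)))"
proof -
  let ?J = "insert UNIV I"
  have J: "finite ?J" "?J \<subseteq> sets borel" "\<And>A. A \<in> ?J \<Longrightarrow> AE \<omega> in M'. \<Theta> i \<omega> \<notin> frontier A" using I by auto
  define bn where "bn n A = (if A \<in> I then a A else 0) - (if A = UNIV then \<Sum>A\<in>I. a A * cond_mean i n A else 0)" for n A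
  define S where "S n \<omega> = (\<Sum>A\<in>I. a A * (g_sum i n A \<omega> - cond_mean i n A * g_sum i n UNIV \<omega>))" for n \<omega>
  define T where "T n \<omega> = (\<Sum>A\<in>I. a A * Z_n M N \<alpha> i X u s n A \<omega>)" for n \<omega>
  define U where "U n = g_sum i n UNIV" for n
  \<comment> \<open>The fourth root of \<open>n * v n\<close> splits the factor
    \<open>sqrt (n * v n)\<close> evenly between the error of the numerator and that of the
    denominator.\<close>
  define k where "k n = sqrt (sqrt (real n * v n))" for n
  have bn: "(\<lambda>n. bn n A) \<longlonglongrightarrow> b A" for A
  proof -
    have "(\<lambda>n. \<Sum>A\<in>I. a A * cond_mean i n A) \<longlonglongrightarrow> (\<Sum>A\<in>I. a A * M'.prob {\<omega> \<in> space M'. \<Theta> i \<omega> \<in> A})"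
      by (intro tendsto_sum tendsto_mult_left cond_mean_tendsto) (use I in auto)
    then show ?thesis unfolding bn_def b_def by (cases "A = UNIV") (auto intro!: tendsto_intros)
  qed
  have S: "S n \<omega> = (\<Sum>A\<in>?J. bn n A * g_sum i n A \<omega>)" for n \<omega>
    unfolding S_def bn_def by (rule sum_subtract_multiple[OF I(1), symmetric])
  have gs: "g_sum i n A \<in> borel_measurable M" if "A \<in> ?J" for n A
    using that J(2) by (intro g_sum_measurable) auto
  have Sm[measurable]: "S n \<in> borel_measurable M" for n
    unfolding S[abs_def] by (intro borel_measurable_sum borel_measurable_times borel_measurable_const gs)
  have Um[measurable]: "U n \<in> borel_measurable M" for n unfolding U_def by (rule gs) simp
  have Tm[measurable]: "T n \<in> borel_measurable M" for n
    unfolding T_def[abs_def] Z_n_def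
    by (intro borel_measurable_sum borel_measurable_times borel_measurable_diff borel_measurable_const p_hat_measurable)
      (use I(2) in auto)
  have kinf: "filterlim k at_top sequentially"
    unfolding k_def[abs_def] by (intro filterlim_compose[OF sqrt_at_top] S_facts(2))
  then have k0: "(\<lambda>n. inverse (k n)) \<longlonglongrightarrow> 0" by (rule tendsto_inverse_0_at_top)
  \<comment> \<open>Division by \<open>k n\<close> makes all coefficients tend to 0, so the same
    limit theorem, now with limiting variance 0, yields convergence to 0 in probability.\<close>
  have van: "(\<lambda>n. \<integral>\<omega>. min 1 \<bar>inverse (k n) * (\<Sum>A\<in>K. d n A * g_sum i n A \<omega>)\<bar> \<partial>M) \<longlonglongrightarrow> 0"
    if K: "K \<subseteq> ?J" and d: "\<And>A. (\<lambda>n. d n A) \<longlonglongrightarrow> d' A" for K d and d' :: "(real^'d) set \<Rightarrow> real"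
  proof (rule M.tendsto_0_in_prob_if_char_tendsto_1)
    show "(\<lambda>\<omega>. inverse (k n) * (\<Sum>A\<in>K. d n A * g_sum i n A \<omega>)) \<in> borel_measurable M" for n
      using K by (intro borel_measurable_sum borel_measurable_times borel_measurable_const gs) auto
    fix t :: real
    have "(\<lambda>n. \<integral>\<omega>. iexp (\<Sum>A\<in>K. (t * (inverse (k n) * d n A)) * g_sum i n A \<omega>) \<partial>M) \<longlonglongrightarrow>
        complex_of_real (exp (- ((\<Sum>A\<in>K. \<Sum>B\<in>K. (t * (0 * d' A)) * (t * (0 * d' B)) * cov_fun M' N \<alpha> i \<Theta> A B) / 2)))"
      using K J by (intro g_sum_combination_clt tendsto_mult_left tendsto_mult k0 d) (auto intro: finite_subset)
    moreover have "(\<Sum>A\<in>K. (t * (inverse (k n) * d n A)) * g_sum i n A \<omega>) = t * (inverse (k n) * (\<Sum>A\<in>K. d n A * g_sum i n A \<omega>))" for n \<omega>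
      by (simp only: sum_distrib_left mult.assoc)
    ultimately show "(\<lambda>n. \<integral>\<omega>. iexp (t * (inverse (k n) * (\<Sum>A\<in>K. d n A * g_sum i n A \<omega>))) \<partial>M) \<longlonglongrightarrow> 1" by simp
  qed
  have S0: "(\<lambda>n. \<integral>\<omega>. min 1 \<bar>inverse (k n) * S n \<omega>\<bar> \<partial>M) \<longlonglongrightarrow> 0"
    unfolding S by (rule van[OF order_refl bn])
  have U0: "(\<lambda>n. \<integral>\<omega>. min 1 \<bar>inverse (k n) * U n \<omega>\<bar> \<partial>M) \<longlonglongrightarrow> 0"
    using van[of "{UNIV}" "\<lambda>_ _. 1" "\<lambda>_. 1"] by (simp add: U_def)
  have "(\<lambda>n. (\<integral>\<omega>. iexp (T n \<omega>) \<partial>M) - (\<integral>\<omega>. iexp (S n \<omega>) \<partial>M)) \<longlonglongrightarrow> 0"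
  proof (rule Lim_null_comparison)
    show "(\<lambda>n. 2 * (\<integral>\<omega>. min 1 \<bar>inverse (k n) * S n \<omega>\<bar> \<partial>M) + 4 * (\<integral>\<omega>. min 1 \<bar>inverse (k n) * U n \<omega>\<bar> \<partial>M)) \<longlonglongrightarrow> 0"
      using tendsto_add[OF tendsto_mult_left[OF S0, of 2] tendsto_mult_left[OF U0, of 4]] by simp
    have "\<forall>\<^sub>F n in sequentially. k n \<ge> 1" using kinf by (simp add: filterlim_at_top)
    then show "\<forall>\<^sub>F n in sequentially. norm ((\<integral>\<omega>. iexp (T n \<omega>) \<partial>M) - (\<integral>\<omega>. iexp (S n \<omega>) \<partial>M)) \<le>
        2 * (\<integral>\<omega>. min 1 \<bar>inverse (k n) * S n \<omega>\<bar> \<partial>M) + 4 * (\<integral>\<omega>. min 1 \<bar>inverse (k n) * U n \<omega>\<bar> \<partial>M)"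
      using eventually_ge_at_top[of 1]
    proof eventually_elim
      case (elim n)
      have kk: "sqrt (real n * v n) = k n * k n" using nv_pos[OF elim(2)] by (simp add: k_def)
      have TS: "T n \<omega> = S n \<omega> / (1 + U n \<omega> / (k n * k n))" if "1 + U n \<omega> / (k n * k n) \<noteq> 0" for \<omega>
      proof -
        have "Z_n M N \<alpha> i X u s n A \<omega> = (g_sum i n A \<omega> - cond_mean i n A * U n \<omega>) / (1 + U n \<omega> / (k n * k n))" if "A \<in> I" for A
          using Z_n_eq[of A n i \<omega>] that I(2) elim(2) \<open>1 + U n \<omega> / (k n * k n) \<noteq> 0\<close> unfolding kk U_def by blast
        then show ?thesis unfolding T_def S_def U_def[symmetric] by (simp add: sum_divide_distrib)
      qed
      have i1: "integrable M (\<lambda>\<omega>. min 1 \<bar>inverse (k n) * f \<omega>\<bar>)" if [measurable]: "f \<in> borel_measurable M" for f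
        by (rule M.integrable_const_bound[where B=1]) auto
      have "norm ((\<integral>\<omega>. iexp (S n \<omega> + (T n \<omega> - S n \<omega>)) \<partial>M) - (\<integral>\<omega>. iexp (S n \<omega>) \<partial>M)) \<le> (\<integral>\<omega>. norm (iexp (T n \<omega> - S n \<omega>) - 1) \<partial>M)"
        by (rule M.norm_expectation_iexp_diff) measurable
      also have "\<dots> \<le> (\<integral>\<omega>. 2 * min 1 \<bar>inverse (k n) * S n \<omega>\<bar> + 4 * min 1 \<bar>inverse (k n) * U n \<omega>\<bar> \<partial>M)"
      proof (rule integral_mono)
        show "integrable M (\<lambda>\<omega>. norm (iexp (T n \<omega> - S n \<omega>) - 1))"
        proof (rule M.integrable_const_bound[where B=2])
          show "AE \<omega> in M. norm (norm (iexp (T n \<omega> - S n \<omega>) - 1)) \<le> 2"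
            by (rule AE_I2) (simp only: real_norm_def abs_norm_cancel norm_iexp_minus_1_le_2)
        qed measurable
        show "integrable M (\<lambda>\<omega>. 2 * min 1 \<bar>inverse (k n) * S n \<omega>\<bar> + 4 * min 1 \<bar>inverse (k n) * U n \<omega>\<bar>)"
          by (intro Bochner_Integration.integrable_add integrable_mult_right i1 Sm Um)
        show "norm (iexp (T n \<omega> - S n \<omega>) - 1) \<le> 2 * min 1 \<bar>inverse (k n) * S n \<omega>\<bar> + 4 * min 1 \<bar>inverse (k n) * U n \<omega>\<bar>" for \<omega>
          by (rule iexp_quotient_bound[OF elim(1) TS])
      qed
      also have "\<dots> = 2 * (\<integral>\<omega>. min 1 \<bar>inverse (k n) * S n \<omega>\<bar> \<partial>M) + 4 * (\<integral>\<omega>. min 1 \<bar>inverse (k n) * U n \<omega>\<bar> \<partial>M)"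
        by (subst Bochner_Integration.integral_add) (intro integrable_mult_right i1 Sm Um | simp only: integral_mult_right_zero)+
      finally show ?case by simp
    qed
  qed
  moreover have "(\<lambda>n. \<integral>\<omega>. iexp (S n \<omega>) \<partial>M) \<longlonglongrightarrow>
      complex_of_real (exp (- ((\<Sum>A\<in>?J. \<Sum>B\<in>?J. b A * b B * cov_fun M' N \<alpha> i \<Theta> A B) / 2)))"
    unfolding S by (rule g_sum_combination_clt[OF J bn])
  ultimately have "(\<lambda>n. ((\<integral>\<omega>. iexp (T n \<omega>) \<partial>M) - (\<integral>\<omega>. iexp (S n \<omega>) \<partial>M)) + (\<integral>\<omega>. iexp (S n \<omega>) \<partial>M)) \<longlonglongrightarrow>
      0 + complex_of_real (exp (- ((\<Sum>A\<in>?J. \<Sum>B\<in>?J. b A * b B * cov_fun M' N \<alpha> i \<Theta> A B) / 2)))"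
    by (rule tendsto_add)
  then show ?thesis by (simp add: T_def)
qed

text \<open>The deterministic shift \<open>d\<close> serves both claims: it is 0 for the centring at
  the conditional mean, and the rescaled bias for the centring at the limit probability. In
  characteristic functions it only contributes a factor tending to 1.\<close>

theorem Z_n_weakly_converges:
  fixes Z :: "(real^'d) set \<Rightarrow> 'z \<Rightarrow> real" and d :: "nat \<Rightarrow> (real^'d) set \<Rightarrow> real"
  assumes M'': "prob_space M''" and Z: "centered_gaussian_process M'' T Z (cov_fun M' N \<alpha> i \<Theta>)"
    and I: "finite I" "I \<subseteq> sets borel" "\<And>A. A \<in> I \<Longrightarrow> AE \<omega> in M'. \<Theta> i \<omega> \<notin> frontier A" "insert UNIV I \<subseteq> T"
    and d: "\<And>A. A \<in> I \<Longrightarrow> (\<lambda>n. d n A) \<longlonglongrightarrow> 0"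
  shows "weakly_converges_PiM I (\<lambda>n. joint_law M I (\<lambda>A \<omega>. Z_n M N \<alpha> i X u s n A \<omega> + d n A))
    (joint_law M'' I (\<lambda>A \<omega>. Z A \<omega> - M'.prob {\<omega> \<in> space M'. \<Theta> i \<omega> \<in> A} * Z UNIV \<omega>)) sequentially"
proof (rule weakly_converges_PiM_if_char_tendsto)
  show "prob_space M" by unfold_locales
  show "prob_space M''" "finite I" by fact+
  show "(\<lambda>\<omega>. Z_n M N \<alpha> i X u s n A \<omega> + d n A) \<in> borel_measurable M" if "A \<in> I" for n A
    unfolding Z_n_def
    by (intro borel_measurable_add borel_measurable_times borel_measurable_diff borel_measurable_const p_hat_measurable)
      (use I(2) that in auto)
  have Zm: "Z A \<in> borel_measurable M''" if "A \<in> T" for A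
    using Z that by (auto simp: centered_gaussian_process_def gaussian_process_def)
  show "(\<lambda>\<omega>. Z A \<omega> - M'.prob {\<omega> \<in> space M'. \<Theta> i \<omega> \<in> A} * Z UNIV \<omega>) \<in> borel_measurable M''" if "A \<in> I" for A
    using that I(4) by (intro borel_measurable_times borel_measurable_diff borel_measurable_const Zm) auto
  fix a :: "(real^'d) set \<Rightarrow> real"
  let ?p = "\<lambda>A. M'.prob {\<omega> \<in> space M'. \<Theta> i \<omega> \<in> A}"
  define b where "b A = (if A \<in> I then a A else 0) - (if A = UNIV then \<Sum>A\<in>I. a A * ?p A else 0)" for A
  have "(\<lambda>n. iexp (\<Sum>A\<in>I. a A * d n A)) \<longlonglongrightarrow> iexp (\<Sum>A\<in>I. a A * 0)"
    by (intro tendsto_intros d)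
  moreover have "(\<lambda>n. \<integral>\<omega>. iexp (\<Sum>A\<in>I. a A * Z_n M N \<alpha> i X u s n A \<omega>) \<partial>M) \<longlonglongrightarrow>
      complex_of_real (exp (- ((\<Sum>A\<in>insert UNIV I. \<Sum>B\<in>insert UNIV I. b A * b B * cov_fun M' N \<alpha> i \<Theta> A B) / 2)))"
    unfolding b_def by (rule Z_n_char_tendsto[OF I(1-3)])
  moreover have "complex_of_real (exp (- ((\<Sum>A\<in>insert UNIV I. \<Sum>B\<in>insert UNIV I. b A * b B * cov_fun M' N \<alpha> i \<Theta> A B) / 2))) =
      (\<integral>\<omega>. iexp (\<Sum>A\<in>insert UNIV I. b A * Z A \<omega>) \<partial>M'')"
    using I(1,4) by (intro centered_gaussian_process_char[OF M'' Z, symmetric]) auto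
  moreover have "(\<Sum>A\<in>insert UNIV I. b A * Z A \<omega>) = (\<Sum>A\<in>I. a A * (Z A \<omega> - ?p A * Z UNIV \<omega>))" for \<omega>
    unfolding b_def by (rule sum_subtract_multiple[OF I(1)])
  ultimately have "(\<lambda>n. iexp (\<Sum>A\<in>I. a A * d n A) * (\<integral>\<omega>. iexp (\<Sum>A\<in>I. a A * Z_n M N \<alpha> i X u s n A \<omega>) \<partial>M)) \<longlonglongrightarrow>
      iexp (\<Sum>A\<in>I. a A * 0) * (\<integral>\<omega>. iexp (\<Sum>A\<in>I. a A * (Z A \<omega> - ?p A * Z UNIV \<omega>)) \<partial>M'')"
    by (intro tendsto_mult) simp_all
  moreover have "iexp (\<Sum>A\<in>I. a A * d n A) * (\<integral>\<omega>. iexp (\<Sum>A\<in>I. a A * Z_n M N \<alpha> i X u s n A \<omega>) \<partial>M) =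
      (\<integral>\<omega>. iexp (\<Sum>A\<in>I. a A * (Z_n M N \<alpha> i X u s n A \<omega> + d n A)) \<partial>M)" for n
  proof -
    have "iexp (\<Sum>A\<in>I. a A * (Z_n M N \<alpha> i X u s n A \<omega> + d n A)) =
        iexp (\<Sum>A\<in>I. a A * d n A) * iexp (\<Sum>A\<in>I. a A * Z_n M N \<alpha> i X u s n A \<omega>)" for \<omega>
      by (simp only: exp_add[symmetric] distrib_left[symmetric] of_real_add[symmetric] sum.distrib[symmetric] add.commute)
    then show ?thesis by (simp only: integral_mult_right_zero)
  qed
  ultimately show "(\<lambda>n. \<integral>\<omega>. iexp (\<Sum>A\<in>I. a A * (Z_n M N \<alpha> i X u s n A \<omega> + d n A)) \<partial>M) \<longlonglongrightarrow>
      (\<integral>\<omega>. iexp (\<Sum>A\<in>I. a A * (Z A \<omega> - ?p A * Z UNIV \<omega>)) \<partial>M'')" by simp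
qed

end

theorem theorem2p1:
  fixes M :: "'w measure" and M' :: "'y measure" and M'' :: "'z measure"
    and N :: "real^'d \<Rightarrow> real" and \<alpha> :: real and i :: int
    and X :: "int \<Rightarrow> 'w \<Rightarrow> real^'d" and Y :: "int \<Rightarrow> 'y \<Rightarrow> real^'d"
    and u :: "nat \<Rightarrow> real" and s l r :: "nat \<Rightarrow> nat"
    and \<A> :: "(real^'d) set set"
    and Z :: "(real^'d) set \<Rightarrow> 'z \<Rightarrow> real"
  defines "\<Theta> \<equiv> spectral_tail N Y"
  defines "p \<equiv> (\<lambda>A. measure M' {\<omega> \<in> space M'. \<Theta> i \<omega> \<in> A})"
  defines "Zp \<equiv> (\<lambda>A \<omega>. Z A \<omega> - p A * Z UNIV \<omega>)"
  assumes "prob_space M" and "prob_space M'" and "prob_space M''"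
    and "is_norm N"
    and "\<A> \<subseteq> sets borel"
    and "\<forall>n\<ge>1. u n > 0" and "filterlim u at_top sequentially"
    and RV: "regularly_varying M M' N \<alpha> X Y"
    and S: "condition_S M N X u s l r"
    and BC: "condition_BC M N X u r"
    and TC: "condition_TC M N \<alpha> X u s"
    and C\<Theta>: "\<forall>A\<in>\<A>. p (frontier A) = 0"
    and Z: "centered_gaussian_process M'' (\<A> \<union> {UNIV}) Z (cov_fun M' N \<alpha> i \<Theta>)"
  shows "(\<forall>I\<subseteq>\<A>. finite I \<longrightarrow>
           weakly_converges_PiM I (\<lambda>n. joint_law M I (Z_n M N \<alpha> i X u s n))
             (joint_law M'' I Zp) sequentially) \<and>
         ((\<forall>A\<in>\<A>. (\<lambda>n. cond_mean_g M N \<alpha> i X u s n A - p A)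
             \<in> o(\<lambda>n. (n * v_seq M N X u n) powr (- 1 / 2))) \<longrightarrow>
         (\<forall>I\<subseteq>\<A>. finite I \<longrightarrow>
           weakly_converges_PiM I
             (\<lambda>n. joint_law M I (\<lambda>A \<omega>. sqrt (n * v_seq M N X u n) * (p_hat N \<alpha> i X u s n A \<omega> - p A)))
             (joint_law M'' I Zp) sequentially))"
proof -
  interpret E: extremal_setting N M M' \<alpha> X Y u s l r
  proof (intro extremal_setting.intro tail_setting.intro norm_fun.intro tail_setting_axioms.intro extremal_setting_axioms.intro)
    show "u n > 0" if "n \<ge> 1" for n using \<open>\<forall>n\<ge>1. u n > 0\<close> that by blast
  qed fact+
  have Theta: "E.\<Theta> = \<Theta>" unfolding E.\<Theta>_def \<Theta>_def ..
  have null: "AE \<omega> in M'. \<Theta> i \<omega> \<notin> frontier A" if "A \<in> \<A>" for A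
  proof -
    have [measurable]: "\<Theta> i \<in> borel_measurable M'" unfolding Theta[symmetric] by (rule E.Theta_measurable)
    have [measurable]: "frontier A \<in> sets borel" by (simp add: borel_closed)
    have "{\<omega> \<in> space M'. \<Theta> i \<omega> \<in> frontier A} \<in> sets M'" by measurable
    from E.M'.prob_Collect_eq_0[OF this] show ?thesis using C\<Theta> that unfolding p_def by blast
  qed
  have conv: "weakly_converges_PiM I (\<lambda>n. joint_law M I (\<lambda>A \<omega>. Z_n M N \<alpha> i X u s n A \<omega> + d n A)) (joint_law M'' I Zp) sequentially"
    if "I \<subseteq> \<A>" "finite I" "\<And>A. A \<in> I \<Longrightarrow> (\<lambda>n. d n A) \<longlonglongrightarrow> 0" for I and d :: "nat \<Rightarrow> (real^'d) set \<Rightarrow> real"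
    unfolding Zp_def p_def
  proof (rule E.Z_n_weakly_converges[unfolded Theta])
    show "prob_space M''" by fact
    show "centered_gaussian_process M'' (\<A> \<union> {UNIV}) Z (cov_fun M' N \<alpha> i \<Theta>)" by fact
    show "I \<subseteq> sets borel" using that(1) \<open>\<A> \<subseteq> sets borel\<close> by blast
    show "AE \<omega> in M'. \<Theta> i \<omega> \<notin> frontier A" if "A \<in> I" for A
      using null[of A] that \<open>I \<subseteq> \<A>\<close> by blast
  qed (use that in auto)
  have "weakly_converges_PiM I (\<lambda>n. joint_law M I (Z_n M N \<alpha> i X u s n)) (joint_law M'' I Zp) sequentially"
    if "I \<subseteq> \<A>" "finite I" for I
    using conv[OF that, of "\<lambda>_ _. 0"] by simp
  moreover have "weakly_converges_PiM I
      (\<lambda>n. joint_law M I (\<lambda>A \<omega>. sqrt (n * v_seq M N X u n) * (p_hat N \<alpha> i X u s n A \<omega> - p A))) (joint_law M'' I Zp) sequentially"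
    if o: "\<forall>A\<in>\<A>. (\<lambda>n. cond_mean_g M N \<alpha> i X u s n A - p A) \<in> o(\<lambda>n. (n * v_seq M N X u n) powr (- 1 / 2))"
      and I: "I \<subseteq> \<A>" "finite I" for I
  proof -
    \<comment> \<open>The bias condition says that this quantity tends to 0; adding it to
      \<open>Z_n\<close> exchanges the centring.\<close>
    define d where "d n A = sqrt (n * v_seq M N X u n) * (cond_mean_g M N \<alpha> i X u s n A - p A)" for n A
    have "(\<lambda>n. d n A) \<longlonglongrightarrow> 0" if "A \<in> I" for A
    proof -
      have "(\<lambda>n. (cond_mean_g M N \<alpha> i X u s n A - p A) / (n * v_seq M N X u n) powr (- 1 / 2)) \<longlonglongrightarrow> 0"
        using o that I(1) by (intro smalloD_tendsto) auto
      moreover have "x / y powr (- 1 / 2) = sqrt y * x" if "y \<ge> 0" for x y :: real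
        using that powr_minus_divide[of y "1/2"] by (simp add: powr_half_sqrt)
      ultimately show ?thesis by (simp add: d_def v_seq_def)
    qed
    from conv[OF I, of d, OF this] show ?thesis
      unfolding Z_n_def d_def distrib_left[symmetric] by simp
  qed
  ultimately show ?thesis by blast
qed

end
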